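(* Steiner Orientation is $W[1]$-hard when parameterized by $k$, the number of terminal pairs. Furthermore, assuming the Exponential Time Hypothesis (ETH), there is no algorithm solving $n$-vertex instances of Steiner Orientation in time $f(k)\, n^{o(k/\log k)}$ for any computable function $f$.
   Context: Steiner Orientation: the input is a mixed graph $G$ (containing both directed arcs and undirected edges) together with a set $\mathcal{T}$ of $k$ terminal pairs $(s,t)$ of vertices of $G$. The question is whether there is an orientation of all undirected edges of $G$ such that, in the resulting directed graph, for every $(s,t)\in\mathcal{T}$ there is a directed path from $s$ to $t$. The parameter is $k=|\mathcal{T}|$. The Exponential Time Hypothesis asserts that there is no algorithm deciding satisfiability of 3-CNF formulas in time subexponential in the number of variables. *)

theory Defs
  imports Complex_Main "HOL-Library.Landau_Symbols"
begin

section \<open>Model of computation\<close>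

text \<open>
  A program works on finitely many binary stacks, with unit cost per elementary operation. A tape of
  a Turing machine is a pair of stacks and a stack is a one-sided tape, so up to constant factors
  this is the running time of deterministic multi-tape Turing machines. \<open>Branch i\<close> distinguishes
  whether stack \<open>i\<close> is empty, has \<open>False\<close> on top, or has \<open>True\<close> on top; \<open>Loop i\<close> iterates as
  long as stack \<open>i\<close> is nonempty.
\<close>

datatype prog =
    Skip
  | Push nat bool
  | Pop nat
  | Seq prog prog
  | Branch nat prog prog prog
  | Loop nat prog

type_synonym store = "nat \<Rightarrow> bool list"

inductive exec :: "prog \<Rightarrow> store \<Rightarrow> nat \<Rightarrow> store \<Rightarrow> bool" where
  Skip: "exec Skip s 1 s"
| Push: "exec (Push i b) s 1 (s(i := b # s i))"
| Pop: "exec (Pop i) s 1 (s(i := tl (s i)))"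
| Seq: "exec p s t s' \<Longrightarrow> exec q s' t' s'' \<Longrightarrow> exec (Seq p q) s (t + t') s''"
| Branch_Nil: "s i = [] \<Longrightarrow> exec p s t s' \<Longrightarrow> exec (Branch i p q r) s (Suc t) s'"
| Branch_False: "s i = False # w \<Longrightarrow> exec q s t s' \<Longrightarrow> exec (Branch i p q r) s (Suc t) s'"
| Branch_True: "s i = True # w \<Longrightarrow> exec r s t s' \<Longrightarrow> exec (Branch i p q r) s (Suc t) s'"
| Loop_Nil: "s i = [] \<Longrightarrow> exec (Loop i p) s 1 s"
| Loop_Step: "s i \<noteq> [] \<Longrightarrow> exec p s t s' \<Longrightarrow> exec (Loop i p) s' t' s'' \<Longrightarrow>
    exec (Loop i p) s (Suc (t + t')) s''"

lemma exec_deterministic: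
  "exec p s t s' \<Longrightarrow> exec p s u s'' \<Longrightarrow> t = u \<and> s' = s''"
proof (induction arbitrary: u s'' rule: exec.induct)
  case (Skip s)
  then show ?case by cases simp
next
  case (Push i b s)
  then show ?case by cases simp
next
  case (Pop i s)
  then show ?case by cases simp
next
  case (Seq p s t s' q t' s1)
  from Seq.prems obtain t1 t2 s2
    where "u = t1 + t2" and "exec p s t1 s2" and "exec q s2 t2 s''"
    by cases simp
  with Seq.IH(1)[of t1 s2] Seq.IH(2)[of t2 s''] show ?case by simp
next
  case (Branch_Nil s i p t s' q r)
  from Branch_Nil.prems obtain u' where "u = Suc u'" and "exec p s u' s''"
    by cases (use Branch_Nil.hyps in simp_all)
  with Branch_Nil.IH[of u' s''] show ?case by simp
next
  case (Branch_False s i w q t s' p r)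
  from Branch_False.prems obtain u' where "u = Suc u'" and "exec q s u' s''"
    by cases (use Branch_False.hyps in simp_all)
  with Branch_False.IH[of u' s''] show ?case by simp
next
  case (Branch_True s i w r t s' p q)
  from Branch_True.prems obtain u' where "u = Suc u'" and "exec r s u' s''"
    by cases (use Branch_True.hyps in simp_all)
  with Branch_True.IH[of u' s''] show ?case by simp
next
  case (Loop_Nil s i p)
  from Loop_Nil.prems show ?case by cases (use Loop_Nil.hyps in simp_all)
next
  case (Loop_Step s i p t s' t' s1)
  from Loop_Step.prems obtain t1 t2 s2
    where "u = Suc (t1 + t2)" and "exec p s t1 s2" and "exec (Loop i p) s2 t2 s''"
    by cases (use Loop_Step.hyps in simp_all)
  with Loop_Step.IH(1)[of t1 s2] Loop_Step.IH(2)[of t2 s''] show ?case by simp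
qed

text \<open>The input is given on stack 0, all other stacks being empty; the output is read from stack 0.\<close>

definition computes :: "prog \<Rightarrow> bool list \<Rightarrow> nat \<Rightarrow> bool list \<Rightarrow> bool" where
  "computes p x t y \<longleftrightarrow> (\<exists>s. exec p ((\<lambda>_. [])(0 := x)) t s \<and> s 0 = y)"

definition enc_nat :: "nat \<Rightarrow> bool list" where
  "enc_nat n = replicate n True @ [False]"

definition enc_list :: "('a \<Rightarrow> bool list) \<Rightarrow> 'a list \<Rightarrow> bool list" where
  "enc_list enc xs = enc_nat (length xs) @ concat (map enc xs)"

text \<open>The encodings of instances below are injective, which is proved by way of prefix-freeness.\<close>

definition prefix_free :: "('a \<Rightarrow> bool list) \<Rightarrow> bool" where
  "prefix_free enc \<longleftrightarrow> (\<forall>x y u v. enc x @ u = enc y @ v \<longrightarrow> x = y \<and> u = v)"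

lemma prefix_freeD: "prefix_free enc \<Longrightarrow> enc x @ u = enc y @ v \<Longrightarrow> x = y \<and> u = v"
  unfolding prefix_free_def by blast

lemma prefix_free_iff: "prefix_free enc \<Longrightarrow> enc x @ u = enc y @ v \<longleftrightarrow> x = y \<and> u = v"
  by (auto dest: prefix_freeD)

lemma prefix_free_inj:
  assumes "prefix_free enc"
  shows "inj enc"
proof (rule injI)
  fix x y assume "enc x = enc y"
  then have "enc x @ [] = enc y @ []" by simp
  then show "x = y" using prefix_freeD[OF assms, of x "[]" y "[]"] by simp
qed

lemma prefix_free_enc_nat: "prefix_free enc_nat"
proof -
  have "enc_nat m @ u = enc_nat n @ v \<Longrightarrow> m = n \<and> u = v" for m n u v
  proof (induction m arbitrary: n)
    case 0
    then show ?case by (cases n) (auto simp: enc_nat_def)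
  next
    case (Suc m)
    then show ?case by (cases n) (auto simp: enc_nat_def)
  qed
  then show ?thesis unfolding prefix_free_def by blast
qed

lemma prefix_free_enc_list:
  assumes "prefix_free enc"
  shows "prefix_free (enc_list enc)"
proof -
  have items: "length xs = length ys \<Longrightarrow>
      concat (map enc xs) @ u = concat (map enc ys) @ v \<Longrightarrow> xs = ys \<and> u = v" for xs ys u v
  proof (induction xs ys rule: list_induct2)
    case (Cons x xs y ys)
    then have "enc x @ (concat (map enc xs) @ u) = enc y @ (concat (map enc ys) @ v)" by simp
    from prefix_freeD[OF assms this] Cons.IH show ?case by simp
  qed simp
  show ?thesis
    unfolding prefix_free_def
  proof (intro allI impI)
    fix xs ys u v
    assume "enc_list enc xs @ u = enc_list enc ys @ v"
    then have "enc_nat (length xs) @ (concat (map enc xs) @ u) =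
        enc_nat (length ys) @ (concat (map enc ys) @ v)"
      by (simp add: enc_list_def)
    from prefix_freeD[OF prefix_free_enc_nat this] items[of xs ys u v]
    show "xs = ys \<and> u = v" by simp
  qed
qed

definition computable :: "(nat \<Rightarrow> nat) \<Rightarrow> bool" where
  "computable f \<longleftrightarrow> (\<exists>p. \<forall>n. \<exists>t. computes p (enc_nat n) t (enc_nat (f n)))"


section \<open>Parameterized problems and the classes W[t]\<close>

type_synonym param_problem = "(bool list \<times> nat) set"

fun enc_param :: "bool list \<times> nat \<Rightarrow> bool list" where
  "enc_param (x, k) = enc_nat k @ x"

definition fpt_reducible :: "param_problem \<Rightarrow> param_problem \<Rightarrow> bool" where
  "fpt_reducible P Q \<longleftrightarrow>
     (\<exists>p f g c. computable f \<and> computable g \<and>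
        (\<forall>x k. \<exists>t x' k'. computes p (enc_param (x, k)) t (enc_param (x', k')) \<and>
           t \<le> f k * length (enc_param (x, k)) ^ c \<and>
           k' \<le> g k \<and>
           ((x, k) \<in> P \<longleftrightarrow> (x', k') \<in> Q)))"

text \<open>
  A Boolean circuit is listed in topological order: gates refer to earlier positions, and the last
  gate is the output.
\<close>

datatype gate = GIn | GNot nat | GAnd "nat list" | GOr "nat list"

type_synonym circuit = "gate list"

fun preds :: "gate \<Rightarrow> nat list" where
  "preds GIn = []"
| "preds (GNot j) = [j]"
| "preds (GAnd js) = js"
| "preds (GOr js) = js"

fun wf_gate :: "gate \<Rightarrow> bool" where
  "wf_gate (GAnd js) \<longleftrightarrow> distinct js \<and> 2 \<le> length js"
| "wf_gate (GOr js) \<longleftrightarrow> distinct js \<and> 2 \<le> length js"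
| "wf_gate _ \<longleftrightarrow> True"

definition wf_circuit :: "circuit \<Rightarrow> bool" where
  "wf_circuit C \<longleftrightarrow> C \<noteq> [] \<and>
     (\<forall>i<length C. wf_gate (C ! i) \<and> (\<forall>j\<in>set (preds (C ! i)). j < i))"

fun gate_value :: "(nat \<Rightarrow> bool) \<Rightarrow> bool list \<Rightarrow> gate \<Rightarrow> bool" where
  "gate_value a vs GIn = a (length vs)"
| "gate_value a vs (GNot j) = (\<not> vs ! j)"
| "gate_value a vs (GAnd js) = (\<forall>j\<in>set js. vs ! j)"
| "gate_value a vs (GOr js) = (\<exists>j\<in>set js. vs ! j)"

text \<open>The assignment is given on the positions of the input gates.\<close>

definition circuit_values :: "(nat \<Rightarrow> bool) \<Rightarrow> circuit \<Rightarrow> bool list" where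
  "circuit_values a C = foldl (\<lambda>vs g. vs @ [gate_value a vs g]) [] C"

definition circuit_satisfies :: "(nat \<Rightarrow> bool) \<Rightarrow> circuit \<Rightarrow> bool" where
  "circuit_satisfies a C \<longleftrightarrow> last (circuit_values a C)"

definition weight :: "(nat \<Rightarrow> bool) \<Rightarrow> circuit \<Rightarrow> nat" where
  "weight a C = card {i. i < length C \<and> C ! i = GIn \<and> a i}"

definition input_output_path :: "circuit \<Rightarrow> nat list \<Rightarrow> bool" where
  "input_output_path C xs \<longleftrightarrow> xs \<noteq> [] \<and> (\<forall>i\<in>set xs. i < length C) \<and>
     successively (\<lambda>j i. j \<in> set (preds (C ! i))) xs \<and>
     C ! hd xs = GIn \<and> last xs = length C - 1"

definition depth_at_most :: "circuit \<Rightarrow> nat \<Rightarrow> bool" where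
  "depth_at_most C d \<longleftrightarrow> (\<forall>xs. input_output_path C xs \<longrightarrow> length xs - 1 \<le> d)"

text \<open>The large gates are those of fan-in greater than two.\<close>

definition weft_at_most :: "circuit \<Rightarrow> nat \<Rightarrow> bool" where
  "weft_at_most C t \<longleftrightarrow> (\<forall>xs. input_output_path C xs \<longrightarrow>
     length (filter (\<lambda>i. length (preds (C ! i)) > 2) xs) \<le> t)"

fun enc_gate :: "gate \<Rightarrow> bool list" where
  "enc_gate GIn = [False, False]"
| "enc_gate (GNot j) = [False, True] @ enc_nat j"
| "enc_gate (GAnd js) = [True, False] @ enc_list enc_nat js"
| "enc_gate (GOr js) = [True, True] @ enc_list enc_nat js"

lemma prefix_free_enc_gate: "prefix_free enc_gate"
proof -
  have "g = g' \<and> u = v" if "enc_gate g @ u = enc_gate g' @ v" for g g' u v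
    using that
    by (cases g; cases g')
      (simp_all add: prefix_free_iff prefix_free_enc_nat prefix_free_enc_list)
  then show ?thesis unfolding prefix_free_def by blast
qed

definition weighted_circuit_sat :: "nat \<Rightarrow> nat \<Rightarrow> param_problem" where
  "weighted_circuit_sat t d =
     {(enc_list enc_gate C, k) | C k. wf_circuit C \<and> weft_at_most C t \<and> depth_at_most C d \<and>
        (\<exists>a. circuit_satisfies a C \<and> weight a C = k)}"

definition W :: "nat \<Rightarrow> param_problem set" where
  "W t = {P. \<exists>d. fpt_reducible P (weighted_circuit_sat t d)}"

definition W_hard :: "nat \<Rightarrow> param_problem \<Rightarrow> bool" where
  "W_hard t Q \<longleftrightarrow> (\<forall>P\<in>W t. fpt_reducible P Q)"


section \<open>The Exponential Time Hypothesis\<close>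

text \<open>The literal \<open>(x, b)\<close> requires the variable \<open>x\<close> to have the value \<open>b\<close>.\<close>

type_synonym cnf = "(nat \<times> bool) list list"

definition three_cnf :: "cnf \<Rightarrow> bool" where
  "three_cnf F \<longleftrightarrow> (\<forall>c\<in>set F. length c \<le> 3)"

definition cnf_vars :: "cnf \<Rightarrow> nat set" where
  "cnf_vars F = (\<Union>c\<in>set F. fst ` set c)"

definition cnf_satisfiable :: "cnf \<Rightarrow> bool" where
  "cnf_satisfiable F \<longleftrightarrow> (\<exists>a. \<forall>c\<in>set F. \<exists>(x, b)\<in>set c. a x = b)"

fun enc_literal :: "nat \<times> bool \<Rightarrow> bool list" where
  "enc_literal (x, b) = b # enc_nat x"

definition enc_cnf :: "cnf \<Rightarrow> bool list" where
  "enc_cnf F = enc_list (enc_list enc_literal) F"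

lemma prefix_free_enc_literal: "prefix_free enc_literal"
  unfolding prefix_free_def
  by (auto simp: prefix_free_iff[OF prefix_free_enc_nat])

lemma inj_enc_cnf: "inj enc_cnf"
  unfolding enc_cnf_def
  by (intro prefix_free_inj prefix_free_enc_list prefix_free_enc_literal)

text \<open>
  Subexponential in the number \<open>n\<close> of variables means \<open>2\<close> to the power \<open>o(n)\<close>. The polynomial
  factor in the length of the formula is needed because clauses may be repeated and variables may
  have large indices, so that this length is not bounded in terms of \<open>n\<close>; without it the
  hypothesis would be trivially true.
\<close>

definition ETH :: bool where
  "ETH \<longleftrightarrow> \<not> (\<exists>p h c. h \<in> o(\<lambda>n. real n) \<and>
     (\<forall>F. three_cnf F \<longrightarrow>
        (\<exists>t. computes p (enc_cnf F) t [cnf_satisfiable F] \<and>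
           real t \<le> 2 powr (h (card (cnf_vars F))) * real (length (enc_cnf F)) ^ c)))"


section \<open>Steiner Orientation\<close>

record 'v mixed_graph =
  verts :: "'v set"
  arcs :: "('v \<times> 'v) set"
  edges :: "'v set set"

definition wf_mixed_graph :: "'v mixed_graph \<Rightarrow> bool" where
  "wf_mixed_graph G \<longleftrightarrow> finite (verts G) \<and> verts G \<noteq> {} \<and>
     arcs G \<subseteq> {(u, v). u \<in> verts G \<and> v \<in> verts G \<and> u \<noteq> v} \<and>
     edges G \<subseteq> {{u, v} | u v. u \<in> verts G \<and> v \<in> verts G \<and> u \<noteq> v}"

definition is_orientation :: "('v \<times> 'v) set \<Rightarrow> 'v set set \<Rightarrow> bool" where
  "is_orientation D E \<longleftrightarrow>
     (\<forall>(u, v)\<in>D. {u, v} \<in> E) \<and> (\<forall>e\<in>E. \<exists>!a. a \<in> D \<and> e = {fst a, snd a})"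

definition steiner_orientable :: "'v mixed_graph \<Rightarrow> ('v \<times> 'v) set \<Rightarrow> bool" where
  "steiner_orientable G T \<longleftrightarrow>
     (\<exists>D. is_orientation D (edges G) \<and> (\<forall>(s, t)\<in>T. (s, t) \<in> (arcs G \<union> D)\<^sup>*))"

text \<open>
  As inputs of algorithms, graphs have vertices \<open>0, \<dots>, n - 1\<close> and are given by adjacency matrices,
  so that the length of the input is polynomial in \<open>n\<close>.
\<close>

definition steiner_instance :: "nat mixed_graph \<Rightarrow> (nat \<times> nat) set \<Rightarrow> bool" where
  "steiner_instance G T \<longleftrightarrow> wf_mixed_graph G \<and> (\<exists>n. verts G = {..<n}) \<and>
     T \<subseteq> verts G \<times> verts G"

definition enc_matrix :: "nat \<Rightarrow> (nat \<Rightarrow> nat \<Rightarrow> bool) \<Rightarrow> bool list" where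
  "enc_matrix n M = concat (map (\<lambda>i. map (M i) [0..<n]) [0..<n])"

definition enc_steiner :: "nat mixed_graph \<Rightarrow> (nat \<times> nat) set \<Rightarrow> bool list" where
  "enc_steiner G T = (let n = card (verts G) in
     enc_nat n @
     enc_matrix n (\<lambda>i j. (i, j) \<in> arcs G) @
     enc_matrix n (\<lambda>i j. {i, j} \<in> edges G) @
     enc_matrix n (\<lambda>i j. (i, j) \<in> T))"

lemma length_enc_matrix: "length (enc_matrix n M) = n * n"
  by (simp add: enc_matrix_def length_concat comp_def sum_list_triv)

lemma enc_matrix_eqD:
  assumes "enc_matrix n M = enc_matrix n M'" and "i < n" and "j < n"
  shows "M i j = M' i j"
proof -
  have "map (\<lambda>i. map (M i) [0..<n]) [0..<n] = map (\<lambda>i. map (M' i) [0..<n]) [0..<n]"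
    by (rule concat_injective) (use assms(1) in \<open>auto simp: enc_matrix_def zip_map_map zip_same_conv_map\<close>)
  then show ?thesis using assms(2,3) by simp
qed

lemma enc_steiner_inj:
  assumes "steiner_instance G T" and "steiner_instance G' T'"
    and eq: "enc_steiner G T = enc_steiner G' T'"
  shows "G = G' \<and> T = T'"
proof -
  obtain n n' where n: "verts G = {..<n}" and n': "verts G' = {..<n'}"
    using assms by (auto simp: steiner_instance_def)
  from eq have "enc_nat n @ (enc_matrix n (\<lambda>i j. (i, j) \<in> arcs G) @
      enc_matrix n (\<lambda>i j. {i, j} \<in> edges G) @ enc_matrix n (\<lambda>i j. (i, j) \<in> T)) =
    enc_nat n' @ (enc_matrix n' (\<lambda>i j. (i, j) \<in> arcs G') @
      enc_matrix n' (\<lambda>i j. {i, j} \<in> edges G') @ enc_matrix n' (\<lambda>i j. (i, j) \<in> T'))"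
    by (simp add: enc_steiner_def Let_def n n')
  note * = prefix_freeD[OF prefix_free_enc_nat this]
  then have nn: "n' = n" by simp
  have bits:
      "enc_matrix n (\<lambda>i j. (i, j) \<in> arcs G) = enc_matrix n (\<lambda>i j. (i, j) \<in> arcs G')"
      "enc_matrix n (\<lambda>i j. {i, j} \<in> edges G) = enc_matrix n (\<lambda>i j. {i, j} \<in> edges G')"
      "enc_matrix n (\<lambda>i j. (i, j) \<in> T) = enc_matrix n (\<lambda>i j. (i, j) \<in> T')"
  proof -
    have "u = u' \<and> v = v' \<and> w = w'"
      if "u @ v @ w = u' @ v' @ w'" "length u = length u'" "length v = length v'"
      for u v w u' v' w' :: "bool list"
      using that by simp
    from this[OF conjunct2[OF *, unfolded nn]]
    show "enc_matrix n (\<lambda>i j. (i, j) \<in> arcs G) = enc_matrix n (\<lambda>i j. (i, j) \<in> arcs G')"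
      "enc_matrix n (\<lambda>i j. {i, j} \<in> edges G) = enc_matrix n (\<lambda>i j. {i, j} \<in> edges G')"
      "enc_matrix n (\<lambda>i j. (i, j) \<in> T) = enc_matrix n (\<lambda>i j. (i, j) \<in> T')"
      by (simp_all only: length_enc_matrix)
  qed
  have arcs_iff: "(i, j) \<in> arcs G \<longleftrightarrow> (i, j) \<in> arcs G'" if "i < n" "j < n" for i j
    using enc_matrix_eqD[OF bits(1) that] .
  have edges_iff: "{i, j} \<in> edges G \<longleftrightarrow> {i, j} \<in> edges G'" if "i < n" "j < n" for i j
    using enc_matrix_eqD[OF bits(2) that] .
  have T_iff: "(i, j) \<in> T \<longleftrightarrow> (i, j) \<in> T'" if "i < n" "j < n" for i j
    using enc_matrix_eqD[OF bits(3) that] .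
  have wf:
      "arcs G \<subseteq> {(u, v). u \<in> verts G \<and> v \<in> verts G \<and> u \<noteq> v}"
      "arcs G' \<subseteq> {(u, v). u \<in> verts G' \<and> v \<in> verts G' \<and> u \<noteq> v}"
      "edges G \<subseteq> {{u, v} | u v. u \<in> verts G \<and> v \<in> verts G \<and> u \<noteq> v}"
      "edges G' \<subseteq> {{u, v} | u v. u \<in> verts G' \<and> v \<in> verts G' \<and> u \<noteq> v}"
      "T \<subseteq> verts G \<times> verts G" "T' \<subseteq> verts G' \<times> verts G'"
    using assms(1,2) by (simp_all add: steiner_instance_def wf_mixed_graph_def)
  have arcs_lt: "i < n \<and> j < n" if "(i, j) \<in> arcs G \<union> arcs G' \<union> T \<union> T'" for i j
    using wf n n' nn that by auto
  have edges_lt: "\<exists>i j. e = {i, j} \<and> i < n \<and> j < n" if "e \<in> edges G \<union> edges G'" for e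
    using that wf(3,4) unfolding n n' nn by blast
  have "arcs G = arcs G'"
  proof (rule set_eqI)
    fix a :: "nat \<times> nat"
    obtain i j where a: "a = (i, j)" by (rule prod.exhaust)
    show "a \<in> arcs G \<longleftrightarrow> a \<in> arcs G'"
      unfolding a using arcs_lt[of i j] arcs_iff[of i j] by blast
  qed
  moreover have "edges G = edges G'"
  proof (rule set_eqI)
    fix e
    show "e \<in> edges G \<longleftrightarrow> e \<in> edges G'"
    proof (cases "e \<in> edges G \<union> edges G'")
      case True
      then obtain i j where "e = {i, j}" "i < n" "j < n" using edges_lt by meson
      then show ?thesis using edges_iff by simp
    qed simp
  qed
  moreover have "T = T'"
  proof (rule set_eqI)
    fix a :: "nat \<times> nat"
    obtain i j where a: "a = (i, j)" by (rule prod.exhaust)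
    show "a \<in> T \<longleftrightarrow> a \<in> T'"
      unfolding a using arcs_lt[of i j] T_iff[of i j] by blast
  qed
  ultimately show ?thesis using n n' nn by simp
qed

definition steiner_orientation :: param_problem where
  "steiner_orientation =
     {(enc_steiner G T, card T) | G T. steiner_instance G T \<and> steiner_orientable G T}"

definition solves_steiner_orientation_in_time :: "prog \<Rightarrow> (nat \<Rightarrow> nat \<Rightarrow> real) \<Rightarrow> bool" where
  "solves_steiner_orientation_in_time p \<tau> \<longleftrightarrow>
     (\<forall>G T. steiner_instance G T \<longrightarrow>
        (\<exists>t. computes p (enc_steiner G T) t [steiner_orientable G T] \<and>
           real t \<le> \<tau> (card (verts G)) (card T)))"

end

theory Submission
  imports Defs
begin

text \<open>
  Both parts rest on a reduction from binary constraint satisfaction. A constraint becomes a grid in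
  which a row path and a column path have to share a cell whenever they encode a forbidden pair of
  values; the shared cell is an undirected edge, which the two paths need in opposite directions.
  Requests between the sides of the grids and a hub for each variable keep the values consistent.
  The number of requests is linear in the number of constraints and variables.

  For W[1]-hardness, the \<open>k\<close> true inputs of a circuit split the positions into \<open>k + 1\<close> gaps. As there
  is at most one large gate on each path, a bounded number of gaps and a guess of the values of the
  topmost large gates suffice to check every gate locally, so that the choices of boundedly many gaps
  at a time serve as variables of a constraint satisfaction problem.

  For the lower bound, a 3-CNF formula is sparsified, and the occurrences of its variables are routed
  to its clauses in the manner of a radix sort: \<open>w + 2\<close> levels of \<open>2 ^ w\<close> bags each, where the
  occurrences in two consecutive levels meet in linearly many pairs of bags. The result has
  \<open>O(w 2 ^ w)\<close> constraints over a domain of size \<open>2 ^ O(n / 2 ^ w)\<close>, so a fast algorithm for Steiner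
  Orientation would yield one for 3-SAT with running time \<open>2 ^ (\<epsilon> n)\<close>, for every \<open>\<epsilon>\<close>.
\<close>

section \<open>Polynomial-time functions\<close>

subsection \<open>Running programs\<close>

text \<open>The quotient \<open>k / ln k\<close> comes from the routing. If \<open>K\<close> groups
  of clauses were compared pairwise, there would be about \<open>K ^ 2\<close> requests, and only
  exponents of the order of the square root of \<open>k\<close> would be excluded. With
  \<open>K = 2 ^ w\<close>, the radix network needs about \<open>w * K\<close> constraints, so that
  \<open>k / ln k\<close> is of order \<open>K\<close>; raising a domain size of
  \<open>2 ^ (O(m / K))\<close> to the power \<open>o(K)\<close> gives \<open>2 ^ (o(m))\<close>,
  where \<open>m\<close> is the number of clauses. Sparsification makes \<open>m\<close> linear in
  the number of variables.

  \<open>ETH\<close> speaks of one program and one function \<open>h\<close>, while the argument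
  gives a bound for each \<epsilon> separately, with parameters that depend on \<epsilon>. The
  search tries all parameters and budgets and runs the given solver against a clock, so that one
  program serves every \<epsilon>.

  All running times are those of actual programs. To avoid programming, a class of functions on
  self-delimiting codes is shown to be closed under the usual list operations, and each construction
  is only shown to belong to it.\<close>

definition runs :: "prog => store => nat => store => bool" where
  "runs p s n s' \<longleftrightarrow> (\<exists>t\<le>n. exec p s t s')"

lemma runs_mono: "runs p s n s' ==> n \<le> m ==> runs p s m s'"
  unfolding runs_def by (meson order_trans)

lemma runs_Seq: "runs p s n s1 ==> runs q s1 m s2 ==> runs (Seq p q) s (n + m) s2"
  unfolding runs_def by (meson add_mono exec.Seq)

lemma runs_Loop_Nil: "s i = [] ==> runs (Loop i p) s 1 s"
  unfolding runs_def using exec.Loop_Nil by blast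

lemma runs_Loop_Step:
  assumes "s i \<noteq> []" "runs p s n s1" "runs (Loop i p) s1 m s2"
  shows "runs (Loop i p) s (Suc (n + m)) s2"
  using assms unfolding runs_def by (meson add_mono exec.Loop_Step Suc_le_mono)

lemma runs_Branch:
  assumes "s i = b # u" "runs (if b then r else q) s n s'"
  shows "runs (Branch i p q r) s (Suc n) s'"
proof -
  obtain t where t: "t \<le> n" "exec (if b then r else q) s t s'"
    using assms(2) unfolding runs_def by blast
  have "exec (Branch i p q r) s (Suc t) s'"
  proof (cases b)
    case True
    with exec.Branch_True[of s i u r t s' p q] assms(1) t show ?thesis by simp
  next
    case False
    with exec.Branch_False[of s i u q t s' p r] assms(1) t show ?thesis by simp
  qed
  with t(1) show ?thesis unfolding runs_def by (meson Suc_le_mono)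
qed

fun loop_free :: "prog => bool" where
  "loop_free (Loop i p) \<longleftrightarrow> False"
| "loop_free (Seq p q) \<longleftrightarrow> loop_free p \<and> loop_free q"
| "loop_free (Branch i p q r) \<longleftrightarrow> loop_free p \<and> loop_free q \<and> loop_free r"
| "loop_free _ \<longleftrightarrow> True"

fun result :: "prog => store => store" where
  "result (Push i b) s = s(i := b # s i)"
| "result (Pop i) s = s(i := tl (s i))"
| "result (Seq p q) s = result q (result p s)"
| "result (Branch i p q r) s =
     (if s i = [] then result p s else if hd (s i) then result r s else result q s)"
| "result _ s = s"

text \<open>All three branches are added up, so that the bound does not depend on the store.\<close>

fun cost :: "prog => nat" where
  "cost (Seq p q) = cost p + cost q"
| "cost (Branch i p q r) = Suc (cost p + cost q + cost r)"
| "cost _ = 1"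

lemma runs_loop_free: "loop_free p ==> runs p s (cost p) (result p s)"
proof (induction p arbitrary: s)
  case (Seq p q)
  then show ?case by (auto intro: runs_Seq)
next
  case (Branch i p q r)
  obtain t1 where t1: "t1 \<le> cost p" "exec p s t1 (result p s)"
    using Branch.IH(1)[of s] Branch.prems unfolding runs_def by auto
  obtain t2 where t2: "t2 \<le> cost q" "exec q s t2 (result q s)"
    using Branch.IH(2)[of s] Branch.prems unfolding runs_def by auto
  obtain t3 where t3: "t3 \<le> cost r" "exec r s t3 (result r s)"
    using Branch.IH(3)[of s] Branch.prems unfolding runs_def by auto
  show ?case
  proof (cases "s i")
    case Nil
    from exec.Branch_Nil[OF Nil t1(2)] t1(1) Nil show ?thesis unfolding runs_def
      by (intro exI[of _ "Suc t1"]) auto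
  next
    case (Cons b w)
    show ?thesis
    proof (cases b)
      case True
      from exec.Branch_True[of s i w r t3 _ p q] t3 Cons True show ?thesis unfolding runs_def
        by (intro exI[of _ "Suc t3"]) auto
    next
      case False
      from exec.Branch_False[of s i w q t2 _ p r] t2 Cons False show ?thesis unfolding runs_def
        by (intro exI[of _ "Suc t2"]) auto
    qed
  qed
qed (simp_all add: runs_def, (metis One_nat_def exec.Skip exec.Push exec.Pop le_refl)+)

lemma runs_loop_freeI: "loop_free p ==> result p s = s' ==> cost p \<le> n ==> runs p s n s'"
  using runs_loop_free runs_mono by blast

text \<open>A step pushes at most one bit. Time bounds are therefore also size bounds; this yields
  \<open>polyb_sz_PF\<close> and bounds the cost of clearing stacks.\<close>

lemma exec_length: "exec p s t s' ==> length (s' i) \<le> length (s i) + t"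
  by (induction arbitrary: i rule: exec.induct) (auto intro: order_trans le_SucI,
      (metis add.assoc add.commute add_le_mono1 order_trans le_SucI)+)

lemma runs_length: "runs p s n s' ==> length (s' i) \<le> length (s i) + n"
  unfolding runs_def using exec_length by (meson add_left_mono order_trans)

text \<open>Convention for programs on data: stack 0 holds the values, with the current argument on
  top; stack 1 controls the current loop and is empty otherwise; stacks 2 and 3 hold saved
  items.\<close>

definition st :: "bool list => bool list => bool list => bool list => store" where
  "st a b c d = (\<lambda>_. [])(0 := a, 1 := b, 2 := c, 3 := d)"

lemma st_apply [simp]: "st a b c d 0 = a" "st a b c d 1 = b" "st a b c d (Suc 0) = b"
    "st a b c d 2 = c" "st a b c d 3 = d"
  by (simp_all add: st_def)

lemma st_upd [simp]: "(st a b c d)(0 := x) = st x b c d" "(st a b c d)(1 := x) = st a x c d"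
    "(st a b c d)(Suc 0 := x) = st a x c d"
    "(st a b c d)(2 := x) = st a b x d" "(st a b c d)(3 := x) = st a b c x"
  by (auto simp: st_def)

subsection \<open>Self-delimiting codes and their manipulation\<close>

text \<open>These are the codes of binary trees: \<open>False\<close> is a leaf.\<close>

inductive code :: "bool list => bool" where
  leaf: "code [False]"
| node: "code a ==> code b ==> code (True # a @ b)"

lemma code_prefix: "code a ==> code b ==> a @ u = b @ v ==> a = b \<and> u = v"
proof (induction arbitrary: b u v rule: code.induct)
  case leaf
  from leaf.prems show ?case by (auto elim: code.cases)
next
  case (node a1 a2)
  from node.prems(1) show ?case
  proof cases
    case leaf
    with node.prems show ?thesis by simp
  next
    case (node b1 b2)
    with node.prems have "a1 @ (a2 @ u) = b1 @ (b2 @ v)" by simp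
    then have 1: "a1 = b1 \<and> a2 @ u = b2 @ v"
      using node.IH(1)[of b1 "a2 @ u" "b2 @ v"] node by blast
    then have "a2 = b2 \<and> u = v" using node.IH(2)[of b2 u v] node by blast
    then show ?thesis using 1 node by simp
  qed
qed

fun seqs :: "prog list => prog" where
  "seqs [] = Skip"
| "seqs [p] = p"
| "seqs (p # ps) = Seq p (seqs ps)"

text \<open>An item saved on an auxiliary stack is reversed, each bit is preceded by the mark
  \<open>True\<close>, and the end of the item has the mark \<open>False\<close>.\<close>

definition mark :: "bool list => bool list" where
  "mark u = concat (map (\<lambda>b. [True, b]) (rev u))"

lemma mark_Nil [simp]: "mark [] = []" by (simp add: mark_def)
lemma mark_Cons [simp]: "mark (b # u) = mark u @ [True, b]" by (simp add: mark_def)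
lemma mark_snoc [simp]: "mark (u @ [b]) = True # b # mark u" by (simp add: mark_def)
lemma mark_append: "mark (u @ v) = mark v @ mark u" by (simp add: mark_def)

text \<open>Stack 1 has one bit for each subtree that is still to be read: a leaf removes a bit, an
  inner node adds one. Two copies are made, so that the same pass serves for duplicating, moving and
  dropping an item.\<close>

definition save_body :: prog where
  "save_body = Branch 0 Skip
     (seqs [Pop 0, Pop 1, Push 2 False, Push 2 True, Push 3 False, Push 3 True])
     (seqs [Pop 0, Push 1 True, Push 2 True, Push 2 True, Push 3 True, Push 3 True])"

definition save :: prog where
  "save = Seq (seqs [Push 2 False, Push 3 False, Push 1 True]) (Loop 1 save_body)"

text \<open>The continuation form allows the induction hypotheses for the two subtrees of a node to
  be chained.\<close>

lemma save_loop:
  assumes "code a"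
  shows "runs (Loop 1 save_body) (st w r (mark a @ c) (mark a @ d)) n s' ==>
    runs (Loop 1 save_body) (st (a @ w) (x # r) c d) (n + 20 * length a) s'"
  using assms
proof (induction arbitrary: w r c d n x rule: code.induct)
  case leaf
  have "runs save_body (st (False # w) (x # r) c d) 19
      (st w r (True # False # c) (True # False # d))"
    by (rule runs_loop_freeI) (simp_all add: save_body_def)
  from runs_Loop_Step[OF _ this, of 1 n s'] leaf show ?case
    by (auto elim: runs_mono)
next
  case (node a b)
  have 1: "runs save_body (st (True # a @ b @ w) (x # r) c d) 19
      (st (a @ b @ w) (True # x # r) (True # True # c) (True # True # d))"
    by (rule runs_loop_freeI) (simp_all add: save_body_def)
  have "runs (Loop 1 save_body) (st (b @ w) (x # r) (mark a @ True # True # c)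
      (mark a @ True # True # d)) (n + 20 * length b) s'"
    by (rule node.IH(2)) (use node.prems in \<open>simp add: mark_append\<close>)
  then have "runs (Loop 1 save_body) (st (a @ b @ w) (True # x # r) (True # True # c)
      (True # True # d)) (n + 20 * length b + 20 * length a) s'"
    by (rule node.IH(1))
  from runs_Loop_Step[OF _ 1 this] show ?case
    by (auto elim!: runs_mono)
qed

lemma runs_save:
  assumes "code a"
  shows "runs save (st (a @ w) [] c d) (20 * length a + 4)
    (st w [] (mark a @ False # c) (mark a @ False # d))"
proof -
  have 1: "runs (seqs [Push 2 False, Push 3 False, Push 1 True]) (st (a @ w) [] c d) 3
     (st (a @ w) [True] (False # c) (False # d))"
    by (rule runs_loop_freeI) simp_all
  have "runs (Loop 1 save_body) (st w [] (mark a @ False # c) (mark a @ False # d)) 1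
      (st w [] (mark a @ False # c) (mark a @ False # d))"
    by (rule runs_Loop_Nil) simp
  from save_loop[OF assms this]
  have "runs (Loop 1 save_body) (st (a @ w) [True] (False # c) (False # d)) (1 + 20 * length a)
     (st w [] (mark a @ False # c) (mark a @ False # d))" .
  from runs_Seq[OF 1 this] show ?thesis unfolding save_def by (auto elim: runs_mono)
qed

definition restore_body :: "nat => prog" where
  "restore_body j = Branch j Skip
     (seqs [Pop j, Pop 1])
     (Seq (Pop j) (Branch j Skip (seqs [Pop j, Push 0 False]) (seqs [Pop j, Push 0 True])))"

definition restore :: "nat => prog" where
  "restore j = Seq (Push 1 True) (Loop 1 (restore_body j))"

definition discard_body :: "nat => prog" where
  "discard_body j = Branch j Skip (seqs [Pop j, Pop 1]) (seqs [Pop j, Pop j])"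

definition discard :: "nat => prog" where
  "discard j = Seq (Push 1 True) (Loop 1 (discard_body j))"

lemma restore_loop:
  "runs (Loop 1 (restore_body 2)) (st w [True] (mark a @ False # c) d) (20 * length a + 20)
    (st (a @ w) [] c d)"
  "runs (Loop 1 (restore_body 3)) (st w [True] c (mark a @ False # d)) (20 * length a + 20)
    (st (a @ w) [] c d)"
proof -
  have 1: "runs (Loop 1 (restore_body 2)) (st w [True] (mark [] @ False # c) d) 20 (st w [] c d)"
    for w
  proof -
    have 1: "runs (restore_body 2) (st w [True] (mark [] @ False # c) d) 12 (st w [] c d)"
      by (rule runs_loop_freeI) (simp_all add: restore_body_def)
    have "runs (Loop 1 (restore_body 2)) (st w [] c d) 1 (st w [] c d)"
      by (rule runs_Loop_Nil) simp
    from runs_Loop_Step[OF _ 1 this] show ?thesis by (auto elim: runs_mono)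
  qed
  have 2: "runs (Loop 1 (restore_body 3)) (st w [True] c (mark [] @ False # d)) 20 (st w [] c d)"
    for w
  proof -
    have 1: "runs (restore_body 3) (st w [True] c (mark [] @ False # d)) 12 (st w [] c d)"
      by (rule runs_loop_freeI) (simp_all add: restore_body_def)
    have "runs (Loop 1 (restore_body 3)) (st w [] c d) 1 (st w [] c d)"
      by (rule runs_Loop_Nil) simp
    from runs_Loop_Step[OF _ 1 this] show ?thesis by (auto elim: runs_mono)
  qed
  show "runs (Loop 1 (restore_body 2)) (st w [True] (mark a @ False # c) d) (20 * length a + 20)
    (st (a @ w) [] c d)"
  proof (induction a arbitrary: w rule: rev_induct)
    case Nil
    then show ?case using 1 by simp
  next
    case (snoc b a)
    have "runs (restore_body 2) (st w [True] (mark (a @ [b]) @ False # c) d) 12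
        (st (b # w) [True] (mark a @ False # c) d)"
      by (rule runs_loop_freeI) (simp_all add: restore_body_def)
    from runs_Loop_Step[OF _ this snoc.IH] show ?case by (auto elim!: runs_mono)
  qed
  show "runs (Loop 1 (restore_body 3)) (st w [True] c (mark a @ False # d)) (20 * length a + 20)
    (st (a @ w) [] c d)"
  proof (induction a arbitrary: w rule: rev_induct)
    case Nil
    then show ?case using 2 by simp
  next
    case (snoc b a)
    have "runs (restore_body 3) (st w [True] c (mark (a @ [b]) @ False # d)) 12
        (st (b # w) [True] c (mark a @ False # d))"
      by (rule runs_loop_freeI) (simp_all add: restore_body_def)
    from runs_Loop_Step[OF _ this snoc.IH] show ?case by (auto elim!: runs_mono)
  qed
qed

lemma discard_loop:
  "runs (Loop 1 (discard_body 2)) (st w [True] (mark a @ False # c) d) (20 * length a + 20)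
    (st w [] c d)"
  "runs (Loop 1 (discard_body 3)) (st w [True] c (mark a @ False # d)) (20 * length a + 20)
    (st w [] c d)"
proof -
  have 1: "runs (Loop 1 (discard_body 2)) (st w [True] (mark [] @ False # c) d) 20 (st w [] c d)"
  proof -
    have 1: "runs (discard_body 2) (st w [True] (mark [] @ False # c) d) 12 (st w [] c d)"
      by (rule runs_loop_freeI) (simp_all add: discard_body_def)
    have "runs (Loop 1 (discard_body 2)) (st w [] c d) 1 (st w [] c d)"
      by (rule runs_Loop_Nil) simp
    from runs_Loop_Step[OF _ 1 this] show ?thesis by (auto elim: runs_mono)
  qed
  have 2: "runs (Loop 1 (discard_body 3)) (st w [True] c (mark [] @ False # d)) 20 (st w [] c d)"
  proof -
    have 1: "runs (discard_body 3) (st w [True] c (mark [] @ False # d)) 12 (st w [] c d)"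
      by (rule runs_loop_freeI) (simp_all add: discard_body_def)
    have "runs (Loop 1 (discard_body 3)) (st w [] c d) 1 (st w [] c d)"
      by (rule runs_Loop_Nil) simp
    from runs_Loop_Step[OF _ 1 this] show ?thesis by (auto elim: runs_mono)
  qed
  show "runs (Loop 1 (discard_body 2)) (st w [True] (mark a @ False # c) d) (20 * length a + 20)
    (st w [] c d)"
  proof (induction a rule: rev_induct)
    case Nil
    then show ?case using 1 by simp
  next
    case (snoc b a)
    have "runs (discard_body 2) (st w [True] (mark (a @ [b]) @ False # c) d) 12
        (st w [True] (mark a @ False # c) d)"
      by (rule runs_loop_freeI) (simp_all add: discard_body_def)
    from runs_Loop_Step[OF _ this snoc.IH] show ?case by (auto elim!: runs_mono)
  qed
  show "runs (Loop 1 (discard_body 3)) (st w [True] c (mark a @ False # d)) (20 * length a + 20)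
    (st w [] c d)"
  proof (induction a rule: rev_induct)
    case Nil
    then show ?case using 2 by simp
  next
    case (snoc b a)
    have "runs (discard_body 3) (st w [True] c (mark (a @ [b]) @ False # d)) 12
        (st w [True] c (mark a @ False # d))"
      by (rule runs_loop_freeI) (simp_all add: discard_body_def)
    from runs_Loop_Step[OF _ this snoc.IH] show ?case by (auto elim!: runs_mono)
  qed
qed

lemma runs_restore:
  "runs (restore 2) (st w [] (mark a @ False # c) d) (20 * length a + 21) (st (a @ w) [] c d)"
  "runs (restore 3) (st w [] c (mark a @ False # d)) (20 * length a + 21) (st (a @ w) [] c d)"
proof -
  have p: "runs (Push 1 True) (st w [] c d) 1 (st w [True] c d)" for w c d
    by (rule runs_loop_freeI) simp_all
  show "runs (restore 2) (st w [] (mark a @ False # c) d) (20 * length a + 21) (st (a @ w) [] c d)"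
    unfolding restore_def by (rule runs_mono[OF runs_Seq[OF p restore_loop(1)]]) simp
  show "runs (restore 3) (st w [] c (mark a @ False # d)) (20 * length a + 21) (st (a @ w) [] c d)"
    unfolding restore_def by (rule runs_mono[OF runs_Seq[OF p restore_loop(2)]]) simp
qed

lemma runs_discard:
  "runs (discard 2) (st w [] (mark a @ False # c) d) (20 * length a + 21) (st w [] c d)"
  "runs (discard 3) (st w [] c (mark a @ False # d)) (20 * length a + 21) (st w [] c d)"
proof -
  have p: "runs (Push 1 True) (st w [] c d) 1 (st w [True] c d)" for w c d
    by (rule runs_loop_freeI) simp_all
  show "runs (discard 2) (st w [] (mark a @ False # c) d) (20 * length a + 21) (st w [] c d)"
    unfolding discard_def by (rule runs_mono[OF runs_Seq[OF p discard_loop(1)]]) simp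
  show "runs (discard 3) (st w [] c (mark a @ False # d)) (20 * length a + 21) (st w [] c d)"
    unfolding discard_def by (rule runs_mono[OF runs_Seq[OF p discard_loop(2)]]) simp
qed

definition dup :: prog where "dup = Seq save (Seq (restore 2) (restore 3))"
definition drop_top :: prog where "drop_top = Seq save (Seq (discard 2) (discard 3))"
definition to2 :: prog where "to2 = Seq save (discard 3)"
definition to3 :: prog where "to3 = Seq save (discard 2)"

lemma runs_dup: "code a ==> runs dup (st (a @ w) [] c d) (100 * length a + 100) (st (a @ a @ w) [] c d)"
  unfolding dup_def
  by (rule runs_mono[OF runs_Seq[OF runs_save runs_Seq[OF runs_restore(1) runs_restore(2)]]]) auto

lemma runs_drop_top: "code a ==> runs drop_top (st (a @ w) [] c d) (100 * length a + 100) (st w [] c d)"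
  unfolding drop_top_def
  by (rule runs_mono[OF runs_Seq[OF runs_save runs_Seq[OF runs_discard(1) runs_discard(2)]]]) auto

lemma runs_to2: "code a ==>
    runs to2 (st (a @ w) [] c d) (100 * length a + 100) (st w [] (mark a @ False # c) d)"
  unfolding to2_def by (rule runs_mono[OF runs_Seq[OF runs_save runs_discard(2)]]) auto

lemma runs_to3: "code a ==>
    runs to3 (st (a @ w) [] c d) (100 * length a + 100) (st w [] c (mark a @ False # d))"
  unfolding to3_def by (rule runs_mono[OF runs_Seq[OF runs_save runs_discard(1)]]) auto

text \<open>Compares the items on stacks 2 and 3, and combines the outcome with the bit on stack 0.\<close>

definition compare_body :: prog where
  "compare_body = Branch 2 Skip
     (Branch 3 Skip (seqs [Pop 2, Pop 3, Pop 1]) (seqs [Pop 0, Push 0 False, Pop 3, Pop 3]))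
     (Branch 3 Skip (seqs [Pop 0, Push 0 False, Pop 2, Pop 2])
       (seqs [Pop 2, Pop 3,
         Branch 2 Skip (Branch 3 Skip Skip (seqs [Pop 0, Push 0 False]))
           (Branch 3 Skip (seqs [Pop 0, Push 0 False]) Skip),
         Pop 2, Pop 3]))"

text \<open>The bit \<open>r\<close> records the agreement so far. When one item ends early, the
  longer one is still consumed, so that nothing is left behind on the auxiliary stacks.\<close>

lemma compare_loop:
  "runs (Loop 1 compare_body) (st (r # w) [True] (mark (rev u) @ False # c) (mark (rev v) @ False # d))
     (50 * (length u + length v + 1)) (st ((r \<and> u = v) # w) [] c d)"
proof (induction "length u + length v" arbitrary: r u v rule: less_induct)
  case less
  have e: "runs (Loop 1 compare_body) (st w [] c d) 1 (st w [] c d)" for w c d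
    by (rule runs_Loop_Nil) simp
  show ?case
  proof (cases u)
    case Nil
    show ?thesis
    proof (cases v)
      case Nil': Nil
      have 1: "runs compare_body (st (r # w) [True] (mark (rev u) @ False # c) (mark (rev v) @ False # d)) 40
          (st (r # w) [] c d)"
        by (rule runs_loop_freeI) (simp_all add: compare_body_def Nil Nil')
      from runs_Loop_Step[OF _ 1 e] show ?thesis using Nil Nil' by (auto elim!: runs_mono)
    next
      case (Cons b v')
      have 1: "runs compare_body (st (r # w) [True] (mark (rev u) @ False # c) (mark (rev v) @ False # d)) 40
          (st (False # w) [True] (mark (rev u) @ False # c) (mark (rev v') @ False # d))"
        by (rule runs_loop_freeI) (simp_all add: compare_body_def Nil Cons)
      from runs_Loop_Step[OF _ 1 less[of u v' False]] show ?thesis using Nil Cons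
        by (auto elim!: runs_mono)
    qed
  next
    case (Cons a u')
    show ?thesis
    proof (cases v)
      case Nil
      have 1: "runs compare_body (st (r # w) [True] (mark (rev u) @ False # c) (mark (rev v) @ False # d)) 40
          (st (False # w) [True] (mark (rev u') @ False # c) (mark (rev v) @ False # d))"
        by (rule runs_loop_freeI) (simp_all add: compare_body_def Nil Cons)
      from runs_Loop_Step[OF _ 1 less[of u' v False]] show ?thesis using Nil Cons
        by (auto elim!: runs_mono)
    next
      case Cons': (Cons b v')
      have 1: "runs compare_body (st (r # w) [True] (mark (rev u) @ False # c) (mark (rev v) @ False # d)) 40
          (st ((r \<and> a = b) # w) [True] (mark (rev u') @ False # c) (mark (rev v') @ False # d))"
        by (rule runs_loop_freeI) (auto simp: compare_body_def Cons Cons')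
      have "(r \<and> a = b) \<and> u' = v' \<longleftrightarrow> r \<and> u = v" using Cons Cons' by auto
      with runs_Loop_Step[OF _ 1 less[of u' v' "r \<and> a = b"]] show ?thesis using Cons Cons'
        by (auto elim!: runs_mono)
    qed
  qed
qed

lemma runs_compare:
  "runs (Seq (Push 1 True) (Loop 1 compare_body))
     (st (r # w) [] (mark u @ False # c) (mark v @ False # d))
     (50 * (length u + length v + 2)) (st ((r \<and> u = v) # w) [] c d)"
proof -
  have p: "runs (Push 1 True) (st w [] c d) 1 (st w [True] c d)" for w c d
    by (rule runs_loop_freeI) simp_all
  from runs_Seq[OF p compare_loop[of r w "rev u" c "rev v" d]] show ?thesis
    by (auto elim: runs_mono)
qed

fun push_all :: "bool list => prog" where
  "push_all [] = Skip"
| "push_all (b # u) = Seq (push_all u) (Push 0 b)"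

lemma runs_push_all: "runs (push_all u) (st w b c d) (length u + 1) (st (u @ w) b c d)"
proof (induction u)
  case Nil
  show ?case by (rule runs_loop_freeI) simp_all
next
  case (Cons x u)
  have "runs (Push 0 x) (st (u @ w) b c d) 1 (st (x # u @ w) b c d)"
    by (rule runs_loop_freeI) simp_all
  from runs_Seq[OF Cons this] show ?case by simp
qed

subsection \<open>Data types\<close>

text \<open>Values lie on stack 0 one after the other, so each code has to mark its own end.\<close>

class data =
  fixes bits :: "'a => bool list"
  assumes code_bits: "code (bits x)"
    and inj_bits: "bits x = bits y ==> x = y"

lemma bits_prefix: "bits (x :: 'a :: data) @ u = bits y @ v ==> x = y \<and> u = v"
  using code_prefix[OF code_bits code_bits] inj_bits by metis

instantiation unit :: data
begin
definition "bits_unit (x :: unit) = [False]"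
instance by standard (auto simp: bits_unit_def intro: code.leaf)
end

instantiation bool :: data
begin
definition "bits_bool b = (if b then [True, False, False] else [False])"
instance
  by standard (use code.node[OF code.leaf code.leaf] in \<open>auto simp: bits_bool_def intro: code.leaf split: if_splits\<close>)
end

text \<open>Numbers are unary and have the codes of lists of units. Polynomial time thus means
  polynomial in the values of the numbers, and iteration over a number is a fold over a
  list.\<close>

instantiation nat :: data
begin
fun bits_nat :: "nat => bool list" where
  "bits_nat 0 = [False]"
| "bits_nat (Suc n) = True # False # bits_nat n"
instance
proof
  fix x y :: nat
  show "code (bits x)"
  proof (induction x)
    case (Suc n)
    from code.node[OF code.leaf this] show ?case by simp
  qed (simp add: code.leaf)
  show "bits x = bits y ==> x = y"
  proof (induction x arbitrary: y)
    case 0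
    then show ?case by (cases y) auto
  next
    case (Suc x)
    then show ?case by (cases y) auto
  qed
qed
end

instantiation prod :: (data, data) data
begin
definition "bits_prod p = True # bits (fst p) @ bits (snd p)"
instance
proof
  fix x y :: "'a \<times> 'b"
  show "code (bits x)" by (auto simp: bits_prod_def intro: code.node code_bits)
  show "bits x = bits y ==> x = y"
    using bits_prefix[of "fst x" "bits (snd x)" "fst y" "bits (snd y)"]
    by (auto simp: bits_prod_def prod_eq_iff dest: inj_bits)
qed
end

instantiation list :: (data) data
begin
fun bits_list :: "'a list => bool list" where
  "bits_list [] = [False]"
| "bits_list (x # xs) = True # bits x @ bits_list xs"
instance
proof
  fix x y :: "'a list"
  show "code (bits x)"
    by (induction x) (auto intro: code.leaf code.node code_bits)
  show "bits x = bits y ==> x = y"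
  proof (induction x arbitrary: y)
    case Nil
    then show ?case by (cases y) auto
  next
    case (Cons a x)
    then obtain b z where y: "y = b # z" by (cases y) auto
    with Cons bits_prefix[of a "bits x" b "bits z"] show ?case by auto
  qed
qed
end

definition sz :: "'a :: data => nat" where "sz x = length (bits x)"

lemma sz_simps [simp]:
  "sz (u :: unit) = 1" "sz b = (if b then 3 else 1)" "sz n = 2 * n + 1"
  "sz (p, q) = 1 + sz p + sz q" "sz ([] :: 'a :: data list) = 1" "sz (x # xs) = 1 + sz x + sz xs"
  by (simp_all add: sz_def bits_unit_def bits_bool_def bits_prod_def) (induction n, auto)

lemma sz_list: "sz xs = sum_list (map sz xs) + length xs + 1"
  by (induction xs) auto

lemma length_le_sz: "length xs < sz xs"
  by (simp add: sz_list)

lemma sz_mem: "x \<in> set xs ==> sz x < sz xs"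
  by (induction xs) auto

lemma sz_list_bound: "(\<And>x. x \<in> set xs ==> sz x \<le> B) ==> sz xs \<le> length xs * (B + 1) + 1"
proof (induction xs)
  case (Cons a xs)
  then have "sz a \<le> B" "sz xs \<le> length xs * (B + 1) + 1" by simp_all
  then show ?case by simp
qed simp

subsection \<open>Polynomially bounded functions\<close>

text \<open>The base is at least 2, so that a single exponent absorbs constant factors and
  sums.\<close>

definition polyb :: "('a :: data => nat) => bool" where
  "polyb T \<longleftrightarrow> (\<exists>c. \<forall>x. T x \<le> (sz x + 2) ^ c)"

lemma polyb_mono: "polyb T ==> (\<And>x. S x \<le> T x) ==> polyb S"
  unfolding polyb_def by (meson order_trans)

lemma polyb_const: "polyb (\<lambda>_. k)"
proof -
  have "k \<le> (n + 2) ^ k" for n :: nat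
    using less_exp[of k] power_mono[of 2 "n + 2" k] by simp
  then show ?thesis unfolding polyb_def by blast
qed

lemma polyb_sz: "polyb sz"
  unfolding polyb_def by (intro exI[of _ 1]) simp

lemma polyb_mult:
  assumes "polyb S" "polyb T"
  shows "polyb (\<lambda>x. S x * T x)"
proof -
  from assms obtain a b where "S x \<le> (sz x + 2) ^ a" "T x \<le> (sz x + 2) ^ b" for x
    unfolding polyb_def by blast
  then have "S x * T x \<le> (sz x + 2) ^ (a + b)" for x
    by (simp add: power_add mult_mono)
  then show ?thesis unfolding polyb_def by blast
qed

lemma polyb_add:
  assumes "polyb S" "polyb T"
  shows "polyb (\<lambda>x. S x + T x)"
proof (rule polyb_mono)
  show "polyb (\<lambda>x. (S x + 1) * (T x + 1))"
  proof (rule polyb_mult)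
    have *: "polyb (\<lambda>x. S x + 1)" if "polyb S" for S :: "'a => nat"
    proof -
      from that obtain a where a: "S x \<le> (sz x + 2) ^ a" for x unfolding polyb_def by blast
      have "S x + 1 \<le> (sz x + 2) ^ (a + 1)" for x
      proof -
        have "1 \<le> (sz x + 2) ^ a" by simp
        with a[of x] have "S x + 1 \<le> 2 * (sz x + 2) ^ a" by linarith
        also have "\<dots> \<le> (sz x + 2) * (sz x + 2) ^ a" by (intro mult_right_mono) auto
        finally show ?thesis by simp
      qed
      then show ?thesis unfolding polyb_def by blast
    qed
    show "polyb (\<lambda>x. S x + 1)" "polyb (\<lambda>x. T x + 1)" using * assms by auto
  qed
qed simp

lemma polyb_power: "polyb T ==> polyb (\<lambda>x. T x ^ k)"
proof (induction k)
  case 0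
  show ?case using polyb_const[of 1] by simp
next
  case (Suc k)
  from polyb_mult[OF Suc.prems Suc.IH[OF Suc.prems]] show ?case by simp
qed

subsection \<open>The class of polynomial-time functions\<close>

text \<open>The rest \<open>w\<close> of stack 0 and the contents \<open>c\<close>, \<open>d\<close>
  of the auxiliary stacks are arbitrary and survive. This framing is what makes the programs
  composable.\<close>

definition realizes :: "prog => ('a :: data => 'b :: data) => nat => bool" where
  "realizes p f k \<longleftrightarrow>
     (\<forall>x w c d. runs p (st (bits x @ w) [] c d) ((sz x + 2) ^ k) (st (bits (f x) @ w) [] c d))"

definition PF :: "('a :: data => 'b :: data) => bool" where
  "PF f \<longleftrightarrow> (\<exists>p k. realizes p f k)"

lemma PF_I:
  assumes "polyb T"
    and "\<And>x w c d. runs p (st (bits x @ w) [] c d) (T x) (st (bits (f x) @ w) [] c d)"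
  shows "PF f"
proof -
  from assms(1) obtain k where "T x \<le> (sz x + 2) ^ k" for x unfolding polyb_def by blast
  then have "realizes p f k" unfolding realizes_def by (auto intro: runs_mono[OF assms(2)])
  then show ?thesis unfolding PF_def by blast
qed

definition runs_in :: "prog => ('a :: data => 'b :: data) => ('a => nat) => bool" where
  "runs_in p f T \<longleftrightarrow>
     (\<forall>x w c d. runs p (st (bits x @ w) [] c d) (T x) (st (bits (f x) @ w) [] c d))"

lemma runs_inD: "runs_in p f T ==> runs p (st (bits x @ w) [] c d) (T x) (st (bits (f x) @ w) [] c d)"
  unfolding runs_in_def by blast

lemma PF_E:
  assumes "PF f"
  obtains p T where "polyb T" "runs_in p f T"
proof -
  from assms obtain p k where r: "realizes p f k" unfolding PF_def by blast
  have 1: "polyb (\<lambda>x. (sz (x :: 'a) + 2) ^ k)"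
    by (intro polyb_power polyb_add polyb_sz polyb_const)
  have 2: "runs_in p f (\<lambda>x. (sz x + 2) ^ k)" using r unfolding runs_in_def realizes_def by blast
  from that[OF 1 2] show ?thesis .
qed

lemma polyb_sz_PF:
  assumes "PF f"
  shows "polyb (\<lambda>x. sz (f x))"
proof -
  obtain p T where T: "polyb T" and r: "runs_in p f T"
    using PF_E[OF assms] by blast
  show ?thesis
  proof (rule polyb_mono)
    show "polyb (\<lambda>x. sz x + T x)" by (intro polyb_add polyb_sz T)
    show "sz (f x) \<le> sz x + T x" for x
      using runs_length[OF runs_inD[OF r, of x "[]" "[]" "[]"], of 0] by (simp add: sz_def)
  qed
qed

lemma polyb_comp:
  assumes "polyb T" "PF f"
  shows "polyb (\<lambda>x. T (f x))"
proof -
  from assms(1) obtain c where c: "T y \<le> (sz y + 2) ^ c" for y unfolding polyb_def by blast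
  have "polyb (\<lambda>x. (sz (f x) + 2) ^ c)"
    by (intro polyb_power polyb_add polyb_sz_PF assms polyb_const)
  then show ?thesis using c by (rule polyb_mono)
qed

lemma PF_comp:
  assumes "PF g" "PF f"
  shows "PF (\<lambda>x. g (f x))"
proof -
  obtain p T where p: "polyb T" "runs_in p f T"
    using PF_E[OF assms(2)] by blast
  obtain q S where q: "polyb S" "runs_in q g S"
    using PF_E[OF assms(1)] by blast
  show ?thesis
  proof (rule PF_I)
    show "polyb (\<lambda>x. T x + S (f x))" by (rule polyb_add[OF p(1) polyb_comp[OF q(1) assms(2)]])
    show "runs (Seq p q) (st (bits x @ w) [] c d) (T x + S (f x)) (st (bits (g (f x)) @ w) [] c d)"
      for x w c d by (rule runs_Seq[OF runs_inD[OF p(2)] runs_inD[OF q(2)]])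
  qed
qed

lemma PF_id: "PF (\<lambda>x :: 'a :: data. x)"
proof (rule PF_I[where p = Skip])
  show "polyb (\<lambda>_ :: 'a. 1)" by (rule polyb_const)
qed (rule runs_loop_freeI, auto)

text \<open>Only codes matter, and the result types may differ: a nonempty list has the code of a
  pair, and a successor that of a pair with a unit.\<close>

lemma PF_cong_bits: "PF f ==> (\<And>x. bits (g x) = bits (f x)) ==> PF g"
  unfolding PF_def realizes_def by simp

lemma PF_const: "PF (\<lambda>_ :: 'a :: data. k :: 'b :: data)"
proof (rule PF_I)
  show "polyb (\<lambda>x. (100 * sz x + 100) + (length (bits k) + 1))"
    by (intro polyb_add polyb_mult polyb_const polyb_sz)
  show "runs (Seq drop_top (push_all (bits k))) (st (bits x @ w) [] c d)
      ((100 * sz x + 100) + (length (bits k) + 1)) (st (bits k @ w) [] c d)" for x :: 'a and w c d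
    by (rule runs_Seq[OF _ runs_push_all]) (simp add: sz_def runs_drop_top code_bits)
qed

lemma PF_Pair:
  assumes "PF f" "PF g"
  shows "PF (\<lambda>x. (f x, g x))"
proof -
  obtain p T where p: "polyb T" "runs_in p f T"
    using PF_E[OF assms(1)] by blast
  obtain q S where q: "polyb S" "runs_in q g S"
    using PF_E[OF assms(2)] by blast
  have push: "runs (Push 0 True) (st w [] c d) 1 (st (True # w) [] c d)" for w c d
    by (rule runs_loop_freeI) simp_all
  show ?thesis
  proof (rule PF_I)
    show "polyb (\<lambda>x. (100 * sz x + 100) + (T x + ((100 * sz (f x) + 100) +
        (S x + ((20 * sz (f x) + 21) + 1)))))"
      by (intro polyb_add polyb_mult polyb_const polyb_sz p q polyb_sz_PF assms)
    show "runs (Seq dup (Seq p (Seq to2 (Seq q (Seq (restore 2) (Push 0 True))))))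
       (st (bits x @ w) [] c d) ((100 * sz x + 100) + (T x + ((100 * sz (f x) + 100) +
        (S x + ((20 * sz (f x) + 21) + 1))))) (st (bits (f x, g x) @ w) [] c d)" for x w c d
    proof -
      have [simp]: "bits (f x, g x) @ w = True # bits (f x) @ bits (g x) @ w"
        by (simp add: bits_prod_def)
      show ?thesis unfolding sz_def
        by (intro runs_Seq[OF runs_dup] runs_Seq[OF runs_inD[OF p(2)]] runs_Seq[OF runs_to2] runs_Seq[OF runs_inD[OF q(2)]]
          runs_Seq[OF runs_restore(1)] code_bits) (use push in simp)
    qed
  qed
qed

lemma PF_fst': "PF (fst :: 'a :: data \<times> 'b :: data => 'a)"
  and PF_snd': "PF (snd :: 'a \<times> 'b => 'b)"
proof -
  have pop: "runs (Pop 0) (st (True # w) [] c d) 1 (st w [] c d)" for w c d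
    by (rule runs_loop_freeI) simp_all
  show "PF (fst :: 'a \<times> 'b => 'a)"
  proof (rule PF_I)
    show "polyb (\<lambda>x :: 'a \<times> 'b. 1 + ((100 * sz x + 100) + ((100 * sz x + 100) + (20 * sz x + 21))))"
      by (intro polyb_add polyb_mult polyb_const polyb_sz)
    show "runs (Seq (Pop 0) (Seq to2 (Seq drop_top (restore 2))))
       (st (bits x @ w) [] c d) (1 + ((100 * sz x + 100) + ((100 * sz x + 100) + (20 * sz x + 21))))
       (st (bits (fst x) @ w) [] c d)" for x :: "'a \<times> 'b" and w c d
    proof -
      have "runs (Seq (Pop 0) (Seq to2 (Seq drop_top (restore 2))))
         (st (True # (bits (fst x) @ (bits (snd x) @ w))) [] c d)
         (1 + ((100 * sz (fst x) + 100) + ((100 * sz (snd x) + 100) + (20 * sz (fst x) + 21))))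
         (st (bits (fst x) @ w) [] c d)"
        unfolding sz_def
        by (intro runs_Seq[OF pop] runs_Seq[OF runs_to2] runs_Seq[OF runs_drop_top] runs_restore code_bits)
      from runs_mono[OF this] show ?thesis by (simp add: bits_prod_def sz_def)
    qed
  qed
  show "PF (snd :: 'a \<times> 'b => 'b)"
  proof (rule PF_I)
    show "polyb (\<lambda>x :: 'a \<times> 'b. 1 + (100 * sz x + 100))"
      by (intro polyb_add polyb_mult polyb_const polyb_sz)
    show "runs (Seq (Pop 0) drop_top)
       (st (bits x @ w) [] c d) (1 + (100 * sz x + 100))
       (st (bits (snd x) @ w) [] c d)" for x :: "'a \<times> 'b" and w c d
    proof -
      have "runs (Seq (Pop 0) drop_top) (st (True # (bits (fst x) @ (bits (snd x) @ w))) [] c d)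
         (1 + (100 * sz (fst x) + 100)) (st (bits (snd x) @ w) [] c d)"
        unfolding sz_def by (intro runs_Seq[OF pop] runs_drop_top code_bits)
      from runs_mono[OF this] show ?thesis by (simp add: bits_prod_def sz_def)
    qed
  qed
qed

lemmas PF_fst = PF_comp[OF PF_fst'] and PF_snd = PF_comp[OF PF_snd']

lemma PF_if:
  assumes "PF c" "PF f" "PF g"
  shows "PF (\<lambda>x. if c x then f x else g x)"
proof -
  obtain r U where r: "polyb U" "runs_in r c U"
    using PF_E[OF assms(1)] by blast
  obtain p T where p: "polyb T" "runs_in p f T"
    using PF_E[OF assms(2)] by blast
  obtain q S where q: "polyb S" "runs_in q g S"
    using PF_E[OF assms(3)] by blast
  have pop: "runs (Pop 0) (st (b # w) [] c d) 1 (st w [] c d)" for w b c d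
    by (rule runs_loop_freeI) simp_all
  have pop3: "runs (seqs [Pop 0, Pop 0, Pop 0]) (st (a # b # e # w) [] c d) 3 (st w [] c d)" for w a b e c d
    by (rule runs_loop_freeI) simp_all
  show ?thesis
  proof (rule PF_I)
    show "polyb (\<lambda>x. (100 * sz x + 100) + (U x + Suc (3 + T x + S x)))"
      unfolding Suc_eq_plus1
      by (intro polyb_add polyb_mult polyb_const polyb_sz p q r)
    show "runs (Seq dup (Seq r (Branch 0 Skip (Seq (Pop 0) q) (Seq (seqs [Pop 0, Pop 0, Pop 0]) p))))
       (st (bits x @ w) [] k d) ((100 * sz x + 100) + (U x + Suc (3 + T x + S x)))
       (st (bits (if c x then f x else g x) @ w) [] k d)" for x w k d
    proof -
      have b: "runs (Branch 0 Skip (Seq (Pop 0) q) (Seq (seqs [Pop 0, Pop 0, Pop 0]) p))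
          (st (bits (c x) @ bits x @ w) [] k d) (Suc (3 + T x + S x))
          (st (bits (if c x then f x else g x) @ w) [] k d)"
      proof (cases "c x")
        case True
        have "runs (Seq (seqs [Pop 0, Pop 0, Pop 0]) p) (st (True # False # False # bits x @ w) [] k d)
            (3 + T x) (st (bits (f x) @ w) [] k d)"
          by (rule runs_Seq[OF pop3 runs_inD[OF p(2)]])
        then have "runs (Seq (seqs [Pop 0, Pop 0, Pop 0]) p) (st (True # False # False # bits x @ w) [] k d)
            (3 + T x + S x) (st (bits (f x) @ w) [] k d)"
          by (rule runs_mono) simp
        with True show ?thesis
          by (intro runs_Branch[where b = True and u = "False # False # bits x @ w"]) (simp_all add: bits_bool_def)
      next
        case False
        have "runs (Seq (Pop 0) q) (st (False # bits x @ w) [] k d)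
            (1 + S x) (st (bits (g x) @ w) [] k d)"
          by (rule runs_Seq[OF pop runs_inD[OF q(2)]])
        then have "runs (Seq (Pop 0) q) (st (False # bits x @ w) [] k d)
            (3 + T x + S x) (st (bits (g x) @ w) [] k d)"
          by (rule runs_mono) simp
        with False show ?thesis
          by (intro runs_Branch[where b = False and u = "bits x @ w"]) (simp_all add: bits_bool_def)
      qed
      show ?thesis
        unfolding sz_def
        by (rule runs_Seq[OF runs_dup[OF code_bits] runs_Seq[OF runs_inD[OF r(2)] b]])
    qed
  qed
qed

lemma PF_eq':
  "PF (\<lambda>p :: 'a :: data \<times> 'a. fst p = snd p)"
proof (rule PF_I)
  let ?cmp = "Seq (Push 1 True) (Loop 1 compare_body)"
  let ?fin = "Branch 0 Skip Skip (seqs [Push 0 False, Push 0 False, Pop 0, Pop 0, Pop 0, Push 0 False, Push 0 False, Push 0 True])"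
  have pop: "runs (Pop 0) (st (True # w) [] c d) 1 (st w [] c d)" for w c d
    by (rule runs_loop_freeI) simp_all
  have push: "runs (Push 0 True) (st w [] c d) 1 (st (True # w) [] c d)" for w c d
    by (rule runs_loop_freeI) simp_all
  have fin: "runs ?fin (st (b # w) [] c d) 12 (st (bits b @ w) [] c d)" for b w c d
    by (rule runs_loop_freeI) (auto simp: bits_bool_def)
  show "polyb (\<lambda>x :: 'a \<times> 'a. 1 + ((100 * sz x + 100) + ((100 * sz x + 100) + (1 + (50 * (sz x + sz x + 2) + 12)))))"
    by (intro polyb_add polyb_mult polyb_const polyb_sz)
  show "runs (Seq (Pop 0) (Seq to2 (Seq to3 (Seq (Push 0 True) (Seq ?cmp ?fin)))))
      (st (bits x @ w) [] c d) (1 + ((100 * sz x + 100) + ((100 * sz x + 100) + (1 + (50 * (sz x + sz x + 2) + 12)))))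
      (st (bits (fst x = snd x) @ w) [] c d)" for x :: "'a \<times> 'a" and w c d
  proof -
    have eq: "(True \<and> bits (fst x) = bits (snd x)) \<longleftrightarrow> fst x = snd x" using inj_bits by auto
    have "runs (Seq (Pop 0) (Seq to2 (Seq to3 (Seq (Push 0 True) (Seq ?cmp ?fin)))))
        (st (True # (bits (fst x) @ (bits (snd x) @ w))) [] c d)
        (1 + ((100 * sz (fst x) + 100) + ((100 * sz (snd x) + 100) + (1 + (50 * (sz (fst x) + sz (snd x) + 2) + 12)))))
        (st (bits (True \<and> bits (fst x) = bits (snd x)) @ w) [] c d)"
      unfolding sz_def
      by (intro runs_Seq[OF pop] runs_Seq[OF runs_to2] runs_Seq[OF runs_to3]
        runs_Seq[OF push] runs_Seq[OF runs_compare] fin code_bits)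
    from runs_mono[OF this[unfolded eq]] show ?thesis by (simp add: bits_prod_def sz_def)
  qed
qed

lemma PF_eq: "PF f ==> PF g ==> PF (\<lambda>x. f x = g x)"
  using PF_comp[OF PF_eq' PF_Pair] by simp

lemma PF_Cons: "PF f ==> PF g ==> PF (\<lambda>x. f x # g x)"
  by (erule (1) PF_cong_bits[OF PF_Pair]) (simp add: bits_prod_def)

lemma PF_Suc: "PF f ==> PF (\<lambda>x. Suc (f x))"
  by (erule PF_cong_bits[OF PF_Pair[OF PF_const[of "()"]]]) (simp add: bits_prod_def bits_unit_def)

lemma PF_replicate_unit: "PF f ==> PF (\<lambda>x. replicate (f x) ())"
proof (erule PF_cong_bits)
  have "bits (replicate n ()) = bits n" for n
    by (induction n) (auto simp: bits_unit_def)
  then show "bits (replicate (f x) ()) = bits (f x)" for x by simp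
qed

lemma PF_pred:
  assumes "PF f"
  shows "PF (\<lambda>x. f x - 1 :: nat)"
proof (rule PF_comp[OF _ assms])
  show "PF (\<lambda>n :: nat. n - 1)"
  proof (rule PF_I)
    show "polyb (\<lambda>_ :: nat. 6)" by (rule polyb_const)
    show "runs (Branch 0 Skip Skip (Seq (Pop 0) (Pop 0))) (st (bits n @ w) [] c d) 6
       (st (bits (n - 1) @ w) [] c d)" for n :: nat and w c d
      by (cases n) (auto intro!: runs_loop_freeI)
  qed
qed

lemma branch_code:
  assumes "code a" "a \<noteq> [False]" "runs r (st (a @ w) b c d) n s'"
  shows "runs (Branch 0 p q r) (st (a @ w) b c d) (Suc n) s'"
proof -
  from assms(1,2) obtain u where "a = True # u" by cases auto
  with assms(3) show ?thesis by (intro runs_Branch[where b = True and u = "u @ w"]) auto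
qed

lemma branch_leaf:
  assumes "runs q (st (False # w) b c d) n s'"
  shows "runs (Branch 0 p q r) (st (False # w) b c d) (Suc n) s'"
  using assms by (intro runs_Branch[where b = False and u = w]) auto

lemma PF_tl': "PF (tl :: 'a :: data list => 'a list)"
proof (rule PF_I)
  have pop: "runs (Pop 0) (st (True # w) [] c d) 1 (st w [] c d)" for w c d
    by (rule runs_loop_freeI) simp_all
  have skip: "runs Skip s 1 s" for s
    by (rule runs_loop_freeI) simp_all
  show "polyb (\<lambda>x :: 'a list. Suc (1 + (100 * sz x + 100)))"
    unfolding Suc_eq_plus1 by (intro polyb_add polyb_mult polyb_const polyb_sz)
  show "runs (Branch 0 Skip Skip (Seq (Pop 0) drop_top)) (st (bits l @ w) [] c d)
     (Suc (1 + (100 * sz l + 100))) (st (bits (tl l) @ w) [] c d)" for l :: "'a list" and w c d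
  proof (cases l)
    case Nil
    have "runs (Branch 0 Skip Skip (Seq (Pop 0) drop_top)) (st (False # w) [] c d)
      (Suc (1 + (100 * sz l + 100))) (st (False # w) [] c d)"
      by (rule runs_mono[OF branch_leaf[OF skip]]) simp
    with Nil show ?thesis by simp
  next
    case (Cons x xs)
    have "runs (Seq (Pop 0) drop_top) (st (True # (bits x @ (bits xs @ w))) [] c d) (1 + (100 * sz x + 100))
      (st (bits xs @ w) [] c d)"
      unfolding sz_def by (intro runs_Seq[OF pop] runs_drop_top code_bits)
    then have "runs (Seq (Pop 0) drop_top) (st (bits l @ w) [] c d) (1 + (100 * sz x + 100))
      (st (bits xs @ w) [] c d)" using Cons by simp
    from runs_mono[OF branch_code[OF code_bits _ this]] Cons show ?thesis by simp
  qed
qed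

lemma PF_hd': "PF (hd :: 'a :: data list => 'a)"
proof (rule PF_I)
  have pop: "runs (Pop 0) (st (b # w) [] c d) 1 (st w [] c d)" for b w c d
    by (rule runs_loop_freeI) simp_all
  \<comment> \<open>The unspecified value \<open>hd []\<close> is a fixed constant, so the program
    can push its code literally.\<close>
  let ?k = "bits (hd [] :: 'a)"
  let ?p = "Branch 0 Skip (Seq (Pop 0) (push_all ?k)) (Seq (Pop 0) (Seq to2 (Seq drop_top (restore 2))))"
  show "polyb (\<lambda>x :: 'a list. Suc (1 + ((100 * sz x + 100) + ((100 * sz x + 100) + (20 * sz x + 21))) + length ?k))"
    unfolding Suc_eq_plus1 by (intro polyb_add polyb_mult polyb_const polyb_sz)
  show "runs ?p (st (bits l @ w) [] c d)
     (Suc (1 + ((100 * sz l + 100) + ((100 * sz l + 100) + (20 * sz l + 21))) + length ?k))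
     (st (bits (hd l) @ w) [] c d)" for l :: "'a list" and w c d
  proof (cases l)
    case Nil
    have "runs ?p (st (False # w) [] c d)
      (Suc (1 + ((100 * sz l + 100) + ((100 * sz l + 100) + (20 * sz l + 21))) + length ?k)) (st (?k @ w) [] c d)"
      by (rule runs_mono[OF branch_leaf[OF runs_Seq[OF pop runs_push_all]]]) simp
    with Nil show ?thesis by simp
  next
    case (Cons x xs)
    have "runs (Seq (Pop 0) (Seq to2 (Seq drop_top (restore 2))))
       (st (True # (bits x @ (bits xs @ w))) [] c d)
       (1 + ((100 * sz x + 100) + ((100 * sz xs + 100) + (20 * sz x + 21))))
       (st (bits x @ w) [] c d)"
      unfolding sz_def
      by (intro runs_Seq[OF pop] runs_Seq[OF runs_to2] runs_Seq[OF runs_drop_top] runs_restore code_bits)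
    then have "runs (Seq (Pop 0) (Seq to2 (Seq drop_top (restore 2)))) (st (bits l @ w) [] c d)
       (1 + ((100 * sz x + 100) + ((100 * sz xs + 100) + (20 * sz x + 21))))
       (st (bits x @ w) [] c d)" using Cons by simp
    from runs_mono[OF branch_code[OF code_bits _ this]] Cons show ?thesis by simp
  qed
qed

lemmas PF_tl = PF_comp[OF PF_tl'] and PF_hd = PF_comp[OF PF_hd']

subsection \<open>Loops\<close>

text \<open>The condition is evaluated on a copy of the state, and its outcome is moved to stack 1,
  where it decides about the next round.\<close>

definition while_prog :: "prog => prog => prog" where
  "while_prog pb pc =
     (let test = Branch 0 Skip (Pop 0) (seqs [Pop 0, Pop 0, Pop 0, Push 1 True]);
          cond = Seq dup (Seq pc test)
      in Seq cond (Loop 1 (Seq (Pop 1) (Seq pb cond))))"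

lemma runs_while:
  fixes x :: "'a :: data" and c :: "'a => bool"
  assumes pb: "realizes pb b kb" and pc: "realizes pc c kc"
    and N: "\<And>i. i < N ==> c ((b ^^ i) x)" "\<not> c ((b ^^ N) x)"
    and S: "\<And>i. i \<le> N ==> sz ((b ^^ i) x) \<le> S"
  shows "runs (while_prog pb pc) (st (bits x @ w) [] k d) ((N + 1) * (S + 2) ^ (kb + kc + 10))
    (st (bits ((b ^^ N) x) @ w) [] k d)"
proof -
  let ?test = "Branch 0 Skip (Pop 0) (seqs [Pop 0, Pop 0, Pop 0, Push 1 True])"
  let ?cond = "Seq dup (Seq pc ?test)"
  let ?body = "Seq (Pop 1) (Seq pb ?cond)"
  let ?M = "(S + 2) ^ (kb + kc)"
  define C where "C = 100 * S + 112 + ?M"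
  have pop: "runs (Pop 1) (st w [True] k d) 1 (st w [] k d)" for w k d
    by (rule runs_loop_freeI) simp_all
  have test: "runs ?test (st (bits b @ w) [] k d) 12 (st w (if b then [True] else []) k d)" for b w k d
    by (rule runs_loop_freeI) (auto simp: bits_bool_def)
  have time: "(sz y + 2) ^ kb \<le> ?M" "(sz y + 2) ^ kc \<le> ?M" if "sz y \<le> S" for y :: 'a
  proof -
    have "(sz y + 2) ^ kb \<le> (S + 2) ^ kb" using that by (intro power_mono) auto
    also have "\<dots> \<le> ?M" by (intro power_increasing) auto
    finally show "(sz y + 2) ^ kb \<le> ?M" .
    have "(sz y + 2) ^ kc \<le> (S + 2) ^ kc" using that by (intro power_mono) auto
    also have "\<dots> \<le> ?M" by (intro power_increasing) auto
    finally show "(sz y + 2) ^ kc \<le> ?M" .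
  qed
  have cond: "runs ?cond (st (bits y @ w) [] k d) C
     (st (bits y @ w) (if c y then [True] else []) k d)" if "sz y \<le> S" for y :: 'a
  proof -
    have "runs ?cond (st (bits y @ w) [] k d) ((100 * sz y + 100) + ((sz y + 2) ^ kc + 12))
     (st (bits y @ w) (if c y then [True] else []) k d)"
      unfolding sz_def
      by (intro runs_Seq[OF runs_dup] runs_Seq[OF _ test] code_bits)
        (use pc in \<open>simp add: realizes_def sz_def\<close>)
    then show ?thesis by (rule runs_mono) (use time[OF that] that in \<open>simp add: C_def\<close>)
  qed
  have loop: "runs (Loop 1 ?body)
      (st (bits ((b ^^ i) x) @ w) (if c ((b ^^ i) x) then [True] else []) k d)
      ((N - i) * (1 + (1 + (?M + C))) + 1) (st (bits ((b ^^ N) x) @ w) [] k d)" if "i \<le> N" for i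
    using that
  proof (induction rule: inc_induct)
    case base
    show ?case using N(2) runs_Loop_Nil[of "st (bits ((b ^^ N) x) @ w) [] k d" 1 ?body] by simp
  next
    case (step i)
    have 1: "runs ?body (st (bits ((b ^^ i) x) @ w) [True] k d)
       (1 + ((sz ((b ^^ i) x) + 2) ^ kb + C))
       (st (bits ((b ^^ Suc i) x) @ w) (if c ((b ^^ Suc i) x) then [True] else []) k d)"
      by (intro runs_Seq[OF pop] runs_Seq[OF _ cond])
        (use pb S[of "Suc i"] step in \<open>simp_all add: realizes_def\<close>)
    have c: "c ((b ^^ i) x)" using N(1) step by simp
    have Ni: "N - i = Suc (N - Suc i)" using step by simp
    from runs_Loop_Step[OF _ 1 step.IH]
    have "runs (Loop 1 ?body) (st (bits ((b ^^ i) x) @ w) [True] k d)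
     (Suc (1 + ((sz ((b ^^ i) x) + 2) ^ kb + C) + ((N - Suc i) * (1 + (1 + (?M + C))) + 1)))
     (st (bits ((b ^^ N) x) @ w) [] k d)" by simp
    then have "runs (Loop 1 ?body) (st (bits ((b ^^ i) x) @ w) [True] k d)
     ((N - i) * (1 + (1 + (?M + C))) + 1) (st (bits ((b ^^ N) x) @ w) [] k d)"
      by (rule runs_mono) (use time(1)[of "(b ^^ i) x"] S[of i] step Ni in simp)
    then show ?case using c by simp
  qed
  have "runs (while_prog pb pc) (st (bits x @ w) [] k d) (C + ((N - 0) * (1 + (1 + (?M + C))) + 1))
    (st (bits ((b ^^ N) x) @ w) [] k d)"
    unfolding while_prog_def Let_def
    by (rule runs_Seq[OF cond[of x] loop[of 0, simplified funpow_0]]) (use S[of 0] in auto)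
  then show ?thesis
  proof (rule runs_mono)
    have "1 \<le> ?M" by simp
    have "(S + 2) * 1 \<le> (S + 2) * ?M" by (rule mult_le_mono2) simp
    moreover have "1 * ?M \<le> (S + 2) * ?M" by (rule mult_le_mono1) simp
    moreover have "3 + M + (100 * S + 112 + M) \<le> 256 * A" if "(S + 2) * 1 \<le> A" "1 * M \<le> A" for A M
      using that by simp
    ultimately have "3 + ?M + C \<le> 256 * ((S + 2) * ?M)" unfolding C_def by blast
    \<comment> \<open>The constant is absorbed by eight powers of \<open>S + 2\<close> and the extra
      factor \<open>S + 2\<close> by a ninth; the exponent 10 leaves some slack.\<close>
    also have "256 * ((S + 2) * ?M) \<le> (S + 2) ^ 8 * ((S + 2) * ?M)"
    proof (rule mult_le_mono1)
      have "(2 :: nat) ^ 8 \<le> (S + 2) ^ 8" by (rule power_mono) simp_all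
      then show "256 \<le> (S + 2) ^ 8" by (simp only: power_numeral) simp
    qed
    also have "\<dots> = (S + 2) ^ (8 + Suc (kb + kc))" by (simp only: power_add power_Suc)
    also have "\<dots> \<le> (S + 2) ^ (kb + kc + 10)" by (intro power_increasing) auto
    finally have *: "3 + ?M + C \<le> (S + 2) ^ (kb + kc + 10)" .
    have "C + ((N - 0) * (1 + (1 + (?M + C))) + 1) \<le> (N + 1) * (3 + ?M + C)"
      by (simp add: algebra_simps)
    also have "\<dots> \<le> (N + 1) * (S + 2) ^ (kb + kc + 10)" using * by (intro mult_left_mono) auto
    finally show "C + ((N - 0) * (1 + (1 + (?M + C))) + 1) \<le> (N + 1) * (S + 2) ^ (kb + kc + 10)" .
  qed
qed

text \<open>Polynomial time is not closed under iteration, since each round might square the size.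
  Hence the separate polynomial bound \<open>S\<close> on all intermediate states.\<close>

lemma PF_while:
  fixes b :: "'b :: data => 'b"
  assumes "PF g" "PF b" "PF c"
    and "\<And>x i. i < N x ==> c ((b ^^ i) (g x))" "\<And>x. \<not> c ((b ^^ N x) (g x))"
    and "polyb N" "polyb S" "\<And>x i. i \<le> N x ==> sz ((b ^^ i) (g x)) \<le> S x"
  shows "PF (\<lambda>x. (b ^^ N x) (g x))"
proof -
  obtain pb kb pc kc where p: "realizes pb b kb" "realizes pc c kc"
    using assms(2,3) unfolding PF_def by blast
  obtain pg Tg where g: "polyb Tg" "runs_in pg g Tg"
    using PF_E[OF assms(1)] by blast
  show ?thesis
  proof (rule PF_I)
    show "polyb (\<lambda>x. Tg x + (N x + 1) * (S x + 2) ^ (kb + kc + 10))"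
      by (intro polyb_mult polyb_power polyb_add polyb_const assms g)
    show "runs (Seq pg (while_prog pb pc)) (st (bits x @ w) [] k d)
      (Tg x + (N x + 1) * (S x + 2) ^ (kb + kc + 10)) (st (bits ((b ^^ N x) (g x)) @ w) [] k d)"
      for x w k d
      by (rule runs_Seq[OF runs_inD[OF g(2)] runs_while[OF p]]) (use assms in auto)
  qed
qed

lemma PF_not: "PF f ==> PF (\<lambda>x. \<not> f x)"
proof -
  assume "PF f"
  moreover have "(\<lambda>x. \<not> f x) = (\<lambda>x. if f x then False else True)" by auto
  ultimately show ?thesis using PF_if[OF _ PF_const[of False] PF_const[of True], of f] by simp
qed

lemma PF_foldl:
  assumes h: "PF (\<lambda>z. h (fst z) (fst (snd z)) (snd (snd z)))" and i: "PF i" and l: "PF l"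
    and S: "polyb S" "\<And>x n. n \<le> length (l x) ==> sz (foldl (h x) (i x) (take n (l x))) \<le> S x"
  shows "PF (\<lambda>x. foldl (h x) (i x) (l x))"
proof -
  define g where "g x = (x, i x, l x)" for x
  define b where "b y = (fst y, h (fst y) (fst (snd y)) (hd (snd (snd y))), tl (snd (snd y)))" for y
  define c where "c y \<longleftrightarrow> snd (snd y) \<noteq> []" for y :: "'a \<times> 'b \<times> 'c list"
  have g: "PF g" unfolding g_def by (intro PF_Pair PF_id i l)
  have c: "PF c" unfolding c_def by (intro PF_not PF_eq PF_snd PF_id PF_const)
  have "PF (\<lambda>y. (fst y, fst (snd y), hd (snd (snd y))))"
    by (intro PF_Pair PF_fst PF_snd PF_hd PF_id)
  from PF_comp[OF h this] have "PF (\<lambda>y. h (fst y) (fst (snd y)) (hd (snd (snd y))))" by simp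
  then have b: "PF b" unfolding b_def by (intro PF_Pair PF_fst PF_snd PF_tl PF_id)
  have bn: "(b ^^ n) (g x) = (x, foldl (h x) (i x) (take n (l x)), drop n (l x))"
    if "n \<le> length (l x)" for n x
    using that
  proof (induction n)
    case 0
    then show ?case by (simp add: g_def)
  next
    case (Suc n)
    then show ?case by (simp add: b_def take_Suc_conv_app_nth hd_drop_conv_nth tl_drop drop_Suc)
  qed
  have "PF (\<lambda>x. (b ^^ length (l x)) (g x))"
  proof (rule PF_while[OF g b c])
    show "c ((b ^^ n) (g x))" if "n < length (l x)" for x n
      using that by (simp add: bn c_def)
    show "\<not> c ((b ^^ length (l x)) (g x))" for x
      by (simp add: bn c_def)
    show "polyb (\<lambda>x. length (l x))"
      by (rule polyb_mono[OF polyb_sz_PF[OF l]]) (simp add: less_imp_le length_le_sz)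
    show "polyb (\<lambda>x. 2 + (sz x + (S x + sz (l x))))"
      by (intro polyb_add polyb_const polyb_sz S polyb_sz_PF l)
    have drop: "sz (drop n xs) \<le> sz xs" for n and xs :: "'c list"
    proof (induction n arbitrary: xs)
      case (Suc n)
      have "sz (tl xs) \<le> sz xs" by (cases xs) auto
      with Suc[of "tl xs"] show ?case by (simp add: drop_Suc)
    qed simp
    show "sz ((b ^^ n) (g x)) \<le> 2 + (sz x + (S x + sz (l x)))" if "n \<le> length (l x)" for x n
      using S(2)[OF that] drop[of n "l x"] by (simp add: bn that)
  qed
  then have "PF (\<lambda>x. fst (snd ((b ^^ length (l x)) (g x))))" by (intro PF_fst PF_snd)
  then show ?thesis by (simp add: bn)
qed

text \<open>Growth by a summand that does not depend on the accumulator is harmless over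
  polynomially many rounds. Most folds below are of this kind.\<close>

lemma PF_foldl_add:
  assumes h: "PF (\<lambda>z. h (fst z) (fst (snd z)) (snd (snd z)))" and i: "PF i" and l: "PF l"
    and B: "polyb B" "\<And>x a e. e \<in> set (l x) ==> sz (h x a e) \<le> sz a + B x"
  shows "PF (\<lambda>x. foldl (h x) (i x) (l x))"
proof (rule PF_foldl[OF h i l])
  show "polyb (\<lambda>x. sz (i x) + sz (l x) * B x)"
    by (intro polyb_add polyb_mult polyb_sz_PF i l B)
  show "sz (foldl (h x) (i x) (take n (l x))) \<le> sz (i x) + sz (l x) * B x"
    if "n \<le> length (l x)" for x n
  proof -
    have "sz (foldl (h x) (i x) (take n (l x))) \<le> sz (i x) + n * B x" using that
    proof (induction n)
      case (Suc n)
      have "sz (h x (foldl (h x) (i x) (take n (l x))) (l x ! n))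
        \<le> sz (foldl (h x) (i x) (take n (l x))) + B x"
        by (rule B) (use Suc in auto)
      with Suc show ?case by (simp add: take_Suc_conv_app_nth)
    qed simp
    also have "\<dots> \<le> sz (i x) + sz (l x) * B x"
      using that length_le_sz[of "l x"] by (intro add_left_mono mult_right_mono) auto
    finally show ?thesis .
  qed
qed

subsection \<open>A library of polynomial-time functions\<close>

lemma polyb_Suc: "polyb T ==> polyb (\<lambda>x. Suc (T x))"
  using polyb_add[OF polyb_const[of 1]] by simp

lemma polyb_sz_elem:
  assumes h: "PF (\<lambda>z. h (fst z) (snd z))" and l: "PF l"
  obtains B where "polyb B" "\<And>x e. e \<in> set (l x) ==> sz (h x e) \<le> B x"
proof -
  have "\<exists>c. \<forall>z. sz (h (fst z) (snd z)) \<le> (sz z + 2) ^ c"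
    using polyb_sz_PF[OF h] unfolding polyb_def .
  then obtain c where c: "\<forall>z. sz (h (fst z) (snd z)) \<le> (sz z + 2) ^ c" ..
  show ?thesis
  proof (rule that)
    show "polyb (\<lambda>x. (sz x + (sz (l x) + 3)) ^ c)"
      by (rule polyb_power[OF polyb_add[OF polyb_sz polyb_add[OF polyb_sz_PF[OF l] polyb_const]]])
    show "sz (h x e) \<le> (sz x + (sz (l x) + 3)) ^ c" if "e \<in> set (l x)" for x e
    proof -
      have "sz (h x e) \<le> (sz (x, e) + 2) ^ c"
        using spec[OF c, of "(x, e)"] by (simp only: fst_conv snd_conv)
      also have "\<dots> \<le> (sz x + (sz (l x) + 3)) ^ c"
        by (rule power_mono) (use sz_mem[OF that] in simp_all)
      finally show ?thesis .
    qed
  qed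
qed

lemma PF_conj:
  assumes "PF f" "PF g" shows "PF (\<lambda>x. f x \<and> g x)"
proof -
  have "(\<lambda>x. f x \<and> g x) = (\<lambda>x. if f x then g x else False)" by auto
  then show ?thesis using PF_if[OF assms PF_const[of False]] by simp
qed

lemma PF_disj:
  assumes "PF f" "PF g" shows "PF (\<lambda>x. f x \<or> g x)"
proof -
  have "(\<lambda>x. f x \<or> g x) = (\<lambda>x. if f x then True else g x)" by auto
  then show ?thesis using PF_if[OF assms(1) PF_const[of True] assms(2)] by simp
qed

lemma PF_imp:
  assumes "PF f" "PF g" shows "PF (\<lambda>x. f x --> g x)"
proof -
  have "(\<lambda>x. f x --> g x) = (\<lambda>x. if f x then g x else True)" by auto
  then show ?thesis using PF_if[OF assms PF_const[of True]] by simp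
qed

lemma PF_rev:
  assumes "PF l" shows "PF (\<lambda>x. rev (l x))"
proof -
  have *: "foldl (\<lambda>a e. e # a) a xs = rev xs @ a" for a xs :: "'b list"
    by (induction xs arbitrary: a) auto
  have "PF (\<lambda>x. foldl (\<lambda>a e. e # a) [] (l x))"
    by (rule PF_foldl_add[where B = "\<lambda>x. 1 + sz (l x)"])
      (auto intro!: PF_Cons PF_fst PF_snd PF_id PF_const polyb_add polyb_Suc polyb_const polyb_sz_PF assms
        dest: sz_mem)
  then show ?thesis by (simp add: *)
qed

lemma PF_append:
  assumes "PF k" "PF l" shows "PF (\<lambda>x. k x @ l x)"
proof -
  have *: "foldl (\<lambda>a e. e # a) a xs = rev xs @ a" for a xs :: "'b list"
    by (induction xs arbitrary: a) auto
  have "PF (\<lambda>x. foldl (\<lambda>a e. e # a) (l x) (rev (k x)))"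
    by (rule PF_foldl_add[where B = "\<lambda>x. 1 + sz (k x)"])
      (auto intro!: PF_Cons PF_fst PF_snd PF_id PF_const PF_rev polyb_add polyb_Suc polyb_const polyb_sz_PF assms
        dest: sz_mem)
  then show ?thesis by (simp add: *)
qed

lemma PF_map:
  assumes h: "PF (\<lambda>z. h (fst z) (snd z))" and l: "PF l"
  shows "PF (\<lambda>x. map (h x) (l x))"
proof -
  obtain B where B: "polyb B" "\<And>x e. e \<in> set (l x) ==> sz (h x e) \<le> B x"
    by (rule polyb_sz_elem[OF h l]) blast
  have *: "foldl (\<lambda>a e. f e # a) a xs = rev (map f xs) @ a" for f :: "'b => 'c" and a xs
    by (induction xs arbitrary: a) auto
  have "PF (\<lambda>z :: 'a \<times> 'c list \<times> 'b. (fst z, snd (snd z)))"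
    by (intro PF_Pair PF_fst PF_snd PF_id)
  from PF_comp[OF h this] have h': "PF (\<lambda>z :: 'a \<times> 'c list \<times> 'b. h (fst z) (snd (snd z)))" by simp
  have "PF (\<lambda>x. foldl (\<lambda>a e. h x e # a) [] (l x))"
    by (rule PF_foldl_add[where B = "\<lambda>x. 1 + B x"])
      (auto intro!: PF_Cons PF_fst PF_snd PF_id PF_const polyb_add polyb_Suc polyb_const B l h')
  then have "PF (\<lambda>x. rev (foldl (\<lambda>a e. h x e # a) [] (l x)))" by (rule PF_rev)
  then show ?thesis by (simp add: *)
qed

lemma PF_filter:
  assumes h: "PF (\<lambda>z. h (fst z) (snd z))" and l: "PF l"
  shows "PF (\<lambda>x. filter (h x) (l x))"
proof -
  have *: "foldl (\<lambda>a e. if f e then e # a else a) a xs = rev (filter f xs) @ a" for f :: "'b => bool" and a xs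
    by (induction xs arbitrary: a) auto
  have "PF (\<lambda>z :: 'a \<times> 'b list \<times> 'b. (fst z, snd (snd z)))"
    by (intro PF_Pair PF_fst PF_snd PF_id)
  from PF_comp[OF h this] have h': "PF (\<lambda>z :: 'a \<times> 'b list \<times> 'b. h (fst z) (snd (snd z)))" by simp
  have "PF (\<lambda>x. foldl (\<lambda>a e. if h x e then e # a else a) [] (l x))"
    by (rule PF_foldl_add[where B = "\<lambda>x. 1 + sz (l x)"])
      (auto intro!: PF_if PF_Cons PF_fst PF_snd PF_id PF_const polyb_add polyb_Suc polyb_const polyb_sz_PF l h'
        dest: sz_mem)
  then have "PF (\<lambda>x. rev (foldl (\<lambda>a e. if h x e then e # a else a) [] (l x)))" by (rule PF_rev)
  then show ?thesis by (simp add: *)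
qed

lemma PF_ball:
  assumes h: "PF (\<lambda>z. h (fst z) (snd z))" and l: "PF l"
  shows "PF (\<lambda>x. \<forall>e \<in> set (l x). h x e)"
proof -
  have "PF (\<lambda>x. filter (\<lambda>e. \<not> h x e) (l x) = [])"
    by (intro PF_eq PF_filter PF_not h l PF_const)
  then show ?thesis by (simp add: filter_empty_conv)
qed

lemma PF_bex:
  assumes h: "PF (\<lambda>z. h (fst z) (snd z))" and l: "PF l"
  shows "PF (\<lambda>x. \<exists>e \<in> set (l x). h x e)"
proof -
  have "PF (\<lambda>x. \<not> (\<forall>e \<in> set (l x). \<not> h x e))"
    by (intro PF_not PF_ball h l)
  then show ?thesis by simp
qed

lemma PF_mem:
  assumes "PF f" "PF l" shows "PF (\<lambda>x. f x \<in> set (l x))"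
proof -
  have "PF (\<lambda>x. \<exists>e \<in> set (l x). e = f x)"
    by (intro PF_bex PF_eq PF_snd PF_id PF_comp[OF assms(1)] PF_fst assms)
  then show ?thesis by (simp add: Bex_def)
qed

lemma PF_concat:
  assumes "PF l" shows "PF (\<lambda>x. concat (l x))"
proof -
  have sz_append: "sz (a @ b) \<le> sz a + sz b" for a b :: "'b list"
    by (induction a) auto
  have *: "foldl (@) a xs = a @ concat xs" for a :: "'b list" and xs
    by (induction xs arbitrary: a) auto
  have "PF (\<lambda>x. foldl (\<lambda>a e. a @ e) [] (l x))"
  proof (rule PF_foldl_add[where B = "\<lambda>x. sz (l x)"])
    show "sz (a @ e) \<le> sz a + sz (l x)" if "e \<in> set (l x)" for x e and a :: "'b list"
      using sz_append[of a e] sz_mem[OF that] by simp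
  qed (intro PF_append PF_fst PF_snd PF_id PF_const polyb_sz_PF assms)+
  then show ?thesis by (simp add: *)
qed

lemma PF_length:
  assumes "PF l" shows "PF (\<lambda>x. length (l x))"
proof -
  have *: "foldl (\<lambda>a e. Suc a) a xs = a + length xs" for a and xs :: "'b list"
    by (induction xs arbitrary: a) auto
  have "PF (\<lambda>x. foldl (\<lambda>a e. Suc a) 0 (l x))"
    by (rule PF_foldl_add[where B = "\<lambda>x. 2"])
      (auto intro!: PF_Suc PF_fst PF_snd PF_id PF_const polyb_const assms)
  then show ?thesis by (simp add: *)
qed

lemma PF_add:
  assumes "PF f" "PF g" shows "PF (\<lambda>x. f x + g x :: nat)"
proof -
  have *: "foldl (\<lambda>a e. Suc a) a (replicate n ()) = a + n" for a n
    by (induction n arbitrary: a) auto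
  have "PF (\<lambda>x. foldl (\<lambda>a e. Suc a) (f x) (replicate (g x) ()))"
    by (rule PF_foldl_add[where B = "\<lambda>x. 2"])
      (auto intro!: PF_Suc PF_fst PF_snd PF_id PF_const PF_replicate_unit polyb_const assms)
  then show ?thesis by (simp add: *)
qed

lemma PF_diff:
  assumes "PF f" "PF g" shows "PF (\<lambda>x. f x - g x :: nat)"
proof -
  have *: "foldl (\<lambda>a e. a - 1) a (replicate n ()) = a - n" for a n
    by (induction n arbitrary: a) auto
  have "PF (\<lambda>x. foldl (\<lambda>a e. a - 1) (f x) (replicate (g x) ()))"
  proof (rule PF_foldl_add[where B = "\<lambda>x. 0"])
    show "PF (\<lambda>z :: 'a \<times> nat \<times> unit. fst (snd z) - 1)" by (intro PF_pred PF_fst PF_snd PF_id)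
  qed (auto intro!: PF_replicate_unit polyb_const assms)
  then show ?thesis by (simp only: *)
qed

lemma PF_mult:
  assumes "PF f" "PF g" shows "PF (\<lambda>x. f x * g x :: nat)"
proof -
  have *: "foldl (\<lambda>a e. a + m) a (replicate n ()) = a + m * n" for a m n :: nat
    by (induction n arbitrary: a) auto
  have "PF (\<lambda>x. foldl (\<lambda>a e. a + f x) 0 (replicate (g x) ()))"
  proof (rule PF_foldl_add[where B = "\<lambda>x. sz (f x)"])
    show "polyb (\<lambda>x. sz (f x))" by (rule polyb_sz_PF[OF assms(1)])
  qed (auto intro!: PF_add PF_fst PF_snd PF_id PF_const PF_replicate_unit assms PF_comp[OF assms(1)])
  then show ?thesis by (simp add: *)
qed

lemma PF_le: "PF f ==> PF g ==> PF (\<lambda>x. (f x :: nat) \<le> g x)"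
  using PF_eq[OF PF_diff PF_const[of 0], of f g] by simp

lemma PF_less: "PF f ==> PF g ==> PF (\<lambda>x. (f x :: nat) < g x)"
  using PF_le[OF PF_Suc, of f g] by (simp add: Suc_le_eq)

lemma foldl_replicate: "foldl f a (replicate n x) = ((\<lambda>a. f a x) ^^ n) a"
proof (induction n arbitrary: a)
  case (Suc n)
  show ?case using Suc[of "f a x"] funpow_swap1[of "\<lambda>a. f a x" n a] by simp
qed simp

lemma PF_upt:
  assumes "PF f" "PF g" shows "PF (\<lambda>x. [f x..<g x])"
proof -
  have *: "foldl (\<lambda>a e. length a # a) [] (replicate n ()) = rev [0..<n]" for n
    unfolding foldl_replicate by (induction n) auto
  have z: "PF (\<lambda>n. foldl (\<lambda>a e. length a # a) [] (replicate n ()))"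
  \<comment> \<open>Each new entry is as large as the accumulator is long, so the additive rule does
    not apply and the total size is bounded directly.\<close>
  proof (rule PF_foldl)
    show "polyb (\<lambda>n :: nat. n * (2 * n + 2) + 1)"
    proof (rule polyb_mono)
      show "polyb (\<lambda>n :: nat. sz n * (sz n + 2) + 1)"
        by (intro polyb_add polyb_mult polyb_sz polyb_const)
    qed (auto intro: add_le_mono mult_le_mono)
    show "sz (foldl (\<lambda>a e. length a # a) [] (take k (replicate n ()))) \<le> n * (2 * n + 2) + 1"
      if "k \<le> length (replicate n ())" for n k
    proof -
      have "sz (rev [0..<k]) \<le> length (rev [0..<k]) * (2 * n + 1 + 1) + 1"
        by (rule sz_list_bound) (use that in auto)
      also have "\<dots> \<le> n * (2 * n + 2) + 1" using that by (simp add: add_le_mono mult_le_mono)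
      finally show ?thesis using that by (simp only: take_replicate min_absorb1 * length_replicate)
    qed
  qed (intro PF_Cons PF_length PF_fst PF_snd PF_id PF_const PF_replicate_unit)+
  have "PF (\<lambda>x. map (\<lambda>i. f x + i) (rev (foldl (\<lambda>a e. length a # a) [] (replicate (g x - f x) ()))))"
    by (intro PF_map PF_add PF_snd PF_id PF_comp[OF assms(1)] PF_fst PF_rev PF_comp[OF z] PF_diff assms)
  moreover have "map (\<lambda>i. m + i) (rev (rev [0..<n - m])) = [m..<n]" for m n :: nat
    by (rule nth_equalityI) auto
  ultimately show ?thesis by (simp add: *)
qed

lemma PF_drop:
  assumes "PF f" "PF l" shows "PF (\<lambda>x. drop (f x) (l x))"
proof -
  have *: "foldl (\<lambda>a e. tl a) a (replicate n ()) = drop n a" for a :: "'b list" and n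
    by (induction n arbitrary: a) (auto simp: drop_Suc)
  have tl: "sz (tl a) \<le> sz a" for a :: "'b list" by (cases a) auto
  have "PF (\<lambda>x. foldl (\<lambda>a e. tl a) (l x) (replicate (f x) ()))"
    by (rule PF_foldl_add[where B = "\<lambda>x. 0"])
      (use tl in \<open>auto intro!: PF_tl PF_fst PF_snd PF_id PF_replicate_unit polyb_const assms\<close>)
  then show ?thesis by (simp add: *)
qed

lemma PF_take:
  assumes "PF f" "PF l" shows "PF (\<lambda>x. take (f x) (l x))"
proof -
  have "PF (\<lambda>x. rev (drop (length (l x) - f x) (rev (l x))))"
    by (intro PF_rev PF_drop PF_diff PF_length assms)
  moreover have "rev (drop (length xs - n) (rev xs)) = take n xs" for n and xs :: "'b list"
    by (cases "n \<le> length xs") (simp_all add: rev_drop)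
  ultimately show ?thesis by simp
qed

text \<open>Unlike \<open>nth\<close>, total in a way that is computable.\<close>

definition get :: "'a => 'a list => nat => 'a" where
  "get d xs i = (if i < length xs then xs ! i else d)"

lemma PF_get:
  assumes "PF d" "PF l" "PF f" shows "PF (\<lambda>x. get (d x) (l x) (f x))"
proof -
  have "PF (\<lambda>x. hd (drop (f x) (l x) @ [d x]))"
    by (intro PF_hd PF_append PF_drop PF_Cons PF_const assms)
  moreover have "hd (drop i xs @ [d]) = get d xs i" for i xs and d :: 'b
    by (auto simp: get_def hd_append hd_drop_conv_nth)
  ultimately show ?thesis by simp
qed

lemma get_nth [simp]: "i < length xs ==> get d xs i = xs ! i"
  by (simp add: get_def)

lemma PF_zip:
  assumes "PF k" "PF l" shows "PF (\<lambda>x. zip (k x) (l x))"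
proof -
  have "PF (\<lambda>x. map (\<lambda>i. (get (hd (k x)) (k x) i, get (hd (l x)) (l x) i))
      (filter (\<lambda>i. i < length (l x)) [0..<length (k x)]))"
    by (intro PF_map PF_filter PF_Pair PF_get PF_hd PF_less PF_length PF_upt PF_const PF_snd PF_id
        PF_comp[OF assms(1)] PF_comp[OF assms(2)] PF_fst assms)
  moreover have "filter (\<lambda>i. i < m) [0..<n] = [0..<min m n]" for m n :: nat
    by (induction n) (auto simp: min_def le_Suc_eq)
  then have "map (\<lambda>i. (get (hd xs) xs i, get (hd ys) ys i)) (filter (\<lambda>i. i < length ys) [0..<length xs])
      = zip xs ys" for xs :: "'b list" and ys :: "'c list"
    by (intro nth_equalityI) auto
  ultimately show ?thesis by simp
qed

lemma PF_replicate:
  assumes "PF f" "PF g" shows "PF (\<lambda>x. replicate (f x) (g x))"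
proof -
  have "PF (\<lambda>x. map (\<lambda>_. g x) (replicate (f x) ()))"
    by (intro PF_map PF_replicate_unit PF_comp[OF assms(2)] PF_fst PF_id assms)
  then show ?thesis by (simp add: map_replicate_const)
qed

lemma PF_parity:
  assumes "PF f" shows "PF (\<lambda>x. (odd (f x :: nat), f x div 2))"
proof -
  have *: "foldl (\<lambda>a e. (\<not> fst a, if fst a then Suc (snd a) else snd a)) (False, 0) (replicate n ())
      = (odd n, n div 2)" for n
    unfolding foldl_replicate by (induction n) auto
  have "PF (\<lambda>x. foldl (\<lambda>a e. (\<not> fst a, if fst a then Suc (snd a) else snd a)) (False, 0)
      (replicate (f x) ()))"
    by (rule PF_foldl_add[where B = "\<lambda>x. 4"])
      (auto intro!: PF_Pair PF_not PF_if PF_Suc PF_fst PF_snd PF_id PF_const PF_replicate_unit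
         polyb_const assms)
  then show ?thesis by (simp only: *)
qed

lemma PF_odd: "PF f ==> PF (\<lambda>x. odd (f x :: nat))"
  using PF_fst[OF PF_parity] by simp

lemma PF_half: "PF f ==> PF (\<lambda>x. f x div 2 :: nat)"
  using PF_snd[OF PF_parity] by simp

text \<open>The constant rule comes first and the rules for projections last, so that \<open>intro\<close> first tries
  to close subgoals that do not depend on the argument.\<close>

lemmas PF_intros = PF_const PF_id PF_Pair PF_if PF_eq PF_Cons PF_Suc PF_not PF_conj PF_disj PF_imp
  PF_rev PF_append PF_map PF_filter PF_ball PF_bex PF_mem PF_concat PF_length PF_add PF_diff PF_mult
  PF_le PF_less PF_upt PF_drop PF_take PF_get PF_zip PF_replicate PF_odd PF_half PF_hd PF_tl
  PF_fst PF_snd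

text \<open>Here \<open>n\<close> is a constant, as the result has \<open>length (l x) ^ n\<close>
  entries.\<close>

lemma PF_n_lists:
  assumes "PF l" shows "PF (\<lambda>x. List.n_lists n (l x))"
proof (induction n)
  case (Suc n)
  then show ?case by (auto intro!: PF_intros PF_comp[OF assms] assms)
qed (simp add: PF_const)

definition dedup :: "'a list => 'a list" where
  "dedup xs = foldl (\<lambda>a e. if e \<in> set a then a else a @ [e]) [] xs"

lemma dedup: "set (dedup xs) = set xs" "distinct (dedup xs)"
proof -
  have "set (foldl (\<lambda>a e. if e \<in> set a then a else a @ [e]) a xs) = set a \<union> set xs \<and>
     (distinct a --> distinct (foldl (\<lambda>a e. if e \<in> set a then a else a @ [e]) a xs))" for a
    by (induction xs arbitrary: a) auto
  from this[of "[]"] show "set (dedup xs) = set xs" "distinct (dedup xs)"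
    by (simp_all add: dedup_def)
qed

lemma length_dedup: "length (dedup xs) = card (set xs)"
  using distinct_card[OF dedup(2)] dedup(1) by metis

lemma PF_dedup: "PF l ==> PF (\<lambda>x. dedup (l x))"
  unfolding dedup_def
proof (rule PF_foldl_add[where B = "\<lambda>x. 1 + sz (l x)"])
  have *: "sz (a @ [e]) = sz a + sz e + 1" for a and e :: 'b
    by (induction a) auto
  show "sz (if e \<in> set a then a else a @ [e]) \<le> sz a + (1 + sz (l x))" if "e \<in> set (l x)" for x a e
    using sz_mem[OF that] by (simp add: *)
qed (auto intro!: PF_intros polyb_add polyb_Suc polyb_const polyb_sz_PF)

subsection \<open>Input and output\<close>

lemma runs_Loop_NilI: "s i = [] ==> s = s' ==> 1 \<le> n ==> runs (Loop i p) s n s'"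
  using runs_Loop_Nil runs_mono by blast

text \<open>The end of a raw input is marked only by the bottom of its stack. It is reversed onto
  stack 2 first, because the code of a list is pushed starting with the last element.\<close>

definition raw_to_2 :: prog where
  "raw_to_2 = Loop 0 (Branch 0 Skip (seqs [Pop 0, Push 2 False]) (seqs [Pop 0, Push 2 True]))"

definition build_list :: prog where
  "build_list = Loop 2 (Branch 2 Skip (seqs [Pop 2, Push 0 False, Push 0 True])
     (seqs [Pop 2, Push 0 False, Push 0 False, Push 0 True, Push 0 True]))"

definition unbuild_body :: "nat => prog" where
  "unbuild_body j = Branch 0 Skip (seqs [Pop 0, Pop 1])
     (Seq (Pop 0) (Branch 0 Skip (seqs [Pop 0, Push j False]) (seqs [Pop 0, Pop 0, Pop 0, Push j True])))"

definition raw_from_2 :: prog where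
  "raw_from_2 = Loop 2 (Branch 2 Skip (seqs [Pop 2, Push 0 False]) (seqs [Pop 2, Push 0 True]))"

lemma runs_raw_to_2: "runs raw_to_2 (st x [] c []) (20 * length x + 1) (st [] [] (rev x @ c) [])"
proof (induction x arbitrary: c)
  case Nil
  show ?case unfolding raw_to_2_def by (rule runs_Loop_NilI) simp_all
next
  case (Cons b x)
  have 1: "runs (Branch 0 Skip (seqs [Pop 0, Push 2 False]) (seqs [Pop 0, Push 2 True]))
      (st (b # x) [] c []) 10 (st x [] (b # c) [])"
    by (rule runs_loop_freeI) simp_all
  from runs_Loop_Step[OF _ 1 Cons.IH[unfolded raw_to_2_def]] show ?case
    unfolding raw_to_2_def by (auto elim!: runs_mono)
qed

lemma runs_build_list:
  "runs build_list (st (bits ys) [] u []) (20 * length u + 1) (st (bits (rev u @ ys)) [] [] [])"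
proof (induction u arbitrary: ys)
  case Nil
  show ?case unfolding build_list_def by (rule runs_Loop_NilI) simp_all
next
  case (Cons b u)
  have 1: "runs (Branch 2 Skip (seqs [Pop 2, Push 0 False, Push 0 True])
     (seqs [Pop 2, Push 0 False, Push 0 False, Push 0 True, Push 0 True]))
      (st (bits ys) [] (b # u) []) 15 (st (bits (b # ys)) [] u [])"
    by (rule runs_loop_freeI) (auto simp: bits_bool_def)
  from runs_Loop_Step[OF _ 1 Cons.IH[unfolded build_list_def]] show ?case
    unfolding build_list_def by (auto elim!: runs_mono)
qed

lemma runs_unbuild:
  "runs (Loop 1 (unbuild_body 2)) (st (bits y) [True] c []) (20 * length y + 20) (st [] [] (rev y @ c) [])"
proof (induction y arbitrary: c)
  case Nil
  have 1: "runs (unbuild_body 2) (st (bits ([] :: bool list)) [True] c []) 14 (st [] [] c [])"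
    by (rule runs_loop_freeI) (auto simp: unbuild_body_def)
  have "runs (Loop 1 (unbuild_body 2)) (st [] [] c []) 1 (st [] [] c [])"
    by (rule runs_Loop_Nil) simp
  from runs_Loop_Step[OF _ 1 this] show ?case by (auto elim!: runs_mono)
next
  case (Cons b y)
  have 1: "runs (unbuild_body 2) (st (bits (b # y)) [True] c []) 14 (st (bits y) [True] (b # c) [])"
    by (rule runs_loop_freeI) (auto simp: unbuild_body_def bits_bool_def)
  from runs_Loop_Step[OF _ 1 Cons.IH] show ?case by (auto elim!: runs_mono)
qed

lemma runs_raw_from_2: "runs raw_from_2 (st w [] u []) (20 * length u + 1) (st (rev u @ w) [] [] [])"
proof (induction u arbitrary: w)
  case Nil
  show ?case unfolding raw_from_2_def by (rule runs_Loop_NilI) simp_all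
next
  case (Cons b u)
  have 1: "runs (Branch 2 Skip (seqs [Pop 2, Push 0 False]) (seqs [Pop 2, Push 0 True]))
      (st w [] (b # u) []) 10 (st (b # w) [] u [])"
    by (rule runs_loop_freeI) simp_all
  from runs_Loop_Step[OF _ 1 Cons.IH[unfolded raw_from_2_def]] show ?case
    unfolding raw_from_2_def by (auto elim!: runs_mono)
qed

definition read_input :: prog where
  "read_input = Seq raw_to_2 (Seq (Push 0 False) build_list)"

definition write_output :: prog where
  "write_output = Seq (Push 1 True) (Seq (Loop 1 (unbuild_body 2)) raw_from_2)"

lemma runs_read_input: "runs read_input (st x [] [] []) (40 * length x + 3) (st (bits x) [] [] [])"
proof -
  have p: "runs (Push 0 False) (st [] [] (rev x) []) 1 (st (bits ([] :: bool list)) [] (rev x) [])"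
    by (rule runs_loop_freeI) simp_all
  have 1: "runs raw_to_2 (st x [] [] []) (20 * length x + 1) (st [] [] (rev x) [])"
    using runs_raw_to_2[of x "[]"] by simp
  have 2: "runs build_list (st (bits ([] :: bool list)) [] (rev x) []) (20 * length x + 1) (st (bits x) [] [] [])"
    using runs_build_list[of "[]" "rev x"] by simp
  show ?thesis unfolding read_input_def
    by (rule runs_mono[OF runs_Seq[OF 1 runs_Seq[OF p 2]]]) simp
qed

lemma runs_write_output: "runs write_output (st (bits y) [] [] []) (40 * length y + 22) (st y [] [] [])"
proof -
  have p: "runs (Push 1 True) (st (bits y) [] [] []) 1 (st (bits y) [True] [] [])"
    by (rule runs_loop_freeI) simp_all
  have 1: "runs (Loop 1 (unbuild_body 2)) (st (bits y) [True] [] []) (20 * length y + 20) (st [] [] (rev y) [])"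
    using runs_unbuild[of y "[]"] by simp
  have 2: "runs raw_from_2 (st [] [] (rev y) []) (20 * length y + 1) (st y [] [] [])"
    using runs_raw_from_2[of "[]" "rev y"] by simp
  show ?thesis unfolding write_output_def
    by (rule runs_mono[OF runs_Seq[OF p runs_Seq[OF 1 2]]]) simp
qed

lemma sz_bools: "sz (x :: bool list) \<le> 4 * length x + 1" "length x < sz (x :: bool list)"
  by (induction x) auto

lemma poly_dominated:
  fixes a b c :: nat
  shows "\<exists>k. \<forall>n. a * (b * n + b + 2) ^ c + a * n + a \<le> (n + 2) ^ k"
proof -
  have "polyb (\<lambda>n :: nat. a * (b * n + b + 2) ^ c + a * n + a)"
  proof (rule polyb_mono)
    show "polyb (\<lambda>n :: nat. a * (b * sz n + b + 2) ^ c + a * sz n + a)"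
      by (intro polyb_add polyb_mult polyb_power polyb_const polyb_sz)
  qed (intro add_le_mono mult_le_mono power_mono, auto)
  then obtain k where k: "a * (b * n + b + 2) ^ c + a * n + a \<le> (sz n + 2) ^ k" for n :: nat
    unfolding polyb_def by blast
  have "(sz n + 2) ^ k \<le> (n + 2) ^ (2 * k)" for n :: nat
  proof -
    have "sz n + 2 \<le> (n + 2) ^ 2" by (simp add: power2_eq_square)
    then have "(sz n + 2) ^ k \<le> ((n + 2) ^ 2) ^ k" by (rule power_mono) simp
    then show ?thesis by (simp only: power_mult)
  qed
  with k show ?thesis using order_trans by blast
qed

definition init :: "bool list => store" where "init x = (\<lambda>_. [])(0 := x)"

lemma init_st: "init x = st x [] [] []"
  by (auto simp: init_def st_def)

lemma PF_program:
  fixes f :: "bool list => bool list"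
  assumes "PF f"
  obtains p k where "\<And>x. runs p (init x) ((length x + 2) ^ k) (init (f x))"
proof -
  obtain p c where p: "realizes p f c" using assms unfolding PF_def by blast
  obtain k where k: "\<forall>n :: nat. 1000 * (4 * n + 4 + 2) ^ c + 1000 * n + 1000 \<le> (n + 2) ^ k"
    using poly_dominated[of 1000 4 c] by blast
  have "runs (Seq read_input (Seq p write_output)) (init x) ((length x + 2) ^ k) (init (f x))" for x
  proof -
    have r: "runs p (st (bits x) [] [] []) ((sz x + 2) ^ c) (st (bits (f x)) [] [] [])"
      using p[unfolded realizes_def, rule_format, of x "[]" "[]" "[]"] by simp
    have s: "sz x + 2 \<le> 4 * length x + 4 + 2" using sz_bools(1)[of x] by simp
    then have s': "(sz x + 2) ^ c \<le> (4 * length x + 4 + 2) ^ c" by (rule power_mono) simp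
    have len: "length (f x) \<le> sz x + (sz x + 2) ^ c"
      using runs_length[OF r, of 0] sz_bools(2)[of "f x"] by (simp add: sz_def)
    show ?thesis unfolding init_st
    proof (rule runs_mono[OF runs_Seq[OF runs_read_input runs_Seq[OF r runs_write_output]]])
      have "40 * length x + 3 + ((sz x + 2) ^ c + (40 * length (f x) + 22))
        \<le> 1000 * (4 * length x + 4 + 2) ^ c + 1000 * length x + 1000"
        using len s s' by linarith
      also have "\<dots> \<le> (length x + 2) ^ k" using k by blast
      finally show "40 * length x + 3 + ((sz x + 2) ^ c + (40 * length (f x) + 22)) \<le> (length x + 2) ^ k" .
    qed
  qed
  then show ?thesis by (rule that)
qed

subsection \<open>Removing garbage\<close>

fun stacks :: "prog => nat" where
  "stacks Skip = 0"
| "stacks (Push i b) = Suc i"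
| "stacks (Pop i) = Suc i"
| "stacks (Seq p q) = max (stacks p) (stacks q)"
| "stacks (Branch i p q r) = max (Suc i) (max (stacks p) (max (stacks q) (stacks r)))"
| "stacks (Loop i p) = max (Suc i) (stacks p)"

lemma exec_untouched: "exec p s t s' ==> stacks p \<le> i ==> s' i = s i"
  by (induction rule: exec.induct) auto

fun clear :: "nat => nat => prog" where
  "clear lo 0 = Skip"
| "clear lo (Suc n) = Seq (clear lo n) (Loop (lo + n) (Pop (lo + n)))"

lemma runs_clear_one: "runs (Loop i (Pop i)) s (2 * length (s i) + 1) (s(i := []))"
proof (induction "length (s i)" arbitrary: s)
  case 0
  then have "s(i := []) = s" by auto
  then show ?case using runs_Loop_Nil[of s i "Pop i"] 0 by simp
next
  case (Suc n)
  have 1: "runs (Pop i) s 1 (s(i := tl (s i)))" by (rule runs_loop_freeI) simp_all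
  have "n = length ((s(i := tl (s i))) i)" using Suc(2)[symmetric] by simp
  from Suc(1)[of "s(i := tl (s i))", OF this]
  have r: "runs (Loop i (Pop i)) (s(i := tl (s i))) (2 * n + 1) (s(i := []))"
    using Suc(2)[symmetric] by simp
  have "s i \<noteq> []" using Suc(2) by auto
  show ?case by (rule runs_mono[OF runs_Loop_Step[OF \<open>s i \<noteq> []\<close> 1 r]]) (use Suc(2)[symmetric] in simp)
qed

lemma runs_clear:
  assumes "\<And>i. lo \<le> i ==> length (s i) \<le> B"
  shows "runs (clear lo n) s (n * (2 * B + 1) + 1) (\<lambda>i. if lo \<le> i \<and> i < lo + n then [] else s i)"
proof (induction n)
  case 0
  have "(\<lambda>i. if lo \<le> i \<and> i < lo + 0 then [] else s i) = s" by (auto simp: fun_eq_iff)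
  then show ?case using runs_loop_freeI[of Skip s s 1] by simp
next
  case (Suc n)
  let ?s = "\<lambda>i. if lo \<le> i \<and> i < lo + n then [] else s i"
  have eq: "(\<lambda>i. if lo \<le> i \<and> i < lo + Suc n then [] else s i) = ?s(lo + n := [])"
    by (auto simp: fun_eq_iff)
  show ?case unfolding eq clear.simps
    by (rule runs_mono[OF runs_Seq[OF Suc runs_clear_one]]) (use assms[of "lo + n"] in simp)
qed

text \<open>The given program may leave garbage on its other stacks, which would spoil its
  successor. Their number is bounded by \<open>stacks p\<close> and their contents by the time used,
  so clearing them costs linear time for a fixed \<open>p\<close>.\<close>

lemma computes_then_PF:
  fixes f :: "bool list => bool list"
  assumes "PF f"
  shows "\<exists>q k. \<forall>x t y. computes p x t y --> (\<exists>t' \<le> (length x + t + 2) ^ k. computes q x t' (f y))"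
proof -
  obtain r k where r: "\<And>x. runs r (init x) ((length x + 2) ^ k) (init (f x))"
    using PF_program[OF assms] by blast
  define M where "M = stacks p"
  obtain K where K: "\<forall>n :: nat. (3 * M + 3) * (1 * n + 1 + 2) ^ k + (3 * M + 3) * n + (3 * M + 3) \<le> (n + 2) ^ K"
    using poly_dominated[of "3 * M + 3" 1 k] by blast
  have "\<exists>t' \<le> (length x + t + 2) ^ K. computes (Seq p (Seq (clear 1 M) r)) x t' (f y)"
    if c: "computes p x t y" for x t y
  proof -
    let ?B = "length x + t"
    obtain s where s: "exec p (init x) t s" "s 0 = y"
      using c unfolding computes_def init_def by blast
    have B: "length (s i) \<le> ?B" for i
      using exec_length[OF s(1), of i] by (auto simp: init_def split: if_splits)
    have eq: "(\<lambda>i. if 1 \<le> i \<and> i < 1 + M then [] else s i) = init y"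
      using exec_untouched[OF s(1)] s(2) by (auto simp: init_def M_def fun_eq_iff)
    have len: "length y \<le> ?B" using B[of 0] s(2) by simp
    have "runs (Seq p (Seq (clear 1 M) r)) (init x) (t + (M * (2 * ?B + 1) + 1 + (length y + 2) ^ k)) (init (f y))"
    proof (rule runs_Seq[OF _ runs_Seq[OF _ r]])
      show "runs p (init x) t s" using s(1) unfolding runs_def by blast
      show "runs (clear 1 M) s (M * (2 * ?B + 1) + 1) (init y)"
        using runs_clear[of 1 s ?B M] B unfolding eq by blast
    qed
    moreover have "t + (M * (2 * ?B + 1) + 1 + (length y + 2) ^ k) \<le> (?B + 2) ^ K"
    proof -
      have "(length y + 2) ^ k \<le> (1 * ?B + 1 + 2) ^ k" using len by (intro power_mono) auto
      also have "\<dots> \<le> (3 * M + 3) * (1 * ?B + 1 + 2) ^ k" by simp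
      finally have "t + (M * (2 * ?B + 1) + 1 + (length y + 2) ^ k) \<le>
        (3 * M + 3) * (1 * ?B + 1 + 2) ^ k + (3 * M + 3) * ?B + (3 * M + 3)"
        by (simp add: algebra_simps)
      also have "\<dots> \<le> (?B + 2) ^ K" using K by blast
      finally show ?thesis .
    qed
    ultimately obtain t' where "t' \<le> (?B + 2) ^ K" "exec (Seq p (Seq (clear 1 M) r)) (init x) t' (init (f y))"
      unfolding runs_def by (meson order_trans)
    then show ?thesis unfolding computes_def init_def
      by (intro exI[of _ t'] conjI exI[of _ "(\<lambda>_. [])(0 := f y)"]) simp_all
  qed
  then show ?thesis by blast
qed

text \<open>Decodes a leading \<open>enc_nat\<close>, but is defined on all strings.\<close>

definition ones :: "bool list => nat" where "ones x = length (takeWhile id x)"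

lemma ones_enc_nat [simp]: "ones (enc_nat n @ u) = n" "ones (enc_nat n) = n"
  by (induction n) (auto simp: ones_def enc_nat_def)

lemma PF_ones:
  assumes "PF l" shows "PF (\<lambda>x. ones (l x))"
proof -
  have 1: "foldl (\<lambda>a e. if fst a \<and> e then (True, Suc (snd a)) else (False, snd a)) (False, n) x = (False, n)" for n x
    by (induction x) auto
  have "snd (foldl (\<lambda>a e. if fst a \<and> e then (True, Suc (snd a)) else (False, snd a)) (True, n) x)
      = n + ones x" for n x
    by (induction x arbitrary: n) (auto simp: ones_def 1)
  moreover have "PF (\<lambda>x. snd (foldl (\<lambda>a e. if fst a \<and> e then (True, Suc (snd a)) else (False, snd a)) (True, 0) (l x)))"
    by (rule PF_snd, rule PF_foldl_add[where B = "\<lambda>_. 5"])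
      (auto intro!: PF_intros polyb_const assms split: if_splits)
  ultimately show ?thesis by simp
qed

lemma PF_enc_nat: "PF l ==> PF (\<lambda>x. enc_nat (l x))"
  unfolding enc_nat_def by (intro PF_intros)

lemma computable_comp:
  assumes "computable f" "PF h"
  shows "computable (\<lambda>n. h (f n))"
proof -
  obtain p where p: "\<forall>n. \<exists>t. computes p (enc_nat n) t (enc_nat (f n))"
    using assms(1) unfolding computable_def by blast
  have "PF (\<lambda>x. enc_nat (h (ones x)))"
    by (intro PF_enc_nat PF_comp[OF assms(2)] PF_ones PF_id)
  from computes_then_PF[OF this, of p] obtain q k where
    q: "\<forall>x t y. computes p x t y --> (\<exists>t' \<le> (length x + t + 2) ^ k. computes q x t' (enc_nat (h (ones y))))"
    by blast
  have "\<exists>t. computes q (enc_nat n) t (enc_nat (h (f n)))" for n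
  proof -
    obtain t where "computes p (enc_nat n) t (enc_nat (f n))" using p by blast
    from q[rule_format, OF this] show ?thesis by auto
  qed
  then show ?thesis unfolding computable_def by blast
qed

text \<open>The intermediate parameter is only known to be at most \<open>h k\<close>; monotonicity
  of \<open>g\<close> carries this bound over to the final parameter.\<close>

lemma fpt_reducible_then_PF:
  assumes PQ: "fpt_reducible P Q"
    and r: "PF r" "\<And>x k. \<exists>x' k'. r (enc_param (x, k)) = enc_param (x', k') \<and> k' \<le> g k \<and>
      ((x, k) \<in> Q \<longleftrightarrow> (x', k') \<in> R)"
    and g: "PF g" "mono g"
  shows "fpt_reducible P R"
proof -
  obtain p f h c where f: "computable f" and h: "computable h" and
    p: "\<forall>x k. \<exists>t x' k'. computes p (enc_param (x, k)) t (enc_param (x', k')) \<and>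
      t \<le> f k * length (enc_param (x, k)) ^ c \<and> k' \<le> h k \<and> ((x, k) \<in> P \<longleftrightarrow> (x', k') \<in> Q)"
    using PQ unfolding fpt_reducible_def by blast
  obtain q K where q: "\<forall>x t y. computes p x t y --> (\<exists>t' \<le> (length x + t + 2) ^ K. computes q x t' (r y))"
    using computes_then_PF[OF r(1)] by blast
  have "PF (\<lambda>m. (m + 3 :: nat) ^ K)"
  proof (induction K)
    case (Suc K)
    then show ?case unfolding power_Suc by (intro PF_mult PF_add PF_id PF_const)
  qed (simp add: PF_const)
  then have f': "computable (\<lambda>k. (f k + 3) ^ K)" using computable_comp[OF f] by blast
  have h': "computable (\<lambda>k. g (h k))" using computable_comp[OF h g(1)] .
  have "\<exists>t x' k'. computes q (enc_param (x, k)) t (enc_param (x', k')) \<and>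
      t \<le> (f k + 3) ^ K * length (enc_param (x, k)) ^ ((c + 1) * K) \<and> k' \<le> g (h k) \<and>
      ((x, k) \<in> P \<longleftrightarrow> (x', k') \<in> R)" for x k
  proof -
    let ?L = "length (enc_param (x, k))"
    obtain t x1 k1 where 1: "computes p (enc_param (x, k)) t (enc_param (x1, k1))"
      "t \<le> f k * ?L ^ c" "k1 \<le> h k" "(x, k) \<in> P \<longleftrightarrow> (x1, k1) \<in> Q"
      using p by blast
    obtain x2 k2 where 2: "r (enc_param (x1, k1)) = enc_param (x2, k2)" "k2 \<le> g k1"
      "(x1, k1) \<in> Q \<longleftrightarrow> (x2, k2) \<in> R" using r(2) by blast
    obtain t' where t': "t' \<le> (?L + t + 2) ^ K" "computes q (enc_param (x, k)) t' (enc_param (x2, k2))"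
      using q[rule_format, OF 1(1)] 2(1) by auto
    have L: "1 \<le> ?L" by (simp add: enc_nat_def)
    \<comment> \<open>The summand 3 pays for the input length and the constant 2; encodings are
      never empty, so powers of \<open>?L\<close> are at least 1.\<close>
    have "?L + t + 2 \<le> (f k + 3) * ?L ^ (c + 1)"
    proof -
      have "?L \<le> ?L ^ (c + 1)" "1 \<le> ?L ^ (c + 1)" "?L ^ c \<le> ?L ^ (c + 1)"
        using L by (auto intro: power_increasing self_le_power simp del: power_Suc power_add)
      moreover have "f k * ?L ^ c \<le> f k * ?L ^ (c + 1)" using calculation(3) by (rule mult_le_mono2)
      ultimately have "?L + t + 2 \<le> ?L ^ (c + 1) + f k * ?L ^ (c + 1) + 2 * ?L ^ (c + 1)"
        using 1(2) by linarith
      then show ?thesis by (simp add: distrib_right del: power_Suc)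
    qed
    then have "(?L + t + 2) ^ K \<le> ((f k + 3) * ?L ^ (c + 1)) ^ K" by (rule power_mono) simp
    also have "\<dots> = (f k + 3) ^ K * ?L ^ ((c + 1) * K)"
      by (simp only: power_mult_distrib power_mult)
    finally have "t' \<le> (f k + 3) ^ K * ?L ^ ((c + 1) * K)" using t'(1) by linarith
    moreover have "k2 \<le> g (h k)" using 2(2) monoD[OF g(2) 1(3)] by linarith
    ultimately show ?thesis using t'(2) 1(4) 2(3) by blast
  qed
  then show ?thesis unfolding fpt_reducible_def using f' h' by blast
qed

subsection \<open>Clocked simulation\<close>

text \<open>Stacks 0 to 3 are the usual ones, stack 4 is the clock, and the simulated store is
  shifted by 5.\<close>

definition big :: "bool list => bool list => bool list => bool list => nat => store => store" where
  "big a b c d n s = (\<lambda>i. if i = 0 then a else if i = 1 then b else if i = 2 then c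
     else if i = 3 then d else if i = 4 then replicate n True else s (i - 5))"

lemma big_apply [simp]: "big a b c d n s 0 = a" "big a b c d n s 1 = b" "big a b c d n s (Suc 0) = b"
    "big a b c d n s 2 = c" "big a b c d n s 3 = d" "big a b c d n s 4 = replicate n True"
    "big a b c d n s (i + 5) = s i" "big a b c d n s 5 = s 0" "big a b c d n s 6 = s (Suc 0)"
  by (simp_all add: big_def)

lemma big_upd [simp]: "(big a b c d n s)(0 := x) = big x b c d n s"
    "(big a b c d n s)(1 := x) = big a x c d n s"
    "(big a b c d n s)(Suc 0 := x) = big a x c d n s"
    "(big a b c d n s)(4 := replicate m True) = big a b c d m s"
    "(big a b c d n s)(4 := True # replicate m True) = big a b c d (Suc m) s"
    "(big a b c d n s)(i + 5 := x) = big a b c d n (s(i := x))"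
    "(big a b c d n s)(5 := x) = big a b c d n (s(0 := x))"
    "(big a b c d n s)(6 := x) = big a b c d n (s(Suc 0 := x))"
  by (auto simp: big_def fun_eq_iff)

lemma st_big: "st a b c d = big a b c d 0 (\<lambda>_. [])"
  by (auto simp: st_def big_def)

definition tick :: "prog => prog" where
  "tick p = Branch 4 Skip Skip (Seq (Pop 4) p)"

definition loop_test :: "nat => prog" where
  "loop_test i = tick (Branch (i + 5) Skip (Push 1 True) (Push 1 True))"

text \<open>The clock loses exactly one bit for each simulated step. Once it is empty, elementary
  operations are skipped and loop tests raise no flag, so every loop ends and the simulation halts
  whatever \<open>p\<close> does.\<close>

fun clocked :: "prog => prog" where
  "clocked Skip = tick Skip"
| "clocked (Push i b) = tick (Push (i + 5) b)"
| "clocked (Pop i) = tick (Pop (i + 5))"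
| "clocked (Seq p q) = Seq (clocked p) (clocked q)"
| "clocked (Branch i p q r) = tick (Branch (i + 5) (clocked p) (clocked q) (clocked r))"
| "clocked (Loop i p) = Seq (loop_test i) (Loop 1 (Seq (Pop 1) (Seq (clocked p) (loop_test i))))"

lemma runs_tick:
  assumes "runs p (big a b c d n s) m s'"
  shows "runs (tick p) (big a b c d (Suc n) s) (m + 2) s'"
proof -
  have "runs (Pop 4) (big a b c d (Suc n) s) 1 (big a b c d n s)"
    by (rule runs_loop_freeI) simp_all
  from runs_Seq[OF this assms] have "runs (Seq (Pop 4) p) (big a b c d (Suc n) s) (1 + m) s'" .
  then have "runs (tick p) (big a b c d (Suc n) s) (Suc (1 + m)) s'" unfolding tick_def
    by (intro runs_Branch[where b = True and u = "replicate n True"]) simp_all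
  then show ?thesis by (rule runs_mono) simp
qed

lemma runs_Branch_Nil:
  assumes "s i = []" "runs p s n s'" shows "runs (Branch i p q r) s (Suc n) s'"
proof -
  obtain t where "t \<le> n" "exec p s t s'" using assms(2) unfolding runs_def by blast
  with exec.Branch_Nil[of s i p t s' q r, OF assms(1)] show ?thesis
    unfolding runs_def by (meson Suc_le_mono)
qed

lemma runs_tick_0: "runs (tick p) (big a b c d 0 s) 2 (big a b c d 0 s)"
proof -
  have "runs Skip (big a b c d 0 s) 1 (big a b c d 0 s)" by (rule runs_loop_freeI) simp_all
  from runs_Branch_Nil[OF _ this, of 4] show ?thesis unfolding tick_def by (simp add: numeral_2_eq_2)
qed

lemma runs_loop_test:
  "s i = [] ==> runs (loop_test i) (big a [] c d (Suc n) s) 6 (big a [] c d n s)"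
  "s i \<noteq> [] ==> runs (loop_test i) (big a [] c d (Suc n) s) 6 (big a [True] c d n s)"
  unfolding loop_test_def
  by (rule runs_mono[OF runs_tick], rule runs_loop_freeI[where n = 4], simp_all)+

lemma runs_Seq_D:
  assumes "runs (Seq p q) s n s'"
  obtains k m s1 where "runs p s k s1" "runs q s1 m s'" "k + m \<le> n"
proof -
  obtain t where t: "t \<le> n" "exec (Seq p q) s t s'" using assms unfolding runs_def by blast
  from t(2) obtain t1 t2 s1 where "t = t1 + t2" "exec p s t1 s1" "exec q s1 t2 s'"
    by cases auto
  then show ?thesis using that[of t1 s1 t2] t(1) unfolding runs_def by blast
qed

text \<open>The first test of a simulated loop stands in front of the loop, all later ones at the
  end of its body. Splitting the remaining run after its first test turns that test into the end of
  one more iteration.\<close>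

lemma clocked_loop_step:
  assumes "s i \<noteq> []" "runs (clocked p) (big a [] c d n s) k (big a [] c d m s1)"
    and "runs (clocked (Loop i p)) (big a [] c d m s1) l s2"
  shows "runs (clocked (Loop i p)) (big a [] c d (Suc n) s) (10 + k + l) s2"
proof -
  let ?b = "Seq (Pop 1) (Seq (clocked p) (loop_test i))"
  obtain u v s3 where uv: "runs (loop_test i) (big a [] c d m s1) u s3" "runs (Loop 1 ?b) s3 v s2" "u + v \<le> l"
    by (rule runs_Seq_D[OF assms(3)[unfolded clocked.simps]]) blast
  have pop: "runs (Pop 1) (big a [True] c d n s) 1 (big a [] c d n s)"
    by (rule runs_loop_freeI) simp_all
  have "runs ?b (big a [True] c d n s) (1 + (k + u)) s3"
    by (rule runs_Seq[OF pop runs_Seq[OF assms(2) uv(1)]])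
  from runs_Loop_Step[OF _ this uv(2)]
  have "runs (Loop 1 ?b) (big a [True] c d n s) (Suc (1 + (k + u) + v)) s2" by simp
  from runs_Seq[OF runs_loop_test(2)[of s i, OF assms(1)] this] show ?thesis
    unfolding clocked.simps by (rule runs_mono) (use uv(3) in simp)
qed

lemma clocked_loop_nil:
  assumes "s i = []"
  shows "runs (clocked (Loop i p)) (big a [] c d (Suc n) s) 10 (big a [] c d n s)"
  unfolding clocked.simps
  by (rule runs_mono[OF runs_Seq[OF runs_loop_test(1)[of s i, OF assms] runs_Loop_Nil]]) simp_all

lemma clocked_exec:
  assumes "exec p s t s'"
  shows "t \<le> n ==> runs (clocked p) (big a [] c d n s) (10 * t) (big a [] c d (n - t) s')"
  using assms
proof (induction arbitrary: n rule: exec.induct)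
  case (Skip s)
  then obtain m where n: "n = Suc m" by (cases n) auto
  have "runs Skip (big a [] c d m s) 1 (big a [] c d m s)" by (rule runs_loop_freeI) simp_all
  from runs_mono[OF runs_tick[OF this], of 10] show ?case unfolding n clocked.simps diff_Suc_1 mult_1_right by simp
next
  case (Push i b s)
  then obtain m where n: "n = Suc m" by (cases n) auto
  have "runs (Push (i + 5) b) (big a [] c d m s) 1 (big a [] c d m (s(i := b # s i)))"
    by (rule runs_loop_freeI) simp_all
  show ?case unfolding n clocked.simps diff_Suc_1 mult_1_right by (rule runs_mono[OF runs_tick[OF \<open>runs _ _ _ _\<close>]]) simp
next
  case (Pop i s)
  then obtain m where n: "n = Suc m" by (cases n) auto
  have "runs (Pop (i + 5)) (big a [] c d m s) 1 (big a [] c d m (s(i := tl (s i))))"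
    by (rule runs_loop_freeI) simp_all
  show ?case unfolding n clocked.simps diff_Suc_1 mult_1_right by (rule runs_mono[OF runs_tick[OF \<open>runs _ _ _ _\<close>]]) simp
next
  case (Seq p s t s' q t' s'')
  have "runs (clocked p) (big a [] c d n s) (10 * t) (big a [] c d (n - t) s')"
    "runs (clocked q) (big a [] c d (n - t) s') (10 * t') (big a [] c d (n - t - t') s'')"
    using Seq.IH(1)[of n] Seq.IH(2)[of "n - t"] Seq.prems by simp_all
  from runs_Seq[OF this] show ?case by (simp add: algebra_simps)
next
  case (Branch_Nil s i p t s' q r)
  then obtain m where n: "n = Suc m" by (cases n) auto
  have "runs (clocked p) (big a [] c d m s) (10 * t) (big a [] c d (m - t) s')"
    using Branch_Nil n by simp
  then have "runs (Branch (i + 5) (clocked p) (clocked q) (clocked r)) (big a [] c d m s) (Suc (10 * t)) (big a [] c d (m - t) s')"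
    by (intro runs_Branch_Nil) (simp_all add: Branch_Nil)
  from runs_mono[OF runs_tick[OF this]] show ?case by (simp add: n)
next
  case (Branch_False s i w q t s' p r)
  then obtain m where n: "n = Suc m" by (cases n) auto
  have "runs (clocked q) (big a [] c d m s) (10 * t) (big a [] c d (m - t) s')"
    using Branch_False n by simp
  then have "runs (Branch (i + 5) (clocked p) (clocked q) (clocked r)) (big a [] c d m s) (Suc (10 * t)) (big a [] c d (m - t) s')"
    by (intro runs_Branch[where b = False and u = w]) (simp_all add: Branch_False)
  from runs_mono[OF runs_tick[OF this]] show ?case by (simp add: n)
next
  case (Branch_True s i w r t s' p q)
  then obtain m where n: "n = Suc m" by (cases n) auto
  have "runs (clocked r) (big a [] c d m s) (10 * t) (big a [] c d (m - t) s')"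
    using Branch_True n by simp
  then have "runs (Branch (i + 5) (clocked p) (clocked q) (clocked r)) (big a [] c d m s) (Suc (10 * t)) (big a [] c d (m - t) s')"
    by (intro runs_Branch[where b = True and u = w]) (simp_all add: Branch_True)
  from runs_mono[OF runs_tick[OF this]] show ?case by (simp add: n)
next
  case (Loop_Nil s i p)
  then obtain m where n: "n = Suc m" by (cases n) auto
  show ?case using clocked_loop_nil[of s i p a c d m, OF Loop_Nil(1)] by (simp add: n)
next
  case (Loop_Step s i p t s' t' s'')
  then obtain m where n: "n = Suc m" by (cases n) auto
  have "runs (clocked p) (big a [] c d m s) (10 * t) (big a [] c d (m - t) s')"
    "runs (clocked (Loop i p)) (big a [] c d (m - t) s') (10 * t') (big a [] c d (m - t - t') s'')"
    using Loop_Step.IH(1)[of m] Loop_Step.IH(2)[of "m - t"] Loop_Step.prems n by simp_all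
  from clocked_loop_step[of s i p a c d m, OF Loop_Step(1) this] show ?case
    by (simp add: n algebra_simps diff_diff_left del: clocked.simps)
qed

text \<open>With an empty clock no loop is iterated, so the time depends on the program only. A
  branch counts its subprograms as well, because the clock may run out inside one of them.\<close>

fun idle :: "prog => nat" where
  "idle (Seq p q) = idle p + idle q"
| "idle (Branch i p q r) = 10 + idle p + idle q + idle r"
| "idle (Loop i p) = 20 + idle p"
| "idle _ = 10"

lemma clocked_idle: "runs (clocked p) (big a [] c d 0 s) (idle p) (big a [] c d 0 s)"
proof (induction p)
  case (Seq p q)
  from runs_Seq[OF Seq] show ?case by simp
next
  case (Loop i p)
  have "runs (loop_test i) (big a [] c d 0 s) 2 (big a [] c d 0 s)"
    unfolding loop_test_def by (rule runs_tick_0)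
  note t = this
  show ?case unfolding clocked.simps by (rule runs_mono[OF runs_Seq[OF t runs_Loop_Nil]]) simp_all
qed (auto intro: runs_mono[OF runs_tick_0])

text \<open>Nothing is assumed about halting: a diverging program is cut off in time linear in the
  clock. For loops, an inner induction on the clock replaces the missing induction over a finite
  execution.\<close>

lemma clocked_cases:
  "(\<exists>t s'. t \<le> n \<and> exec p s t s') \<or>
   (\<exists>s'. runs (clocked p) (big a [] c d n s) (10 * n + idle p) (big a [] c d 0 s'))"
proof (induction p arbitrary: n s)
  case Skip
  show ?case
  proof (cases n)
    case 0
    then show ?thesis using clocked_idle[of "Skip"] by (intro disjI2 exI[of _ s]) simp
  next
    case (Suc m)
    then show ?thesis using exec.Skip[of s] by (intro disjI1 exI[of _ 1]) auto
  qed
next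
  case (Push i b)
  show ?case
  proof (cases n)
    case 0
    then show ?thesis using clocked_idle[of "Push i b"] by (intro disjI2 exI[of _ s]) simp
  next
    case (Suc m)
    then show ?thesis using exec.Push[of i b s] by (intro disjI1 exI[of _ 1]) auto
  qed
next
  case (Pop i)
  show ?case
  proof (cases n)
    case 0
    then show ?thesis using clocked_idle[of "Pop i"] by (intro disjI2 exI[of _ s]) simp
  next
    case (Suc m)
    then show ?thesis using exec.Pop[of i s] by (intro disjI1 exI[of _ 1]) auto
  qed
next
  case (Seq p q)
  from Seq.IH(1)[of n s] show ?case
  proof (elim disjE exE conjE)
    fix t s1 assume 1: "t \<le> n" "exec p s t s1"
    from Seq.IH(2)[of "n - t" s1] show ?thesis
    proof (elim disjE exE conjE)
      fix t' s2 assume 2: "t' \<le> n - t" "exec q s1 t' s2"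
      from exec.Seq[OF 1(2) 2(2)] 1(1) 2(1) show ?thesis
        by (intro disjI1 exI[of _ "t + t'"] exI[of _ s2]) auto
    next
      fix s2 assume "runs (clocked q) (big a [] c d (n - t) s1) (10 * (n - t) + idle q) (big a [] c d 0 s2)"
      from runs_Seq[OF clocked_exec[OF 1(2,1)] this] 1(1) show ?thesis
        by (intro disjI2 exI[of _ s2]) (auto elim!: runs_mono simp: algebra_simps)
    qed
  next
    fix s1 assume "runs (clocked p) (big a [] c d n s) (10 * n + idle p) (big a [] c d 0 s1)"
    from runs_Seq[OF this clocked_idle[of q]] show ?thesis
      by (intro disjI2 exI[of _ s1]) (auto elim!: runs_mono simp: algebra_simps)
  qed
next
  case (Branch i p q r)
  show ?case
  proof (cases n)
    case 0
    then show ?thesis using clocked_idle[of "Branch i p q r"] by (intro disjI2 exI[of _ s]) simp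
  next
    case (Suc m)
    define x where "x = (case s i of [] => p | b # _ => if b then r else q)"
    have "(\<exists>t s'. t \<le> m \<and> exec x s t s') \<or>
       (\<exists>s'. runs (clocked x) (big a [] c d m s) (10 * m + idle x) (big a [] c d 0 s'))"
      using Branch.IH[of m s] unfolding x_def by (auto split: list.split)
    then show ?thesis
    proof (elim disjE exE conjE)
      fix t s' assume "t \<le> m" "exec x s t s'"
      then have "exec (Branch i p q r) s (Suc t) s'"
        by (auto simp: x_def split: list.splits if_splits intro: exec.intros)
      with \<open>t \<le> m\<close> Suc show ?thesis by blast
    next
      fix s' assume x: "runs (clocked x) (big a [] c d m s) (10 * m + idle x) (big a [] c d 0 s')"
      have "runs (Branch (i + 5) (clocked p) (clocked q) (clocked r)) (big a [] c d m s) (Suc (10 * m + idle x)) (big a [] c d 0 s')"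
      proof (cases "s i")
        case Nil
        with x show ?thesis by (intro runs_Branch_Nil) (auto simp: x_def)
      next
        case (Cons b w)
        with x show ?thesis by (intro runs_Branch[where b = b and u = w]) (auto simp: x_def)
      qed
      from runs_tick[OF this] have "runs (clocked (Branch i p q r)) (big a [] c d n s)
         (10 * n + idle (Branch i p q r)) (big a [] c d 0 s')"
        using Suc by (auto elim!: runs_mono simp: x_def split: list.splits)
      then show ?thesis by blast
    qed
  qed
next
  case (Loop i p)
  show ?case
  proof (induction n arbitrary: s rule: less_induct)
    case (less n)
    show ?case
    proof (cases n)
      case 0
      then show ?thesis using clocked_idle[of "Loop i p"] by (intro disjI2 exI[of _ s]) simp
    next
      case (Suc m)
      show ?thesis
      proof (cases "s i = []")
        case True
        from exec.Loop_Nil[of s i p, OF this] Suc show ?thesis by (intro disjI1 exI[of _ 1]) auto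
      next
        case False
        from Loop.IH[of m s] show ?thesis
        proof (elim disjE exE conjE)
          fix t s1 assume 1: "t \<le> m" "exec p s t s1"
          from less[of "m - t" s1] have "(\<exists>t' s'. t' \<le> m - t \<and> exec (Loop i p) s1 t' s') \<or>
            (\<exists>s'. runs (clocked (Loop i p)) (big a [] c d (m - t) s1) (10 * (m - t) + idle (Loop i p)) (big a [] c d 0 s'))"
            using Suc by simp
          then show ?thesis
          proof (elim disjE exE conjE)
            fix t' s2 assume 2: "t' \<le> m - t" "exec (Loop i p) s1 t' s2"
            from exec.Loop_Step[OF False 1(2) 2(2)] 1(1) 2(1) Suc show ?thesis
              by (intro disjI1 exI[of _ "Suc (t + t')"] exI[of _ s2]) auto
          next
            fix s2 assume 2: "runs (clocked (Loop i p)) (big a [] c d (m - t) s1)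
              (10 * (m - t) + idle (Loop i p)) (big a [] c d 0 s2)"
            have "runs (clocked (Loop i p)) (big a [] c d n s) (10 * n + idle (Loop i p)) (big a [] c d 0 s2)"
              unfolding Suc
              by (rule runs_mono[OF clocked_loop_step[of s i p a c d m, OF False clocked_exec[OF 1(2,1)] 2]])
                (use 1(1) in simp)
            then show ?thesis by blast
          qed
        next
          fix s1 assume 1: "runs (clocked p) (big a [] c d m s) (10 * m + idle p) (big a [] c d 0 s1)"
          have "runs (clocked (Loop i p)) (big a [] c d 0 s1) 4 (big a [] c d 0 s1)"
            unfolding clocked.simps loop_test_def
            by (rule runs_mono[OF runs_Seq[OF runs_tick_0 runs_Loop_Nil]]) simp_all
          note idle = this
          have "runs (clocked (Loop i p)) (big a [] c d n s) (10 * n + idle (Loop i p)) (big a [] c d 0 s1)"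
            unfolding Suc
            by (rule runs_mono[OF clocked_loop_step[of s i p a c d m, OF False 1 idle]]) simp
          then show ?thesis by blast
        qed
      qed
    qed
  qed
qed

text \<open>The bound is strict because the simulation recognises halting by a clock that still has
  a bit left.\<close>

definition halts_within :: "prog => nat => bool list => bool" where
  "halts_within p n x \<longleftrightarrow> (\<exists>t y. t < n \<and> computes p x t y)"

definition accepts_within :: "prog => nat => bool list => bool" where
  "accepts_within p n x \<longleftrightarrow> (\<exists>t. t < n \<and> computes p x t [True])"

definition move_clock :: prog where
  "move_clock = Branch 0 Skip (seqs [Pop 0, Pop 1]) (seqs [Pop 0, Pop 0, Push 4 True])"

lemma runs_move_clock:
  "runs (Loop 1 move_clock) (big (bits n @ w) [True] c d m s) (20 * n + 20) (big w [] c d (n + m) s)"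
proof (induction n arbitrary: m)
  case 0
  have 1: "runs move_clock (big (bits (0 :: nat) @ w) [True] c d m s) 10 (big w [] c d m s)"
    by (rule runs_loop_freeI) (simp_all add: move_clock_def)
  have e: "runs (Loop 1 move_clock) (big w [] c d m s) 1 (big w [] c d m s)"
    by (rule runs_Loop_NilI) simp_all
  from runs_Loop_Step[OF _ 1 e] show ?case by (auto elim!: runs_mono)
next
  case (Suc n)
  have 1: "runs move_clock (big (bits (Suc n) @ w) [True] c d m s) 10 (big (bits n @ w) [True] c d (Suc m) s)"
    by (rule runs_loop_freeI) (simp_all add: move_clock_def)
  from runs_Loop_Step[OF _ 1 Suc.IH[of "Suc m"]] show ?case by (auto elim!: runs_mono)
qed

lemma runs_unbuild_6:
  "runs (Loop 1 (unbuild_body 6)) (big (bits y @ w) [True] c d n (s(1 := u))) (20 * length y + 20)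
     (big w [] c d n (s(1 := rev y @ u)))"
proof (induction y arbitrary: u)
  case Nil
  have 1: "runs (unbuild_body 6) (big (bits ([] :: bool list) @ w) [True] c d n (s(1 := u))) 14
      (big w [] c d n (s(1 := u)))"
    by (rule runs_loop_freeI) (auto simp: unbuild_body_def)
  have e: "runs (Loop 1 (unbuild_body 6)) (big w [] c d n (s(1 := u))) 1 (big w [] c d n (s(1 := u)))"
    by (rule runs_Loop_NilI) simp_all
  have "runs (Loop 1 (unbuild_body 6)) (big (bits ([] :: bool list) @ w) [True] c d n (s(1 := u))) 20
     (big w [] c d n (s(1 := u)))"
    by (rule runs_mono[OF runs_Loop_Step[OF _ 1 e]]) simp_all
  then show ?case by (simp del: fun_upd_apply)
next
  case (Cons b y)
  have 1: "runs (unbuild_body 6) (big (bits (b # y) @ w) [True] c d n (s(1 := u))) 14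
      (big (bits y @ w) [True] c d n (s(1 := b # u)))"
    by (rule runs_loop_freeI) (auto simp: unbuild_body_def bits_bool_def)
  from runs_Loop_Step[OF _ 1 Cons.IH] show ?case by (auto elim!: runs_mono simp del: fun_upd_apply)
qed

definition move_6_5 :: prog where
  "move_6_5 = Loop 6 (Branch 6 Skip (seqs [Pop 6, Push 5 False]) (seqs [Pop 6, Push 5 True]))"

lemma runs_move_6_5:
  "runs move_6_5 (big w [] c d n ((\<lambda>_. [])(0 := x, 1 := u))) (20 * length u + 1)
     (big w [] c d n ((\<lambda>_. [])(0 := rev u @ x)))"
proof (induction u arbitrary: x)
  case Nil
  have eq: "(\<lambda>_. [])(0 := x, 1 := []) = ((\<lambda>_. [])(0 := x) :: store)" by auto
  show ?case unfolding move_6_5_def eq by (rule runs_Loop_NilI) simp_all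
next
  case (Cons b u)
  have 1: "runs (Branch 6 Skip (seqs [Pop 6, Push 5 False]) (seqs [Pop 6, Push 5 True]))
      (big w [] c d n ((\<lambda>_. [])(0 := x, 1 := b # u))) 10
      (big w [] c d n ((\<lambda>_. [])(0 := b # x, 1 := u)))"
    by (rule runs_loop_freeI) (auto simp: big_def fun_eq_iff)
  have "runs move_6_5 (big w [] c d n ((\<lambda>_. [])(0 := x, 1 := b # u))) (20 * length (b # u) + 1)
     (big w [] c d n ((\<lambda>_. [])(0 := rev u @ b # x)))"
    unfolding move_6_5_def
    by (rule runs_mono[OF runs_Loop_Step[OF _ 1 Cons.IH[unfolded move_6_5_def]]]) simp_all
  then show ?case by (simp del: fun_upd_apply)
qed

fun push_back :: "bool \<times> bool => prog" where
  "push_back v = push_all (bits v)"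

definition read_result :: prog where
  "read_result = Branch 4 (push_back (False, False)) Skip
     (Branch 5 (push_back (True, False)) (push_back (True, False))
       (Seq (Pop 5) (Branch 5 (push_back (True, True)) (push_back (True, False)) (push_back (True, False)))))"

definition clocked_run :: "prog => prog" where
  "clocked_run p = Seq (seqs [Pop 0, Push 1 True]) (Seq (Loop 1 move_clock)
     (Seq (Push 1 True) (Seq (Loop 1 (unbuild_body 6)) (Seq move_6_5
     (Seq (clocked p) (Seq read_result (clear 4 (stacks p + 2))))))))"

lemma loop_free_push_all [simp]: "loop_free (push_all u)"
  by (induction u) auto

lemma result_push_all [simp]: "result (push_all u) s = s(0 := u @ s 0)"
  by (induction u) auto

lemma cost_push_all [simp]: "cost (push_all u) = Suc (length u)"
  by (induction u) auto

lemma runs_read_result: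
  "\<exists>u. runs read_result (big w [] c d n s) 100
     (big (bits (0 < n, 0 < n \<and> s 0 = [True]) @ w) [] c d n (s(0 := u)))"
proof -
  have l: "loop_free read_result" by (simp add: read_result_def)
  have k: "cost read_result \<le> 100" by (simp add: read_result_def bits_prod_def bits_bool_def)
  have "\<exists>u. result read_result (big w [] c d n s) =
     big (bits (0 < n, 0 < n \<and> s 0 = [True]) @ w) [] c d n (s(0 := u))"
  proof (cases "0 < n \<and> s 0 \<noteq> [] \<and> hd (s 0)")
    case True
    then obtain v where "s 0 = True # v" by (cases "s 0") auto
    with True show ?thesis
      by (intro exI[of _ v]) (cases v; auto simp: read_result_def)
  next
    case False
    have eq: "s(0 := s 0) = s" by simp
    from False show ?thesis
      by (intro exI[of _ "s 0"], unfold eq) (cases "s 0", auto simp: read_result_def)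
  qed
  then show ?thesis using runs_loop_freeI[OF l _ k] by blast
qed

text \<open>The budget is a unary argument, so linear simulation is polynomial. An arbitrary fixed
  program thereby becomes an ordinary test that later constructions may call.\<close>

lemma PF_clocked_run:
  "PF (\<lambda>z. (halts_within p (fst z) (snd z), accepts_within p (fst z) (snd z)))"
proof (rule PF_I)
  define M where "M = stacks p + 2"
  define T where "T z = (20 * sz z + 22) + ((20 * sz z + 20) + (20 * sz z + 1) + (10 * sz z + idle p) + 100)
     + (M * (2 * (sz z + (20 * sz z + idle p + 100)) + 1) + 1)" for z :: "nat \<times> bool list"
  show "polyb T" unfolding T_def by (intro polyb_add polyb_mult polyb_const polyb_sz)
  fix z :: "nat \<times> bool list" and w c d
  obtain n x where z: "z = (n, x)" by (cases z)
  let ?s = "(\<lambda>_. [])(0 := x) :: store"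
  have nz: "n \<le> sz z" "length x \<le> sz z" using sz_bools(2)[of x] by (simp_all add: z)
  let ?h = "halts_within p n x" and ?a = "accepts_within p n x"
  have "runs (seqs [Pop 0, Push 1 True]) (st (bits z @ w) [] c d) 2
      (big (bits n @ bits x @ w) [True] c d 0 (\<lambda>_. []))"
    by (rule runs_loop_freeI) (auto simp: z bits_prod_def st_big)
  note 1 = this
  have 2: "runs (Loop 1 move_clock) (big (bits n @ bits x @ w) [True] c d 0 (\<lambda>_. [])) (20 * n + 20)
      (big (bits x @ w) [] c d n (\<lambda>_. []))"
    using runs_move_clock[of n "bits x @ w" c d 0 "\<lambda>_. []"] by simp
  have 3: "runs (Push 1 True) (big (bits x @ w) [] c d n (\<lambda>_. [])) 1
      (big (bits x @ w) [True] c d n ((\<lambda>_. [])(1 := [])))"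
    by (rule runs_loop_freeI) (auto simp: fun_upd_idem)
  have 4: "runs (Loop 1 (unbuild_body 6)) (big (bits x @ w) [True] c d n ((\<lambda>_. [])(1 := [])))
      (20 * length x + 20) (big w [] c d n ((\<lambda>_. [])(1 := rev x)))"
    using runs_unbuild_6[of x w c d n "\<lambda>_. []" "[]"] by (simp del: fun_upd_apply)
  have 5: "runs move_6_5 (big w [] c d n ((\<lambda>_. [])(1 := rev x))) (20 * length x + 1) (big w [] c d n ?s)"
    using runs_move_6_5[of w c d n "[]" "rev x"] by (simp add: fun_upd_idem)
  have "\<exists>s n'. runs (clocked p) (big w [] c d n ?s) (10 * n + idle p) (big w [] c d n' s) \<and>
     n' \<le> n \<and> (0 < n' \<longleftrightarrow> ?h) \<and> (?h --> (s 0 = [True] \<longleftrightarrow> ?a))"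
  proof (cases ?h)
    case True
    then obtain t y where "t < n" "computes p x t y" unfolding halts_within_def by blast
    then obtain s where s: "t < n" "exec p ?s t s" unfolding computes_def by blast
    have a: "?a \<longleftrightarrow> s 0 = [True]"
      using s exec_deterministic[OF s(2)] unfolding accepts_within_def computes_def by blast
    from clocked_exec[OF s(2), of n w c d] s(1) have
      "runs (clocked p) (big w [] c d n ?s) (10 * n + idle p) (big w [] c d (n - t) s)"
      by (auto elim: runs_mono)
    with s(1) a True show ?thesis by (intro exI[of _ s] exI[of _ "n - t"]) auto
  next
    case False
    have "\<exists>s. runs (clocked p) (big w [] c d n ?s) (10 * n + idle p) (big w [] c d 0 s)"
      using clocked_cases[of n p ?s w c d]
    proof (elim disjE exE conjE)
      fix t s assume t: "t \<le> n" "exec p ?s t s"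
      \<comment> \<open>A run of exactly \<open>n\<close> steps exhausts the clock and counts as not
        halting.\<close>
      have "t = n"
      proof (rule ccontr)
        assume "t \<noteq> n"
        with t False show False unfolding halts_within_def computes_def by (metis le_neq_implies_less)
      qed
      with clocked_exec[OF t(2,1), of w c d] have
        "runs (clocked p) (big w [] c d n ?s) (10 * n) (big w [] c d 0 s)" by simp
      then have "runs (clocked p) (big w [] c d n ?s) (10 * n + idle p) (big w [] c d 0 s)"
        by (rule runs_mono) simp
      then show ?thesis by blast
    qed blast
    with False show ?thesis by auto
  qed
  then obtain s n' where 6: "runs (clocked p) (big w [] c d n ?s) (10 * n + idle p) (big w [] c d n' s)"
    and n': "n' \<le> n" "0 < n' \<longleftrightarrow> ?h" "?h --> (s 0 = [True] \<longleftrightarrow> ?a)" by blast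
  obtain u where 7: "runs read_result (big w [] c d n' s) 100
     (big (bits (0 < n', 0 < n' \<and> s 0 = [True]) @ w) [] c d n' (s(0 := u)))"
    using runs_read_result by blast
  have ah: "?a ==> ?h" unfolding accepts_within_def halts_within_def by blast
  have v: "(0 < n', 0 < n' \<and> s 0 = [True]) = (?h, ?a)" using n' ah by auto
  have st0: "stacks (clocked p) \<le> stacks p + 5"
  proof (induction p)
    case (Loop i p)
    then show ?case by (simp add: loop_test_def tick_def)
  qed (auto simp: tick_def)
  have 67: "runs (Seq (clocked p) read_result) (big w [] c d n ?s) (10 * n + idle p + 100)
      (big (bits (?h, ?a) @ w) [] c d n' (s(0 := u)))"
    using runs_Seq[OF 6 7] unfolding v .
  define S where "S = big (bits (?h, ?a) @ w) [] c d n' (s(0 := u))"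
  have len: "length (S i) \<le> sz z + (20 * sz z + idle p + 100)" if "4 \<le> i" for i
  proof -
    have "length (big w [] c d n ?s i) \<le> sz z" using that nz by (auto simp: big_def)
    then show ?thesis using runs_length[OF 67, of i] nz by (simp add: S_def)
  qed
  have "S i = []" if "stacks p + 6 \<le> i" for i
  proof -
    have "stacks (push_all v) \<le> 1" for v by (induction v) auto
    from this[of "bits (False, False)"] this[of "bits (True, False)"] this[of "bits (True, True)"]
    have "stacks read_result \<le> 6" by (simp add: read_result_def)
    with st0 have "stacks (Seq (clocked p) read_result) \<le> i" using that by simp
    then have "S i = big w [] c d n ?s i"
      using 67 exec_untouched unfolding runs_def S_def by blast
    then show ?thesis using that by (simp add: big_def)
  qed
  then have eq: "(\<lambda>i. if 4 \<le> i \<and> i < 4 + M then [] else S i) = st (bits (?h, ?a) @ w) [] c d"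
    by (auto simp: fun_eq_iff M_def st_def S_def big_def)
  have 8: "runs (clear 4 M) S (M * (2 * (sz z + (20 * sz z + idle p + 100)) + 1) + 1)
      (st (bits (?h, ?a) @ w) [] c d)"
    using runs_clear[of 4 S "sz z + (20 * sz z + idle p + 100)" M] len unfolding eq by blast
  have "runs (clocked_run p) (st (bits z @ w) [] c d)
      (2 + ((20 * n + 20) + (1 + ((20 * length x + 20) + ((20 * length x + 1) + ((10 * n + idle p) +
        (100 + (M * (2 * (sz z + (20 * sz z + idle p + 100)) + 1) + 1))))))))
      (st (bits (?h, ?a) @ w) [] c d)"
    unfolding clocked_run_def M_def[symmetric]
    by (rule runs_Seq[OF 1 runs_Seq[OF 2 runs_Seq[OF 3 runs_Seq[OF 4 runs_Seq[OF 5 runs_Seq[OF 6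
      runs_Seq[OF 7[unfolded v, folded S_def] 8]]]]]]])
  then show "runs (clocked_run p) (st (bits z @ w) [] c d) (T z)
     (st (bits (halts_within p (fst z) (snd z), accepts_within p (fst z) (snd z)) @ w) [] c d)"
    unfolding z fst_conv snd_conv by (rule runs_mono) (use nz in \<open>simp add: T_def z\<close>)
qed

section \<open>From binary constraint satisfaction to Steiner Orientation\<close>

text \<open>
  A vertex is a tuple \<open>(kind, t, c, i, j)\<close>. The line \<open>(t, c)\<close> is the row side (\<open>t = 0\<close>) or the column
  side (\<open>t = 1\<close>) of the constraint \<open>c\<close>, or the hub of the variable \<open>c\<close> (\<open>t = 2\<close>). It has an entry
  path (kind 0) and an exit path (kind 1), both undirected; its value is the place where the entry
  path is left. The cell \<open>(i, j)\<close> of a constraint has two vertices (kind 2), seen from the row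
  side as \<open>(2, 0, c, i, j)\<close> and from the column side as \<open>(2, 1, c, j, i)\<close>.
\<close>

type_synonym vtx = "nat \<times> nat \<times> nat \<times> nat \<times> nat"

locale gadget =
  fixes V D m :: nat and var :: "nat => nat => nat" and tbl :: "nat => nat => nat => bool"
  assumes D_pos: "0 < D"
    and var_less: "t < 2 ==> c < m ==> var t c < V"
begin

definition line :: "nat => nat => bool" where
  "line t c \<longleftrightarrow> t < 2 \<and> c < m \<or> t = 2 \<and> c < V"

fun vertex :: "vtx => bool" where
  "vertex (k, t, c, i, j) \<longleftrightarrow> k < 2 \<and> line t c \<and> i < D \<and> j = 0 \<or>
     k = 2 \<and> t < 2 \<and> c < m \<and> i < D \<and> j < D"

definition sync :: "nat => nat => nat => nat => bool" where
  "sync t c t' c' \<longleftrightarrow> t = 2 \<and> t' < 2 \<and> c = var t' c' \<or> t < 2 \<and> t' = 2 \<and> c' = var t c"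

definition ok :: "nat => nat => nat => nat => bool" where
  "ok t c i j \<longleftrightarrow> (if t = 0 then tbl c i j else tbl c j i)"

text \<open>A path enters a cell at the vertex of its own side, crosses to the vertex of the other
  side, and goes on to the next cell. The clauses are, in order: from the entry path to the first
  cell, from a cell to the next one, from the last cell to the exit path, the direct connections
  between synchronised lines and within a hub, and the crossing of a permitted cell, which is
  possible in both directions. The crossing of a forbidden cell is an undirected edge
  instead.\<close>

fun arc :: "vtx => vtx => bool" where
  "arc (k, t, c, i, j) (k', t', c', i', j') \<longleftrightarrow>
     k = 0 \<and> k' = 2 \<and> t' = t \<and> c' = c \<and> i' = i \<and> j' = 0 \<or>
     k = 2 \<and> k' = 2 \<and> t' = 1 - t \<and> c' = c \<and> i' = j \<and> j' = Suc i \<or>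
     k = 2 \<and> k' = 1 \<and> t' = 1 - t \<and> c' = c \<and> i' = j \<and> Suc i = D \<or>
     k = 0 \<and> k' = 1 \<and> i' = i \<and> (sync t c t' c' \<or> t = 2 \<and> t' = 2 \<and> c' = c) \<or>
     k = 2 \<and> k' = 2 \<and> t' = 1 - t \<and> c' = c \<and> i' = j \<and> j' = i \<and> ok t c i j"

fun edge :: "vtx => vtx => bool" where
  "edge (k, t, c, i, j) (k', t', c', i', j') \<longleftrightarrow>
     k = k' \<and> k < 2 \<and> t' = t \<and> c' = c \<and> (i' = Suc i \<or> i = Suc i') \<or>
     k = 2 \<and> k' = 2 \<and> t' = 1 - t \<and> c' = c \<and> i' = j \<and> j' = i \<and> \<not> ok t c i j"

text \<open>The two kinds of request make opposite demands: within a line from the upper end of the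
  entry path to the lower end of the exit path, between synchronised lines from the lower to the
  upper end. As the paths are undirected, the demands can only be reconciled at a common turning
  point, the value.\<close>

fun request :: "vtx => vtx => bool" where
  "request (k, t, c, i, j) (k', t', c', i', j') \<longleftrightarrow> k = 0 \<and> k' = 1 \<and>
     (t' = t \<and> c' = c \<and> Suc i = D \<and> i' = 0 \<or> sync t c t' c' \<and> i = 0 \<and> Suc i' = D)"

definition graph :: "vtx mixed_graph" where
  "graph = \<lparr>verts = Collect vertex, arcs = {(u, v). vertex u \<and> vertex v \<and> arc u v},
     edges = {{u, v} | u v. vertex u \<and> vertex v \<and> edge u v}\<rparr>"

definition requests :: "(vtx \<times> vtx) set" where
  "requests = {(u, v). vertex u \<and> vertex v \<and> request u v}"

definition solvable :: bool where
  "solvable \<longleftrightarrow> (\<exists>val. (\<forall>v<V. val v < D) \<and> (\<forall>c<m. tbl c (val (var 0 c)) (val (var 1 c))))"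

lemma edge_sym: "vertex u ==> edge u v ==> edge v u"
  by (cases u; cases v) (auto simp: ok_def)

lemma edge_neq: "vertex u ==> edge u v ==> u \<noteq> v"
  by (cases u; cases v) (auto, arith)

subsection \<open>Soundness\<close>

context
  fixes Or
  assumes ori: "is_orientation Or (edges graph)"
    and req: "\<And>s t. (s, t) \<in> requests ==> (s, t) \<in> (arcs graph \<union> Or)\<^sup>*"
begin

abbreviation "E \<equiv> arcs graph \<union> Or"

lemma Or_in_edges: "(u, v) \<in> Or ==> {u, v} \<in> edges graph"
  using ori unfolding is_orientation_def by (elim conjE) (drule (1) bspec, simp)

lemma edges_Or: "e \<in> edges graph ==> \<exists>!a. a \<in> Or \<and> e = {fst a, snd a}"
  using ori unfolding is_orientation_def by (elim conjE) (erule (1) bspec)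

lemma Or_edge: "(u, v) \<in> Or ==> vertex u \<and> vertex v \<and> edge u v"
proof -
  assume "(u, v) \<in> Or"
  then have "{u, v} \<in> edges graph" by (rule Or_in_edges)
  then obtain u' v' where uv: "{u, v} = {u', v'}" "vertex u'" "vertex v'" "edge u' v'"
    unfolding graph_def by auto
  from this(1) consider "u = u'" "v = v'" | "u = v'" "v = u'" by (auto simp: doubleton_eq_iff)
  then show ?thesis using uv(2-4) edge_sym[of u' v'] by cases simp_all
qed

lemma Or_unique: "(u, v) \<in> Or ==> (v, u) \<notin> Or"
proof
  assume uv: "(u, v) \<in> Or" and vu: "(v, u) \<in> Or"
  have 1: "(u, v) \<in> Or \<and> {u, v} = {fst (u, v), snd (u, v)}" using uv by simp
  have 2: "(v, u) \<in> Or \<and> {u, v} = {fst (v, u), snd (v, u)}" using vu by auto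
  have "(u, v) = (v, u)" by (rule ex1E[OF edges_Or[OF Or_in_edges[OF uv]]]) (metis 1 2)
  then show False using Or_edge[OF uv] edge_neq[of u v] by simp
qed

lemma E_cases: "(u, v) \<in> E ==> vertex u \<and> vertex v \<and> (arc u v \<or> edge u v \<and> (u, v) \<in> Or)"
  using Or_edge[of u v] unfolding graph_def by auto

abbreviation "P t c i \<equiv> (0 :: nat, t :: nat, c :: nat, i :: nat, 0 :: nat)"
abbreviation "Q t c i \<equiv> (1 :: nat, t :: nat, c :: nat, i :: nat, 0 :: nat)"
abbreviation "X t c i j \<equiv> (2 :: nat, t :: nat, c :: nat, i :: nat, j :: nat)"

fun inv :: "(nat => nat => nat => bool) => (nat => nat => nat => bool) =>
    (nat => nat => nat => nat => bool) => vtx => bool" where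
  "inv p q x (k, t, c, i, j) \<longleftrightarrow> (k = 0 --> p t c i) \<and> (k = 1 --> q t c i) \<and> (k = 2 --> x t c i j)"

text \<open>All forced orientations are found by refuting reachability: \<open>p\<close>,
  \<open>q\<close> and \<open>x\<close> describe the entry, exit and grid part of a vertex set that
  contains the source but not the target, and the hypotheses say that no arc or oriented edge leaves
  it.\<close>

lemma closed:
  assumes reach: "(u, v) \<in> E\<^sup>*" and start: "inv p q x u"
    and px: "\<And>t c i. p t c i ==> t < 2 ==> x t c i 0"
    and xx: "\<And>t c i j. x t c i j ==> t < 2 ==> Suc i < D ==> x (1 - t) c j (Suc i)"
    and xq: "\<And>t c i j. x t c i j ==> t < 2 ==> Suc i = D ==> j < D ==> q (1 - t) c j"
    and sq: "\<And>t c t' c' i. p t c i ==> i < D ==> sync t c t' c' ==> q t' c' i"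
    and pq: "\<And>c i. p 2 c i ==> q 2 c i"
    and cross: "\<And>t c i j. x t c i j ==> t < 2 ==>
      ok t c i j \<or> (X t c i j, X (1 - t) c j i) \<in> Or ==> x (1 - t) c j i"
    and pr: "\<And>t c i. p t c i ==> Suc i < D ==> (P t c i, P t c (Suc i)) \<in> Or ==> p t c (Suc i)"
    and pl: "\<And>t c i. p t c (Suc i) ==> (P t c (Suc i), P t c i) \<in> Or ==> p t c i"
    and qr: "\<And>t c i. q t c i ==> Suc i < D ==> (Q t c i, Q t c (Suc i)) \<in> Or ==> q t c (Suc i)"
    and ql: "\<And>t c i. q t c (Suc i) ==> (Q t c (Suc i), Q t c i) \<in> Or ==> q t c i"
  shows "inv p q x v"
  using reach
proof (induction rule: rtrancl_induct)
  case (step y z)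
  note E = E_cases[OF step(2)]
  obtain k t c i j where y: "y = (k, t, c, i, j)" by (cases y) blast
  obtain k' t' c' i' j' where z: "z = (k', t', c', i', j')" by (cases z) blast
  from E have "arc y z \<or> edge y z \<and> (y, z) \<in> Or" by blast
  then have "((k = 0) \<and> (k' = 2) \<and> (t' = t) \<and> (c' = c) \<and> (i' = i) \<and> (j' = 0)) \<or>
      ((k = 2) \<and> (k' = 2) \<and> (t' = 1 - t) \<and> (c' = c) \<and> (i' = j) \<and> (j' = Suc i)) \<or>
      ((k = 2) \<and> (k' = 1) \<and> (t' = 1 - t) \<and> (c' = c) \<and> (i' = j) \<and> (Suc i = D)) \<or>
      ((k = 0) \<and> (k' = 1) \<and> (i' = i) \<and> (sync t c t' c')) \<or>
      ((k = 0) \<and> (k' = 1) \<and> (i' = i) \<and> (t = 2) \<and> (t' = 2) \<and> (c' = c)) \<or>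
      ((k = 2) \<and> (k' = 2) \<and> (t' = 1 - t) \<and> (c' = c) \<and> (i' = j) \<and> (j' = i) \<and> (ok t c i j \<or> (y, z) \<in> Or)) \<or>
      ((k = 0) \<and> (k' = 0) \<and> (t' = t) \<and> (c' = c) \<and> (i' = Suc i) \<and> ((y, z) \<in> Or)) \<or>
      ((k = 0) \<and> (k' = 0) \<and> (t' = t) \<and> (c' = c) \<and> (i = Suc i') \<and> ((y, z) \<in> Or)) \<or>
      ((k = 1) \<and> (k' = 1) \<and> (t' = t) \<and> (c' = c) \<and> (i' = Suc i) \<and> ((y, z) \<in> Or)) \<or>
      ((k = 1) \<and> (k' = 1) \<and> (t' = t) \<and> (c' = c) \<and> (i = Suc i') \<and> ((y, z) \<in> Or))"
    unfolding y z arc.simps edge.simps less_2_cases_iff One_nat_def by (elim disjE conjE) simp_all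
  then show ?case
  proof (elim disjE conjE, goal_cases)
    case 1
    then show ?case using E step.IH px by (simp add: y z)
  next
    case 2
    then show ?case using E step.IH xx by (simp add: y z)
  next
    case 3
    then show ?case using E step.IH xq by (simp add: y z)
  next
    case 4
    then show ?case using E step.IH sq[of t c i t' c'] by (simp add: y z)
  next
    case 5
    then show ?case using E step.IH pq by (simp add: y z)
  next
    case 6
    then show ?case using E step.IH cross[of t c i j] by (simp add: y z)
  next
    case 7
    then show ?case using E step.IH cross[of t c i j] by (simp add: y z)
  next
    case 8
    then show ?case using E step.IH pr[of t c i] by (simp add: y z)
  next
    case 9
    then show ?case using E step.IH pl[of t c i'] by (simp add: y z)
  next
    case 10
    then show ?case using E step.IH qr[of t c i] by (simp add: y z)
  next
    case 11
    then show ?case using E step.IH ql[of t c i'] by (simp add: y z)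
  qed
qed (rule start)

text \<open>This is the value of a line in a given solution. It is defined through reachability and
  not through a chosen path, so nothing has to be known about the shape of the paths.\<close>

definition turn :: "nat => nat => nat" where
  "turn t c = (LEAST x. (P t c (D - 1), P t c x) \<in> E\<^sup>*)"

lemma turn_reach: "(P t c (D - 1), P t c (turn t c)) \<in> E\<^sup>*"
  unfolding turn_def by (rule LeastI[of _ "D - 1"]) simp

lemma turn_le: "(P t c (D - 1), P t c x) \<in> E\<^sup>* ==> turn t c \<le> x"
  unfolding turn_def by (rule Least_le)

lemma turn_less: "turn t c < D"
  using turn_le[of t c "D - 1"] D_pos by auto

lemma turn_left_stop: "Suc x = turn t c ==> (P t c (Suc x), P t c x) \<notin> Or"
proof
  assume x: "Suc x = turn t c" and "(P t c (Suc x), P t c x) \<in> Or"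
  then have "(P t c (D - 1), P t c x) \<in> E\<^sup>*"
    using turn_reach[of t c] by (auto intro: rtrancl.rtrancl_into_rtrancl)
  from turn_le[OF this] x show False by simp
qed

text \<open>No arc leads into an entry path, so the turn can only be reached along the edges of the
  path itself.\<close>

lemma entry_left:
  assumes "line t c" "turn t c \<le> x" "Suc x < D"
  shows "(P t c (Suc x), P t c x) \<in> Or"
proof (rule ccontr)
  assume n: "(P t c (Suc x), P t c x) \<notin> Or"
  have "inv (\<lambda>t' c' i. t' = t --> c' = c --> x < i) (\<lambda>_ _ _. True) (\<lambda>_ _ _ _. True) (P t c (turn t c))"
  proof (rule closed[OF turn_reach])
    show "t' = t --> c' = c --> x < i"
      if "t' = t --> c' = c --> x < Suc i" "(P t' c' (Suc i), P t' c' i) \<in> Or" for t' c' i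
      using that n less_antisym by blast
  qed (use assms(3) in auto)
  then show False using assms(2) by simp
qed

text \<open>Grid coordinates never decrease. A path from the upper end of the entry path leaves it
  at the turn or above, hence arrives on the exit path at the turn or above, and has to descend from
  there to 0.\<close>

lemma exit_left:
  assumes l: "line t c" and x: "x < turn t c"
  shows "(Q t c (Suc x), Q t c x) \<in> Or"
proof (rule ccontr)
  assume n: "(Q t c (Suc x), Q t c x) \<notin> Or"
  define a where "a = turn t c"
  have xa: "x < a" using x a_def by simp
  have "(P t c (D - 1), Q t c 0) \<in> E\<^sup>*"
    by (rule req) (use l D_pos in \<open>auto simp: requests_def\<close>)
  then have "inv (\<lambda>t' c' i. t' = t \<and> c' = c \<and> a \<le> i) (\<lambda>t' c' i. t' = t --> c' = c --> x < i)
     (\<lambda>t' c' i j. t < 2 --> c' = c --> (t' = t --> a \<le> i) \<and> (t' = 1 - t --> a \<le> j)) (Q t c 0)"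
  proof (rule closed)
    show "t' = t \<and> c' = c \<and> a \<le> i"
      if "t' = t \<and> c' = c \<and> a \<le> Suc i" "(P t' c' (Suc i), P t' c' i) \<in> Or" for t' c' i
      using that turn_left_stop[of i t c] a_def by (auto simp: le_Suc_eq)
    show "t' = t --> c' = c --> x < i"
      if "t' = t --> c' = c --> x < Suc i" "(Q t' c' (Suc i), Q t' c' i) \<in> Or" for t' c' i
      using that n less_antisym by blast
    show "1 - t' = t --> c' = c --> x < j"
      if "t < 2 --> c' = c --> (t' = t --> a \<le> i) \<and> (t' = 1 - t --> a \<le> j)" "t' < 2" for t' c' i j
      using that xa by auto
    show "t < 2 --> c' = c --> (1 - t' = t --> a \<le> j) \<and> (1 - t' = 1 - t --> a \<le> Suc i)"
      if "t < 2 --> c' = c --> (t' = t --> a \<le> i) \<and> (t' = 1 - t --> a \<le> j)" "t' < 2" for t' c' i j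
      using that by (auto simp: less_2_cases_iff)
    show "t < 2 --> c' = c --> (1 - t' = t --> a \<le> j) \<and> (1 - t' = 1 - t --> a \<le> i)"
      if "t < 2 --> c' = c --> (t' = t --> a \<le> i) \<and> (t' = 1 - t --> a \<le> j)" "t' < 2" for t' c' i j
      using that by (auto simp: less_2_cases_iff)
    show "t < 2 --> c' = c --> (t' = t --> a \<le> i) \<and> (t' = 1 - t --> a \<le> 0)"
      if "t' = t \<and> c' = c \<and> a \<le> i" "t' < 2" for t' c' i
      using that by (auto simp: less_2_cases_iff)
  qed (use turn_less[of t c] xa in \<open>auto simp: a_def sync_def\<close>)
  then show False by simp
qed

text \<open>The request from the lower end of one entry path cannot pass the turn of its line, as
  the edges above it point down. It thus arrives on the other exit path at this height or below, and
  cannot climb over edges that point down below a higher turn.\<close>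

lemma turn_sync_le:
  assumes l: "line t c" "line t' c'" and s: "sync t c t' c'"
  shows "turn t' c' \<le> turn t c"
proof (rule ccontr)
  assume neg: "\<not> turn t' c' \<le> turn t c"
  define a where "a = turn t c"
  define a' where "a' = turn t' c'"
  have aa: "a < a'" "a' < D" using neg turn_less by (auto simp: a_def a'_def)
  obtain x where x: "a' = Suc x" using aa by (cases a') auto
  have "(Q t' c' (Suc x), Q t' c' x) \<in> Or" using exit_left[OF l(2)] x a'_def by auto
  then have stop: "(Q t' c' x, Q t' c' (Suc x)) \<notin> Or" by (rule Or_unique)
  have stop': "(P t c a, P t c (Suc a)) \<notin> Or" if "Suc a < D"
    using entry_left[OF l(1), of a] that Or_unique by (simp add: a_def)
  have "(P t c 0, Q t' c' (D - 1)) \<in> E\<^sup>*"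
    by (rule req) (use l s D_pos in \<open>auto simp: requests_def\<close>)
  then have "inv (\<lambda>t1 c1 i. t1 = t \<and> c1 = c \<and> i \<le> a) (\<lambda>t1 c1 i. t1 = t' --> c1 = c' --> i < a')
     (\<lambda>t1 c1 i j. t < 2 \<and> c1 = c) (Q t' c' (D - 1))"
  proof (rule closed)
    show "t1 = t \<and> c1 = c \<and> Suc i \<le> a"
      if "t1 = t \<and> c1 = c \<and> i \<le> a" "Suc i < D" "(P t1 c1 i, P t1 c1 (Suc i)) \<in> Or" for t1 c1 i
      using that stop' by (cases "i = a") auto
    show "t1 = t' --> c1 = c' --> Suc i < a'"
      if "t1 = t' --> c1 = c' --> i < a'" "(Q t1 c1 i, Q t1 c1 (Suc i)) \<in> Or" for t1 c1 i
      using that stop x by (cases "i = x") auto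
    show "1 - t1 = t' --> c1 = c' --> j < a'" if "t < 2 \<and> c1 = c" for t1 c1 j :: nat
      using that s by (auto simp: sync_def)
  qed (use aa s in \<open>auto simp: sync_def\<close>)
  then show False using aa by auto
qed

lemma turn_side:
  assumes "t < 2" "c < m"
  shows "turn t c = turn 2 (var t c)"
proof (rule antisym)
  have l: "line t c" "line 2 (var t c)" using assms var_less by (auto simp: line_def)
  show "turn t c \<le> turn 2 (var t c)"
    using turn_sync_le[OF l(2,1)] assms by (simp add: sync_def)
  show "turn 2 (var t c) \<le> turn t c"
    using turn_sync_le[OF l] assms by (simp add: sync_def)
qed

text \<open>A hub has no grid. Its request to a side arrives on the exit path through a direct arc,
  at the common turn or below, and has to climb all edges above.\<close>

lemma exit_right_only:
  assumes t: "t < 2" "c < m" and x: "turn t c \<le> x" "Suc x < D"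
  shows "(Q t c (Suc x), Q t c x) \<notin> Or"
proof
  assume "(Q t c (Suc x), Q t c x) \<in> Or"
  then have stop: "(Q t c x, Q t c (Suc x)) \<notin> Or" by (rule Or_unique)
  define h where "h = var t c"
  define a where "a = turn t c"
  have ah: "a = turn 2 h" using turn_side[OF t] by (simp add: a_def h_def)
  have l: "line t c" "line 2 h" using t var_less by (auto simp: line_def h_def)
  have s: "sync 2 h t c" using t by (simp add: sync_def h_def)
  have stop': "(P 2 h a, P 2 h (Suc a)) \<notin> Or" if "Suc a < D"
    using entry_left[OF l(2), of a] that Or_unique by (simp add: ah)
  have "(P 2 h 0, Q t c (D - 1)) \<in> E\<^sup>*"
    by (rule req) (use l s D_pos in \<open>auto simp: requests_def\<close>)
  then have "inv (\<lambda>t1 c1 i. t1 = 2 \<and> c1 = h \<and> i \<le> a) (\<lambda>t1 c1 i. t1 = t --> c1 = c --> i \<le> x)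
    (\<lambda>_ _ _ _. False) (Q t c (D - 1))"
  proof (rule closed)
    show "t1 = 2 \<and> c1 = h \<and> Suc i \<le> a"
      if "t1 = 2 \<and> c1 = h \<and> i \<le> a" "Suc i < D" "(P t1 c1 i, P t1 c1 (Suc i)) \<in> Or" for t1 c1 i
      using that stop' by (cases "i = a") auto
    show "t1 = t --> c1 = c --> Suc i \<le> x"
      if "t1 = t --> c1 = c --> i \<le> x" "(Q t1 c1 i, Q t1 c1 (Suc i)) \<in> Or" for t1 c1 i
      using that stop by (cases "i = x") auto
  qed (use x t in \<open>auto simp: a_def\<close>)
  then show False using x by auto
qed

text \<open>Exit edges above the turn do not point down, so the descending request must leave the
  grid on the line of the turn itself. As coordinates only grow, it has followed this line
  throughout and has crossed the cell in which the line meets that of the other side.\<close>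

lemma cell_orientation:
  assumes t: "t < 2" "c < m" and nok: "\<not> ok t c (turn t c) (turn (1 - t) c)"
  shows "(X t c (turn t c) (turn (1 - t) c), X (1 - t) c (turn (1 - t) c) (turn t c)) \<in> Or"
proof (rule ccontr)
  define a where "a = turn t c"
  define b where "b = turn (1 - t) c"
  assume "(X t c (turn t c) (turn (1 - t) c), X (1 - t) c (turn (1 - t) c) (turn t c)) \<notin> Or"
  then have n: "(X t c a b, X (1 - t) c b a) \<notin> Or" by (simp add: a_def b_def)
  have nok': "\<not> ok t c a b" using nok by (simp add: a_def b_def)
  have ab: "a < D" "b < D" using turn_less by (auto simp: a_def b_def)
  have l: "line t c" using t by (simp add: line_def)
  have two: "1 - t \<noteq> t" "1 - (1 - t) = t" using t by (auto simp: less_2_cases_iff)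
  have "(P t c (D - 1), Q t c 0) \<in> E\<^sup>*"
    by (rule req) (use l D_pos in \<open>auto simp: requests_def\<close>)
  \<comment> \<open>In the grid of \<open>c\<close>, the path is strictly beyond line
    \<open>a\<close>, or it is on line \<open>a\<close> and has not passed the crossing with line
    \<open>b\<close>. The two vertices of a cell have their coordinates in opposite order; the near
    one satisfies \<open>j \<le> b\<close>, the far one \<open>i < b\<close>.\<close>
  then have "inv (\<lambda>t' c' i. t' = t \<and> c' = c \<and> a \<le> i) (\<lambda>t' c' i. t' = t --> c' = c --> a < i)
     (\<lambda>t' c' i j. c' = c \<and> (t' = t --> a < i \<or> i = a \<and> j \<le> b) \<and> (t' = 1 - t --> a < j \<or> j = a \<and> i < b)) (Q t c 0)"
  proof (rule closed)
    show "t' = t \<and> c' = c \<and> a \<le> i"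
      if "t' = t \<and> c' = c \<and> a \<le> Suc i" "(P t' c' (Suc i), P t' c' i) \<in> Or" for t' c' i
      using that turn_left_stop[of i t c] a_def by (auto simp: le_Suc_eq)
    show "t' = t --> c' = c --> a < i"
      if "t' = t --> c' = c --> a < Suc i" "(Q t' c' (Suc i), Q t' c' i) \<in> Or" for t' c' i
    proof (intro impI, rule ccontr)
      assume "t' = t" "c' = c" "\<not> a < i"
      then have i: "i = a" using that(1) by simp
      have i': "(Q t c (Suc a), Q t c a) \<in> Or" using that(2) \<open>t' = t\<close> \<open>c' = c\<close> i by simp
      have "Suc a < D" using Or_edge[OF i'] by simp
      then show False using exit_right_only[OF t, of a] i' by (simp add: a_def)
    qed
    show "1 - t' = t --> c' = c --> a < j"
      if "c' = c \<and> (t' = t --> a < i \<or> i = a \<and> j \<le> b) \<and> (t' = 1 - t --> a < j \<or> j = a \<and> i < b)"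
        "t' < 2" "Suc i = D" for t' c' i j
      using that ab by auto
    show "c' = c \<and> (1 - t' = t --> a < j \<or> j = a \<and> Suc i \<le> b) \<and> (1 - t' = 1 - t --> a < Suc i \<or> Suc i = a \<and> j < b)"
      if "c' = c \<and> (t' = t --> a < i \<or> i = a \<and> j \<le> b) \<and> (t' = 1 - t --> a < j \<or> j = a \<and> i < b)"
        "t' < 2" for t' c' i j
      using that t by (auto simp: less_2_cases_iff)
    show "c' = c \<and> (1 - t' = t --> a < j \<or> j = a \<and> i \<le> b) \<and> (1 - t' = 1 - t --> a < i \<or> i = a \<and> j < b)"
      if h: "c' = c \<and> (t' = t --> a < i \<or> i = a \<and> j \<le> b) \<and> (t' = 1 - t --> a < j \<or> j = a \<and> i < b)"
        "t' < 2" "ok t' c' i j \<or> (X t' c' i j, X (1 - t') c' j i) \<in> Or" for t' c' i j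
    proof (cases "t' = t")
      case True
      have "\<not> (i = a \<and> j = b)" using h(3) n nok' h(1) True by auto
      then show ?thesis using h(1) True two by auto
    next
      case False
      then have "t' = 1 - t" using h(2) t by auto
      then show ?thesis using h(1) two by auto
    qed
  qed (use turn_less[of t c] ab t in \<open>auto simp: a_def sync_def less_2_cases_iff\<close>)
  then show False by simp
qed

lemma turn_solution: "c < m ==> tbl c (turn 2 (var 0 c)) (turn 2 (var 1 c))"
proof (rule ccontr)
  assume c: "c < m" and n: "\<not> tbl c (turn 2 (var 0 c)) (turn 2 (var 1 c))"
  have t: "turn 0 c = turn 2 (var 0 c)" "turn 1 c = turn 2 (var 1 c)"
    using turn_side[of 0 c] turn_side[of 1 c] c by auto
  have "(X 0 c (turn 0 c) (turn 1 c), X 1 c (turn 1 c) (turn 0 c)) \<in> Or"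
    using cell_orientation[of 0 c] c n t by (simp add: ok_def)
  moreover have "(X 1 c (turn 1 c) (turn 0 c), X 0 c (turn 0 c) (turn 1 c)) \<in> Or"
    using cell_orientation[of 1 c] c n t by (simp add: ok_def)
  ultimately show False using Or_unique by blast
qed

lemma solvable: "solvable"
  unfolding solvable_def using turn_less turn_solution by (intro exI[of _ "turn 2"]) auto

end

subsection \<open>Completeness\<close>

context
  fixes val
  assumes val: "\<And>v. v < V ==> val v < D"
    and tbl: "\<And>c. c < m ==> tbl c (val (var 0 c)) (val (var 1 c))"
begin

definition tv :: "nat => nat => nat" where
  "tv t c = (if t = 2 then val c else val (var t c))"

lemma tv_less: "line t c ==> tv t c < D"
  using val var_less by (auto simp: tv_def line_def)

text \<open>Entry paths point towards the value from both ends, exit paths away from it. A forbidden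
  cell is given to the row side in the chosen row and to the column side elsewhere; the chosen
  column meets the chosen row in a permitted cell, so it loses nothing.\<close>

fun good :: "vtx => vtx => bool" where
  "good (k, t, c, i, j) (k', t', c', i', j') \<longleftrightarrow>
     k = 0 \<and> (i' = Suc i \<and> i < tv t c \<or> i = Suc i' \<and> tv t c \<le> i') \<or>
     k = 1 \<and> (i' = Suc i \<and> tv t c \<le> i \<or> i = Suc i' \<and> i' < tv t c) \<or>
     k = 2 \<and> (t = 0 \<and> i = tv 0 c \<or> t = 1 \<and> j \<noteq> tv 0 c)"

definition Ori :: "(vtx \<times> vtx) set" where
  "Ori = {(u, v). vertex u \<and> vertex v \<and> edge u v \<and> good u v}"

lemma good_xor:
  assumes "vertex u" "vertex v" "edge u v"
  shows "good v u \<longleftrightarrow> \<not> good u v"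
proof -
  obtain k t c i j where u: "u = (k, t, c, i, j)" by (cases u) blast
  obtain k' t' c' i' j' where v: "v = (k', t', c', i', j')" by (cases v) blast
  have "k = k'" "k < 3" using assms by (auto simp: u v)
  then consider "k = 0" "k' = 0" | "k = 1" "k' = 1" | "k = 2" "k' = 2" by linarith
  then show ?thesis
  proof cases
    case 1
    then show ?thesis using assms by (auto simp: u v)
  next
    case 2
    then show ?thesis using assms by (auto simp: u v)
  next
    case 3
    then show ?thesis using assms by (auto simp: u v less_2_cases_iff)
  qed
qed

lemma Ori_orientation: "is_orientation Ori (edges graph)"
  unfolding is_orientation_def
proof (intro conjI ballI)
  fix a assume "a \<in> Ori"
  obtain u v where uv: "a = (u, v)" by (cases a)
  have "vertex u" "vertex v" "edge u v" using \<open>a \<in> Ori\<close> uv by (simp_all add: Ori_def)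
  then have "{u, v} \<in> edges graph" unfolding graph_def mixed_graph.simps by blast
  then show "case a of (u, v) => {u, v} \<in> edges graph" by (simp add: uv)
next
  fix e assume "e \<in> edges graph"
  then obtain u v where e: "e = {u, v}" "vertex u" "vertex v" "edge u v"
    unfolding graph_def mixed_graph.simps by blast
  have main: "\<exists>!a. a \<in> Ori \<and> {u, v} = {fst a, snd a}"
    if uv: "vertex u" "vertex v" "edge u v" "good u v" for u v
  proof (rule ex1I[of _ "(u, v)"])
    show "(u, v) \<in> Ori \<and> {u, v} = {fst (u, v), snd (u, v)}" using uv by (simp add: Ori_def)
    fix a assume a: "a \<in> Ori \<and> {u, v} = {fst a, snd a}"
    obtain x y where xy: "a = (x, y)" by (cases a)
    from a xy have "x = u \<and> y = v \<or> x = v \<and> y = u" by (auto simp: doubleton_eq_iff)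
    moreover have "\<not> (x = v \<and> y = u)"
      using a xy good_xor[OF uv(1-3)] uv(4) by (auto simp: Ori_def)
    ultimately show "a = (u, v)" using xy by blast
  qed
  show "\<exists>!a. a \<in> Ori \<and> e = {fst a, snd a}"
  proof (cases "good u v")
    case True
    then show ?thesis using main[of u v] e by simp
  next
    case False
    then have "good v u" using good_xor e by blast
    from main[OF e(3,2) edge_sym[OF e(2,4)] this] show ?thesis
      unfolding e(1) by (simp add: insert_commute)
  qed
qed

abbreviation "F \<equiv> arcs graph \<union> Ori"

lemma descend: "(\<And>i. a \<le> i ==> i < b ==> (f (Suc i), f i) \<in> R) ==> a \<le> b ==> (f b, f a) \<in> R\<^sup>*"
proof (induction b)
  case (Suc b)
  show ?case
  proof (cases "a = Suc b")
    case False
    then have "(f b, f a) \<in> R\<^sup>*" "(f (Suc b), f b) \<in> R" using Suc by auto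
    then show ?thesis by (rule converse_rtrancl_into_rtrancl[rotated])
  qed simp
qed simp

lemma ascend: "(\<And>i. a \<le> i ==> i < b ==> (f i, f (Suc i)) \<in> R\<^sup>*) ==> a \<le> b ==> (f a, f b) \<in> R\<^sup>*"
proof (induction b)
  case (Suc b)
  show ?case
  proof (cases "a = Suc b")
    case False
    then have "(f a, f b) \<in> R\<^sup>*" "(f b, f (Suc b)) \<in> R\<^sup>*" using Suc by auto
    then show ?thesis by (rule rtrancl_trans)
  qed simp
qed simp

lemma path_P_left: "line t c ==> (P t c (D - 1), P t c (tv t c)) \<in> F\<^sup>*"
  by (rule descend[where f = "\<lambda>i. P t c i"]) (use tv_less[of t c] in \<open>auto simp: Ori_def\<close>)

lemma path_P_right: "line t c ==> (P t c 0, P t c (tv t c)) \<in> F\<^sup>*"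
  by (rule ascend[where f = "\<lambda>i. P t c i"], rule r_into_rtrancl)
    (use tv_less[of t c] in \<open>auto simp: Ori_def\<close>)

lemma path_Q_left: "line t c ==> (Q t c (tv t c), Q t c 0) \<in> F\<^sup>*"
  by (rule descend[where f = "\<lambda>i. Q t c i"]) (use tv_less[of t c] in \<open>auto simp: Ori_def\<close>)

lemma path_Q_right: "line t c ==> (Q t c (tv t c), Q t c (D - 1)) \<in> F\<^sup>*"
  by (rule ascend[where f = "\<lambda>i. Q t c i"], rule r_into_rtrancl)
    (use tv_less[of t c] in \<open>auto simp: Ori_def\<close>)

lemma path_cell:
  assumes t: "t < 2" "c < m" and j: "j < D"
  shows "(X t c (tv t c) j, X (1 - t) c j (tv t c)) \<in> F"
proof -
  have a: "tv t c < D" using tv_less t by (simp add: line_def)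
  show ?thesis
  proof (cases "ok t c (tv t c) j")
    case True
    then show ?thesis using a j t by (auto simp: graph_def)
  next
    case False
    have "good (X t c (tv t c) j) (X (1 - t) c j (tv t c))"
    proof (cases "t = 0")
      case False': False
      then have t1: "t = 1" using t by simp
      then have "j \<noteq> tv 0 c" using tbl[OF t(2)] False by (auto simp: ok_def tv_def)
      then show ?thesis using t1 by simp
    qed simp
    then show ?thesis using a j t False by (auto simp: Ori_def)
  qed
qed

lemma path_grid:
  assumes t: "t < 2" "c < m"
  shows "(P t c (tv t c), Q t c (tv t c)) \<in> F\<^sup>*"
proof -
  let ?a = "tv t c"
  have a: "?a < D" using tv_less t by (simp add: line_def)
  have tt: "1 - (1 - t) = t" using t by auto
  have l: "line t c" using t by (simp add: line_def)
  have 1: "(P t c ?a, X t c ?a 0) \<in> F" using a t D_pos l by (auto simp: graph_def)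
  have 2: "(X t c ?a 0, X t c ?a (D - 1)) \<in> F\<^sup>*"
  proof (rule ascend[where f = "\<lambda>j. X t c ?a j"])
    fix j assume j: "j < D - 1"
    have "(X t c ?a j, X (1 - t) c j ?a) \<in> F" using path_cell[OF t] j by simp
    moreover have "(X (1 - t) c j ?a, X t c ?a (Suc j)) \<in> F"
      using a j t tt by (auto simp: graph_def)
    ultimately show "(X t c ?a j, X t c ?a (Suc j)) \<in> F\<^sup>*" by (meson r_into_rtrancl rtrancl_trans)
  qed simp
  have 3: "(X t c ?a (D - 1), X (1 - t) c (D - 1) ?a) \<in> F" using path_cell[OF t] D_pos by simp
  have 4: "(X (1 - t) c (D - 1) ?a, Q t c ?a) \<in> F"
    using a t tt l D_pos by (auto simp: graph_def)
  from 1 2 3 4 show ?thesis by (meson r_into_rtrancl rtrancl_trans)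
qed

lemma path_line:
  assumes "line t c"
  shows "(P t c (tv t c), Q t c (tv t c)) \<in> F\<^sup>*"
proof (cases "t = 2")
  case True
  then have "(P t c (tv t c), Q t c (tv t c)) \<in> F"
    using assms tv_less[OF assms] by (auto simp: graph_def)
  then show ?thesis by blast
next
  case False
  then show ?thesis using path_grid assms by (auto simp: line_def)
qed

lemma requests_satisfied: "(s, t) \<in> requests ==> (s, t) \<in> F\<^sup>*"
proof -
  assume r: "(s, t) \<in> requests"
  obtain k t1 c1 i j where s: "s = (k, t1, c1, i, j)" by (cases s) blast
  obtain k' t2 c2 i' j' where t: "t = (k', t2, c2, i', j')" by (cases t) blast
  have k: "k = 0" "k' = 1" "j = 0" "j' = 0" and l: "line t1 c1" "line t2 c2"
    and c: "t2 = t1 \<and> c2 = c1 \<and> Suc i = D \<and> i' = 0 \<or> sync t1 c1 t2 c2 \<and> i = 0 \<and> Suc i' = D"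
    using r by (auto simp: requests_def s t)
  from c show ?thesis
  proof (elim disjE conjE)
    assume "t2 = t1" "c2 = c1" "Suc i = D" "i' = 0"
    then show ?thesis
      using rtrancl_trans[OF rtrancl_trans[OF path_P_left[OF l(1)] path_line[OF l(1)]] path_Q_left[OF l(1)]]
      by (auto simp: s t k)
  next
    assume sy: "sync t1 c1 t2 c2" "i = 0" "Suc i' = D"
    have eq: "tv t1 c1 = tv t2 c2" using sy(1) by (auto simp: sync_def tv_def)
    have "(P t1 c1 (tv t1 c1), Q t2 c2 (tv t2 c2)) \<in> F"
      using sy l tv_less[OF l(1)] tv_less[OF l(2)] eq by (auto simp: graph_def)
    then have "(P t1 c1 0, Q t2 c2 (D - 1)) \<in> F\<^sup>*"
      using path_P_right[OF l(1)] path_Q_right[OF l(2)] by (meson r_into_rtrancl rtrancl_trans)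
    then show ?thesis using sy by (auto simp: s t k)
  qed
qed

end

theorem orientable_iff: "steiner_orientable graph requests \<longleftrightarrow> solvable"
proof
  assume "steiner_orientable graph requests"
  then obtain Or where "is_orientation Or (edges graph)"
    "\<forall>(s, t)\<in>requests. (s, t) \<in> (arcs graph \<union> Or)\<^sup>*"
    unfolding steiner_orientable_def by blast
  then show solvable by (intro solvable) auto
next
  assume solvable
  then obtain val where "\<forall>v<V. val v < D" "\<forall>c<m. tbl c (val (var 0 c)) (val (var 1 c))"
    unfolding solvable_def by blast
  then show "steiner_orientable graph requests"
    unfolding steiner_orientable_def using Ori_orientation requests_satisfied
    by (intro exI[of _ "Ori val"] conjI ballI) auto
qed

end

subsection \<open>Encoded instances\<close>

text \<open>Number of variables, size of the domain, constraints with their tables.\<close>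

type_synonym csp = "nat \<times> nat \<times> (nat \<times> nat \<times> bool list list) list"

definition csp_var :: "csp => nat => nat => nat" where
  "csp_var I t c = (if t = 0 then fst (get (0, 0, []) (snd (snd I)) c)
     else fst (snd (get (0, 0, []) (snd (snd I)) c)))"

definition csp_tbl :: "csp => nat => nat => nat => bool" where
  "csp_tbl I c i j = get False (get [] (snd (snd (get (0, 0, []) (snd (snd I)) c))) i) j"

definition csp_wf :: "csp => bool" where
  "csp_wf I \<longleftrightarrow> 0 < fst I \<and> 0 < fst (snd I) \<and> (\<forall>c \<in> set (snd (snd I)). fst c < fst I \<and> fst (snd c) < fst I)"

definition csp_sat :: "csp => bool" where
  "csp_sat I \<longleftrightarrow> (\<exists>val. (\<forall>v<fst I. val v < fst (snd I)) \<and>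
     (\<forall>c \<in> set (snd (snd I)). get False (get [] (snd (snd c)) (val (fst c))) (val (fst (snd c)))))"

definition csp_lines :: "csp => (nat \<times> nat) list" where
  "csp_lines I = concat (map (\<lambda>t. map (\<lambda>c. (t, c)) [0..<length (snd (snd I))]) [0, 1]) @
     map (\<lambda>c. (2, c)) [0..<fst I]"

definition csp_vertices :: "csp => vtx list" where
  "csp_vertices I =
     concat (map (\<lambda>k. concat (map (\<lambda>l. map (\<lambda>i. (k, fst l, snd l, i, 0)) [0..<fst (snd I)]) (csp_lines I))) [0, 1]) @
     concat (map (\<lambda>t. concat (map (\<lambda>c. concat (map (\<lambda>i. map (\<lambda>j. (2, t, c, i, j)) [0..<fst (snd I)])
       [0..<fst (snd I)])) [0..<length (snd (snd I))])) [0, 1])"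

definition csp_sync :: "csp => nat => nat => nat => nat => bool" where
  "csp_sync I t c t' c' \<longleftrightarrow> t = 2 \<and> t' < 2 \<and> c = csp_var I t' c' \<or> t < 2 \<and> t' = 2 \<and> c' = csp_var I t c"

definition csp_ok :: "csp => nat => nat => nat => nat => bool" where
  "csp_ok I t c i j = (if t = 0 then csp_tbl I c i j else csp_tbl I c j i)"

text \<open>Projections stand in for pattern matching, for which the class of polynomial-time
  functions has no closure rule.\<close>

definition csp_arc :: "csp => vtx => vtx => bool" where
  "csp_arc I u v \<longleftrightarrow>
     fst u = 0 \<and> fst v = 2 \<and> fst (snd v) = fst (snd u) \<and> fst (snd (snd v)) = fst (snd (snd u)) \<and>
       fst (snd (snd (snd v))) = fst (snd (snd (snd u))) \<and> snd (snd (snd (snd v))) = 0 \<or>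
     fst u = 2 \<and> fst v = 2 \<and> fst (snd v) = 1 - fst (snd u) \<and> fst (snd (snd v)) = fst (snd (snd u)) \<and>
       fst (snd (snd (snd v))) = snd (snd (snd (snd u))) \<and> snd (snd (snd (snd v))) = Suc (fst (snd (snd (snd u)))) \<or>
     fst u = 2 \<and> fst v = 1 \<and> fst (snd v) = 1 - fst (snd u) \<and> fst (snd (snd v)) = fst (snd (snd u)) \<and>
       fst (snd (snd (snd v))) = snd (snd (snd (snd u))) \<and> Suc (fst (snd (snd (snd u)))) = fst (snd I) \<or>
     fst u = 0 \<and> fst v = 1 \<and> fst (snd (snd (snd v))) = fst (snd (snd (snd u))) \<and>
       (csp_sync I (fst (snd u)) (fst (snd (snd u))) (fst (snd v)) (fst (snd (snd v))) \<or>
        fst (snd u) = 2 \<and> fst (snd v) = 2 \<and> fst (snd (snd v)) = fst (snd (snd u))) \<or>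
     fst u = 2 \<and> fst v = 2 \<and> fst (snd v) = 1 - fst (snd u) \<and> fst (snd (snd v)) = fst (snd (snd u)) \<and>
       fst (snd (snd (snd v))) = snd (snd (snd (snd u))) \<and> snd (snd (snd (snd v))) = fst (snd (snd (snd u))) \<and>
       csp_ok I (fst (snd u)) (fst (snd (snd u))) (fst (snd (snd (snd u)))) (snd (snd (snd (snd u))))"

definition csp_edge :: "csp => vtx => vtx => bool" where
  "csp_edge I u v \<longleftrightarrow>
     fst u = fst v \<and> fst u < 2 \<and> fst (snd v) = fst (snd u) \<and> fst (snd (snd v)) = fst (snd (snd u)) \<and>
       (fst (snd (snd (snd v))) = Suc (fst (snd (snd (snd u)))) \<or> fst (snd (snd (snd u))) = Suc (fst (snd (snd (snd v))))) \<or>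
     fst u = 2 \<and> fst v = 2 \<and> fst (snd v) = 1 - fst (snd u) \<and> fst (snd (snd v)) = fst (snd (snd u)) \<and>
       fst (snd (snd (snd v))) = snd (snd (snd (snd u))) \<and> snd (snd (snd (snd v))) = fst (snd (snd (snd u))) \<and>
       \<not> csp_ok I (fst (snd u)) (fst (snd (snd u))) (fst (snd (snd (snd u)))) (snd (snd (snd (snd u))))"

definition csp_request :: "csp => vtx => vtx => bool" where
  "csp_request I u v \<longleftrightarrow> fst u = 0 \<and> fst v = 1 \<and>
     (fst (snd v) = fst (snd u) \<and> fst (snd (snd v)) = fst (snd (snd u)) \<and>
        Suc (fst (snd (snd (snd u)))) = fst (snd I) \<and> fst (snd (snd (snd v))) = 0 \<or>
      csp_sync I (fst (snd u)) (fst (snd (snd u))) (fst (snd v)) (fst (snd (snd v))) \<and>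
        fst (snd (snd (snd u))) = 0 \<and> Suc (fst (snd (snd (snd v)))) = fst (snd I))"

definition steiner_bits :: "csp => bool list" where
  "steiner_bits I = enc_nat (length (csp_vertices I)) @
     concat (map (\<lambda>u. map (\<lambda>v. csp_arc I u v) (csp_vertices I)) (csp_vertices I)) @
     concat (map (\<lambda>u. map (\<lambda>v. csp_edge I u v) (csp_vertices I)) (csp_vertices I)) @
     concat (map (\<lambda>u. map (\<lambda>v. csp_request I u v) (csp_vertices I)) (csp_vertices I))"

definition steiner_k :: "csp => nat" where
  "steiner_k I = length (filter (\<lambda>b. b)
     (concat (map (\<lambda>u. map (\<lambda>v. csp_request I u v) (csp_vertices I)) (csp_vertices I))))"

lemma PF_csp_sync:
  assumes "PF f" "PF t" "PF c" "PF t'" "PF c'"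
  shows "PF (\<lambda>x. csp_sync (f x) (t x) (c x) (t' x) (c' x))"
  unfolding csp_sync_def csp_var_def by (intro PF_intros assms)

lemma PF_csp_ok:
  assumes "PF f" "PF t" "PF c" "PF i" "PF j"
  shows "PF (\<lambda>x. csp_ok (f x) (t x) (c x) (i x) (j x))"
  unfolding csp_ok_def csp_tbl_def by (intro PF_intros assms)

lemma PF_csp_arc:
  assumes "PF f" "PF u" "PF v" shows "PF (\<lambda>x. csp_arc (f x) (u x) (v x))"
  unfolding csp_arc_def by (intro PF_csp_sync PF_csp_ok PF_intros assms)

lemma PF_csp_edge:
  assumes "PF f" "PF u" "PF v" shows "PF (\<lambda>x. csp_edge (f x) (u x) (v x))"
  unfolding csp_edge_def by (intro PF_csp_ok PF_intros assms)

lemma PF_csp_request: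
  assumes "PF f" "PF u" "PF v" shows "PF (\<lambda>x. csp_request (f x) (u x) (v x))"
  unfolding csp_request_def by (intro PF_csp_sync PF_intros assms)

lemma PF_csp_vertices:
  shows "PF csp_vertices"
  unfolding csp_vertices_def[abs_def] csp_lines_def by (intro PF_intros)

lemma PF_steiner_bits: "PF steiner_bits"
  unfolding steiner_bits_def[abs_def]
  by (intro PF_enc_nat PF_csp_arc PF_csp_edge PF_csp_request PF_intros PF_comp[OF PF_csp_vertices])

lemma PF_steiner_k: "PF steiner_k"
  unfolding steiner_k_def[abs_def]
  by (intro PF_csp_request PF_intros PF_comp[OF PF_csp_vertices])

subsection \<open>Renaming vertices\<close>

definition rename :: "('v => 'w) => 'v mixed_graph => 'w mixed_graph" where
  "rename h G = \<lparr>verts = h ` verts G, arcs = map_prod h h ` arcs G, edges = (`) h ` edges G\<rparr>"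

text \<open>Only one direction is stated; the converse follows by renaming back.\<close>

lemma steiner_orientable_rename:
  assumes inj: "inj_on h (verts G)" and E: "\<And>e. e \<in> edges G ==> e \<subseteq> verts G"
    and so: "steiner_orientable G T"
  shows "steiner_orientable (rename h G) (map_prod h h ` T)"
proof -
  obtain D where D: "is_orientation D (edges G)" and reach: "\<forall>(s, t)\<in>T. (s, t) \<in> (arcs G \<union> D)\<^sup>*"
    using so unfolding steiner_orientable_def by blast
  have D1: "{u, v} \<in> edges G" if "(u, v) \<in> D" for u v
    using D that unfolding is_orientation_def by auto
  have D2: "\<exists>!a. a \<in> D \<and> e = {fst a, snd a}" if "e \<in> edges G" for e
    using D that unfolding is_orientation_def by (elim conjE) (erule (1) bspec)
  let ?D = "map_prod h h ` D"
  have "is_orientation ?D (edges (rename h G))"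
    unfolding is_orientation_def
  proof (intro conjI ballI)
    fix a assume "a \<in> ?D"
    then obtain u v where a: "a = (h u, h v)" "(u, v) \<in> D" by auto
    have "h ` {u, v} \<in> edges (rename h G)" using D1[OF a(2)] unfolding rename_def mixed_graph.simps by blast
    then show "case a of (u, v) => {u, v} \<in> edges (rename h G)" by (simp add: a)
  next
    fix e' assume "e' \<in> edges (rename h G)"
    then obtain e where e: "e \<in> edges G" "e' = h ` e" unfolding rename_def mixed_graph.simps by blast
    obtain a where a: "a \<in> D" "e = {fst a, snd a}" and u: "\<And>b. b \<in> D ==> e = {fst b, snd b} ==> b = a"
      using D2[OF e(1)] by (elim ex1E) metis
    show "\<exists>!a. a \<in> ?D \<and> e' = {fst a, snd a}"
    proof (rule ex1I[of _ "map_prod h h a"])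
      show "map_prod h h a \<in> ?D \<and> e' = {fst (map_prod h h a), snd (map_prod h h a)}"
        using a e by (cases a) auto
      fix b assume b: "b \<in> ?D \<and> e' = {fst b, snd b}"
      then obtain b' where b': "b' \<in> D" "b = map_prod h h b'" by auto
      have "{fst b', snd b'} \<in> edges G" using D1[of "fst b'" "snd b'"] b'(1) by simp
      moreover have "h ` e = h ` {fst b', snd b'}" using b b' e by (cases b') auto
      ultimately have "e = {fst b', snd b'}" using E e(1) inj by (metis inj_on_image_eq_iff)
      then show "b = map_prod h h a" using u[OF b'(1)] b'(2) by simp
    qed
  qed
  moreover have "(h s, h t) \<in> (arcs (rename h G) \<union> ?D)\<^sup>*" if "(s, t) \<in> (arcs G \<union> D)\<^sup>*" for s t
    using that
  proof (induction rule: rtrancl_induct)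
    case (step y z)
    then have "(h y, h z) \<in> arcs (rename h G) \<union> ?D" unfolding rename_def mixed_graph.simps by force
    with step.IH show ?case by (rule rtrancl_into_rtrancl)
  qed simp
  ultimately show ?thesis unfolding steiner_orientable_def using reach by (intro exI[of _ ?D]) auto
qed

lemma rename_inverse:
  assumes "\<And>v. v \<in> verts G ==> k (h v) = v" "\<And>e. e \<in> edges G ==> e \<subseteq> verts G"
    "arcs G \<subseteq> verts G \<times> verts G"
  shows "rename k (rename h G) = G"
proof -
  have 1: "k ` h ` S = S" if "S \<subseteq> verts G" for S
  proof -
    have "(\<lambda>x. k (h x)) ` S = (\<lambda>x. x) ` S" by (rule image_cong) (use that assms(1) in auto)
    then show ?thesis by (simp add: image_image)
  qed
  have 2: "map_prod k k ` map_prod h h ` arcs G = arcs G"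
  proof -
    have "(\<lambda>x. map_prod k k (map_prod h h x)) ` arcs G = (\<lambda>x. x) ` arcs G"
      by (rule image_cong) (use assms(1,3) in auto)
    then show ?thesis by (simp add: image_image)
  qed
  have 3: "(`) k ` (`) h ` edges G = edges G"
  proof -
    have "(\<lambda>e. k ` h ` e) ` edges G = (\<lambda>e. e) ` edges G"
      by (rule image_cong) (use 1 assms(2) in auto)
    then show ?thesis by (simp add: image_image)
  qed
  have 4: "k ` h ` verts G = verts G" by (rule 1) simp
  show ?thesis unfolding rename_def mixed_graph.simps 2 3 4 by simp
qed

context
  fixes I :: csp
  assumes wf: "csp_wf I"
begin

interpretation gadget "fst I" "fst (snd I)" "length (snd (snd I))" "csp_var I" "csp_tbl I"
  by standard (use wf in \<open>auto simp: csp_wf_def csp_var_def get_def\<close>)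

private abbreviation "vs \<equiv> csp_vertices I"

lemma set_csp_lines: "set (csp_lines I) = {(t, c). line t c}"
  by (auto simp: csp_lines_def line_def less_2_cases_iff)

lemma set_csp_vertices: "set vs = Collect vertex"
proof (rule set_eqI)
  fix u :: vtx
  obtain k t c i j where u: "u = (k, t, c, i, j)" by (cases u) blast
  show "u \<in> set vs \<longleftrightarrow> u \<in> Collect vertex"
    unfolding u csp_vertices_def
    by (simp add: set_csp_lines less_2_cases_iff, simp add: image_iff) auto
qed

lemma distinct_concat_map:
  "distinct xs ==> (\<And>x. x \<in> set xs ==> distinct (f x)) ==>
   (\<And>x y. x \<in> set xs ==> y \<in> set xs ==> x \<noteq> y ==> set (f x) \<inter> set (f y) = {}) ==>
   distinct (concat (map f xs))"
  by (induction xs) auto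

lemma distinct_csp_lines: "distinct (csp_lines I)"
  unfolding csp_lines_def
  by (auto simp: distinct_map inj_on_def intro!: distinct_concat_map)

lemma distinct_csp_vertices: "distinct vs"
  unfolding csp_vertices_def distinct_append
  by (intro conjI distinct_concat_map distinct_csp_lines) (auto simp: distinct_map inj_on_def)

lemma arc_eq: "csp_arc I u v = arc u v"
  by (cases u; cases v) (simp add: csp_arc_def csp_sync_def sync_def csp_ok_def ok_def)

lemma edge_eq: "csp_edge I u v = edge u v"
  by (cases u; cases v) (simp add: csp_edge_def csp_ok_def ok_def)

lemma request_eq: "csp_request I u v = request u v"
  by (cases u; cases v) (simp add: csp_request_def csp_sync_def sync_def)

lemma solvable_eq: "solvable \<longleftrightarrow> csp_sat I"
  unfolding solvable_def csp_sat_def by (simp add: csp_tbl_def csp_var_def all_set_conv_all_nth)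

definition vertex_index :: "vtx => nat" where
  "vertex_index = the_inv_into {..<length vs} ((!) vs)"

lemma nth_bij: "bij_betw ((!) vs) {..<length vs} (Collect vertex)"
  using bij_betw_nth[OF distinct_csp_vertices, of "{..<length vs}" "Collect vertex"] set_csp_vertices by simp

lemma index_nth: "i < length vs ==> vertex_index (vs ! i) = i"
  unfolding vertex_index_def using nth_bij by (auto simp: bij_betw_def the_inv_into_f_f)

lemma nth_index: "vertex u ==> vs ! vertex_index u = u" and index_less: "vertex u ==> vertex_index u < length vs"
proof -
  assume "vertex u"
  then obtain i where "i < length vs" "u = vs ! i" using nth_bij by (auto simp: bij_betw_def)
  then show "vs ! vertex_index u = u" "vertex_index u < length vs" by (auto simp: index_nth)
qed

lemma vertex_nth: "i < length vs ==> vertex (vs ! i)"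
  using nth_bij by (auto simp: bij_betw_def)

definition csp_graph where "csp_graph = rename vertex_index graph"
definition csp_requests where "csp_requests = map_prod vertex_index vertex_index ` requests"

lemma verts_graph: "verts graph = Collect vertex" by (simp add: graph_def)

lemma edges_graph: "e \<in> edges graph ==> e \<subseteq> verts graph"
  unfolding graph_def mixed_graph.simps by blast

lemma arcs_graph: "arcs graph \<subseteq> verts graph \<times> verts graph"
  unfolding graph_def mixed_graph.simps by blast

lemma verts_G: "verts csp_graph = {..<length vs}"
proof -
  have "vertex_index ` Collect vertex = {..<length vs}"
  proof (intro equalityI subsetI)
    fix i assume "i \<in> {..<length vs}"
    then have "i = vertex_index (vs ! i)" "vs ! i \<in> Collect vertex" by (simp_all add: index_nth vertex_nth)
    then show "i \<in> vertex_index ` Collect vertex" by (rule image_eqI)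
  qed (use index_less in blast)
  then show ?thesis unfolding csp_graph_def rename_def verts_graph by simp
qed

lemma arcs_G: "(i, j) \<in> arcs csp_graph \<longleftrightarrow> i < length vs \<and> j < length vs \<and> csp_arc I (vs ! i) (vs ! j)"
proof
  assume "(i, j) \<in> arcs csp_graph"
  then have "(i, j) \<in> map_prod vertex_index vertex_index ` {(u, v). vertex u \<and> vertex v \<and> arc u v}"
    unfolding csp_graph_def rename_def graph_def by simp
  then obtain u v where "i = vertex_index u" "j = vertex_index v" "vertex u" "vertex v" "arc u v" by blast
  then show "i < length vs \<and> j < length vs \<and> csp_arc I (vs ! i) (vs ! j)"
    by (simp add: index_less nth_index arc_eq)
next
  assume a: "i < length vs \<and> j < length vs \<and> csp_arc I (vs ! i) (vs ! j)"
  then have "(vs ! i, vs ! j) \<in> arcs graph" by (simp add: graph_def vertex_nth arc_eq)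
  then have "map_prod vertex_index vertex_index (vs ! i, vs ! j) \<in> arcs csp_graph" unfolding csp_graph_def rename_def mixed_graph.simps by blast
  then show "(i, j) \<in> arcs csp_graph" using a by (simp add: index_nth)
qed

lemma edges_G: "{i, j} \<in> edges csp_graph \<longleftrightarrow> i < length vs \<and> j < length vs \<and> csp_edge I (vs ! i) (vs ! j)"
proof
  assume "{i, j} \<in> edges csp_graph"
  then have "{i, j} \<in> (`) vertex_index ` {{u, v} | u v. vertex u \<and> vertex v \<and> edge u v}"
    unfolding csp_graph_def rename_def graph_def by simp
  then obtain u v where uv: "{i, j} = {vertex_index u, vertex_index v}" "vertex u" "vertex v" "edge u v" by blast
  then have "i = vertex_index u \<and> j = vertex_index v \<or> i = vertex_index v \<and> j = vertex_index u" by (auto simp: doubleton_eq_iff)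
  then show "i < length vs \<and> j < length vs \<and> csp_edge I (vs ! i) (vs ! j)"
    using uv(2-4) edge_sym[OF uv(2,4)] by (auto simp: index_less nth_index edge_eq)
next
  assume a: "i < length vs \<and> j < length vs \<and> csp_edge I (vs ! i) (vs ! j)"
  then have "{vs ! i, vs ! j} \<in> edges graph" unfolding graph_def mixed_graph.simps edge_eq
    using vertex_nth by blast
  then have "vertex_index ` {vs ! i, vs ! j} \<in> edges csp_graph" unfolding csp_graph_def rename_def mixed_graph.simps by blast
  then show "{i, j} \<in> edges csp_graph" using a by (simp add: index_nth)
qed

lemma T_iff: "(i, j) \<in> csp_requests \<longleftrightarrow> i < length vs \<and> j < length vs \<and> csp_request I (vs ! i) (vs ! j)"
proof
  assume "(i, j) \<in> csp_requests"
  then obtain u v where "i = vertex_index u" "j = vertex_index v" "vertex u" "vertex v" "request u v"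
    unfolding csp_requests_def requests_def by blast
  then show "i < length vs \<and> j < length vs \<and> csp_request I (vs ! i) (vs ! j)"
    by (simp add: index_less nth_index request_eq)
next
  assume a: "i < length vs \<and> j < length vs \<and> csp_request I (vs ! i) (vs ! j)"
  then have "(vs ! i, vs ! j) \<in> requests" by (simp add: requests_def vertex_nth request_eq)
  then have "map_prod vertex_index vertex_index (vs ! i, vs ! j) \<in> csp_requests" unfolding csp_requests_def by blast
  then show "(i, j) \<in> csp_requests" using a by (simp add: index_nth)
qed

lemma enc_matrix_vs:
  assumes "\<And>i j. i < length vs ==> j < length vs ==> M i j = f (vs ! i) (vs ! j)"
  shows "enc_matrix (length vs) M = concat (map (\<lambda>u. map (\<lambda>v. f u v) vs) vs)"
proof -
  have 1: "map g vs = map (\<lambda>i. g (vs ! i)) [0..<length vs]" for g :: "vtx => 'x"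
    by (rule nth_equalityI) auto
  have "map (\<lambda>u. map (\<lambda>v. f u v) vs) vs = map (\<lambda>i. map (M i) [0..<length vs]) [0..<length vs]"
    unfolding 1[of "\<lambda>u. map (\<lambda>v. f u v) vs"] unfolding 1[of "\<lambda>v. f _ v"] using assms by auto
  then show ?thesis unfolding enc_matrix_def by simp
qed

lemma steiner_bits: "enc_steiner csp_graph csp_requests = steiner_bits I"
  unfolding enc_steiner_def verts_G card_lessThan Let_def steiner_bits_def
  by (simp add: enc_matrix_vs arcs_G edges_G T_iff)

lemma steiner_instance: "steiner_instance csp_graph csp_requests"
proof -
  have 1: "edges csp_graph \<subseteq> {{u, v} | u v. u \<in> verts csp_graph \<and> v \<in> verts csp_graph \<and> u \<noteq> v}"
  proof
    fix e assume e: "e \<in> edges csp_graph"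
    then have "e \<in> (`) vertex_index ` {{u, v} | u v. vertex u \<and> vertex v \<and> edge u v}"
      unfolding csp_graph_def rename_def graph_def by simp
    then obtain u v where uv: "e = {vertex_index u, vertex_index v}" "vertex u" "vertex v" "edge u v" by blast
    have "vertex_index u \<noteq> vertex_index v"
      using edge_neq[OF uv(2,4)] nth_index[OF uv(2)] nth_index[OF uv(3)] by metis
    moreover have "vertex_index u \<in> verts csp_graph" "vertex_index v \<in> verts csp_graph" using uv by (simp_all add: verts_G index_less)
    ultimately show "e \<in> {{u, v} | u v. u \<in> verts csp_graph \<and> v \<in> verts csp_graph \<and> u \<noteq> v}"
      using uv(1) by blast
  qed
  have 2: "arcs csp_graph \<subseteq> {(u, v). u \<in> verts csp_graph \<and> v \<in> verts csp_graph \<and> u \<noteq> v}"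
  proof
    fix a assume "a \<in> arcs csp_graph"
    moreover obtain i j where a: "a = (i, j)" by (cases a)
    ultimately have ij: "i < length vs" "j < length vs" "arc (vs ! i) (vs ! j)"
      using arcs_G[of i j] arc_eq by simp_all
    have "\<not> arc u u" if "vertex u" for u
      using that by (cases u) (auto simp: less_2_cases_iff)
    then have "i \<noteq> j" using ij vertex_nth by blast
    then show "a \<in> {(u, v). u \<in> verts csp_graph \<and> v \<in> verts csp_graph \<and> u \<noteq> v}" using ij a by (simp add: verts_G)
  qed
  have 3: "csp_requests \<subseteq> verts csp_graph \<times> verts csp_graph"
  proof
    fix a assume "a \<in> csp_requests"
    moreover obtain i j where a: "a = (i, j)" by (cases a)
    ultimately show "a \<in> verts csp_graph \<times> verts csp_graph" using T_iff[of i j] by (simp add: verts_G)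
  qed
  have 4: "verts csp_graph \<noteq> {}"
  proof -
    have "vertex (0, 2, 0, 0, 0)" using wf by (simp add: csp_wf_def line_def)
    then have "vertex_index (0, 2, 0, 0, 0) < length vs" by (rule index_less)
    then show ?thesis unfolding verts_G by blast
  qed
  show ?thesis unfolding steiner_instance_def wf_mixed_graph_def
    using 1 2 3 4 verts_G by simp
qed

lemma orientable_csp: "steiner_orientable csp_graph csp_requests \<longleftrightarrow> csp_sat I"
proof -
  have inj: "inj_on vertex_index (verts graph)" unfolding verts_graph
    by (rule inj_on_inverseI[of _ "(!) vs"]) (simp add: nth_index)
  have 1: "steiner_orientable graph requests ==> steiner_orientable csp_graph csp_requests"
    unfolding csp_graph_def csp_requests_def by (rule steiner_orientable_rename[OF inj edges_graph])
  have "rename ((!) vs) csp_graph = graph" unfolding csp_graph_def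
    by (rule rename_inverse) (use edges_graph arcs_graph in \<open>auto simp: verts_graph nth_index\<close>)
  moreover have "map_prod ((!) vs) ((!) vs) ` csp_requests = requests"
  proof -
    have "(\<lambda>p. map_prod ((!) vs) ((!) vs) (map_prod vertex_index vertex_index p)) ` requests = (\<lambda>p. p) ` requests"
      by (rule image_cong) (auto simp: requests_def nth_index)
    then show ?thesis unfolding csp_requests_def by (simp add: image_image)
  qed
  moreover have "steiner_orientable (rename ((!) vs) csp_graph) (map_prod ((!) vs) ((!) vs) ` csp_requests)"
    if "steiner_orientable csp_graph csp_requests"
  proof (rule steiner_orientable_rename[OF _ _ that])
    show "inj_on ((!) vs) (verts csp_graph)" using nth_bij by (simp add: verts_G bij_betw_def)
    show "e \<subseteq> verts csp_graph" if "e \<in> edges csp_graph" for e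
      using that steiner_instance unfolding steiner_instance_def wf_mixed_graph_def by blast
  qed
  ultimately have "steiner_orientable csp_graph csp_requests \<longleftrightarrow> steiner_orientable graph requests" using 1 by metis
  then show ?thesis using orientable_iff solvable_eq by simp
qed

lemma finite_requests: "finite requests"
proof -
  have "requests \<subseteq> set vs \<times> set vs" by (auto simp: requests_def set_csp_vertices)
  then show ?thesis by (rule finite_subset) simp
qed

lemma steiner_k_requests: "steiner_k I = card requests"
proof -
  have *: "concat (map (\<lambda>u. map (f u) xs) ys) = map (\<lambda>p. f (fst p) (snd p)) (List.product ys xs)"
    for f :: "vtx => vtx => bool" and xs ys
    by (induction ys) (auto simp: comp_def)
  have "steiner_k I = length (filter (\<lambda>p. csp_request I (fst p) (snd p)) (List.product vs vs))"
    unfolding steiner_k_def * by (simp add: filter_map comp_def)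
  also have "\<dots> = card (set (filter (\<lambda>p. csp_request I (fst p) (snd p)) (List.product vs vs)))"
    using distinct_product[OF distinct_csp_vertices distinct_csp_vertices]
    by (simp only: distinct_card distinct_filter)
  also have "set (filter (\<lambda>p. csp_request I (fst p) (snd p)) (List.product vs vs)) = requests"
    by (auto simp: requests_def set_csp_vertices request_eq)
  finally show ?thesis .
qed

lemma card_T: "card csp_requests = steiner_k I"
proof -
  have "inj_on (map_prod vertex_index vertex_index) requests"
    by (rule inj_on_inverseI[of _ "map_prod ((!) vs) ((!) vs)"]) (auto simp: requests_def nth_index)
  then show ?thesis unfolding csp_requests_def steiner_k_requests by (rule card_image)
qed

text \<open>Every hub has a request of its own, which gives the lower bound. A request is determined
  by its two lines: there is one for each of the \<open>2 * m + V\<close> lines, and two for each of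
  the \<open>2 * m\<close> sides to synchronise it with its hub, where \<open>m\<close> and
  \<open>V\<close> count the constraints and variables.\<close>

lemma steiner_k_bounds: "fst I \<le> steiner_k I" "steiner_k I \<le> 6 * length (snd (snd I)) + fst I"
proof -
  let ?V = "fst I" and ?D = "fst (snd I)" and ?m = "length (snd (snd I))"
  define h :: "nat => vtx \<times> vtx" where "h = (\<lambda>c. ((0, 2, c, ?D - 1, 0), (1, 2, c, 0, 0)))"
  have "h ` {..<?V} \<subseteq> requests"
    using D_pos by (auto simp: requests_def line_def h_def)
  moreover have "card (h ` {..<?V}) = ?V"
    by (subst card_image) (auto simp: inj_on_def h_def)
  ultimately show "?V \<le> steiner_k I"
    using card_mono[OF finite_requests, of "h ` {..<?V}"] by (simp add: steiner_k_requests)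
  define p :: "vtx \<times> vtx => (nat \<times> nat) \<times> nat \<times> nat" where
    "p = (\<lambda>((k, t, c, i, j), (k', t', c', i', j')). ((t, c), (t', c')))"
  let ?L = "{(t, c). line t c}"
  let ?S = "{..<2 :: nat} \<times> {..<?m}"
  let ?f1 = "\<lambda>l. (l, l)" and ?f2 = "\<lambda>l. (l, (2 :: nat, csp_var I (fst l) (snd l)))"
    and ?f3 = "\<lambda>l. ((2 :: nat, csp_var I (fst l) (snd l)), l)"
  have sub: "p ` requests \<subseteq> ?f1 ` ?L \<union> (?f2 ` ?S \<union> ?f3 ` ?S)"
  proof
    fix x assume "x \<in> p ` requests"
    then obtain k t c i j k' t' c' i' j' where r: "((k, t, c, i, j), (k', t', c', i', j')) \<in> requests"
      and x: "x = ((t, c), (t', c'))" by (auto simp: p_def)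
    have l: "line t c" "line t' c'" and "t' = t \<and> c' = c \<or> sync t c t' c'" using r by (auto simp: requests_def)
    then consider "t' = t \<and> c' = c" | "t < 2" "t' = 2" "c' = csp_var I t c" | "t = 2" "t' < 2" "c = csp_var I t' c'"
      unfolding sync_def by blast
    then show "x \<in> ?f1 ` ?L \<union> (?f2 ` ?S \<union> ?f3 ` ?S)"
    proof cases
      case 1
      then have "x = ?f1 (t, c)" "(t, c) \<in> ?L" using l x by auto
      then show ?thesis by blast
    next
      case 2
      then have "x = ?f2 (t, c)" "(t, c) \<in> ?S" using l x by (auto simp: line_def)
      then show ?thesis by blast
    next
      case 3
      then have "x = ?f3 (t', c')" "(t', c') \<in> ?S" using l x by (auto simp: line_def)
      then show ?thesis by blast
    qed
  qed
  have L: "?L = ?S \<union> {2} \<times> {..<?V}" by (auto simp: line_def)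
  have fL: "finite ?L" unfolding L by simp
  have cL: "card ?L \<le> 2 * ?m + ?V"
    unfolding L by (rule order_trans[OF card_Un_le]) (simp add: card_cartesian_product)
  have "inj_on p requests"
  proof (rule inj_onI)
    fix x y assume xy: "x \<in> requests" "y \<in> requests" "p x = p y"
    obtain k t c i j k' t' c' i' j' where x: "x = ((k, t, c, i, j), (k', t', c', i', j'))" by (cases x) auto
    obtain l s d a b l' s' d' a' b' where y: "y = ((l, s, d, a, b), (l', s', d', a', b'))" by (cases y) auto
    show "x = y" using xy by (auto simp: x y p_def requests_def sync_def)
  qed
  then have "card requests = card (p ` requests)" by (simp add: card_image)
  also have "\<dots> \<le> card (?f1 ` ?L \<union> (?f2 ` ?S \<union> ?f3 ` ?S))"
    by (rule card_mono[OF _ sub]) (use fL in simp)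
  also have "\<dots> \<le> card (?f1 ` ?L) + card (?f2 ` ?S \<union> ?f3 ` ?S)" by (rule card_Un_le)
  also have "\<dots> \<le> card ?L + (card ?S + card ?S)"
  proof (rule add_mono)
    show "card (?f1 ` ?L) \<le> card ?L" by (rule card_image_le[OF fL])
    have "card (?f2 ` ?S) \<le> card ?S" "card (?f3 ` ?S) \<le> card ?S" by (intro card_image_le; simp)+
    then show "card (?f2 ` ?S \<union> ?f3 ` ?S) \<le> card ?S + card ?S"
      using card_Un_le[of "?f2 ` ?S" "?f3 ` ?S"] by linarith
  qed
  also have "\<dots> \<le> 6 * ?m + ?V" using cL by (simp add: card_cartesian_product)
  finally show "steiner_k I \<le> 6 * ?m + ?V" unfolding steiner_k_requests .
qed

lemma length_csp_vertices:
  "length vs = 2 * (2 * length (snd (snd I)) + fst I) * fst (snd I) + 2 * length (snd (snd I)) * fst (snd I) * fst (snd I)"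
  by (simp add: csp_vertices_def csp_lines_def length_concat comp_def sum_list_triv algebra_simps)

end

lemma steiner_reduction:
  assumes "csp_wf I"
  obtains G T where "steiner_instance G T" "enc_steiner G T = steiner_bits I" "card T = steiner_k I"
    "card (verts G) = length (csp_vertices I)" "steiner_orientable G T \<longleftrightarrow> csp_sat I"
  using that steiner_instance[OF assms] steiner_bits[OF assms] card_T[OF assms] verts_G[OF assms]
    orientable_csp[OF assms] card_lessThan by metis

section \<open>W[1]-hardness\<close>

subsection \<open>Parsing\<close>

definition many :: "(bool list => 'a \<times> bool list) => nat => bool list => 'a list \<times> bool list" where
  "many p n s = foldl (\<lambda>a _. (fst a @ [fst (p (snd a))], snd (p (snd a)))) ([], s) (replicate n ())"

definition parse_list :: "(bool list => 'a \<times> bool list) => bool list => 'a list \<times> bool list" where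
  "parse_list p s = many p (ones s) (drop (Suc (ones s)) s)"

definition parse_nat :: "bool list => nat \<times> bool list" where
  "parse_nat s = (ones s, drop (Suc (ones s)) s)"

lemma many_snd_length:
  assumes "\<And>r. length (snd (p r)) \<le> length r"
  shows "length (snd (many p n s)) \<le> length s"
  unfolding many_def foldl_replicate
  by (induction n) (auto intro: order_trans[OF assms])

lemma many_fst:
  "many p (Suc n) s = (fst (many p n s) @ [fst (p (snd (many p n s)))], snd (p (snd (many p n s))))"
  unfolding many_def foldl_replicate by simp

lemma sz_drop_le: "length r \<le> length s ==> sz (r :: bool list) \<le> 4 * sz (s :: bool list)"
  using sz_bools(1)[of r] sz_bools(2)[of s] by linarith

text \<open>A parser never lengthens its input, so every item is read from a string no longer than
  the original one. This excludes an explosion during the iteration, even on strings that are not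
  codes.\<close>

lemma PF_many:
  assumes p: "PF p" and len: "\<And>r. length (snd (p r)) \<le> length r" and n: "PF n" and s: "PF s"
  shows "PF (\<lambda>x. many p (n x) (s x))"
proof -
  obtain c where c: "\<forall>r. sz (fst (p r)) \<le> (sz r + 2) ^ c"
    using polyb_sz_PF[OF PF_fst[OF p]] unfolding polyb_def by blast
  have sz_snoc: "sz (a @ [e]) = sz a + sz e + 1" for a and e :: 'a
    by (induction a) auto
  show ?thesis unfolding many_def
  proof (rule PF_foldl)
    show "PF (\<lambda>z. (fst (fst (snd z)) @ [fst (p (snd (fst (snd z))))], snd (p (snd (fst (snd z))))))"
      by (intro PF_intros PF_comp[OF p])
    show "PF (\<lambda>x. ([], s x))" "PF (\<lambda>x. replicate (n x) ())" by (intro PF_intros PF_replicate_unit n s)+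
    show "polyb (\<lambda>x. 2 + (sz (n x) * ((4 * sz (s x) + 2) ^ c + 1) + 4 * sz (s x)))"
      by (intro polyb_add polyb_mult polyb_power polyb_const polyb_sz_PF n s)
    show "sz (foldl (\<lambda>a _. (fst a @ [fst (p (snd a))], snd (p (snd a)))) ([], s x) (take k (replicate (n x) ())))
        \<le> 2 + (sz (n x) * ((4 * sz (s x) + 2) ^ c + 1) + 4 * sz (s x))"
      if "k \<le> length (replicate (n x) ())" for x k
    proof -
      let ?B = "(4 * sz (s x) + 2) ^ c"
      have "sz (fst (many p k (s x))) \<le> k * (?B + 1) + 1"
      proof (induction k)
        case (Suc k)
        have "sz (snd (many p k (s x))) \<le> 4 * sz (s x)"
          by (rule sz_drop_le[OF many_snd_length[OF len]])
        then have "(sz (snd (many p k (s x))) + 2) ^ c \<le> ?B" by (intro power_mono) auto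
        then have "sz (fst (p (snd (many p k (s x))))) \<le> ?B" using c order_trans by blast
        then show ?case using Suc by (simp add: many_fst sz_snoc)
      qed (simp add: many_def)
      moreover have "k * (?B + 1) \<le> sz (n x) * (?B + 1)" using that by (intro mult_right_mono) auto
      moreover have "sz (snd (many p k (s x))) \<le> 4 * sz (s x)"
        by (rule sz_drop_le[OF many_snd_length[OF len]])
      ultimately have "sz (many p k (s x)) \<le> 2 + (sz (n x) * (?B + 1) + 4 * sz (s x))"
        by (cases "many p k (s x)") simp
      then show ?thesis using that by (simp add: many_def)
    qed
  qed
qed

lemma PF_parse_nat: "PF parse_nat"
  unfolding parse_nat_def[abs_def] by (intro PF_ones PF_intros)

lemma PF_parse_list:
  assumes "PF p" "\<And>r. length (snd (p r)) \<le> length r"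
  shows "PF (parse_list p)"
  unfolding parse_list_def[abs_def] by (intro PF_many PF_ones PF_intros assms)

lemma parse_list_length: "(\<And>r. length (snd (p r)) \<le> length r) ==> length (snd (parse_list p s)) \<le> length s"
  unfolding parse_list_def by (rule order_trans[OF many_snd_length]) auto

lemma parse_nat [simp]: "parse_nat (enc_nat n @ u) = (n, u)"
  by (simp add: parse_nat_def) (simp add: enc_nat_def)

lemma many_append:
  assumes "\<And>x u. x \<in> set xs ==> p (enc x @ u) = (f x, u)"
  shows "many p (length xs) (concat (map enc xs) @ u) = (map f xs, u)"
  using assms
proof (induction xs arbitrary: u rule: rev_induct)
  case (snoc x xs)
  then have "many p (length xs) (concat (map enc xs) @ (enc x @ u)) = (map f xs, enc x @ u)" by simp
  then show ?case using snoc.prems by (simp add: many_fst)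
qed (simp add: many_def)

lemma parse_list:
  assumes "\<And>x u. p (enc x @ u) = (f x, u)"
  shows "parse_list p (enc_list enc xs @ u) = (map f xs, u)"
proof -
  have "drop (Suc n) (enc_nat n @ v) = v" for n v by (simp add: enc_nat_def)
  then show ?thesis unfolding parse_list_def enc_list_def by (simp add: many_append assms del: drop_append)
qed

text \<open>A kind and the list of predecessors; this type already has a code.\<close>

type_synonym rgate = "nat \<times> nat list"

fun rep :: "gate => rgate" where
  "rep GIn = (0, [])"
| "rep (GNot j) = (1, [j])"
| "rep (GAnd js) = (2, js)"
| "rep (GOr js) = (3, js)"

fun unrep :: "rgate => gate" where
  "unrep g = (if fst g = 0 then GIn else if fst g = 1 then GNot (hd (snd g))
     else if fst g = 2 then GAnd (snd g) else GOr (snd g))"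

lemma unrep_rep [simp]: "unrep (rep g) = g" by (cases g) auto

definition enc_rgate :: "rgate => bool list" where
  "enc_rgate g = (if fst g = 0 then [False, False] else if fst g = 1 then [False, True] @ enc_nat (hd (snd g))
     else if fst g = 2 then [True, False] @ (enc_nat (length (snd g)) @ concat (map (\<lambda>j. enc_nat j) (snd g)))
     else [True, True] @ (enc_nat (length (snd g)) @ concat (map (\<lambda>j. enc_nat j) (snd g))))"

lemma enc_rgate: "enc_rgate g = enc_gate (unrep g)"
  by (simp add: enc_rgate_def enc_list_def)

definition parse_gate :: "bool list => rgate \<times> bool list" where
  "parse_gate s = (if \<not> get False s 0 \<and> \<not> get False s 1 then ((0, []), drop 2 s)
     else if \<not> get False s 0 then ((1, [fst (parse_nat (drop 2 s))]), snd (parse_nat (drop 2 s)))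
     else ((if get False s 1 then 3 else 2, fst (parse_list parse_nat (drop 2 s))),
       snd (parse_list parse_nat (drop 2 s))))"

lemma parse_nat_length: "length (snd (parse_nat r)) \<le> length r"
  by (simp add: parse_nat_def)

lemma parse_gate_length: "length (snd (parse_gate r)) \<le> length r"
  using parse_list_length[of parse_nat "drop 2 r", OF parse_nat_length] parse_nat_length[of "drop 2 r"]
  by (auto simp: parse_gate_def)

lemma PF_parse_gate: "PF parse_gate"
proof -
  note 1 = PF_comp[OF PF_parse_list[OF PF_parse_nat parse_nat_length]]
  show ?thesis
    unfolding parse_gate_def[abs_def] by (intro PF_intros PF_comp[OF PF_parse_nat] 1)
qed

lemma parse_gate [simp]: "parse_gate (enc_gate g @ u) = (rep g, u)"
proof -
  have 1: "parse_list parse_nat (enc_list enc_nat js @ u) = (map (\<lambda>j. j) js, u)" for js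
    by (rule parse_list) simp
  show ?thesis by (cases g) (simp_all add: parse_gate_def 1)
qed

definition parse_circuit :: "bool list => rgate list" where
  "parse_circuit s = fst (parse_list parse_gate s)"

lemma PF_parse_circuit: "PF parse_circuit"
  unfolding parse_circuit_def[abs_def]
  by (intro PF_fst PF_parse_list PF_parse_gate parse_gate_length)

lemma parse_circuit: "parse_circuit (enc_list enc_gate C) = map rep C"
  using parse_list[of parse_gate enc_gate rep C "[]"] by (simp add: parse_circuit_def)

text \<open>The parser is total and returns something on every string, so malformed inputs are
  detected by encoding the result again.\<close>

definition is_code :: "bool list => bool" where
  "is_code s \<longleftrightarrow> enc_nat (length (parse_circuit s)) @ concat (map (\<lambda>g. enc_rgate g) (parse_circuit s)) = s"

lemma enc_rgate_eq: "enc_rgate = (\<lambda>g. enc_gate (unrep g))"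
  by (rule ext, rule enc_rgate)

lemma is_code: "is_code s \<longleftrightarrow> (\<exists>C. s = enc_list enc_gate C)"
proof
  assume "is_code s"
  then have "s = enc_list enc_gate (map unrep (parse_circuit s))"
    unfolding is_code_def enc_list_def by (simp add: enc_rgate_eq comp_def del: unrep.simps)
  then show "\<exists>C. s = enc_list enc_gate C" by blast
next
  assume "\<exists>C. s = enc_list enc_gate C"
  then obtain C where "s = enc_list enc_gate C" by blast
  then show "is_code s" unfolding is_code_def
    by (simp add: parse_circuit enc_rgate comp_def del: unrep.simps) (simp add: enc_list_def)
qed

lemma PF_is_code: "PF is_code"
  unfolding is_code_def[abs_def] enc_rgate_def
  by (intro PF_enc_nat PF_intros PF_comp[OF PF_parse_circuit])

subsection \<open>Walks in circuits\<close>

definition kd :: "rgate list => nat => nat" where "kd R i = fst (get (0, []) R i)"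
definition pr :: "rgate list => nat => nat list" where "pr R i = snd (get (0, []) R i)"
definition large :: "rgate list => nat => bool" where "large R i \<longleftrightarrow> 2 < length (pr R i)"

text \<open>Walks are built downwards from \<open>g\<close> but listed upwards, like input-output
  paths: the head is the lowest gate. The variant \<open>twalks\<close> is not continued below a
  large gate.\<close>

fun walks :: "nat => rgate list => nat => nat list list" where
  "walks 0 R g = [[g]]"
| "walks (Suc j) R g = concat (map (\<lambda>w. map (\<lambda>i. i # w) (pr R (hd w))) (walks j R g))"

fun twalks :: "nat => rgate list => nat => nat list list" where
  "twalks 0 R g = [[g]]"
| "twalks (Suc j) R g =
     concat (map (\<lambda>w. if large R (hd w) then [] else map (\<lambda>i. i # w) (pr R (hd w))) (twalks j R g))"

fun all_walks :: "nat => rgate list => nat => nat list list" where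
  "all_walks 0 R g = walks 0 R g"
| "all_walks (Suc j) R g = all_walks j R g @ walks (Suc j) R g"

fun all_twalks :: "nat => rgate list => nat => nat list list" where
  "all_twalks 0 R g = twalks 0 R g"
| "all_twalks (Suc j) R g = all_twalks j R g @ twalks (Suc j) R g"

lemma set_all_walks: "w \<in> set (all_walks d R g) \<longleftrightarrow> (\<exists>j\<le>d. w \<in> set (walks j R g))"
  by (induction d) (simp_all del: walks.simps add: le_Suc_eq, blast)

lemma set_all_twalks: "w \<in> set (all_twalks d R g) \<longleftrightarrow> (\<exists>j\<le>d. w \<in> set (twalks j R g))"
  by (induction d) (simp_all del: twalks.simps add: le_Suc_eq, blast)

text \<open>In a well-formed circuit every gate lies above some input, so a walk of
  \<open>Suc d\<close> steps down from the output exists exactly if the depth exceeds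
  \<open>d\<close>. As \<open>d\<close> is a constant, the number of walks is polynomial.\<close>

definition valid :: "nat => rgate list => bool" where
  "valid d R \<longleftrightarrow> R \<noteq> [] \<and>
     (\<forall>i\<in>set [0..<length R]. (2 \<le> kd R i --> length (dedup (pr R i)) = length (pr R i) \<and> 2 \<le> length (pr R i)) \<and>
        (\<forall>j\<in>set (pr R i). j < i)) \<and>
     walks (Suc d) R (length R - 1) = [] \<and>
     (\<forall>w\<in>set (all_walks d R (length R - 1)). kd R (hd w) = 0 --> length (filter (\<lambda>i. large R i) w) \<le> 1)"

lemma PF_kd: "PF R ==> PF i ==> PF (\<lambda>x. kd (R x) (i x))"
  unfolding kd_def by (intro PF_intros)

lemma PF_pr: "PF R ==> PF i ==> PF (\<lambda>x. pr (R x) (i x))"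
  unfolding pr_def by (intro PF_intros)

lemma PF_large: "PF R ==> PF i ==> PF (\<lambda>x. large (R x) (i x))"
  unfolding large_def by (intro PF_intros PF_pr)

lemma PF_walks: "PF R ==> PF g ==> PF (\<lambda>x. walks j (R x) (g x))"
proof (induction j)
  case (Suc j)
  show ?case unfolding walks.simps by (intro PF_pr PF_intros Suc PF_comp[OF Suc.prems(1)])
qed (simp, intro PF_intros)

lemma PF_twalks: "PF R ==> PF g ==> PF (\<lambda>x. twalks j (R x) (g x))"
proof (induction j)
  case (Suc j)
  show ?case unfolding twalks.simps by (intro PF_pr PF_large PF_intros Suc PF_comp[OF Suc.prems(1)])
qed (simp, intro PF_intros)

lemma PF_all_walks: "PF R ==> PF g ==> PF (\<lambda>x. all_walks j (R x) (g x))"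
proof (induction j)
  case (Suc j)
  show ?case unfolding all_walks.simps by (intro PF_append PF_walks Suc)
qed (simp, intro PF_intros)

lemma PF_all_twalks: "PF R ==> PF g ==> PF (\<lambda>x. all_twalks j (R x) (g x))"
proof (induction j)
  case (Suc j)
  show ?case unfolding all_twalks.simps by (intro PF_append PF_twalks Suc)
qed (simp, intro PF_intros)

lemma PF_valid:
  assumes R: "PF R" shows "PF (\<lambda>x. valid d (R x))"
  unfolding valid_def
  by (intro PF_kd PF_large PF_dedup PF_pr PF_walks PF_all_walks PF_intros PF_comp[OF R] R)

lemma foldl_snoc:
  fixes F :: "'b list => 'a => 'b"
  defines "v xs \<equiv> foldl (\<lambda>vs g. vs @ [F vs g]) [] xs"
  shows "length (v xs) = length xs" "i < length xs ==> v xs ! i = F (take i (v xs)) (xs ! i)"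
proof -
  have "length (v xs) = length xs \<and> (\<forall>i<length xs. v xs ! i = F (take i (v xs)) (xs ! i))"
    by (induction xs rule: rev_induct) (auto simp: v_def nth_append less_Suc_eq)
  then show "length (v xs) = length xs" "i < length xs ==> v xs ! i = F (take i (v xs)) (xs ! i)" by auto
qed

section \<open>Local evaluation of a circuit and the constraint satisfaction problem built from
  it\<close>

type_synonym gaps = "(nat \<times> nat) list"
text \<open>A gate, its guessed value, and a predecessor offered as the reason for this
  value.\<close>

type_synonym guess = "(nat \<times> bool \<times> nat) list"

definition gate_eval :: "gaps => guess => bool list => rgate => bool" where
  "gate_eval gaps z vs g = (if \<exists>e\<in>set z. fst e = length vs then \<exists>e\<in>set z. fst e = length vs \<and> fst (snd e)
     else if fst g = 0 then \<exists>p\<in>set gaps. fst p = Suc (length vs)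
     else if fst g = 1 then \<not> get False vs (hd (snd g))
     else if fst g = 2 then \<forall>j\<in>set (snd g). get False vs j
     else \<exists>j\<in>set (snd g). get False vs j)"

definition local_eval :: "gaps => guess => rgate list => bool list" where
  "local_eval gaps z R = foldl (\<lambda>vs g. vs @ [gate_eval gaps z vs g]) [] R"

definition cone :: "nat => rgate list => nat => nat list" where
  "cone d R g = filter (\<lambda>i. kd R i = 0) (map (\<lambda>w. hd w) (all_twalks d R g))"

definition top_large :: "nat => rgate list => nat list" where
  "top_large d R = dedup (filter (\<lambda>i. large R i) (map (\<lambda>w. hd w) (all_twalks d R (length R - 1))))"

text \<open>The range is half-open: an input at the lower end of a gap is chosen, any other input
  within the gap is not. A gap that covers an input therefore determines its value.\<close>

definition resolved :: "gaps => nat list => bool" where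
  "resolved gaps xs \<longleftrightarrow> (\<forall>x\<in>set xs. \<exists>p\<in>set gaps. fst p \<le> Suc x \<and> Suc x < snd p)"

text \<open>Bounds the number of gates at the ends of walks that do not continue below a large gate, as all
  other gates have at most two predecessors.\<close>

definition width :: "nat => nat" where "width d = 2 ^ Suc d"

type_synonym w1_value = "(bool \<times> nat) list \<times> gaps"

text \<open>Three checks: the shape of the gaps, the truth of the output, and the guesses at the
  topmost large gates. The equation \<open>(kd R (fst e) = 2) = fst (snd e)\<close> singles out
  conjunctions guessed true and disjunctions guessed false, for which all predecessors count;
  otherwise the offered witness does. A check is vacuous if the gaps at hand do not resolve its
  inputs; it is then carried out at another variable.\<close>

definition w1_ok :: "nat => rgate list => nat => nat list => w1_value => bool" where
  "w1_ok d R k t x \<longleftrightarrow>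
    (\<forall>p\<in>set (zip t (snd x)). fst (snd p) < snd (snd p) \<and> (fst p = 0 --> fst (snd p) = 0) \<and>
       (fst p = k --> snd (snd p) = Suc (length R)) \<and> snd (snd p) \<le> Suc (length R) \<and>
       (fst p \<noteq> 0 --> fst (snd p) \<noteq> 0 \<and> kd R (fst (snd p) - 1) = 0)) \<and>
    (resolved (snd x) (cone d R (length R - 1)) -->
       get False (local_eval (snd x) (zip (top_large d R) (fst x)) R) (length R - 1)) \<and>
    (\<forall>e\<in>set (zip (top_large d R) (fst x)).
      (if (kd R (fst e) = 2) = fst (snd e)
       then \<forall>j\<in>set (pr R (fst e)). resolved (snd x) (cone d R j) -->
         get False (local_eval (snd x) [] R) j = fst (snd e)
       else snd (snd e) \<in> set (pr R (fst e)) \<and> (resolved (snd x) (cone d R (snd (snd e))) -->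
         get False (local_eval (snd x) [] R) (snd (snd e)) = fst (snd e))))"

definition w1_rel :: "nat => rgate list => nat => nat list => w1_value => nat list => w1_value => bool" where
  "w1_rel d R k t x u y \<longleftrightarrow> w1_ok d R k t x \<and> w1_ok d R k u y \<and> fst x = fst y \<and>
    (\<forall>p\<in>set (zip t (snd x)). \<forall>q\<in>set (zip u (snd y)).
      (fst p = fst q --> snd p = snd q) \<and> (Suc (fst p) = fst q --> snd (snd p) = fst (snd q)))"

text \<open>One variable for each tuple of gap numbers. The tuples are long enough for the inputs
  below any gate that has to be evaluated, so some variable sees all of them, and the number of
  tuples depends on \<open>d\<close> and \<open>k\<close> only.\<close>

definition w1_indices :: "nat => nat => nat list list" where
  "w1_indices d k = List.n_lists (width d) [0..<Suc k]"

text \<open>Malformed values are included, since \<open>w1_ok\<close> rejects them. The size is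
  polynomial because \<open>width d\<close> is a constant.\<close>

definition w1_domain :: "nat => rgate list => w1_value list" where
  "w1_domain d R = concat (map (\<lambda>z. map (\<lambda>y. (z, y))
      (List.n_lists (width d) (concat (map (\<lambda>a. map (\<lambda>b. (a, b)) [0..<length R + 2]) [0..<length R + 2]))))
     (List.n_lists (width d) (concat (map (\<lambda>a. map (\<lambda>b. (a, b)) [0..<length R]) [False, True]))))"

definition w1_csp :: "nat => rgate list => nat => csp" where
  "w1_csp d R k = (length (w1_indices d k), length (w1_domain d R),
     concat (map (\<lambda>i. map (\<lambda>j. (i, j, map (\<lambda>x. map (\<lambda>y.
         w1_rel d R k (get [] (w1_indices d k) i) x (get [] (w1_indices d k) j) y) (w1_domain d R)) (w1_domain d R)))
       [0..<length (w1_indices d k)]) [0..<length (w1_indices d k)]))"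

lemma PF_local_eval:
  assumes "PF gaps" "PF z" "PF R" shows "PF (\<lambda>x. local_eval (gaps x) (z x) (R x))"
  unfolding local_eval_def
proof (rule PF_foldl_add[where B = "\<lambda>_. 4"])
  have snoc: "sz (a @ [e]) = sz a + sz e + 1" for a and e :: bool
    by (induction a) auto
  show "sz (a @ [gate_eval (gaps x) (z x) a e]) \<le> sz a + 4" for x a e
    unfolding snoc by simp
  show "PF (\<lambda>y. fst (snd y) @ [gate_eval (gaps (fst y)) (z (fst y)) (fst (snd y)) (snd (snd y))])"
    unfolding gate_eval_def by (intro PF_intros PF_comp[OF assms(1)] PF_comp[OF assms(2)])
qed (intro PF_const polyb_const assms)+

lemma PF_cone:
  assumes "PF R" "PF g" shows "PF (\<lambda>x. cone d (R x) (g x))"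
  unfolding cone_def by (intro PF_kd PF_all_twalks PF_intros assms PF_comp[OF assms(1)])

lemma PF_top_large:
  assumes "PF R" shows "PF (\<lambda>x. top_large d (R x))"
  unfolding top_large_def by (intro PF_dedup PF_large PF_all_twalks PF_intros assms PF_comp[OF assms(1)])

lemma PF_resolved: "PF f ==> PF g ==> PF (\<lambda>x. resolved (f x) (g x))"
proof -
  assume a: "PF f" "PF g"
  show ?thesis unfolding resolved_def by (intro PF_intros a PF_comp[OF a(1)])
qed

lemma PF_w1_ok:
  assumes "PF R" "PF k" "PF t" "PF v"
  shows "PF (\<lambda>x. w1_ok d (R x) (k x) (t x) (v x))"
  unfolding w1_ok_def
  by (intro PF_resolved PF_cone PF_kd PF_pr PF_local_eval PF_top_large PF_intros assms
      PF_comp[OF assms(1)] PF_comp[OF assms(2)] PF_comp[OF assms(4)])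

lemma PF_w1_rel:
  assumes "PF R" "PF k" "PF t" "PF v" "PF u" "PF w"
  shows "PF (\<lambda>x. w1_rel d (R x) (k x) (t x) (v x) (u x) (w x))"
  unfolding w1_rel_def
  by (intro PF_w1_ok PF_intros assms PF_comp[OF assms(5)] PF_comp[OF assms(6)])

lemma PF_w1_indices: "PF k ==> PF (\<lambda>x. w1_indices d (k x))"
  unfolding w1_indices_def by (intro PF_n_lists PF_intros)

lemma PF_w1_domain:
  assumes "PF R" shows "PF (\<lambda>x. w1_domain d (R x))"
  unfolding w1_domain_def
  by (intro PF_n_lists PF_intros assms PF_comp[OF assms])

lemma PF_w1_csp:
  assumes "PF R" "PF k" shows "PF (\<lambda>x. w1_csp d (R x) (k x))"
  unfolding w1_csp_def
  by (intro PF_w1_rel PF_w1_indices PF_w1_domain PF_intros assms PF_comp[OF assms(1)] PF_comp[OF assms(2)])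

lemma csp_sat_all_pairs:
  "csp_sat (length ts, length dm, concat (map (\<lambda>i. map (\<lambda>j. (i, j, map (\<lambda>x. map (\<lambda>y.
     rel (get [] ts i) x (get [] ts j) y) dm) dm)) [0..<length ts]) [0..<length ts])) \<longleftrightarrow>
   (\<exists>Y. (\<forall>i<length ts. Y i \<in> set dm) \<and>
     (\<forall>i<length ts. \<forall>j<length ts. rel (ts ! i) (Y i) (ts ! j) (Y j)))"
  (is "?l \<longleftrightarrow> ?r")
proof
  assume ?l
  then obtain val where v: "\<forall>v<length ts. val v < length dm"
    and c: "\<forall>i<length ts. \<forall>j<length ts. get False (get [] (map (\<lambda>x. map (\<lambda>y.
     rel (get [] ts i) x (get [] ts j) y) dm) dm) (val i)) (val j)"
    unfolding csp_sat_def by auto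
  have "rel (ts ! i) (dm ! val i) (ts ! j) (dm ! val j)" if "i < length ts" "j < length ts" for i j
    using c[rule_format, OF that] v that by simp
  then show ?r using v by (intro exI[of _ "\<lambda>i. dm ! val i"]) auto
next
  assume ?r
  then obtain Y where Y: "\<forall>i<length ts. Y i \<in> set dm"
    "\<forall>i<length ts. \<forall>j<length ts. rel (ts ! i) (Y i) (ts ! j) (Y j)" by blast
  from Y(1) have "\<forall>i. \<exists>a. i < length ts --> a < length dm \<and> dm ! a = Y i"
    by (auto simp: in_set_conv_nth)
  then obtain val where "\<forall>i. i < length ts --> val i < length dm \<and> dm ! val i = Y i" by metis
  then show ?l using Y(2) unfolding csp_sat_def by (intro exI[of _ val]) auto
qed

section \<open>Circuits, their parsed form, and paths through them\<close>

locale circuit_instance =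
  fixes C :: circuit and d :: nat and R :: "rgate list" and n :: nat
  assumes R_def: "R = map rep C" and n_def: "n = length C"
    and wf: "wf_circuit C"
begin

lemma lenR: "length R = n" by (simp add: R_def n_def)
lemma n_pos: "0 < n" using wf by (simp add: n_def wf_circuit_def)

lemma pr_preds: "i < n ==> pr R i = preds (C ! i)"
  unfolding pr_def R_def n_def by (cases "C ! i") auto

lemma kd_in: "i < n ==> kd R i = 0 \<longleftrightarrow> C ! i = GIn"
  unfolding kd_def R_def n_def by (cases "C ! i") auto

lemma pred_less: "i < n ==> j \<in> set (pr R i) ==> j < i"
  using wf pr_preds unfolding wf_circuit_def n_def by auto

lemma pred_nonempty: "i < n ==> C ! i \<noteq> GIn ==> pr R i \<noteq> []"
  using wf pr_preds[of i] unfolding wf_circuit_def n_def by (cases "C ! i") force+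

definition down :: "nat list => bool" where
  "down w \<longleftrightarrow> w \<noteq> [] \<and> (\<forall>i\<in>set w. i < n) \<and> successively (\<lambda>j i. j \<in> set (pr R i)) w"

lemma down_Cons: "down (i # w) \<longleftrightarrow> i < n \<and> (w = [] \<or> i \<in> set (pr R (hd w)) \<and> down w)"
  by (auto simp: down_def successively_Cons)

lemma down_append: "u \<noteq> [] ==> v \<noteq> [] ==>
    down (u @ v) \<longleftrightarrow> down u \<and> down v \<and> last u \<in> set (pr R (hd v))"
  by (auto simp: down_def successively_append_iff)

lemma input_output_path_down:
  "input_output_path C xs \<longleftrightarrow> down xs \<and> kd R (hd xs) = 0 \<and> last xs = n - 1"
proof -
  have "successively (\<lambda>j i. j \<in> set (preds (C ! i))) xs \<longleftrightarrow> successively (\<lambda>j i. j \<in> set (pr R i)) xs"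
    if "\<forall>i\<in>set xs. i < n"
    using that by (induction xs) (auto simp: successively_Cons pr_preds)
  moreover have "hd xs < n" if "\<forall>i\<in>set xs. i < n" "xs \<noteq> []" using that by simp
  ultimately show ?thesis unfolding input_output_path_def down_def n_def[symmetric]
    using kd_in[of "hd xs"] by metis
qed

lemma walks_iff: "g < n ==> w \<in> set (walks j R g) \<longleftrightarrow> down w \<and> last w = g \<and> length w = Suc j"
proof (induction j arbitrary: w)
  case 0
  then show ?case by (cases w) (auto simp: down_Cons)
next
  case (Suc j)
  show ?case
  proof (cases w)
    case (Cons i v)
    have "w \<in> set (walks (Suc j) R g) \<longleftrightarrow> v \<in> set (walks j R g) \<and> i \<in> set (pr R (hd v))"
      by (auto simp: Cons)
    also have "\<dots> \<longleftrightarrow> down w \<and> last w = g \<and> length w = Suc (Suc j)"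
    proof -
      have "i < n" if "down v" "i \<in> set (pr R (hd v))"
      proof -
        have "hd v < n" using that(1) by (auto simp: down_def)
        then show ?thesis using pred_less[OF _ that(2)] by simp
      qed
      moreover have "down v ==> v \<noteq> []" by (simp add: down_def)
      ultimately show ?thesis using Suc by (auto simp: Cons down_Cons)
    qed
    finally show ?thesis .
  qed auto
qed

lemma extend_below: "i < n ==> \<exists>u. down (u @ [i]) \<and> kd R (hd (u @ [i])) = 0"
proof (induction i rule: less_induct)
  case (less i)
  show ?case
  proof (cases "C ! i = GIn")
    case True
    then show ?thesis using less by (intro exI[of _ "[]"]) (auto simp: down_Cons kd_in)
  next
    case False
    then obtain j where j: "j \<in> set (pr R i)" using pred_nonempty[OF less.prems] by (cases "pr R i") auto
    then have "j < i" using pred_less less.prems by blast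
    then obtain u where u: "down (u @ [j])" "kd R (hd (u @ [j])) = 0" using less by force
    then show ?thesis using j less.prems
      by (intro exI[of _ "u @ [j]"]) (auto simp: down_append down_Cons simp flip: append_assoc)
  qed
qed

lemma extend_walk:
  assumes "down w"
  obtains u where "down (u @ w)" "kd R (hd (u @ w)) = 0"
proof -
  obtain i v where w: "w = i # v" using assms by (cases w) (auto simp: down_def)
  obtain u where u: "down (u @ [i])" "kd R (hd (u @ [i])) = 0"
    using extend_below[of i] assms by (auto simp: w down_def)
  have "down (u @ w)"
  proof (cases v)
    case Nil
    then show ?thesis using u w by simp
  next
    case (Cons a b)
    have "down ((u @ [i]) @ v) \<longleftrightarrow> down (u @ [i]) \<and> down v \<and> last (u @ [i]) \<in> set (pr R (hd v))"
      by (rule down_append) (auto simp: Cons)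
    then show ?thesis using u(1) assms Cons by (simp add: w down_Cons)
  qed
  moreover have "kd R (hd (u @ w)) = 0" using u(2) by (cases u) (auto simp: w)
  ultimately show ?thesis by (rule that)
qed

lemma valid_iff: "valid d R \<longleftrightarrow> weft_at_most C 1 \<and> depth_at_most C d"
proof -
  have out: "n - 1 < n" using n_pos by simp
  have wfR: "R \<noteq> []" "\<forall>i\<in>set [0..<length R]. (2 \<le> kd R i --> length (dedup (pr R i)) = length (pr R i) \<and> 2 \<le> length (pr R i)) \<and>
        (\<forall>j\<in>set (pr R i). j < i)"
  proof -
    show "R \<noteq> []" using n_pos lenR by auto
    show "\<forall>i\<in>set [0..<length R]. (2 \<le> kd R i --> length (dedup (pr R i)) = length (pr R i) \<and> 2 \<le> length (pr R i)) \<and>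
        (\<forall>j\<in>set (pr R i). j < i)"
    proof (intro ballI conjI impI)
      fix i assume i: "i \<in> set [0..<length R]"
      then have "i < n" by (simp add: lenR)
      then have w: "wf_gate (C ! i)" using wf by (simp add: wf_circuit_def n_def)
      show "j < i" if "j \<in> set (pr R i)" for j using pred_less[OF \<open>i < n\<close> that] .
      assume k: "2 \<le> kd R i"
      have "distinct (pr R i) \<and> 2 \<le> length (pr R i)"
        using w k \<open>i < n\<close> unfolding pr_preds[OF \<open>i < n\<close>]
        by (cases "C ! i") (auto simp: kd_def R_def n_def)
      then show "length (dedup (pr R i)) = length (pr R i)" "2 \<le> length (pr R i)"
        by (auto simp: length_dedup distinct_card)
    qed
  qed
  have depth: "walks (Suc d) R (n - 1) = [] \<longleftrightarrow> depth_at_most C d"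
  proof
    assume e: "walks (Suc d) R (n - 1) = []"
    show "depth_at_most C d" unfolding depth_at_most_def
    proof (intro allI impI, rule ccontr)
      fix xs assume p: "input_output_path C xs" and l: "\<not> length xs - 1 \<le> d"
      \<comment> \<open>The upper part of an overlong path is a walk of exactly \<open>Suc d\<close>
        steps that ends in the output.\<close>
      define w where "w = drop (length xs - Suc (Suc d)) xs"
      have lw: "length w = Suc (Suc d)" using l by (simp add: w_def)
      have dx: "down xs" "last xs = n - 1" using p input_output_path_down by auto
      have "down w"
      proof (cases "take (length xs - Suc (Suc d)) xs = []")
        case True
        then have "w = xs" unfolding w_def by (metis append_Nil append_take_drop_id)
        then show ?thesis using dx by simp
      next
        case False
        have "w \<noteq> []" using lw by auto
        from down_append[OF False this] show ?thesis using dx by (simp add: w_def)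
      qed
      moreover have "last w = n - 1" using dx lw by (simp add: w_def)
      ultimately have "w \<in> set (walks (Suc d) R (n - 1))" using walks_iff[OF out] lw by blast
      then show False using e by simp
    qed
  next
    assume dp: "depth_at_most C d"
    show "walks (Suc d) R (n - 1) = []"
    proof (rule ccontr)
      assume "walks (Suc d) R (n - 1) \<noteq> []"
      then obtain w where "w \<in> set (walks (Suc d) R (n - 1))" using list.set_sel(1) by metis
      then have w: "down w" "last w = n - 1" "length w = Suc (Suc d)"
        unfolding walks_iff[OF out] by blast+
      obtain u where u: "down (u @ w)" "kd R (hd (u @ w)) = 0" using extend_walk[OF w(1)] by blast
      have "w \<noteq> []" using w by auto
      then have "input_output_path C (u @ w)" using u w by (simp add: input_output_path_down)
      then have "length (u @ w) - 1 \<le> d" using dp unfolding depth_at_most_def by blast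
      then show False using w by simp
    qed
  qed
  have weft: "(\<forall>w\<in>set (all_walks d R (n - 1)). kd R (hd w) = 0 --> length (filter (\<lambda>i. large R i) w) \<le> 1)
     \<longleftrightarrow> weft_at_most C 1" if dp: "depth_at_most C d"
  proof -
    have "w \<in> set (all_walks d R (n - 1)) \<and> kd R (hd w) = 0 \<longleftrightarrow> input_output_path C w" for w
    proof -
      have "input_output_path C w ==> w \<noteq> [] \<and> length w - 1 \<le> d"
        using dp unfolding depth_at_most_def by (auto simp: input_output_path_def)
      then show ?thesis unfolding set_all_walks walks_iff[OF out] input_output_path_down
        by (cases w) (auto simp: down_def)
    qed
    moreover have "length (filter (\<lambda>i. large R i) w) = length (filter (\<lambda>i. length (preds (C ! i)) > 2) w)"
      if "input_output_path C w" for w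
      using that unfolding large_def input_output_path_down down_def
      by (intro arg_cong[of _ _ length] filter_cong) (auto simp: pr_preds)
    ultimately show ?thesis unfolding weft_at_most_def by (metis (no_types, lifting))
  qed
  show ?thesis unfolding valid_def lenR using wfR depth weft by (auto simp: lenR)
qed

end

subsection \<open>Correctness of the local checks\<close>

text \<open>Gap number \<open>i\<close> lies between the \<open>i\<close>-th and the next chosen input; positions are shifted by 1.\<close>

locale gap_system =
  fixes k n :: nat and lo hi :: "nat => nat"
  assumes lo_hi: "i \<le> k ==> lo i < hi i"
    and hi_lo: "i < k ==> hi i = lo (Suc i)"
    and lo_0: "lo 0 = 0" and hi_k: "hi k = Suc n"
begin

lemma hi_le_lo: "i < j ==> j \<le> k ==> hi i \<le> lo j"
proof (induction j)
  case (Suc j)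
  show ?case
  proof (cases "i = j")
    case True
    then show ?thesis using hi_lo[of j] Suc by simp
  next
    case False
    then have "hi i \<le> lo j" using Suc by simp
    also have "\<dots> < hi j" using lo_hi Suc by simp
    also have "hi j = lo (Suc j)" using hi_lo Suc by simp
    finally show ?thesis by simp
  qed
qed simp

lemma lo_inj: "i \<le> k ==> j \<le> k ==> lo i = lo j ==> i = j"
  using hi_le_lo[of i j] hi_le_lo[of j i] lo_hi[of i] lo_hi[of j] by (cases i j rule: linorder_cases) auto

lemma gap_unique: "i \<le> k ==> j \<le> k ==> lo i \<le> lo j ==> lo j < hi i ==> i = j"
  using hi_le_lo[of i j] hi_le_lo[of j i] lo_hi[of i] lo_hi[of j] by (cases i j rule: linorder_cases) auto

lemma gap_cover: "x \<le> n ==> \<exists>i\<le>k. lo i \<le> x \<and> x < hi i"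
proof -
  assume x: "x \<le> n"
  define i where "i = Max {i. i \<le> k \<and> lo i \<le> x}"
  have fin: "finite {i. i \<le> k \<and> lo i \<le> x}" by (rule finite_subset[of _ "{..k}"]) auto
  have "0 \<in> {i. i \<le> k \<and> lo i \<le> x}" using lo_0 by simp
  then have i: "i \<le> k" "lo i \<le> x" using Max_in[OF fin] unfolding i_def by blast+
  have "x < hi i"
  proof (cases "i = k")
    case True
    then show ?thesis using hi_k x by simp
  next
    case False
    then have ik: "Suc i \<le> k" using i by simp
    then have "\<not> lo (Suc i) \<le> x" using Max_ge[OF fin, of "Suc i"] unfolding i_def[symmetric] by auto
    then show ?thesis using hi_lo[of i] ik by simp
  qed
  with i show ?thesis by blast
qed

lemma lo_le: "i \<le> k ==> lo i \<le> n"
  using hi_le_lo[of i k] lo_hi[of i] lo_hi[of k] hi_k by (cases "i = k") auto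

lemma resolved_choice:
  assumes "length xs \<le> Q" "\<And>x. x \<in> set xs ==> x < n"
  shows "\<exists>t. length t = Q \<and> set t \<subseteq> {0..<Suc k} \<and> resolved (map (\<lambda>i. (lo i, hi i)) t) xs"
proof -
  have "\<forall>x. \<exists>i. x < n --> i \<le> k \<and> lo i \<le> Suc x \<and> Suc x < hi i"
    using gap_cover by (meson Suc_leI)
  then obtain f where f: "\<forall>x. x < n --> f x \<le> k \<and> lo (f x) \<le> Suc x \<and> Suc x < hi (f x)" by metis
  \<comment> \<open>Variables are tuples of a fixed length, so the list of gaps is filled up with
    gap 0.\<close>
  have "length (map f xs @ replicate (Q - length xs) 0) = Q" using assms by simp
  moreover have "set (map f xs @ replicate (Q - length xs) 0) \<subseteq> {0..<Suc k}"
    using f assms by (auto simp: less_Suc_eq_le)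
  moreover have "resolved (map (\<lambda>i. (lo i, hi i)) (map f xs @ replicate (Q - length xs) 0)) xs"
    unfolding resolved_def
  proof
    fix x assume x: "x \<in> set xs"
    have mem: "(lo (f x), hi (f x)) \<in> set (map (\<lambda>i. (lo i, hi i)) (map f xs @ replicate (Q - length xs) 0))"
      unfolding list.set_map by (rule image_eqI[where x = "f x"]) (simp_all add: x)
    have "lo (f x) \<le> Suc x \<and> Suc x < hi (f x)" using f assms(2)[OF x] by simp
    then show "\<exists>p\<in>set (map (\<lambda>i. (lo i, hi i)) (map f xs @ replicate (Q - length xs) 0)).
        fst p \<le> Suc x \<and> Suc x < snd p" by (intro bexI[OF _ mem]) simp
  qed
  ultimately show ?thesis by blast
qed

text \<open>Only one gap contains the position \<open>Suc x\<close>. If it is the lower end of any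
  gap, this is the listed gap that covers it. The lower end of gap 0 is 0, which is the shifted
  position of no input.\<close>

lemma resolved_value:
  assumes t: "set t \<subseteq> {0..<Suc k}" and r: "resolved (map (\<lambda>i. (lo i, hi i)) t) xs" and x: "x \<in> set xs"
  shows "(\<exists>p\<in>set (map (\<lambda>i. (lo i, hi i)) t). fst p = Suc x) \<longleftrightarrow> (\<exists>i. 0 < i \<and> i \<le> k \<and> lo i = Suc x)"
proof
  assume "\<exists>p\<in>set (map (\<lambda>i. (lo i, hi i)) t). fst p = Suc x"
  then obtain i where "i \<in> set t" "lo i = Suc x" by auto
  moreover have "i \<noteq> 0"
  proof
    assume "i = 0"
    then show False using \<open>lo i = Suc x\<close> lo_0 by simp
  qed
  moreover have "i \<le> k" using t \<open>i \<in> set t\<close> by (auto simp: less_Suc_eq_le)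
  ultimately show "\<exists>i. 0 < i \<and> i \<le> k \<and> lo i = Suc x" by (metis gr0I)
next
  assume "\<exists>i. 0 < i \<and> i \<le> k \<and> lo i = Suc x"
  then obtain i where i: "i \<le> k" "lo i = Suc x" by blast
  from r x obtain j where j: "j \<in> set t" "lo j \<le> Suc x" "Suc x < hi j"
    unfolding resolved_def by auto
  then have "j \<le> k" using t by auto
  then have "j = i" using gap_unique[of j i] i j by simp
  then show "\<exists>p\<in>set (map (\<lambda>i. (lo i, hi i)) t). fst p = Suc x" using j i by force
qed

end

lemma zip_map_self: "p \<in> set (zip t (map f t)) \<longleftrightarrow> (\<exists>i\<in>set t. p = (i, f i))"
  by (induction t) auto

locale w1_instance = circuit_instance +
  assumes weft: "weft_at_most C 1" and depth: "depth_at_most C d"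
begin

lemma twalks_walks: "w \<in> set (twalks j R g) ==> w \<in> set (walks j R g)"
  by (induction j arbitrary: w) (auto split: if_splits)

lemma length_twalks: "length (twalks j R g) \<le> 2 ^ j"
proof (induction j)
  case (Suc j)
  have *: "length (concat (map f xs)) \<le> 2 * length xs" if "\<And>x. length (f x) \<le> 2"
    for f :: "nat list => nat list list" and xs
    using that by (induction xs) (auto intro: order_trans[OF add_le_mono])
  have "length (twalks (Suc j) R g) \<le> 2 * length (twalks j R g)"
    unfolding twalks.simps by (rule *) (auto simp: large_def)
  with Suc show ?case by simp
qed simp

lemma length_all_twalks: "length (all_twalks j R g) < width j"
proof (induction j)
  case (Suc j)
  then show ?case using length_twalks[of "Suc j" g] by (simp add: width_def)
qed (simp add: width_def)

lemma length_cone: "length (cone d R g) \<le> width d"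
  unfolding cone_def using length_all_twalks[of d g] length_filter_le[of "\<lambda>i. kd R i = 0" "map (\<lambda>w. hd w) (all_twalks d R g)"]
  unfolding length_map by linarith

lemma length_top_large: "length (top_large d R) \<le> width d"
proof -
  have "length (top_large d R) \<le> length (filter (\<lambda>i. large R i) (map (\<lambda>w. hd w) (all_twalks d R (length R - 1))))"
    unfolding top_large_def length_dedup by (rule card_length)
  also have "\<dots> \<le> length (all_twalks d R (length R - 1))" by (rule order_trans[OF length_filter_le]) simp
  finally show ?thesis using length_all_twalks[of d "length R - 1"] by simp
qed

lemma set_cone: "x \<in> set (cone d R g) \<longleftrightarrow> kd R x = 0 \<and> (\<exists>j\<le>d. \<exists>w\<in>set (twalks j R g). hd w = x)"
  unfolding cone_def set_filter set_map mem_Collect_eq image_iff by (metis set_all_twalks)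

lemma cone_less: "g < n ==> x \<in> set (cone d R g) ==> x < n"
proof -
  assume g: "g < n" and "x \<in> set (cone d R g)"
  then obtain j w where "w \<in> set (twalks j R g)" "hd w = x" by (auto simp: set_cone)
  then have "down w" "hd w = x" using twalks_walks walks_iff[OF g] by blast+
  then show "x < n" by (auto simp: down_def)
qed

lemma set_top_large: "x \<in> set (top_large d R) \<longleftrightarrow> large R x \<and> (\<exists>j\<le>d. \<exists>w\<in>set (twalks j R (n - 1)). hd w = x)"
  unfolding top_large_def dedup set_filter set_map mem_Collect_eq image_iff lenR by (metis set_all_twalks)

lemma out_less: "n - 1 < n" using n_pos by simp

lemma top_large_less: "g \<in> set (top_large d R) ==> g < n"
proof -
  assume "g \<in> set (top_large d R)"
  then obtain j w where "w \<in> set (twalks j R (n - 1))" "hd w = g" by (auto simp: set_top_large)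
  then have "down w" "hd w = g" using twalks_walks walks_iff[OF out_less] by blast+
  then show "g < n" by (auto simp: down_def)
qed

lemma no_long_twalks: "twalks (Suc d) R (n - 1) = []"
proof -
  have "walks (Suc d) R (n - 1) = []" using valid_iff weft depth by (simp add: valid_def lenR)
  then have "set (twalks (Suc d) R (n - 1)) \<subseteq> {}" using twalks_walks by fastforce
  then show ?thesis unfolding subset_empty set_empty .
qed

text \<open>A walk into a predecessor of a topmost large gate extends to an input-output path
  through this gate, which uses up the weft and at least one step of the depth.\<close>

lemma child:
  assumes g: "g \<in> set (top_large d R)" and j: "j \<in> set (pr R g)" and w: "w \<in> set (walks i R j)"
  shows "\<not> large R (hd w)" "i < d"
proof -
  obtain l w2 where w2: "w2 \<in> set (twalks l R (n - 1))" "hd w2 = g" "large R g"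
    using g by (auto simp: set_top_large)
  then have d2: "down w2" "last w2 = n - 1" using walks_iff[OF out_less] twalks_walks by blast+
  have "g < n" using top_large_less[OF g] .
  then have "j < n" using pred_less[OF _ j] by simp
  then have d1: "down w" "last w = j" "length w = Suc i" using walks_iff w by auto
  have ne: "w \<noteq> []" "w2 \<noteq> []" using d1 d2 by (auto simp: down_def)
  have "down (w @ w2)" using down_append[OF ne] d1 d2 w2 j by simp
  then obtain u where u: "down (u @ w @ w2)" "kd R (hd (u @ w @ w2)) = 0" using extend_walk by blast
  then have p: "input_output_path C (u @ w @ w2)"
    using d2 ne by (simp add: input_output_path_down)
  have f: "filter (\<lambda>i. length (preds (C ! i)) > 2) xs = filter (\<lambda>i. large R i) xs" if "\<forall>i\<in>set xs. i < n" for xs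
    using that by (intro filter_cong) (auto simp: large_def pr_preds)
  have "length (filter (\<lambda>i. large R i) (u @ w @ w2)) \<le> 1"
    using weft p f[of "u @ w @ w2"] u(1) unfolding weft_at_most_def down_def by auto
  moreover have "filter (\<lambda>i. large R i) w2 \<noteq> []"
    using w2(2,3) ne(2) hd_in_set[of w2] unfolding filter_empty_conv by blast
  ultimately have "length (filter (\<lambda>i. large R i) w) = 0" by (cases "filter (\<lambda>i. large R i) w2") auto
  then show "\<not> large R (hd w)" using ne(1) by (auto simp: filter_empty_conv)
  have "length (u @ w @ w2) - 1 \<le> d" using depth p unfolding depth_at_most_def by blast
  then show "i < d" using d1(3) ne by (cases w2) auto
qed

lemma child_twalks: "g \<in> set (top_large d R) ==> j \<in> set (pr R g) ==> twalks (Suc d) R j = []"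
proof (rule ccontr)
  assume g: "g \<in> set (top_large d R)" "j \<in> set (pr R g)" and ne: "twalks (Suc d) R j \<noteq> []"
  obtain w where "w \<in> set (twalks (Suc d) R j)" using list.set_sel(1)[OF ne] by blast
  then have "w \<in> set (walks (Suc d) R j)" by (rule twalks_walks)
  from child(2)[OF g this] show False by simp
qed

context
  fixes a :: "nat => bool"
begin

definition vals :: "bool list" where "vals = circuit_values a C"

lemma length_vals: "length vals = n"
  unfolding vals_def circuit_values_def n_def by (rule foldl_snoc)

lemma R_nth: "i < n ==> R ! i = (kd R i, pr R i)"
  by (simp add: kd_def pr_def lenR)

lemma R_kinds:
  assumes "i < n"
  obtains "kd R i = 0" "C ! i = GIn" | j where "kd R i = 1" "C ! i = GNot j" "pr R i = [j]"
  | "kd R i = 2" "C ! i = GAnd (pr R i)" | "kd R i = 3" "C ! i = GOr (pr R i)"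
  using assms that unfolding kd_def pr_def R_def n_def by (cases "C ! i") auto

lemma vals_nth:
  assumes i: "i < n"
  shows "vals ! i = (if kd R i = 0 then a i else if kd R i = 1 then \<not> vals ! hd (pr R i)
    else if kd R i = 2 then \<forall>j\<in>set (pr R i). vals ! j else \<exists>j\<in>set (pr R i). vals ! j)"
proof -
  have v: "vals ! i = gate_value a (take i vals) (C ! i)"
    using foldl_snoc(2)[of i C "gate_value a"] i unfolding vals_def circuit_values_def n_def by simp
  have l: "length (take i vals) = i" using i length_vals by simp
  have t: "take i vals ! j = vals ! j" if "j \<in> set (pr R i)" for j
    using pred_less[OF i that] by simp
  from i show ?thesis
    by (rule R_kinds) (auto simp: v l t simp del: length_take)
qed

lemma local_eval_nth:
  fixes gaps :: gaps and z :: guess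
  assumes i: "i < n" and z: "\<not> (\<exists>e\<in>set z. fst e = i)"
  defines "le \<equiv> local_eval gaps z R"
  shows "le ! i = (if kd R i = 0 then \<exists>p\<in>set gaps. fst p = Suc i else if kd R i = 1 then \<not> le ! hd (pr R i)
    else if kd R i = 2 then \<forall>j\<in>set (pr R i). le ! j else \<exists>j\<in>set (pr R i). le ! j)"
proof -
  have v: "le ! i = gate_eval gaps z (take i le) (R ! i)"
    using foldl_snoc(2)[of i R "gate_eval gaps z"] i unfolding le_def local_eval_def lenR by simp
  have len: "length le = n" unfolding le_def local_eval_def lenR[symmetric] by (rule foldl_snoc)
  have l: "length (take i le) = i" using i len by simp
  have t: "get False (take i le) j = le ! j" if "j \<in> set (pr R i)" for j
    using pred_less[OF i that] len i by (simp add: get_def)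
  have z': "(\<exists>e\<in>set z. fst e = i) = False" using z by simp
  from i show ?thesis
    unfolding v gate_eval_def l z' R_nth[OF i] fst_conv snd_conv
    by (rule R_kinds) (simp_all add: t del: length_take)
qed

lemma local_eval_override:
  assumes i: "i < n" and z: "\<exists>e\<in>set z. fst e = i" "\<forall>e\<in>set z. fst (snd e) = vals ! fst e"
  shows "local_eval gaps z R ! i = vals ! i"
proof -
  have v: "local_eval gaps z R ! i = gate_eval gaps z (take i (local_eval gaps z R)) (R ! i)"
    using foldl_snoc(2)[of i R "gate_eval gaps z"] i unfolding local_eval_def lenR by simp
  have "length (local_eval gaps z R) = n" unfolding local_eval_def lenR[symmetric] by (rule foldl_snoc)
  then have l: "length (take i (local_eval gaps z R)) = i" using i by simp
  have "(\<exists>e\<in>set z. fst e = i \<and> fst (snd e)) \<longleftrightarrow> vals ! i" using z by metis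
  then show ?thesis unfolding v gate_eval_def l using z(1) by argo
qed

lemma length_local_eval: "length (local_eval gaps z R) = n"
  unfolding local_eval_def lenR[symmetric] by (rule foldl_snoc)

text \<open>Local values may be wrong at gates whose inputs are not resolved. The induction is
  therefore restricted to gates on truncated walks from \<open>g\<close>; by \<open>short\<close>,
  the predecessors of such a gate are again on walks of at most \<open>d\<close> steps, unless its
  value is guessed.\<close>

lemma local_eval_correct:
  assumes g: "g < n" and short: "twalks (Suc d) R g = []"
    and inp: "\<And>x. x \<in> set (cone d R g) ==> (\<exists>p\<in>set gaps. fst p = Suc x) \<longleftrightarrow> a x"
    and lg: "\<And>j w. j \<le> d ==> w \<in> set (twalks j R g) ==> large R (hd w) ==> \<exists>e\<in>set z. fst e = hd w"
    and z: "\<forall>e\<in>set z. fst (snd e) = vals ! fst e"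
  shows "get False (local_eval gaps z R) g = vals ! g"
proof -
  have "\<forall>j w. j \<le> d --> w \<in> set (twalks j R g) --> hd w = i --> local_eval gaps z R ! i = vals ! i" for i
  proof (induction i rule: less_induct)
    case (less i)
    show ?case
    proof (intro allI impI)
      fix j w assume jw: "j \<le> d" "w \<in> set (twalks j R g)" "hd w = i"
      have "down w" using twalks_walks[OF jw(2)] walks_iff[OF g] by simp
      then have i: "i < n" using jw(3) by (auto simp: down_def)
      show "local_eval gaps z R ! i = vals ! i"
      proof (cases "\<exists>e\<in>set z. fst e = i")
        case True
        then show ?thesis using local_eval_override[OF i] z by blast
      next
        case False
        then have nl: "\<not> large R i" using lg jw by blast
        have p: "local_eval gaps z R ! m = vals ! m" if "m \<in> set (pr R i)" for m
        proof -
          have mw: "m # w \<in> set (twalks (Suc j) R g)" using that nl jw by auto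
          have "j \<noteq> d" using mw short by (metis empty_iff empty_set)
          then have "j < d" using jw(1) by simp
          then show ?thesis using less mw pred_less[OF i that] by (metis Suc_leI list.sel(1))
        qed
        have inp': "kd R i = 0 ==> (\<exists>p\<in>set gaps. fst p = Suc i) \<longleftrightarrow> a i"
          using inp jw by (auto simp: set_cone)
        have h: "kd R i = 1 ==> hd (pr R i) \<in> set (pr R i)"
          using i by (rule R_kinds) auto
        show ?thesis unfolding vals_nth[OF i] local_eval_nth[OF i False]
          using p inp' h by auto
      qed
    qed
  qed
  moreover have "[g] \<in> set (twalks 0 R g)" by simp
  ultimately have "local_eval gaps z R ! g = vals ! g" by (metis le0 list.sel(1))
  then show ?thesis using g by (simp add: length_local_eval)
qed

lemma satisfies: "circuit_satisfies a C \<longleftrightarrow> vals ! (n - 1)"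
  unfolding circuit_satisfies_def vals_def[symmetric]
  using length_vals n_pos by (subst last_conv_nth) auto

lemma large_kinds: "g < n ==> large R g ==> kd R g = 2 \<or> kd R g = 3"
proof -
  assume g: "g < n" and l: "large R g"
  from g show ?thesis by (rule R_kinds) (use l pr_preds[OF g] in \<open>auto simp: large_def\<close>)
qed

end

end

lemma length_n_lists': "length (List.n_lists m xs) = length xs ^ m"
  by (induction m) (simp_all add: length_concat comp_def sum_list_triv)

lemma length_w1_indices: "length (w1_indices d k) = Suc k ^ width d"
  by (simp add: w1_indices_def length_n_lists' del: upt_Suc)

lemma set_w1_indices: "t \<in> set (w1_indices d k) \<longleftrightarrow> length t = width d \<and> set t \<subseteq> {0..<Suc k}"
  unfolding w1_indices_def set_n_lists set_upt by blast

lemma set_pairs: "p \<in> set (concat (map (\<lambda>a. map (\<lambda>b. (a, b)) ys) xs)) \<longleftrightarrow> fst p \<in> set xs \<and> snd p \<in> set ys"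
  by (cases p) auto

lemma set_w1_domain: "u \<in> set (w1_domain d R) \<longleftrightarrow>
    length (fst u) = width d \<and> (\<forall>e\<in>set (fst u). snd e < length R) \<and>
    length (snd u) = width d \<and> (\<forall>p\<in>set (snd u). fst p < length R + 2 \<and> snd p < length R + 2)"
proof -
  have "x \<in> set [False, True]" for x by (cases x) auto
  then show ?thesis
    unfolding w1_domain_def set_pairs set_n_lists subset_eq mem_Collect_eq set_upt
    by simp
qed

context w1_instance
begin

context
  fixes k :: nat and lo hi :: "nat => nat" and a :: "nat => bool"
  assumes gs: "gap_system k n lo hi"
    and a: "\<And>x. x < n ==> kd R x = 0 ==> a x \<longleftrightarrow> (\<exists>i. 0 < i \<and> i \<le> k \<and> lo i = Suc x)"
begin

lemma eval_gaps:
  assumes t: "set t \<subseteq> {0..<Suc k}" and g: "g < n" "twalks (Suc d) R g = []"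
    and r: "resolved (map (\<lambda>i. (lo i, hi i)) t) (cone d R g)"
    and lg: "\<And>j w. j \<le> d ==> w \<in> set (twalks j R g) ==> large R (hd w) ==> \<exists>e\<in>set z. fst e = hd w"
    and z: "\<forall>e\<in>set z. fst (snd e) = vals a ! fst e"
  shows "get False (local_eval (map (\<lambda>i. (lo i, hi i)) t) z R) g = vals a ! g"
proof (rule local_eval_correct[OF g _ lg z])
  fix x assume x: "x \<in> set (cone d R g)"
  have "x < n" using cone_less[OF g(1) x] .
  moreover have "kd R x = 0" using x by (simp add: set_cone)
  ultimately show "(\<exists>p\<in>set (map (\<lambda>i. (lo i, hi i)) t). fst p = Suc x) \<longleftrightarrow> a x"
    using gap_system.resolved_value[OF gs t r x] a by simp
qed

lemma eval_child:
  assumes g: "g \<in> set (top_large d R)" "j \<in> set (pr R g)" and t: "set t \<subseteq> {0..<Suc k}"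
    and r: "resolved (map (\<lambda>i. (lo i, hi i)) t) (cone d R j)"
  shows "get False (local_eval (map (\<lambda>i. (lo i, hi i)) t) [] R) j = vals a ! j"
proof (rule eval_gaps[OF t _ child_twalks[OF g] r])
  show "j < n" using pred_less[OF top_large_less[OF g(1)] g(2)] top_large_less[OF g(1)] by simp
  show "\<exists>e\<in>set []. fst e = hd w" if "w \<in> set (twalks i R j)" "large R (hd w)" for i w
    using child(1)[OF g twalks_walks[OF that(1)]] that(2) by blast
qed simp

lemma eval_out:
  assumes t: "set t \<subseteq> {0..<Suc k}"
    and r: "resolved (map (\<lambda>i. (lo i, hi i)) t) (cone d R (n - 1))"
    and len: "length (top_large d R) \<le> length zs"
    and z: "\<forall>e\<in>set (zip (top_large d R) zs). fst (snd e) = vals a ! fst e"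
  shows "get False (local_eval (map (\<lambda>i. (lo i, hi i)) t) (zip (top_large d R) zs) R) (n - 1) = vals a ! (n - 1)"
proof (rule eval_gaps[OF t out_less no_long_twalks r _ z])
  fix j w assume "j \<le> d" "w \<in> set (twalks j R (n - 1))" "large R (hd w)"
  then have "hd w \<in> set (top_large d R)" by (auto simp: set_top_large)
  then have "hd w \<in> set (map fst (zip (top_large d R) zs))" using len by (simp add: map_fst_zip_take del: set_map)
  then show "\<exists>e\<in>set (zip (top_large d R) zs). fst e = hd w" by force
qed

end

lemma csp_if_satisfiable:
  assumes sat: "circuit_satisfies a C" and w: "weight a C = k"
  shows "csp_sat (w1_csp d R k)"
proof -
  define X where "X = {i. i < n \<and> C ! i = GIn \<and> a i}"
  define ps where "ps = sorted_list_of_set (Suc ` X)"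
  have fin: "finite X" by (simp add: X_def)
  have "card X = k" using w by (simp add: weight_def X_def n_def)
  then have len: "length ps = k" by (simp add: ps_def card_image)
  have set_ps: "set ps = Suc ` X" using fin by (simp add: ps_def)
  have sorted: "sorted_wrt (<) ps" by (simp add: ps_def)
  define lo where "lo i = (if i = 0 then 0 else ps ! (i - 1))" for i
  define hi where "hi i = (if i = k then Suc n else ps ! i)" for i
  have ps_X: "i < k ==> \<exists>x\<in>X. ps ! i = Suc x" for i
    using set_ps len nth_mem[of i ps] by auto
  have gs: "gap_system k n lo hi"
  proof
    fix i assume i: "i \<le> k"
    show "lo i < hi i"
    proof (cases "i = k")
      case True
      show ?thesis
      proof (cases "k = 0")
        case False
        then obtain x where "x \<in> X" "ps ! (k - 1) = Suc x" using ps_X[of "k - 1"] by auto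
        then show ?thesis using True False by (simp add: lo_def hi_def X_def)
      qed (simp add: True lo_def hi_def)
    next
      case False
      then have ik: "i < k" using i by simp
      show ?thesis
      proof (cases "i = 0")
        case True
        then show ?thesis using ps_X[OF ik] False by (auto simp: lo_def hi_def)
      next
        case False
        then show ?thesis using sorted_wrt_nth_less[OF sorted, of "i - 1" i] ik len by (simp add: lo_def hi_def)
      qed
    qed
  qed (simp_all add: lo_def hi_def)
  interpret gs: gap_system k n lo hi by (rule gs)
  have a: "a x \<longleftrightarrow> (\<exists>i. 0 < i \<and> i \<le> k \<and> lo i = Suc x)" if x: "x < n" "kd R x = 0" for x
  proof -
    have "a x \<longleftrightarrow> Suc x \<in> set ps" using x by (auto simp: set_ps X_def kd_in)
    also have "\<dots> \<longleftrightarrow> (\<exists>i<k. ps ! i = Suc x)" by (auto simp: in_set_conv_nth len)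
    also have "\<dots> \<longleftrightarrow> (\<exists>i. 0 < i \<and> i \<le> k \<and> lo i = Suc x)"
    proof
      assume "\<exists>i<k. ps ! i = Suc x"
      then obtain i where "i < k" "ps ! i = Suc x" by blast
      then show "\<exists>i. 0 < i \<and> i \<le> k \<and> lo i = Suc x" by (intro exI[of _ "Suc i"]) (simp add: lo_def)
    next
      assume "\<exists>i. 0 < i \<and> i \<le> k \<and> lo i = Suc x"
      then obtain i where "0 < i" "i \<le> k" "lo i = Suc x" by blast
      then show "\<exists>i<k. ps ! i = Suc x" by (intro exI[of _ "i - 1"]) (auto simp: lo_def)
    qed
    finally show ?thesis .
  qed
  define L where "L = top_large d R"
  \<comment> \<open>Where no predecessor has the value of the gate, no witness will be asked for,
    and position 0 keeps the guess within the domain.\<close>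
  define wit where "wit g = (if \<exists>j\<in>set (pr R g). vals a ! j = vals a ! g
    then SOME j. j \<in> set (pr R g) \<and> vals a ! j = vals a ! g else 0)" for g
  have wit: "wit g \<in> set (pr R g) \<and> vals a ! wit g = vals a ! g"
    if "\<exists>j\<in>set (pr R g). vals a ! j = vals a ! g" for g
    unfolding wit_def using that someI_ex[of "\<lambda>j. j \<in> set (pr R g) \<and> vals a ! j = vals a ! g"] by auto
  \<comment> \<open>There may be fewer large gates than \<open>width d\<close>; the padding is cut
    off again by \<open>zip\<close>.\<close>
  define zs where "zs = map (\<lambda>i. if i < length L then (vals a ! (L ! i), wit (L ! i)) else (False, 0)) [0..<width d]"
  have lL: "length L \<le> width d" unfolding L_def by (rule length_top_large)
  have zip_zs: "e \<in> set (zip L zs) ==> fst e \<in> set L \<and> snd e = (vals a ! fst e, wit (fst e))" for e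
    using lL by (auto simp: zs_def set_zip)
  define Y where "Y t = (zs, map (\<lambda>i. (lo i, hi i)) t)" for t
  have hi_le: "hi i \<le> Suc n" if "i \<le> k" for i
    using gs.hi_lo[of i] gs.lo_le[of "Suc i"] gs.hi_k that by (cases "i = k") auto
  have dom: "Y t \<in> set (w1_domain d R)" if t: "t \<in> set (w1_indices d k)" for t
  proof -
    have "snd e < n" if e: "e \<in> set zs" for e
    proof -
      from e obtain i where "i < width d" "e = (if i < length L then (vals a ! (L ! i), wit (L ! i)) else (False, 0))"
        by (auto simp: zs_def)
      moreover have "wit (L ! i) < n" if "i < length L"
      proof -
        have g: "L ! i < n" using that top_large_less[of "L ! i"] by (simp add: L_def)
        show ?thesis
        proof (cases "\<exists>j\<in>set (pr R (L ! i)). vals a ! j = vals a ! (L ! i)")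
          case True
          from wit[OF True] show ?thesis using pred_less[OF g] g by (meson less_trans)
        next
          case False
          then show ?thesis using n_pos by (simp add: wit_def)
        qed
      qed
      ultimately show ?thesis using n_pos by (auto split: if_splits)
    qed
    moreover have "lo i < n + 2 \<and> hi i < n + 2" if "i \<in> set t" for i
      using t that gs.lo_le[of i] hi_le[of i] by (fastforce simp: set_w1_indices)
    ultimately show ?thesis using t by (auto simp: Y_def set_w1_domain set_w1_indices lenR zs_def)
  qed
  have vz: "\<forall>e\<in>set (zip L zs). fst (snd e) = vals a ! fst e" using zip_zs by simp
  have okY: "w1_ok d R k t (Y t)" if t: "t \<in> set (w1_indices d k)" for t
  proof -
    have t': "set t \<subseteq> {0..<Suc k}" using t by (simp add: set_w1_indices)
    show ?thesis unfolding w1_ok_def Y_def fst_conv snd_conv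
    proof (intro conjI ballI impI)
      fix p assume "p \<in> set (zip t (map (\<lambda>i. (lo i, hi i)) t))"
      then obtain i where i: "i \<in> set t" "p = (i, lo i, hi i)" unfolding zip_map_self by auto
      then have ik: "i \<le> k" using t' by auto
      show "fst (snd p) < snd (snd p)" "snd (snd p) \<le> Suc (length R)"
        using gs.lo_hi[OF ik] hi_le[OF ik] i by (simp_all add: lenR)
      show "fst (snd p) = 0" if "fst p = 0" using that i gs.lo_0 by simp
      show "snd (snd p) = Suc (length R)" if "fst p = k" using that i gs.hi_k by (simp add: lenR)
      show "fst (snd p) \<noteq> 0" "kd R (fst (snd p) - 1) = 0" if "fst p \<noteq> 0"
      proof -
        have "\<exists>x\<in>X. lo i = Suc x" using ps_X[of "i - 1"] that i ik by (auto simp: lo_def)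
        then show "fst (snd p) \<noteq> 0" "kd R (fst (snd p) - 1) = 0" using i by (auto simp: X_def kd_in)
      qed
    next
      assume r: "resolved (map (\<lambda>i. (lo i, hi i)) t) (cone d R (length R - 1))"
      show "get False (local_eval (map (\<lambda>i. (lo i, hi i)) t) (zip (top_large d R) zs) R) (length R - 1)"
        using eval_out[OF gs a t' r[unfolded lenR], of zs] sat[unfolded satisfies] vz lL
        by (simp add: lenR L_def zs_def)
    next
      fix e assume e: "e \<in> set (zip (top_large d R) zs)"
      define g where "g = fst e"
      have g: "g \<in> set (top_large d R)" "fst (snd e) = vals a ! g" "snd (snd e) = wit g"
        using zip_zs[of e] e by (auto simp: L_def g_def)
      have gn: "g < n" using top_large_less[OF g(1)] .
      have lg: "large R g" using g(1) by (simp add: set_top_large)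
      note k23 = large_kinds[OF gn lg]
      have "pr R g \<noteq> []" using lg by (auto simp: large_def)
      show "if (kd R (fst e) = 2) = fst (snd e)
         then \<forall>j\<in>set (pr R (fst e)). resolved (map (\<lambda>i. (lo i, hi i)) t) (cone d R j) -->
           get False (local_eval (map (\<lambda>i. (lo i, hi i)) t) [] R) j = fst (snd e)
         else snd (snd e) \<in> set (pr R (fst e)) \<and>
           (resolved (map (\<lambda>i. (lo i, hi i)) t) (cone d R (snd (snd e))) -->
            get False (local_eval (map (\<lambda>i. (lo i, hi i)) t) [] R) (snd (snd e)) = fst (snd e))"
      proof (cases "(kd R g = 2) = (vals a ! g)")
        case True
        have "vals a ! j = vals a ! g" if "j \<in> set (pr R g)" for j
          using True k23 vals_nth[OF gn, of a] that by auto
        then show ?thesis using True eval_child[OF gs a g(1) _ t'] g by (auto simp: g_def)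
      next
        case False
        have "vals a ! g = (if kd R g = 2 then \<forall>j\<in>set (pr R g). vals a ! j else \<exists>j\<in>set (pr R g). vals a ! j)"
          using k23 vals_nth[OF gn, of a] by auto
        then have "\<exists>j\<in>set (pr R g). vals a ! j = vals a ! g"
          using False by metis
        from wit[OF this] show ?thesis using False eval_child[OF gs a g(1) _ t'] g by (auto simp: g_def)
      qed
    qed
  qed
  have rel: "w1_rel d R k t (Y t) u (Y u)" if "t \<in> set (w1_indices d k)" "u \<in> set (w1_indices d k)" for t u
    unfolding w1_rel_def
  proof (intro conjI ballI impI okY that)
    show "fst (Y t) = fst (Y u)" by (simp add: Y_def)
    fix p q assume "p \<in> set (zip t (snd (Y t)))" "q \<in> set (zip u (snd (Y u)))"
    then obtain i j where ij: "p = (i, lo i, hi i)" "q = (j, lo j, hi j)" "i \<in> set t" "j \<in> set u"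
      by (auto simp: Y_def zip_map_self)
    then show "snd p = snd q" if "fst p = fst q" using that by simp
    show "snd (snd p) = fst (snd q)" if "Suc (fst p) = fst q"
      using that ij \<open>u \<in> set (w1_indices d k)\<close> gs.hi_lo[of i] by (auto simp: set_w1_indices)
  qed
  show ?thesis unfolding w1_csp_def csp_sat_all_pairs
    by (rule exI[of _ "\<lambda>i. Y (w1_indices d k ! i)"]) (use dom rel in auto)
qed

lemma satisfiable_if_csp:
  assumes "csp_sat (w1_csp d R k)"
  shows "\<exists>a. circuit_satisfies a C \<and> weight a C = k"
proof -
  define ts where "ts = w1_indices d k"
  obtain Y0 where Y0: "\<forall>i<length ts. Y0 i \<in> set (w1_domain d R)"
    "\<forall>i<length ts. \<forall>j<length ts. w1_rel d R k (ts ! i) (Y0 i) (ts ! j) (Y0 j)"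
    using assms unfolding w1_csp_def csp_sat_all_pairs ts_def by blast
  have "\<forall>t. \<exists>i. t \<in> set ts --> i < length ts \<and> ts ! i = t" by (auto simp: in_set_conv_nth)
  then obtain ix where ix: "\<forall>t. t \<in> set ts --> ix t < length ts \<and> ts ! ix t = t" by metis
  define Y where "Y t = Y0 (ix t)" for t
  have dom: "Y t \<in> set (w1_domain d R)" if "t \<in> set ts" for t using Y0(1) ix that by (simp add: Y_def)
  have rel: "w1_rel d R k t (Y t) u (Y u)" if "t \<in> set ts" "u \<in> set ts" for t u
    using Y0(2) ix that by (metis Y_def)
  have Q: "0 < width d" by (simp add: width_def)
  \<comment> \<open>The variable whose tuple repeats \<open>i\<close> supplies the ends of gap
    \<open>i\<close>; as all pairs of variables are constrained, every other variable has to agree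
    with it.\<close>
  define con where "con i = replicate (width d) i" for i :: nat
  have con: "con i \<in> set ts" if "i \<le> k" for i
    using that by (auto simp: con_def ts_def set_w1_indices)
  define zs where "zs = fst (Y (con 0))"
  have zs: "fst (Y t) = zs" if "t \<in> set ts" for t
    using rel[OF that con[of 0]] by (simp add: w1_rel_def zs_def)
  define lo where "lo i = fst (snd (Y (con i)) ! 0)" for i
  define hi where "hi i = snd (snd (Y (con i)) ! 0)" for i
  have lenY: "length (snd (Y t)) = width d" "length (fst (Y t)) = width d" if "t \<in> set ts" for t
    using dom[OF that] by (simp_all add: set_w1_domain)
  have conzip: "(i, lo i, hi i) \<in> set (zip (con i) (snd (Y (con i))))" if "i \<le> k" for i
    unfolding set_zip using lenY(1)[OF con[OF that]] Q by (auto simp: con_def lo_def hi_def intro!: exI[of _ 0])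
  have gaps: "snd (Y t) = map (\<lambda>i. (lo i, hi i)) t" if t: "t \<in> set ts" for t
  proof (rule nth_equalityI)
    have lt: "length t = width d" using t by (simp add: ts_def set_w1_indices)
    show "length (snd (Y t)) = length (map (\<lambda>i. (lo i, hi i)) t)" using lenY[OF t] lt by simp
    fix b assume b: "b < length (snd (Y t))"
    then have bt: "b < length t" using lenY[OF t] lt by simp
    have tk: "t ! b \<le> k" using t nth_mem[OF bt] by (auto simp: ts_def set_w1_indices)
    have "(t ! b, snd (Y t) ! b) \<in> set (zip t (snd (Y t)))" using b bt by (auto simp: set_zip)
    with rel[OF t con[OF tk]] conzip[OF tk] have "snd (Y t) ! b = (lo (t ! b), hi (t ! b))"
      unfolding w1_rel_def by fastforce
    then show "snd (Y t) ! b = map (\<lambda>i. (lo i, hi i)) t ! b" using bt by simp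
  qed
  have ok: "w1_ok d R k t (zs, map (\<lambda>i. (lo i, hi i)) t)" if "t \<in> set ts" for t
    using rel[OF that that] zs[OF that] gaps[OF that] unfolding w1_rel_def by (metis prod.collapse)
  have okc: "lo i < hi i \<and> (i = 0 --> lo i = 0) \<and> (i = k --> hi i = Suc n) \<and> hi i \<le> Suc n \<and>
     (i \<noteq> 0 --> lo i \<noteq> 0 \<and> kd R (lo i - 1) = 0)" if i: "i \<le> k" for i
  proof -
    have "(i, lo i, hi i) \<in> set (zip (con i) (map (\<lambda>i. (lo i, hi i)) (con i)))"
      using conzip[OF i] gaps[OF con[OF i]] by simp
    then show ?thesis using ok[OF con[OF i]] unfolding w1_ok_def lenR by fastforce
  qed
  have gs: "gap_system k n lo hi"
  proof
    fix i assume "i < k"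
    then have i: "i \<le> k" "Suc i \<le> k" by auto
    show "hi i = lo (Suc i)"
      using rel[OF con[OF i(1)] con[OF i(2)]] conzip[OF i(1)] conzip[OF i(2)] unfolding w1_rel_def by fastforce
  qed (use okc in auto)
  interpret gs: gap_system k n lo hi by (rule gs)
  define a where "a x \<longleftrightarrow> (\<exists>i. 0 < i \<and> i \<le> k \<and> lo i = Suc x)" for x
  have lo_in: "lo i - 1 < n" "C ! (lo i - 1) = GIn" if "0 < i" "i \<le> k" for i
  proof -
    have "lo i \<noteq> 0" "kd R (lo i - 1) = 0" using okc[of i] that by auto
    moreover have "lo i \<le> n" by (rule gs.lo_le) (rule that)
    ultimately show "lo i - 1 < n" "C ! (lo i - 1) = GIn" using kd_in[of "lo i - 1"] by auto
  qed
  have "{x. x < length C \<and> C ! x = GIn \<and> a x} = (\<lambda>i. lo i - 1) ` {1..k}"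
  proof (intro equalityI subsetI)
    fix x assume "x \<in> {x. x < length C \<and> C ! x = GIn \<and> a x}"
    then obtain i where "0 < i" "i \<le> k" "lo i = Suc x" by (auto simp: a_def)
    then show "x \<in> (\<lambda>i. lo i - 1) ` {1..k}" by (intro image_eqI[of _ _ i]) auto
  next
    fix x assume "x \<in> (\<lambda>i. lo i - 1) ` {1..k}"
    then obtain i where "i \<in> {1..k}" "x = lo i - 1" by blast
    then have i: "0 < i" "i \<le> k" "x = lo i - 1" by auto
    moreover have "lo i \<noteq> 0" using okc[of i] i by auto
    ultimately show "x \<in> {x. x < length C \<and> C ! x = GIn \<and> a x}"
      using lo_in[of i] by (auto simp: a_def n_def intro!: exI[of _ i])
  qed
  moreover have "inj_on (\<lambda>i. lo i - 1) {1..k}"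
  proof (rule inj_onI)
    fix i j assume ij: "i \<in> {1..k}" "j \<in> {1..k}" "lo i - 1 = lo j - 1"
    then have "lo i \<noteq> 0" "lo j \<noteq> 0" using okc[of i] okc[of j] by auto
    then have "lo i = lo j" using ij(3) by linarith
    then show "i = j" using gs.lo_inj[of i j] ij by simp
  qed
  ultimately have weight: "weight a C = k" unfolding weight_def by (simp add: card_image)
  have choose: "\<exists>t\<in>set ts. set t \<subseteq> {0..<Suc k} \<and> resolved (map (\<lambda>i. (lo i, hi i)) t) (cone d R g)" if "g < n" for g
    using gs.resolved_choice[OF length_cone, of g] cone_less[OF that] by (auto simp: ts_def set_w1_indices)
  \<comment> \<open>All guesses are the true values: each predecessor involved has its inputs
    resolved at some variable, and the check made there evaluates it correctly.\<close>
  have z: "\<forall>e\<in>set (zip (top_large d R) zs). fst (snd e) = vals a ! fst e"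
  proof
    fix e assume e: "e \<in> set (zip (top_large d R) zs)"
    define g v w where "g = fst e" "v = fst (snd e)" "w = snd (snd e)"
    note gvw = g_v_w_def
    have g: "g \<in> set (top_large d R)" using e set_zip_leftD[of "fst e" "snd e"] by (simp add: gvw)
    have gn: "g < n" using top_large_less[OF g] .
    have lg: "large R g" using g by (simp add: set_top_large)
    note k23 = large_kinds[OF gn lg]
    have chk: "if (kd R g = 2) = v then \<forall>j\<in>set (pr R g). resolved (map (\<lambda>i. (lo i, hi i)) t) (cone d R j) -->
         get False (local_eval (map (\<lambda>i. (lo i, hi i)) t) [] R) j = v
       else w \<in> set (pr R g) \<and> (resolved (map (\<lambda>i. (lo i, hi i)) t) (cone d R w) -->
         get False (local_eval (map (\<lambda>i. (lo i, hi i)) t) [] R) w = v)" if "t \<in> set ts" for t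
      using ok[OF that] e unfolding w1_ok_def fst_conv snd_conv gvw by blast
    have child: "vals a ! j = v" if j: "j \<in> set (pr R g)" and c: "(kd R g = 2) = v \<or> j = w" for j
    proof -
      have "j < n" using pred_less[OF gn j] gn by simp
      then obtain t where t: "t \<in> set ts" "set t \<subseteq> {0..<Suc k}"
        "resolved (map (\<lambda>i. (lo i, hi i)) t) (cone d R j)" using choose by blast
      have "get False (local_eval (map (\<lambda>i. (lo i, hi i)) t) [] R) j = v"
        using chk[OF t(1)] j c t(3) by (auto split: if_splits)
      then show ?thesis using eval_child[OF gs a_def g j t(2,3)] by simp
    qed
    show "fst (snd e) = vals a ! fst e"
    proof (cases "(kd R g = 2) = v")
      case True
      have "pr R g \<noteq> []" using lg by (auto simp: large_def)
      then have "vals a ! g = v" using True child k23 vals_nth[OF gn, of a] by (cases "pr R g") auto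
      then show ?thesis by (simp add: gvw)
    next
      case False
      then have "w \<in> set (pr R g)" using chk[OF con[of 0]] by simp
      then have "vals a ! g = v" using False child[of w] k23 vals_nth[OF gn, of a] by auto
      then show ?thesis by (simp add: gvw)
    qed
  qed
  obtain t where t: "t \<in> set ts" "set t \<subseteq> {0..<Suc k}"
    "resolved (map (\<lambda>i. (lo i, hi i)) t) (cone d R (n - 1))" using choose[OF out_less] by blast
  have "length (top_large d R) \<le> length zs"
    using length_top_large lenY(2)[OF con[of 0]] by (simp add: zs_def)
  from eval_out[OF gs a_def t(2,3) this z] ok[OF t(1)] t(3)
  have "vals a ! (n - 1)" unfolding w1_ok_def by (simp add: lenR)
  then show ?thesis using weight satisfies by blast
qed

lemma w1_csp_correct: "(\<exists>a. circuit_satisfies a C \<and> weight a C = k) \<longleftrightarrow> csp_sat (w1_csp d R k)"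
  using csp_if_satisfiable satisfiable_if_csp by blast

lemma w1_csp_wf: "csp_wf (w1_csp d R k)"
proof -
  have "replicate (width d) (0 :: nat) \<in> set (w1_indices d k)" by (auto simp: set_w1_indices)
  then have "0 < length (w1_indices d k)" by (cases "w1_indices d k") auto
  moreover have "(replicate (width d) (False, 0), replicate (width d) (0, 0)) \<in> set (w1_domain d R)"
    using n_pos by (auto simp: set_w1_domain lenR)
  then have "0 < length (w1_domain d R)" by (cases "w1_domain d R") auto
  ultimately show ?thesis unfolding csp_wf_def w1_csp_def by auto
qed

end

subsection \<open>The reduction\<close>

text \<open>Strings that are no codes of admissible circuits are no-instances, and are mapped to a
  constraint without permitted pairs.\<close>

definition w1_instance_of :: "nat => bool list => csp" where
  "w1_instance_of d y = (if is_code (drop (Suc (ones y)) y) \<and> valid d (parse_circuit (drop (Suc (ones y)) y))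
     then w1_csp d (parse_circuit (drop (Suc (ones y)) y)) (ones y) else (1, 1, [(0, 0, [[False]])]))"

definition w1_reduction :: "nat => bool list => bool list" where
  "w1_reduction d y = enc_nat (steiner_k (w1_instance_of d y)) @ steiner_bits (w1_instance_of d y)"

lemma PF_w1_reduction: "PF (w1_reduction d)"
proof -
  have 1: "PF (\<lambda>y. drop (Suc (ones y)) y)" by (intro PF_ones PF_intros)
  note 2 = PF_comp[OF PF_parse_circuit 1]
  have "PF (w1_instance_of d)" unfolding w1_instance_of_def[abs_def]
    by (intro PF_if PF_conj PF_comp[OF PF_is_code 1] PF_valid[OF 2] PF_w1_csp[OF 2] PF_ones PF_id PF_const)
  note 3 = PF_comp[OF PF_steiner_k this] PF_comp[OF PF_steiner_bits this]
  show ?thesis unfolding w1_reduction_def[abs_def] by (intro PF_append PF_enc_nat 3)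
qed

lemma wf_if_valid:
  assumes "valid d (map rep C)"
  shows "wf_circuit C"
proof -
  let ?R = "map rep C"
  have v: "C \<noteq> []" "\<And>i. i < length C ==> (2 \<le> kd ?R i --> length (dedup (pr ?R i)) = length (pr ?R i) \<and> 2 \<le> length (pr ?R i)) \<and>
        (\<forall>j\<in>set (pr ?R i). j < i)"
    using assms unfolding valid_def by auto
  have "wf_gate (C ! i) \<and> (\<forall>j\<in>set (preds (C ! i)). j < i)" if i: "i < length C" for i
    using v(2)[OF i] i by (cases "C ! i") (auto simp: kd_def pr_def length_dedup card_distinct)
  then show ?thesis using v(1) unfolding wf_circuit_def by blast
qed

lemma w1_reduction:
  "\<exists>x' k'. w1_reduction d (enc_param (x, k)) = enc_param (x', k') \<and> k' \<le> 7 * (Suc k ^ width d * Suc k ^ width d) \<and>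
     ((x, k) \<in> weighted_circuit_sat 1 d \<longleftrightarrow> (x', k') \<in> steiner_orientation)"
proof -
  define I where "I = w1_instance_of d (enc_param (x, k))"
  have drop: "drop (Suc k) (enc_nat k @ x) = x" by (simp add: enc_nat_def)
  have I: "I = (if is_code x \<and> valid d (parse_circuit x) then w1_csp d (parse_circuit x) k else (1, 1, [(0, 0, [[False]])]))"
    unfolding I_def w1_instance_of_def enc_param.simps ones_enc_nat drop ..
  have main: "csp_wf I \<and> ((x, k) \<in> weighted_circuit_sat 1 d \<longleftrightarrow> csp_sat I)"
  proof (cases "is_code x \<and> valid d (parse_circuit x)")
    case True
    then obtain C where C: "x = enc_list enc_gate C" using is_code by blast
    then have pC: "parse_circuit x = map rep C" by (simp add: parse_circuit)
    have wf: "wf_circuit C" by (rule wf_if_valid[of d]) (use True pC in simp)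
    have vi: "weft_at_most C 1 \<and> depth_at_most C d"
      using circuit_instance.valid_iff[of C "map rep C" "length C" d] True pC wf
      unfolding circuit_instance_def by simp
    interpret w1_instance C d "map rep C" "length C"
      by standard (use wf vi in auto)
    have inj: "inj (enc_list enc_gate)" by (rule prefix_free_inj[OF prefix_free_enc_list[OF prefix_free_enc_gate]])
    have "(x, k) \<in> weighted_circuit_sat 1 d \<longleftrightarrow> (\<exists>a. circuit_satisfies a C \<and> weight a C = k)"
      unfolding weighted_circuit_sat_def using C wf vi inj by (auto simp: inj_def)
    then show ?thesis using True pC w1_csp_correct w1_csp_wf by (simp add: I)
  next
    case False
    have "(x, k) \<notin> weighted_circuit_sat 1 d"
    proof
      assume "(x, k) \<in> weighted_circuit_sat 1 d"
      then obtain C where C: "x = enc_list enc_gate C" "wf_circuit C" "weft_at_most C 1" "depth_at_most C d"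
        unfolding weighted_circuit_sat_def by blast
      then have "is_code x" "parse_circuit x = map rep C" using is_code parse_circuit by blast+
      moreover have "valid d (map rep C)"
        using circuit_instance.valid_iff[of C "map rep C" "length C" d] C
        unfolding circuit_instance_def by simp
      ultimately show False using False by simp
    qed
    moreover have "I = (1, 1, [(0, 0, [[False]])])" unfolding I using False by (simp only: if_False)
    ultimately show ?thesis by (auto simp: csp_wf_def csp_sat_def get_def)
  qed
  obtain G T where GT: "steiner_instance G T" "enc_steiner G T = steiner_bits I" "card T = steiner_k I"
    "steiner_orientable G T \<longleftrightarrow> csp_sat I" using steiner_reduction main by metis
  have "(steiner_bits I, steiner_k I) \<in> steiner_orientation \<longleftrightarrow> csp_sat I"
    unfolding steiner_orientation_def using GT enc_steiner_inj by (auto; metis)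
  \<comment> \<open>With \<open>?V\<close> variables and \<open>?V * ?V\<close> constraints there
    are at most \<open>6 * (?V * ?V) + ?V\<close> requests, whence the factor 7.\<close>
  moreover have "steiner_k I \<le> 7 * (Suc k ^ width d * Suc k ^ width d)"
  proof -
    let ?V = "Suc k ^ width d"
    have V: "1 \<le> ?V" by simp
    have "fst I \<le> ?V \<and> length (snd (snd I)) \<le> ?V * ?V"
      unfolding I by (auto simp: w1_csp_def length_w1_indices length_concat comp_def sum_list_triv)
    moreover have "?V \<le> ?V * ?V" using V by simp
    ultimately show ?thesis using steiner_k_bounds(2)[of I] main by linarith
  qed
  ultimately show ?thesis
    unfolding w1_reduction_def I_def[symmetric] using main by (intro exI[of _ "steiner_bits I"] exI[of _ "steiner_k I"]) simp
qed

theorem steiner_orientation_W1_hard: "W_hard 1 steiner_orientation"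
  unfolding W_hard_def
proof
  fix P assume "P \<in> W 1"
  then obtain d where d: "fpt_reducible P (weighted_circuit_sat 1 d)" unfolding W_def by blast
  define g where "g = (\<lambda>k. 7 * (Suc k ^ width d * Suc k ^ width d))"
  have pw: "PF (\<lambda>k. Suc k ^ m)" for m
  proof (induction m)
    case (Suc m)
    then show ?case unfolding power_Suc by (intro PF_mult PF_Suc PF_id)
  qed (simp add: PF_const)
  show "fpt_reducible P steiner_orientation"
  proof (rule fpt_reducible_then_PF[OF d PF_w1_reduction[of d]])
    show "PF g" unfolding g_def by (intro PF_mult PF_const pw)
    show "mono g" unfolding g_def by (intro monoI mult_le_mono power_mono) auto
    show "\<exists>x' k'. w1_reduction d (enc_param (x, k)) = enc_param (x', k') \<and> k' \<le> g k \<and>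
        ((x, k) \<in> weighted_circuit_sat 1 d) = ((x', k') \<in> steiner_orientation)" for x k
      unfolding g_def by (rule w1_reduction)
  qed
qed

section \<open>Sparsification\<close>

type_synonym clause = "(nat \<times> bool) list"

text \<open>Clauses become sublists of the list of all literals, so that equal sets of literals are
  equal lists and the length counts the literals.\<close>

definition canon :: "clause => clause => clause" where
  "canon L c = filter (\<lambda>l. l \<in> set c) L"

definition live :: "clause list => clause list" where
  "live S = filter (\<lambda>c. \<not> (\<exists>d\<in>set S. length d < length c \<and> (\<forall>l\<in>set d. l \<in> set c))) (dedup S)"

definition flower :: "clause list => clause => nat => clause list" where
  "flower S H s = filter (\<lambda>c. length c = s \<and> (\<forall>l\<in>set H. l \<in> set c)) (live S)"

definition petals :: "clause list => clause => nat => clause list" where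
  "petals S H s = map (\<lambda>c. filter (\<lambda>l. l \<notin> set H) c) (flower S H s)"

definition singles :: "clause => clause list" where
  "singles L = map (\<lambda>l. [l]) L"

definition pairs :: "clause => clause list" where
  "pairs L = filter (\<lambda>c. length c = 2) (concat (map (\<lambda>l. map (\<lambda>m. canon L [l, m]) L) L))"

text \<open>A rule consists of a heart, the size of the clauses and the number of petals required.\<close>

definition rules :: "nat => clause => (clause \<times> nat \<times> nat) list" where
  "rules \<theta> L = map (\<lambda>H. (H, 2, \<theta>)) (singles L) @ map (\<lambda>H. (H, 3, \<theta>)) (pairs L) @
     map (\<lambda>H. (H, 3, \<theta> * \<theta>)) (singles L)"

text \<open>The order of \<open>rules\<close> matters, as the first applicable rule will be used.
  When binary petals are added, no literal lies in many live binary clauses and no pair of literals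
  in many live ternary ones.\<close>

definition applicable :: "nat => clause => clause list => (clause \<times> nat \<times> nat) list" where
  "applicable \<theta> L S = filter (\<lambda>r. snd (snd r) \<le> length (flower S (fst r) (fst (snd r)))) (rules \<theta> L)"

text \<open>Selecting from a fixed list of candidates, instead of appending, bounds the size of an
  open branch in terms of \<open>L\<close> alone.\<close>

definition extend :: "clause => clause list => clause list => clause list" where
  "extend L A P = filter (\<lambda>c. c \<in> set A \<or> c \<in> set P) (singles L @ pairs L)"

text \<open>Depth-first search with an explicit stack: the first component holds the open branches,
  each as the list of clauses added so far, the second one the sparse formulas found at the leaves.
  A branch adds either the heart or all the petals.\<close>

definition sparsify_step ::
  "nat => clause => clause list => clause list list \<times> clause list list => clause list list \<times> clause list list" where
  "sparsify_step \<theta> L F z = (if fst z = [] then z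
     else if applicable \<theta> L (F @ hd (fst z)) = [] then (tl (fst z), live (F @ hd (fst z)) # snd z)
     else (extend L (hd (fst z)) [fst (hd (applicable \<theta> L (F @ hd (fst z))))] #
       extend L (hd (fst z)) (petals (F @ hd (fst z)) (fst (hd (applicable \<theta> L (F @ hd (fst z)))))
         (fst (snd (hd (applicable \<theta> L (F @ hd (fst z))))))) # tl (fst z), snd z))"

definition sparsify :: "nat => clause => clause list => nat => clause list list \<times> clause list list" where
  "sparsify \<theta> L F t = foldl (\<lambda>z _. sparsify_step \<theta> L F z) ([[]], []) (replicate t ())"

lemma sz_filter_le: "sz (filter P xs) \<le> sz xs"
  by (induction xs) auto

lemma sz_append_le: "sz (xs @ ys) \<le> sz xs + sz ys"
  by (induction xs) auto

lemma sz_dedup_le: "sz (dedup xs) \<le> sz xs"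
proof -
  have *: "sz (a @ [e]) = sz a + sz e + 1" for a and e :: 'a by (induction a) auto
  have "sz (foldl (\<lambda>a e. if e \<in> set a then a else a @ [e]) a xs) + 1 \<le> sz a + sz xs" for a
  proof (induction xs arbitrary: a)
    case (Cons x xs)
    show ?case using Cons[of a] Cons[of "a @ [x]"] by (simp add: *)
  qed simp
  from this[of "[]"] show ?thesis by (simp add: dedup_def)
qed

lemma sz_live_le: "sz (live S) \<le> sz S"
  unfolding live_def by (rule order_trans[OF sz_filter_le sz_dedup_le])

lemma sz_extend_le: "sz (extend L A P) \<le> sz (singles L @ pairs L)"
  unfolding extend_def by (rule sz_filter_le)

lemma PF_canon:
  assumes "PF L" "PF c" shows "PF (\<lambda>x. canon (L x) (c x))"
  unfolding canon_def by (intro PF_intros assms PF_comp[OF assms(2)])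

lemma PF_live:
  assumes "PF S" shows "PF (\<lambda>x. live (S x))"
  unfolding live_def by (intro PF_dedup PF_intros assms PF_comp[OF assms])

lemma PF_flower:
  assumes "PF S" "PF H" "PF s" shows "PF (\<lambda>x. flower (S x) (H x) (s x))"
  unfolding flower_def by (intro PF_live PF_intros assms PF_comp[OF assms(2)] PF_comp[OF assms(3)])

lemma PF_petals:
  assumes "PF S" "PF H" "PF s" shows "PF (\<lambda>x. petals (S x) (H x) (s x))"
  unfolding petals_def by (intro PF_flower PF_intros assms PF_comp[OF assms(2)])

lemma PF_singles: "PF L ==> PF (\<lambda>x. singles (L x))"
  unfolding singles_def by (intro PF_intros)

lemma PF_pairs:
  assumes "PF L" shows "PF (\<lambda>x. pairs (L x))"
  unfolding pairs_def by (intro PF_canon PF_intros assms PF_comp[OF assms])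

lemma PF_rules:
  assumes "PF \<theta>" "PF L" shows "PF (\<lambda>x. rules (\<theta> x) (L x))"
  unfolding rules_def by (intro PF_singles PF_pairs PF_intros assms PF_comp[OF assms(1)])

lemma PF_applicable:
  assumes "PF \<theta>" "PF L" "PF S" shows "PF (\<lambda>x. applicable (\<theta> x) (L x) (S x))"
  unfolding applicable_def by (intro PF_flower PF_rules PF_intros assms PF_comp[OF assms(3)])

lemma PF_extend:
  assumes "PF L" "PF A" "PF P" shows "PF (\<lambda>x. extend (L x) (A x) (P x))"
  unfolding extend_def by (intro PF_singles PF_pairs PF_intros assms PF_comp[OF assms(2)] PF_comp[OF assms(3)])

lemma PF_sparsify_step:
  assumes "PF \<theta>" "PF L" "PF F" "PF z" shows "PF (\<lambda>x. sparsify_step (\<theta> x) (L x) (F x) (z x))"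
  unfolding sparsify_step_def
  by (intro PF_if PF_Pair PF_Cons PF_eq PF_live PF_extend PF_petals PF_applicable PF_append PF_hd PF_tl assms
      PF_const[of "[]"] PF_fst PF_snd)

lemma PF_sparsify:
  assumes "PF \<theta>" "PF L" "PF F" "PF t" shows "PF (\<lambda>x. sparsify (\<theta> x) (L x) (F x) (t x))"
  unfolding sparsify_def
proof (rule PF_foldl_add[where B = "\<lambda>x. 5 + (sz (F x) + 2 * sz (singles (L x) @ pairs (L x)))"])
  show "polyb (\<lambda>x. 5 + (sz (F x) + 2 * sz (singles (L x) @ pairs (L x))))"
    by (intro polyb_add polyb_mult polyb_const polyb_sz_PF PF_append PF_singles PF_pairs assms)
  show "sz (sparsify_step (\<theta> x) (L x) (F x) a) \<le> sz a + (5 + (sz (F x) + 2 * sz (singles (L x) @ pairs (L x))))" for x a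
  proof (cases a)
    case (Pair st lv)
    show ?thesis
    proof (cases st)
      case Nil
      then show ?thesis by (simp add: sparsify_step_def Pair)
    next
      case (Cons A rest)
      have "sz (live (F x @ A)) \<le> sz (F x) + sz A" by (rule order_trans[OF sz_live_le sz_append_le])
      moreover have "sz (extend (L x) A P) \<le> sz (singles (L x) @ pairs (L x))" for P by (rule sz_extend_le)
      note this[of "[fst (hd (applicable (\<theta> x) (L x) (F x @ A)))]"]
        this[of "petals (F x @ A) (fst (hd (applicable (\<theta> x) (L x) (F x @ A)))) (fst (snd (hd (applicable (\<theta> x) (L x) (F x @ A)))))"]
      ultimately show ?thesis unfolding sparsify_step_def Pair Cons by simp
    qed
  qed
  show "PF (\<lambda>z. sparsify_step (\<theta> (fst z)) (L (fst z)) (F (fst z)) (fst (snd z)))"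
    by (intro PF_sparsify_step PF_comp[OF assms(1)] PF_comp[OF assms(2)] PF_comp[OF assms(3)] PF_fst PF_snd PF_id)
qed (intro PF_intros assms)+

section \<open>Correctness of the branching and its budget\<close>

definition models :: "(nat => bool) => clause list => bool" where
  "models a S \<longleftrightarrow> (\<forall>c\<in>set S. \<exists>l\<in>set c. a (fst l) = snd l)"

lemma cnf_satisfiable_iff: "cnf_satisfiable F \<longleftrightarrow> (\<exists>a. models a F)"
  unfolding cnf_satisfiable_def models_def by (simp add: split_def)

lemma set_live: "c \<in> set (live S) \<longleftrightarrow> c \<in> set S \<and> \<not> (\<exists>d\<in>set S. length d < length c \<and> set d \<subseteq> set c)"
  unfolding live_def set_filter dedup mem_Collect_eq subset_eq ..

lemma distinct_live: "distinct (live S)"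
  unfolding live_def by (intro distinct_filter dedup)

lemma models_live: "models a (live S) \<longleftrightarrow> models a S"
proof
  assume m: "models a (live S)"
  have "c \<in> set S --> (\<exists>l\<in>set c. a (fst l) = snd l)" for c
  proof (induction "length c" arbitrary: c rule: less_induct)
    case less
    show ?case
    proof
      assume c: "c \<in> set S"
      show "\<exists>l\<in>set c. a (fst l) = snd l"
      proof (cases "c \<in> set (live S)")
        case True
        then show ?thesis using m by (simp add: models_def)
      next
        case False
        then obtain d where "d \<in> set S" "length d < length c" "set d \<subseteq> set c" using c by (auto simp: set_live)
        then show ?thesis using less by blast
      qed
    qed
  qed
  then show "models a S" by (simp add: models_def)
qed (simp add: models_def set_live)

text \<open>The selected rule comes with the failure of all rules in the preceding groups.\<close>

lemma hd_filter_append3: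
  assumes "filter P (xs @ ys @ zs) \<noteq> []"
  defines "r \<equiv> hd (filter P (xs @ ys @ zs))"
  shows "P r \<and> (r \<in> set xs \<or> r \<in> set ys \<and> (\<forall>x\<in>set xs. \<not> P x) \<or> r \<in> set zs \<and> (\<forall>x\<in>set xs \<union> set ys. \<not> P x))"
proof -
  have h: "P (hd (filter P us)) \<and> hd (filter P us) \<in> set us" if "filter P us \<noteq> []" for us
    using hd_in_set[OF that] by simp
  show ?thesis
  proof (cases "filter P xs = []")
    case x: True
    then have x': "\<forall>x\<in>set xs. \<not> P x" by (simp add: filter_empty_conv)
    show ?thesis
    proof (cases "filter P ys = []")
      case y: True
      then have y': "\<forall>x\<in>set ys. \<not> P x" by (simp add: filter_empty_conv)
      have "r = hd (filter P zs)" "filter P zs \<noteq> []" using assms(1) x y by (simp_all add: r_def)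
      then show ?thesis using h[of zs] x' y' by auto
    next
      case False
      then have "r = hd (filter P ys)" using x by (simp add: r_def)
      then show ?thesis using h[OF False] x' by auto
    qed
  next
    case False
    then have "r = hd (filter P xs)" by (simp add: r_def)
    then show ?thesis using h[OF False] by auto
  qed
qed

locale sparsification =
  fixes L :: clause and F :: "clause list" and \<theta> :: nat
  assumes dL: "distinct L" and F_canon: "c \<in> set F ==> canon L c = c"
    and F3: "c \<in> set F ==> length c \<le> 3" and \<theta>: "1 \<le> \<theta>"
begin

lemma canon_canon: "canon L (canon L c) = canon L c"
  unfolding canon_def by (rule filter_cong) auto

lemma canonical_filter: "canon L c = c ==> canon L (filter P c) = filter P c"
proof -
  assume "canon L c = c"
  then have "filter P (filter (\<lambda>l. l \<in> set c) L) = filter P c" by (simp add: canon_def)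
  moreover have "filter P (filter (\<lambda>l. l \<in> set c) L) = filter (\<lambda>l. l \<in> set (filter P c)) L"
    unfolding filter_filter by (rule filter_cong) auto
  ultimately show ?thesis by (simp add: canon_def)
qed

lemma canonicalD: "canon L c = c ==> distinct c \<and> set c \<subseteq> set L \<and> length c = card (set c)"
proof -
  assume c: "canon L c = c"
  have "distinct (canon L c)" "set (canon L c) \<subseteq> set L" unfolding canon_def using dL by auto
  then show ?thesis using c distinct_card by metis
qed

lemma canonical_eqI: "canon L c = c ==> canon L d = d ==> set c = set d ==> c = d"
  unfolding canon_def by metis

lemma canon_single: "l \<in> set L ==> canon L [l] = [l]"
proof -
  assume l: "l \<in> set L"
  have d: "distinct (canon L [l])" using dL by (simp add: canon_def)
  have "set (canon L [l]) = {l}" using l by (auto simp: canon_def)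
  then show ?thesis using d by (cases "canon L [l]"; cases "tl (canon L [l])") auto
qed

lemma set_candidates: "c \<in> set (singles L @ pairs L) \<longleftrightarrow> canon L c = c \<and> (length c = 1 \<or> length c = 2)"
proof
  assume "c \<in> set (singles L @ pairs L)"
  then show "canon L c = c \<and> (length c = 1 \<or> length c = 2)"
    by (auto simp: singles_def pairs_def canon_single canon_canon)
next
  assume c: "canon L c = c \<and> (length c = 1 \<or> length c = 2)"
  then have s: "set c \<subseteq> set L" using canonicalD by blast
  show "c \<in> set (singles L @ pairs L)"
  proof (cases "length c = 1")
    case True
    then obtain l where "c = [l]" by (auto simp: length_Suc_conv)
    then show ?thesis using s by (simp add: singles_def)
  next
    case False
    then obtain l m where lm: "c = [l, m]" using c by (auto simp: length_Suc_conv numeral_2_eq_2)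
    then have "c = canon L [l, m]" "l \<in> set L" "m \<in> set L" "length c = 2" using c s by auto
    then show ?thesis unfolding pairs_def by auto
  qed
qed

definition U where "U A = {l. [l] \<in> set A}"
definition L2 where "L2 A = {c \<in> set A. length c = 2 \<and> c \<in> set (live (F @ A))}"
text \<open>A unit clause kills at most \<open>2 * \<theta>\<close> added binary clauses, so that every addition decreases the budget.\<close>

definition B where "B A = 4 * \<theta> * (length L - card (U A)) - card (L2 A)"

definition inv where
  "inv A \<longleftrightarrow> set A \<subseteq> set (singles L @ pairs L) \<and> (\<forall>l. card {c \<in> L2 A. l \<in> set c} \<le> 2 * \<theta>)"

lemma finite_L2: "finite (L2 A)" by (simp add: L2_def)

lemma U_subset: "set A \<subseteq> set (singles L @ pairs L) ==> U A \<subseteq> set L"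
proof
  fix l assume "set A \<subseteq> set (singles L @ pairs L)" "l \<in> U A"
  then have "canon L [l] = [l]" using set_candidates by (auto simp: U_def)
  from canonicalD[OF this] show "l \<in> set L" by simp
qed

text \<open>A live binary clause contains no added unit, so it can be counted at its first literal,
  one of those that are not yet units. In particular, the subtraction in \<open>B\<close> does not
  truncate.\<close>

lemma L2_bound:
  assumes "inv A" shows "card (L2 A) \<le> 2 * \<theta> * (length L - card (U A))"
proof -
  have A: "set A \<subseteq> set (singles L @ pairs L)" and d: "\<And>l. card {c \<in> L2 A. l \<in> set c} \<le> 2 * \<theta>"
    using assms by (auto simp: inv_def)
  have "L2 A \<subseteq> (\<Union>l\<in>set L - U A. {c \<in> L2 A. l \<in> set c})"
  proof
    fix c assume c: "c \<in> L2 A"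
    then have ne: "c \<noteq> []" and c2: "length c = 2" "c \<in> set A" "c \<in> set (live (F @ A))" by (auto simp: L2_def)
    have "canon L c = c" using c2 A set_candidates by blast
    then have "hd c \<in> set L" using canonicalD hd_in_set[OF ne] by blast
    moreover have "hd c \<notin> U A"
    proof
      assume "hd c \<in> U A"
      then have "[hd c] \<in> set (F @ A)" by (simp add: U_def)
      moreover have "length [hd c] < length c" "set [hd c] \<subseteq> set c" using c2(1) hd_in_set[OF ne] by simp_all
      ultimately show False using c2(3) unfolding set_live by blast
    qed
    ultimately show "c \<in> (\<Union>l\<in>set L - U A. {c \<in> L2 A. l \<in> set c})" using c hd_in_set[OF ne] by blast
  qed
  then have "card (L2 A) \<le> card (\<Union>l\<in>set L - U A. {c \<in> L2 A. l \<in> set c})"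
    by (rule card_mono[rotated]) (simp add: finite_L2)
  also have "\<dots> \<le> (\<Sum>l\<in>set L - U A. card {c \<in> L2 A. l \<in> set c})" by (rule card_UN_le) simp
  also have "\<dots> \<le> card (set L - U A) * (2 * \<theta>)" using d by (intro sum_bounded_above[THEN order_trans]) auto
  also have "card (set L - U A) = length L - card (U A)"
    using card_Diff_subset[OF finite_subset[OF U_subset[OF A]] U_subset[OF A]] distinct_card[OF dL] by simp
  finally show ?thesis by (simp add: mult.commute)
qed

context
  fixes A A' :: "clause list" and P :: "clause set" and s :: nat
  assumes inv: "inv A" and A': "set A' = set A \<union> P"
    and P: "\<And>p. p \<in> P ==> canon L p = p \<and> length p = s \<and>
       (\<exists>C\<in>set (live (F @ A)). length p < length C \<and> set p \<subseteq> set C)"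
begin

text \<open>A clause inside the new clause would also lie properly inside the live clause from which
  the new one was obtained.\<close>

lemma fresh: "p \<in> P ==> d \<in> set (F @ A) ==> length d \<le> length p ==> \<not> set d \<subseteq> set p"
proof
  assume p: "p \<in> P" and d: "d \<in> set (F @ A)" "length d \<le> length p" "set d \<subseteq> set p"
  obtain C where "C \<in> set (live (F @ A))" "length p < length C" "set p \<subseteq> set C" using P[OF p] by blast
  then have "C \<in> set (live (F @ A))" "length d < length C" "set d \<subseteq> set C" using d by auto
  then show False using d(1) unfolding set_live by blast
qed

lemma finP: "finite P"
  using A' finite_set[of A'] by (metis finite_Un)

lemma U_step: "U A' = U A \<union> {l. [l] \<in> P}" "U A \<inter> {l. [l] \<in> P} = {}"
  using fresh[of "[l]" "[l]" for l] by (auto simp: U_def A')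

lemma card_units: "s = 1 ==> card {l. [l] \<in> P} = card P"
proof -
  assume s: "s = 1"
  have "P = (\<lambda>l. [l]) ` {l. [l] \<in> P}"
  proof (intro equalityI subsetI)
    fix p assume p: "p \<in> P"
    then have "length p = 1" using P s by simp
    then obtain l where "p = [l]" by (auto simp: length_Suc_conv)
    then show "p \<in> (\<lambda>l. [l]) ` {l. [l] \<in> P}" using p by blast
  qed auto
  moreover have "inj_on (\<lambda>l. [l]) {l. [l] \<in> P}" by (auto simp: inj_on_def)
  ultimately show ?thesis using card_image by metis
qed

lemma inv_subset:
  assumes "s = 1 \<or> s = 2" shows "set A' \<subseteq> set (singles L @ pairs L)"
proof
  fix c assume "c \<in> set A'"
  then have "c \<in> set A \<or> c \<in> P" by (simp add: A')
  then show "c \<in> set (singles L @ pairs L)"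
  proof
    assume "c \<in> set A"
    then show ?thesis using inv unfolding inv_def by blast
  next
    assume "c \<in> P"
    then show ?thesis using P[of c] assms unfolding set_candidates by blast
  qed
qed

lemma live_anti: "c \<in> set (F @ A) ==> c \<in> set (live (F @ A')) ==> c \<in> set (live (F @ A))"
  unfolding set_live by (auto simp: A')

text \<open>Each new unit takes \<open>4 * \<theta>\<close> from the budget and gives back at most
  \<open>2 * \<theta>\<close>, namely the added binary clauses that it subsumes.\<close>

lemma add_units:
  assumes s: "s = 1"
  shows "inv A'" "B A' + 2 * \<theta> * card P \<le> B A"
proof -
  have sub: "L2 A' \<subseteq> L2 A"
  proof
    fix c assume c: "c \<in> L2 A'"
    then have "c \<notin> P" using P[of c] s by (auto simp: L2_def)
    then have "c \<in> set A" using c by (simp add: L2_def A')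
    then show "c \<in> L2 A" using c live_anti[of c] by (simp add: L2_def)
  qed
  show inv': "inv A'" unfolding inv_def
  proof (intro conjI allI)
    fix l
    have "card {c \<in> L2 A'. l \<in> set c} \<le> card {c \<in> L2 A. l \<in> set c}"
      using sub by (intro card_mono) (auto simp: finite_L2)
    then show "card {c \<in> L2 A'. l \<in> set c} \<le> 2 * \<theta>" using inv unfolding inv_def by (meson order_trans)
  qed (rule inv_subset, simp add: s)
  have "L2 A \<subseteq> L2 A' \<union> (\<Union>l\<in>{l. [l] \<in> P}. {c \<in> L2 A. l \<in> set c})"
  proof
    fix c assume c: "c \<in> L2 A"
    show "c \<in> L2 A' \<union> (\<Union>l\<in>{l. [l] \<in> P}. {c \<in> L2 A. l \<in> set c})"
    proof (cases "\<exists>l. [l] \<in> P \<and> l \<in> set c")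
      case True
      then show ?thesis using c by blast
    next
      case False
      have "\<not> (\<exists>d\<in>set (F @ A'). length d < length c \<and> set d \<subseteq> set c)"
      proof
        assume "\<exists>d\<in>set (F @ A'). length d < length c \<and> set d \<subseteq> set c"
        then obtain d where d: "d \<in> set (F @ A')" "length d < length c" "set d \<subseteq> set c" by blast
        have "d \<notin> set (F @ A)" using c d unfolding L2_def set_live by blast
        then have "d \<in> P" using d(1) by (simp add: A')
        then obtain l where "d = [l]" using P[of d] s by (auto simp: length_Suc_conv)
        then have "[l] \<in> P" "l \<in> set c" using d(3) \<open>d \<in> P\<close> by auto
        then show False using False by blast
      qed
      then show ?thesis using c unfolding L2_def set_live by (simp add: A')
    qed
  qed
  then have "card (L2 A) \<le> card (L2 A' \<union> (\<Union>l\<in>{l. [l] \<in> P}. {c \<in> L2 A. l \<in> set c}))"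
    by (rule card_mono[rotated]) (rule finite_subset[of _ "L2 A' \<union> L2 A"], auto simp: finite_L2)
  also have "\<dots> \<le> card (L2 A') + card (\<Union>l\<in>{l. [l] \<in> P}. {c \<in> L2 A. l \<in> set c})" by (rule card_Un_le)
  also have "card (\<Union>l\<in>{l. [l] \<in> P}. {c \<in> L2 A. l \<in> set c}) \<le> (\<Sum>l\<in>{l. [l] \<in> P}. card {c \<in> L2 A. l \<in> set c})"
    by (rule card_UN_le) (rule finite_subset[OF _ finite_set[of L]], use U_step(1) U_subset[OF inv_subset] s in auto)
  also have "\<dots> \<le> card {l. [l] \<in> P} * (2 * \<theta>)"
    using inv by (intro sum_bounded_above[THEN order_trans]) (auto simp: inv_def)
  finally have x: "card (L2 A) \<le> card (L2 A') + 2 * (\<theta> * card P)" using card_units[OF s] by (simp add: algebra_simps)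
  have UL: "U A' \<subseteq> set L" using U_subset[OF inv_subset] s by simp
  have fU: "finite (U A)" "finite {l. [l] \<in> P}" using UL U_step(1) by (metis List.finite_set finite_Un finite_subset)+
  have u: "card (U A') = card (U A) + card P"
    using card_Un_disjoint[OF fU U_step(2)] U_step(1) card_units[OF s] by simp
  have "card (U A') \<le> length L" using card_mono[OF _ UL] distinct_card[OF dL] by simp
  then obtain M where M: "length L = card (U A') + M" using le_Suc_ex by blast
  have x': "card (L2 A') \<le> 2 * (\<theta> * M)" using L2_bound[OF inv'] M by simp
  have "4 * (\<theta> * M) - c' + 2 * k \<le> 4 * (\<theta> * M) + 4 * k - c" if "c \<le> c' + 2 * k" "c' \<le> 2 * (\<theta> * M)" for c c' k :: nat
    using that by linarith
  from this[OF x x'] show "B A' + 2 * \<theta> * card P \<le> B A"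
    unfolding B_def using M u by (simp add: algebra_simps)
qed

text \<open>Only shorter clauses subsume, so binary clauses do not kill each other and each new one
  counts in full. The degree bound \<open>2 * \<theta>\<close> is the sum of \<theta> for the old
  clauses and \<theta> for the new ones.\<close>

lemma add_pairs:
  assumes s: "s = 2"
    and d: "\<And>l. card {c \<in> L2 A. l \<in> set c} \<le> \<theta>" "\<And>l. card {c \<in> P. l \<in> set c} \<le> \<theta>"
  shows "inv A'" "B A' + card P \<le> B A"
proof -
  have sub: "L2 A' \<subseteq> L2 A \<union> P"
  proof
    fix c assume c: "c \<in> L2 A'"
    show "c \<in> L2 A \<union> P"
    proof (cases "c \<in> P")
      case False
      then have "c \<in> set A" using c by (simp add: L2_def A')
      then show ?thesis using c live_anti[of c] by (simp add: L2_def)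
    qed simp
  qed
  show inv': "inv A'" unfolding inv_def
  proof (intro conjI allI)
    fix l
    have "{c \<in> L2 A'. l \<in> set c} \<subseteq> {c \<in> L2 A. l \<in> set c} \<union> {c \<in> P. l \<in> set c}" using sub by blast
    then have "card {c \<in> L2 A'. l \<in> set c} \<le> card ({c \<in> L2 A. l \<in> set c} \<union> {c \<in> P. l \<in> set c})"
      by (rule card_mono[rotated]) (simp add: finite_L2 finP)
    also have "\<dots> \<le> card {c \<in> L2 A. l \<in> set c} + card {c \<in> P. l \<in> set c}" by (rule card_Un_le)
    finally show "card {c \<in> L2 A'. l \<in> set c} \<le> 2 * \<theta>" using d[of l] by simp
  qed (rule inv_subset, simp add: s)
  have lv: "c \<in> L2 A'" if "c \<in> L2 A \<union> P" for c
  proof -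
    have c2: "length c = 2" "c \<in> set A'" using that P[of c] s by (auto simp: L2_def A')
    have "\<not> (\<exists>d\<in>set (F @ A'). length d < length c \<and> set d \<subseteq> set c)"
    proof
      assume "\<exists>d\<in>set (F @ A'). length d < length c \<and> set d \<subseteq> set c"
      then obtain d where d: "d \<in> set (F @ A')" "length d < length c" "set d \<subseteq> set c" by blast
      then have "d \<notin> P" using P[of d] s c2 by auto
      then have dA: "d \<in> set (F @ A)" using d(1) by (simp add: A')
      from that show False
      proof
        assume "c \<in> L2 A"
        then show False using d dA unfolding L2_def set_live by blast
      next
        assume "c \<in> P"
        then show False using fresh[of c d] d dA by simp
      qed
    qed
    then show ?thesis using c2 unfolding L2_def set_live by simp
  qed
  have disj: "L2 A \<inter> P = {}" using fresh[of c c for c] by (auto simp: L2_def)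
  have "card (L2 A) + card P = card (L2 A \<union> P)" using card_Un_disjoint[OF finite_L2 finP disj] by simp
  also have "\<dots> \<le> card (L2 A')" using lv by (intro card_mono finite_L2) blast
  finally have x: "card (L2 A) + card P \<le> card (L2 A')" .
  have "{l. [l] \<in> P} = {}" using P[of "[l]" for l] s by auto
  then have u: "U A' = U A" by (metis Un_empty_right U_step(1))
  have x': "card (L2 A') \<le> 2 * (\<theta> * (length L - card (U A)))" using L2_bound[OF inv'] u by simp
  have "4 * m - c' + k \<le> 4 * m - c" if "c + k \<le> c'" "c' \<le> 2 * m" for c c' k m :: nat
    using that by linarith
  from this[OF x x'] show "B A' + card P \<le> B A" unfolding B_def u by (simp add: mult.assoc)
qed

end

lemma set_extend: "set A \<subseteq> set (singles L @ pairs L) ==> set P \<subseteq> set (singles L @ pairs L) ==>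
    set (extend L A P) = set A \<union> set P"
  unfolding extend_def set_filter by blast

lemma canonical_all: "set A \<subseteq> set (singles L @ pairs L) ==> c \<in> set (F @ A) ==> canon L c = c \<and> length c \<le> 3"
proof -
  assume A: "set A \<subseteq> set (singles L @ pairs L)" and c: "c \<in> set (F @ A)"
  show ?thesis
  proof (cases "c \<in> set F")
    case True
    then show ?thesis using F_canon F3 by blast
  next
    case False
    then have "c \<in> set (singles L @ pairs L)" using A c by auto
    then show ?thesis unfolding set_candidates by auto
  qed
qed

lemma set_flower: "c \<in> set (flower S H s) \<longleftrightarrow> c \<in> set (live S) \<and> length c = s \<and> set H \<subseteq> set c"
  unfolding flower_def by auto

lemma set_petals: "p \<in> set (petals S H s) \<longleftrightarrow> (\<exists>c\<in>set (flower S H s). p = filter (\<lambda>l. l \<notin> set H) c)"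
  unfolding petals_def by auto

lemma petal_props:
  assumes A: "set A \<subseteq> set (singles L @ pairs L)" and H: "canon L H = H" and c: "c \<in> set (flower (F @ A) H s)"
  shows "canon L (filter (\<lambda>l. l \<notin> set H) c) = filter (\<lambda>l. l \<notin> set H) c"
    "length (filter (\<lambda>l. l \<notin> set H) c) + length H = s" "set c = set (filter (\<lambda>l. l \<notin> set H) c) \<union> set H"
proof -
  have c': "c \<in> set (live (F @ A))" "length c = s" "set H \<subseteq> set c" using c by (auto simp: set_flower)
  then have cc: "canon L c = c" using canonical_all[OF A, of c] by (simp add: set_live)
  then show 1: "canon L (filter (\<lambda>l. l \<notin> set H) c) = filter (\<lambda>l. l \<notin> set H) c" by (rule canonical_filter)
  show 2: "set c = set (filter (\<lambda>l. l \<notin> set H) c) \<union> set H" using c'(3) by auto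
  have "card (set c) = card (set (filter (\<lambda>l. l \<notin> set H) c)) + card (set H)"
    unfolding 2 by (rule card_Un_disjoint) auto
  then show "length (filter (\<lambda>l. l \<notin> set H) c) + length H = s"
    using canonicalD[OF 1] canonicalD[OF cc] canonicalD[OF H] c'(2) by metis
qed

lemma card_petals:
  assumes A: "set A \<subseteq> set (singles L @ pairs L)" and H: "canon L H = H"
  shows "card (set (petals (F @ A) H s)) = length (flower (F @ A) H s)"
proof -
  have "inj_on (\<lambda>c. filter (\<lambda>l. l \<notin> set H) c) (set (flower (F @ A) H s))"
  proof (rule inj_onI)
    fix c d assume cd: "c \<in> set (flower (F @ A) H s)" "d \<in> set (flower (F @ A) H s)"
      "filter (\<lambda>l. l \<notin> set H) c = filter (\<lambda>l. l \<notin> set H) d"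
    have "set c = set d" using petal_props(3)[OF A H cd(1)] petal_props(3)[OF A H cd(2)] unfolding cd(3) by blast
    moreover have "canon L c = c" "canon L d = d"
      using canonical_all[OF A, of c] canonical_all[OF A, of d] cd(1,2) by (simp_all add: set_flower set_live)
    ultimately show "c = d" using canonical_eqI by blast
  qed
  then have "card (set (petals (F @ A) H s)) = card (set (flower (F @ A) H s))"
    unfolding petals_def set_map by (rule card_image)
  also have "\<dots> = length (flower (F @ A) H s)"
    by (rule distinct_card) (simp add: flower_def distinct_live)
  finally show ?thesis .
qed

text \<open>An assignment that falsifies the heart has to satisfy each petal. The petals cost
  \<open>\<theta> * \<theta>\<close> of the budget in either case: unit petals number at least
  \<theta> and are worth \<open>2 * \<theta>\<close> each, binary ones number at least
  \<open>\<theta> * \<theta>\<close> and are worth 1 each.\<close>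

lemma branch:
  assumes inv: "inv A" and R: "applicable \<theta> L (F @ A) \<noteq> []"
  defines "H \<equiv> fst (hd (applicable \<theta> L (F @ A)))" and "s \<equiv> fst (snd (hd (applicable \<theta> L (F @ A))))"
  defines "A1 \<equiv> extend L A [H]" and "A2 \<equiv> extend L A (petals (F @ A) H s)"
  shows "inv A1 \<and> inv A2 \<and> B A1 + 1 \<le> B A \<and> B A2 + \<theta> * \<theta> \<le> B A \<and>
    ((\<exists>a. models a (F @ A)) \<longleftrightarrow> (\<exists>a. models a (F @ A1)) \<or> (\<exists>a. models a (F @ A2)))"
proof -
  let ?S = "F @ A"
  have A: "set A \<subseteq> set (singles L @ pairs L)" using inv by (simp add: inv_def)
  define t where "t = snd (snd (hd (applicable \<theta> L ?S)))"
  have r: "hd (applicable \<theta> L ?S) = (H, s, t)" by (simp add: H_def s_def t_def)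
  let ?G1 = "map (\<lambda>H. (H, 2, \<theta>)) (singles L)" and ?G2 = "map (\<lambda>H. (H, 3, \<theta>)) (pairs L)"
    and ?G3 = "map (\<lambda>H. (H, 3, \<theta> * \<theta>)) (singles L)"
  note cs = hd_filter_append3[OF R[unfolded applicable_def rules_def], folded rules_def, folded applicable_def, unfolded r]
  have tf: "t \<le> length (flower ?S H s)" using cs by simp
  have no1: "card {c \<in> L2 A. l \<in> set c} \<le> \<theta>"
    if n: "\<forall>r\<in>set ?G1. \<not> snd (snd r) \<le> length (flower ?S (fst r) (fst (snd r)))" for l
  proof (cases "l \<in> set L")
    case True
    then have "([l], 2, \<theta>) \<in> set ?G1" by (auto simp: singles_def)
    from bspec[OF n this] have "length (flower ?S [l] 2) < \<theta>" by simp
    moreover have "{c \<in> L2 A. l \<in> set c} \<subseteq> set (flower ?S [l] 2)" by (auto simp: L2_def set_flower)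
    then have "card {c \<in> L2 A. l \<in> set c} \<le> length (flower ?S [l] 2)"
      using card_mono[OF finite_set] card_length order_trans by blast
    ultimately show ?thesis by simp
  next
    case False
    have "{c \<in> L2 A. l \<in> set c} = {}"
    proof -
      have "l \<notin> set c" if "c \<in> L2 A" for c
        using that False canonical_all[OF A, of c] canonicalD[of c] by (auto simp: L2_def)
      then show ?thesis by blast
    qed
    then show ?thesis by (simp only: card.empty le0)
  qed
  have cases: "(length H = 1 \<and> s = 2 \<and> t = \<theta>) \<or>
      (length H = 2 \<and> s = 3 \<and> t = \<theta> \<and> (\<forall>l. card {c \<in> L2 A. l \<in> set c} \<le> \<theta>)) \<or>
      (length H = 1 \<and> s = 3 \<and> t = \<theta> * \<theta> \<and> (\<forall>l. card {c \<in> L2 A. l \<in> set c} \<le> \<theta>) \<and>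
        (\<forall>h\<in>set (pairs L). length (flower ?S h 3) < \<theta>))"
  proof -
    from cs have "(H, s, t) \<in> set ?G1 \<or> (H, s, t) \<in> set ?G2 \<and> (\<forall>r\<in>set ?G1. \<not> snd (snd r) \<le> length (flower ?S (fst r) (fst (snd r))))
      \<or> (H, s, t) \<in> set ?G3 \<and> (\<forall>r\<in>set ?G1 \<union> set ?G2. \<not> snd (snd r) \<le> length (flower ?S (fst r) (fst (snd r))))"
      by blast
    then show ?thesis
    proof (elim disjE conjE, goal_cases)
      case 1
      then show ?case by (auto simp: singles_def)
    next
      case 2
      have "length H = 2 \<and> s = 3 \<and> t = \<theta>" using 2(1) by (auto simp: pairs_def)
      then show ?case using no1[OF 2(2)] by blast
    next
      case 3
      have 1: "length H = 1 \<and> s = 3 \<and> t = \<theta> * \<theta>" using 3(1) by (auto simp: singles_def)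
      have 2: "\<forall>r\<in>set ?G1. \<not> snd (snd r) \<le> length (flower ?S (fst r) (fst (snd r)))" using 3(2) by blast
      have "length (flower ?S h 3) < \<theta>" if "h \<in> set (pairs L)" for h
      proof -
        have "(h, 3, \<theta>) \<in> set ?G1 \<union> set ?G2" using that by auto
        from bspec[OF 3(2) this] show ?thesis by simp
      qed
      then show ?case using 1 no1[OF 2] by blast
    qed
  qed
  have Hc: "canon L H = H \<and> (length H = 1 \<or> length H = 2)"
  proof -
    have "(H, s, t) \<in> set ?G1 \<union> set ?G2 \<union> set ?G3" using cs by blast
    then have "H \<in> set (singles L @ pairs L)" by auto
    then show ?thesis by (simp only: set_candidates)
  qed
  have "1 \<le> t" using cases \<theta> by auto
  then obtain C where C: "C \<in> set (flower ?S H s)" using tf by (cases "flower ?S H s") auto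
  have lHs: "length H < s" using cases by auto
  have A1: "set A1 = set A \<union> {H}" unfolding A1_def using set_extend[OF A, of "[H]"] Hc set_candidates[of H] by simp
  have P1: "canon L p = p \<and> length p = length H \<and> (\<exists>C\<in>set (live ?S). length p < length C \<and> set p \<subseteq> set C)"
    if "p \<in> {H}" for p using that Hc C lHs by (auto simp: set_flower)
  have P2: "canon L p = p \<and> length p = s - length H \<and> (\<exists>C\<in>set (live ?S). length p < length C \<and> set p \<subseteq> set C)"
    if p: "p \<in> set (petals ?S H s)" for p
  proof -
    obtain c where c: "c \<in> set (flower ?S H s)" "p = filter (\<lambda>l. l \<notin> set H) c" using p unfolding set_petals by blast
    have "length p + length H = s" using petal_props(2)[OF A _ c(1)] Hc c(2) by simp
    moreover have "canon L p = p" using petal_props(1)[OF A _ c(1)] Hc c(2) by simp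
    moreover have c': "set p \<subseteq> set c" "c \<in> set (live ?S)" "length c = s" using c by (auto simp: set_flower)
    have "length p < length c" using \<open>length p + length H = s\<close> Hc c'(3) by auto
    ultimately show ?thesis using c' by (intro conjI bexI[of _ c]) auto
  qed
  have "s - length H = 1 \<or> s - length H = 2" using cases by auto
  then have "set (petals ?S H s) \<subseteq> set (singles L @ pairs L)" using P2 unfolding subset_eq set_candidates by metis
  then have A2: "set A2 = set A \<union> set (petals ?S H s)" unfolding A2_def by (rule set_extend[OF A])
  have cP: "t \<le> card (set (petals ?S H s))" using card_petals[OF A, of H s] Hc tf by simp
  have f1: "inv A1 \<and> B A1 + 1 \<le> B A"
  proof (cases "length H = 1")
    case True
    note 1 = add_units[OF inv A1 P1 True]
    then show ?thesis using \<theta> by (simp add: mult.commute)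
  next
    case False
    then have H2: "length H = 2" and d: "\<And>l. card {c \<in> L2 A. l \<in> set c} \<le> \<theta>" using cases by auto
    have "card {c \<in> {H}. l \<in> set c} \<le> \<theta>" for l
    proof -
      have "card {c \<in> {H}. l \<in> set c} \<le> card {H}" by (rule card_mono) auto
      also have "\<dots> = 1" by simp
      finally show ?thesis using \<theta> by (rule order_trans)
    qed
    from add_pairs[OF inv A1 P1 H2 d this] show ?thesis by simp
  qed
  have f2: "inv A2 \<and> B A2 + \<theta> * \<theta> \<le> B A"
  proof (cases "s - length H = 1")
    case True
    note 1 = add_units[OF inv A2 P2 True]
    have "\<theta> \<le> card (set (petals ?S H s))" using cP cases True by auto
    then have "\<theta> * \<theta> \<le> 2 * \<theta> * card (set (petals ?S H s))" by (intro mult_le_mono) simp_all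
    from order_trans[OF add_left_mono[OF this] 1(2)] 1(1) show ?thesis by blast
  next
    case False
    then have c3: "length H = 1" "s = 3" "t = \<theta> * \<theta>" and d: "\<And>l. card {c \<in> L2 A. l \<in> set c} \<le> \<theta>"
      and f: "\<And>h. h \<in> set (pairs L) ==> length (flower ?S h 3) < \<theta>" using cases by auto
    obtain l where l: "H = [l]" using c3(1) by (auto simp: length_Suc_conv)
    have lL: "l \<in> set L" using canonicalD[of H] Hc l by auto
    \<comment> \<open>Petals that contain \<open>m\<close> stem from ternary clauses with both
      \<open>l\<close> and \<open>m\<close>, which are fewer than \<theta> as the rule for this pair
      has failed.\<close>
    have deg: "card {p \<in> set (petals ?S H s). m \<in> set p} \<le> \<theta>" for m
    proof (cases "m \<in> set L \<and> m \<noteq> l")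
      case True
      define h where "h = canon L [l, m]"
      have hs: "set h = {l, m}" using True lL by (auto simp: h_def canon_def)
      have hc: "canon L h = h" by (simp add: h_def canon_canon)
      have "l \<noteq> m" using True by blast
      then have "length h = 2" using canonicalD[OF hc] hs by simp
      then have hp: "h \<in> set (pairs L)" unfolding pairs_def using True lL by (auto simp: h_def)
      have "{p \<in> set (petals ?S H s). m \<in> set p} \<subseteq> (\<lambda>c. filter (\<lambda>l. l \<notin> set H) c) ` set (flower ?S h 3)"
        using c3(2) l hs by (auto simp: set_petals set_flower)
      then have "card {p \<in> set (petals ?S H s). m \<in> set p} \<le> card ((\<lambda>c. filter (\<lambda>l. l \<notin> set H) c) ` set (flower ?S h 3))"
        by (rule card_mono[rotated]) simp
      also have "\<dots> \<le> card (set (flower ?S h 3))" by (rule card_image_le) simp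
      also have "\<dots> \<le> length (flower ?S h 3)" by (rule card_length)
      finally show ?thesis using f[OF hp] by simp
    next
      case False
      have "m \<notin> set p" if p: "p \<in> set (petals ?S H s)" for p
      proof
        assume m: "m \<in> set p"
        then have "m \<in> set L" using canonicalD[of p] P2[OF p] by blast
        moreover have "m \<noteq> l" using p m l by (auto simp: set_petals)
        ultimately show False using False by blast
      qed
      then have "{p \<in> set (petals ?S H s). m \<in> set p} = {}" by blast
      then show ?thesis by (simp only: card.empty le0)
    qed
    have "s - length H = 2" using c3 by simp
    from add_pairs[OF inv A2 P2 this d deg] cP c3(3) show ?thesis by simp
  qed
  have f3: "(\<exists>a. models a ?S) \<longleftrightarrow> (\<exists>a. models a (F @ A1)) \<or> (\<exists>a. models a (F @ A2))"
  proof
    assume "\<exists>a. models a ?S"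
    then obtain a where a: "models a ?S" ..
    show "(\<exists>a. models a (F @ A1)) \<or> (\<exists>a. models a (F @ A2))"
    proof (cases "\<exists>l\<in>set H. a (fst l) = snd l")
      case True
      have "models a (F @ A1)" unfolding models_def
      proof
        fix c assume "c \<in> set (F @ A1)"
        then have "c \<in> set ?S \<or> c = H" by (auto simp: A1)
        then show "\<exists>l\<in>set c. a (fst l) = snd l" using a True unfolding models_def by blast
      qed
      then show ?thesis by (intro disjI1 exI)
    next
      case False
      have "\<exists>l\<in>set p. a (fst l) = snd l" if p: "p \<in> set (petals ?S H s)" for p
      proof -
        obtain c where c: "c \<in> set (flower ?S H s)" "p = filter (\<lambda>l. l \<notin> set H) c" using p unfolding set_petals by blast
        then have "c \<in> set ?S" by (simp add: set_flower set_live)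
        then obtain l where l: "l \<in> set c" "a (fst l) = snd l" using a unfolding models_def by blast
        have "l \<notin> set H" using False l(2) by blast
        then have "l \<in> set p" using l(1) c(2) by simp
        then show ?thesis using l(2) by blast
      qed
      note petals_true = this
      have "models a (F @ A2)" unfolding models_def
      proof
        fix c assume "c \<in> set (F @ A2)"
        then have "c \<in> set ?S \<or> c \<in> set (petals ?S H s)" by (auto simp: A2)
        then show "\<exists>l\<in>set c. a (fst l) = snd l" using a petals_true[of c] unfolding models_def by blast
      qed
      then show ?thesis by (intro disjI2 exI)
    qed
  next
    assume "(\<exists>a. models a (F @ A1)) \<or> (\<exists>a. models a (F @ A2))"
    then have "\<exists>a. models a (F @ A1) \<or> models a (F @ A2)" by (rule ex_disj_distrib[THEN iffD2])
    then obtain a where "models a (F @ A1) \<or> models a (F @ A2)" by (rule exE)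
    then have "models a ?S" unfolding models_def set_append A1 A2 ball_Un
      by (elim disjE conjE) (intro conjI, assumption+)+
    then show "\<exists>a. models a ?S" by (intro exI)
  qed
  show ?thesis
    by (intro conjI f1[THEN conjunct1] f2[THEN conjunct1] f1[THEN conjunct2] f2[THEN conjunct2] f3)
qed

definition sparse where
  "sparse G \<longleftrightarrow> (\<forall>c\<in>set G. length c \<le> 3) \<and> length G \<le> 1 + length L * (1 + \<theta> + \<theta> * \<theta>)"

text \<open>If no rule applies, each literal lies in fewer than \<theta> binary and fewer than
  \<open>\<theta> * \<theta>\<close> ternary live clauses. The remaining terms of the bound count
  the units and the empty clause.\<close>

lemma leaf:
  assumes inv: "inv A" and R: "applicable \<theta> L (F @ A) = []"
  shows "sparse (live (F @ A))"
proof -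
  let ?G = "live (F @ A)"
  have A: "set A \<subseteq> set (singles L @ pairs L)" using inv by (simp add: inv_def)
  have G: "canon L c = c \<and> length c \<le> 3" if "c \<in> set ?G" for c
    using that canonical_all[OF A, of c] by (simp add: set_live)
  have na: "length (flower (F @ A) H s) < t" if "(H, s, t) \<in> set (rules \<theta> L)" for H s t
  proof -
    have "(H, s, t) \<notin> set (applicable \<theta> L (F @ A))" unfolding R by simp
    then show ?thesis using that unfolding applicable_def by simp
  qed
  have f: "length (flower (F @ A) [l] 2) < \<theta>" "length (flower (F @ A) [l] 3) < \<theta> * \<theta>" if "l \<in> set L" for l
    using that by (auto intro!: na simp: rules_def singles_def)
  have deg: "card {c \<in> set ?G. length c = s} \<le> length L * t" if s: "0 < s" and t: "\<And>l. l \<in> set L ==> length (flower (F @ A) [l] s) < t" for s t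
  proof -
    have "{c \<in> set ?G. length c = s} \<subseteq> (\<Union>l\<in>set L. set (flower (F @ A) [l] s))"
    proof
      fix c assume c: "c \<in> {c \<in> set ?G. length c = s}"
      then have h: "hd c \<in> set c" using s by (cases c) auto
      then have "hd c \<in> set L" using c G canonicalD by blast
      then show "c \<in> (\<Union>l\<in>set L. set (flower (F @ A) [l] s))" using c h by (auto simp: set_flower)
    qed
    then have "card {c \<in> set ?G. length c = s} \<le> card (\<Union>l\<in>set L. set (flower (F @ A) [l] s))"
      by (rule card_mono[rotated]) simp
    also have "\<dots> \<le> (\<Sum>l\<in>set L. card (set (flower (F @ A) [l] s)))" by (rule card_UN_le) simp
    also have "\<dots> \<le> (\<Sum>l\<in>set L. t)"
    proof (rule sum_mono)
      fix l assume "l \<in> set L"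
      then show "card (set (flower (F @ A) [l] s)) \<le> t"
        using t[of l] card_length[of "flower (F @ A) [l] s"] by simp
    qed
    also have "\<dots> = card (set L) * t" by simp
    finally show ?thesis using distinct_card[OF dL] by simp
  qed
  have 1: "card {c \<in> set ?G. length c = 1} \<le> length L"
  proof -
    have "{c \<in> set ?G. length c = 1} \<subseteq> (\<lambda>l. [l]) ` set L"
    proof
      fix c assume c: "c \<in> {c \<in> set ?G. length c = 1}"
      then obtain l where l: "c = [l]" by (auto simp: length_Suc_conv)
      then have "l \<in> set L" using c G[of c] canonicalD[of c] by auto
      then show "c \<in> (\<lambda>l. [l]) ` set L" using l by blast
    qed
    then have "card {c \<in> set ?G. length c = 1} \<le> card ((\<lambda>l. [l]) ` set L)" by (rule card_mono[rotated]) simp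
    also have "\<dots> \<le> card (set L)" by (rule card_image_le) simp
    also have "\<dots> \<le> length L" by (rule card_length)
    finally show ?thesis .
  qed
  have 0: "card {c \<in> set ?G. length c = 0} \<le> 1"
  proof -
    have "{c \<in> set ?G. length c = 0} \<subseteq> {[]}" by blast
    from card_mono[OF _ this] show ?thesis by simp
  qed
  let ?k = "\<lambda>i. {c \<in> set ?G. length c = i}"
  have "set ?G \<subseteq> ?k 0 \<union> ?k 1 \<union> ?k 2 \<union> ?k 3"
  proof
    fix c assume c: "c \<in> set ?G"
    then have "length c \<le> 3" using G by blast
    then have "length c = 0 \<or> length c = 1 \<or> length c = 2 \<or> length c = 3" by linarith
    then show "c \<in> ?k 0 \<union> ?k 1 \<union> ?k 2 \<union> ?k 3" using c by blast
  qed
  then have "card (set ?G) \<le> card (?k 0 \<union> ?k 1 \<union> ?k 2 \<union> ?k 3)" by (rule card_mono[rotated]) simp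
  then have "card (set ?G) \<le> card (?k 0) + card (?k 1) + card (?k 2) + card (?k 3)"
    using card_Un_le[of "?k 0 \<union> ?k 1 \<union> ?k 2" "?k 3"] card_Un_le[of "?k 0 \<union> ?k 1" "?k 2"] card_Un_le[of "?k 0" "?k 1"]
    by linarith
  then have "length ?G \<le> 1 + length L + length L * \<theta> + length L * (\<theta> * \<theta>)"
    using 0 1 deg[of 2 \<theta>, OF _ f(1)] deg[of 3 "\<theta> * \<theta>", OF _ f(2)] distinct_card[OF distinct_live, of "F @ A"] by simp
  then show ?thesis unfolding sparse_def using G by (simp add: algebra_simps)
qed

section \<open>Soundness and termination of the search\<close>

lemma sparsify_Suc: "sparsify \<theta> L F (Suc t) = sparsify_step \<theta> L F (sparsify \<theta> L F t)"
  unfolding sparsify_def foldl_replicate by simp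

definition sound where
  "sound z \<longleftrightarrow> (\<forall>A\<in>set (fst z). inv A) \<and> (\<forall>G\<in>set (snd z). sparse G) \<and>
     ((\<exists>a. models a F) \<longleftrightarrow> (\<exists>A\<in>set (fst z). \<exists>a. models a (F @ A)) \<or> (\<exists>G\<in>set (snd z). \<exists>a. models a G))"

lemma sound_step: "sound z ==> sound (sparsify_step \<theta> L F z)"
proof (cases "fst z")
  case Nil
  then show "sound z ==> ?thesis" by (simp add: sparsify_step_def)
next
  case (Cons A st)
  assume z: "sound z"
  then have A: "inv A" by (simp add: sound_def Cons)
  show ?thesis
  proof (cases "applicable \<theta> L (F @ A) = []")
    case True
    then have "sparsify_step \<theta> L F z = (st, live (F @ A) # snd z)" by (simp add: sparsify_step_def Cons)
    then show ?thesis using z leaf[OF A True] by (auto simp: sound_def Cons models_live)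
  next
    case False
    note b = branch[OF A False]
    have e: "sparsify_step \<theta> L F z = (extend L A [fst (hd (applicable \<theta> L (F @ A)))] #
       extend L A (petals (F @ A) (fst (hd (applicable \<theta> L (F @ A)))) (fst (snd (hd (applicable \<theta> L (F @ A)))))) # st, snd z)"
      using False by (simp add: sparsify_step_def Cons)
    show ?thesis using z b unfolding e sound_def Cons fst_conv snd_conv list.set by blast
  qed
qed

lemma inv_Nil: "inv []" by (simp add: inv_def L2_def)

lemma sound_sparsify: "sound (sparsify \<theta> L F t)"
proof (induction t)
  case 0
  show ?case using inv_Nil by (simp add: sparsify_def sound_def)
next
  case (Suc t)
  then show ?case unfolding sparsify_Suc by (rule sound_step)
qed

text \<open>The weight \<open>2 * \<gamma> ^ B A - 1\<close> bounds the number of nodes in the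
  search tree below the branch \<open>A\<close>. The condition on \<gamma> says that the powers for
  the two children sum to at most the power for the parent, so each step lowers the total weight by
  at least 1.\<close>

lemma sparsify_terminates:
  fixes \<gamma> :: real
  assumes \<gamma>: "1 \<le> \<gamma>" "\<gamma> ^ (\<theta> * \<theta> - 1) + 1 \<le> \<gamma> ^ (\<theta> * \<theta>)"
    and t: "2 * \<gamma> ^ (4 * \<theta> * length L) \<le> real t"
  shows "fst (sparsify \<theta> L F t) = []"
proof -
  define \<Psi> where "\<Psi> z = (\<Sum>A\<leftarrow>fst z. 2 * \<gamma> ^ B A - 1)" for z :: "clause list list \<times> clause list list"
  have pos: "0 \<le> 2 * \<gamma> ^ b - 1" for b using one_le_power[OF \<gamma>(1), of b] by linarith
  have nonneg: "0 \<le> \<Psi> z" for z unfolding \<Psi>_def using pos by (intro sum_list_nonneg) auto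
  have dec: "\<Psi> (sparsify_step \<theta> L F z) + 1 \<le> \<Psi> z" if z: "sound z" "fst z \<noteq> []" for z
  proof -
    obtain A st where Cons: "fst z = A # st" using z(2) by (cases "fst z") auto
    have A: "inv A" using z by (simp add: sound_def Cons)
    show ?thesis
    proof (cases "applicable \<theta> L (F @ A) = []")
      case True
      then show ?thesis using one_le_power[OF \<gamma>(1), of "B A"] by (simp add: sparsify_step_def Cons \<Psi>_def)
    next
      case False
      define A1 where "A1 = extend L A [fst (hd (applicable \<theta> L (F @ A)))]"
      define A2 where "A2 = extend L A (petals (F @ A) (fst (hd (applicable \<theta> L (F @ A)))) (fst (snd (hd (applicable \<theta> L (F @ A))))))"
      have b: "B A1 + 1 \<le> B A" "B A2 + \<theta> * \<theta> \<le> B A"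
        using branch[OF A False] unfolding A1_def A2_def by blast+
      define M where "M = B A - \<theta> * \<theta>"
      have M: "B A = \<theta> * \<theta> + M" using b(2) by (simp add: M_def)
      have \<theta>1: "1 \<le> \<theta> * \<theta>" using \<theta> mult_le_mono[of 1 \<theta> 1 \<theta>] by simp
      have "\<gamma> ^ B A1 + \<gamma> ^ B A2 \<le> \<gamma> ^ (\<theta> * \<theta> - 1 + M) + \<gamma> ^ M"
        using b M \<theta>1 \<gamma>(1) by (intro add_mono power_increasing) auto
      also have "\<dots> = (\<gamma> ^ (\<theta> * \<theta> - 1) + 1) * \<gamma> ^ M" by (simp add: power_add algebra_simps)
      also have "\<dots> \<le> \<gamma> ^ (\<theta> * \<theta>) * \<gamma> ^ M" using \<gamma> by (intro mult_right_mono) auto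
      finally have "\<gamma> ^ B A1 + \<gamma> ^ B A2 \<le> \<gamma> ^ B A" by (simp add: M power_add)
      moreover have "fst (sparsify_step \<theta> L F z) = A1 # A2 # st"
        using False by (simp add: sparsify_step_def Cons A1_def A2_def)
      ultimately show ?thesis by (simp add: \<Psi>_def Cons)
    qed
  qed
  have run: "fst (sparsify \<theta> L F u) = [] \<or> \<Psi> (sparsify \<theta> L F u) + real u \<le> \<Psi> ([[]], [])" for u
  proof (induction u)
    case 0
    then show ?case by (simp add: sparsify_def)
  next
    case (Suc u)
    show ?case
    proof (cases "fst (sparsify \<theta> L F u) = []")
      case True
      then show ?thesis by (simp add: sparsify_Suc sparsify_step_def)
    next
      case False
      then have "\<Psi> (sparsify \<theta> L F (Suc u)) + 1 \<le> \<Psi> (sparsify \<theta> L F u)"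
        unfolding sparsify_Suc using dec[OF sound_sparsify] by blast
      moreover have "\<Psi> (sparsify \<theta> L F u) + real u \<le> \<Psi> ([[]], [])" using Suc False by blast
      ultimately show ?thesis by simp
    qed
  qed
  have start: "\<Psi> ([[]], []) < real t"
  proof -
    have "B [] \<le> 4 * \<theta> * length L" unfolding B_def by (simp add: le_diff_conv mult_le_mono trans_le_add1)
    then have "\<gamma> ^ B [] \<le> \<gamma> ^ (4 * \<theta> * length L)" using \<gamma>(1) by (intro power_increasing) auto
    then show ?thesis using t by (simp add: \<Psi>_def)
  qed
  show ?thesis
  proof (rule ccontr)
    assume "fst (sparsify \<theta> L F t) \<noteq> []"
    then have "\<Psi> (sparsify \<theta> L F t) + real t \<le> \<Psi> ([[]], [])" using run[of t] by blast
    then show False using start nonneg[of "sparsify \<theta> L F t"] by linarith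
  qed
qed

lemma sparsify_correct:
  assumes "fst (sparsify \<theta> L F t) = []"
  shows "(\<exists>a. models a F) \<longleftrightarrow> (\<exists>G\<in>set (snd (sparsify \<theta> L F t)). \<exists>a. models a G)"
    "\<forall>G\<in>set (snd (sparsify \<theta> L F t)). sparse G"
  using sound_sparsify[of t] unfolding sound_def assms by auto

end

section \<open>Sparse formulas as constraint satisfaction problems\<close>

subsection \<open>Variables covered by bags\<close>

definition agree :: "nat list => bool list => nat list => bool list => bool" where
  "agree xs a ys b \<longleftrightarrow> (\<forall>p\<in>set (zip xs a). \<forall>q\<in>set (zip ys b). fst p = fst q --> snd p = snd q)"

definition sat_locally :: "clause list => nat list => bool list => bool" where
  "sat_locally G xs a \<longleftrightarrow> (\<forall>c\<in>set G. (\<forall>l\<in>set c. fst l \<in> set xs) --> (\<exists>l\<in>set c. l \<in> set (zip xs a)))"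

definition cover_csp :: "clause list => bool list list => nat list list => (nat \<times> nat) list => csp" where
  "cover_csp G words bags E = (length bags, length words,
     map (\<lambda>e. (fst e, snd e, map (\<lambda>a. map (\<lambda>b. sat_locally G (get [] bags (fst e)) a \<and>
       agree (get [] bags (fst e)) a (get [] bags (snd e)) b) words) words)) E)"

lemma PF_agree:
  assumes "PF xs" "PF a" "PF ys" "PF b" shows "PF (\<lambda>x. agree (xs x) (a x) (ys x) (b x))"
  unfolding agree_def by (intro PF_intros assms PF_comp[OF assms(3)] PF_comp[OF assms(4)])

lemma PF_sat_locally:
  assumes "PF G" "PF xs" "PF a" shows "PF (\<lambda>x. sat_locally (G x) (xs x) (a x))"
  unfolding sat_locally_def by (intro PF_intros assms PF_comp[OF assms(2)] PF_comp[OF assms(3)])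

lemma PF_cover_csp:
  assumes "PF G" "PF words" "PF bags" "PF E" shows "PF (\<lambda>x. cover_csp (G x) (words x) (bags x) (E x))"
  unfolding cover_csp_def
  by (intro PF_sat_locally PF_agree PF_intros assms PF_comp[OF assms(1)] PF_comp[OF assms(2)] PF_comp[OF assms(3)])

lemma csp_sat_cover: "csp_sat (cover_csp G words bags E) \<longleftrightarrow>
    (\<exists>val. (\<forall>v<length bags. val v < length words) \<and>
      (\<forall>e\<in>set E. get False (get [] (map (\<lambda>a. map (\<lambda>b. sat_locally G (get [] bags (fst e)) a \<and>
       agree (get [] bags (fst e)) a (get [] bags (snd e)) b) words) words) (val (fst e))) (val (snd e))))"
  unfolding csp_sat_def cover_csp_def by simp

text \<open>Like a tree decomposition, but with an arbitrary graph of bags: each clause lies within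
  a bag, and the bags that contain a given variable are connected. The link from the bag of a clause
  to itself triggers the check of the clause, and also makes repeated entries for a variable in this
  bag agree.\<close>

locale cover =
  fixes G :: "clause list" and words :: "bool list list" and bags :: "nat list list" and E :: "(nat \<times> nat) list"
    and b :: nat
  assumes words: "set words = {a. length a = b}" and bags: "bags \<noteq> []"
    and len: "p < length bags ==> length (bags ! p) \<le> b"
    and E: "(p, q) \<in> set E ==> p < length bags \<and> q < length bags"
    and home: "c \<in> set G ==> \<exists>p. (p, p) \<in> set E \<and> (\<forall>l\<in>set c. fst l \<in> set (bags ! p))"
    and conn: "p < length bags ==> q < length bags ==> x \<in> set (bags ! p) ==> x \<in> set (bags ! q) ==>
      (p, q) \<in> {(p, q). ((p, q) \<in> set E \<or> (q, p) \<in> set E) \<and> x \<in> set (bags ! p) \<and> x \<in> set (bags ! q)}\<^sup>*"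
begin

lemma cover_wf: "csp_wf (cover_csp G words bags E)"
proof -
  have "replicate b False \<in> set words" by (simp add: words)
  then have "0 < length words" by (cases words) auto
  then show ?thesis using bags E unfolding csp_wf_def cover_csp_def by auto
qed

lemma cover_sat: "csp_sat (cover_csp G words bags E) \<longleftrightarrow> (\<exists>a. models a G)"
proof
  assume "csp_sat (cover_csp G words bags E)"
  then obtain val where val: "\<forall>v<length bags. val v < length words"
    "\<forall>e\<in>set E. get False (get [] (map (\<lambda>a. map (\<lambda>b. sat_locally G (get [] bags (fst e)) a \<and>
       agree (get [] bags (fst e)) a (get [] bags (snd e)) b) words) words) (val (fst e))) (val (snd e))"
    unfolding csp_sat_cover by blast
  define A where "A p = words ! val p" for p
  have lenA: "length (A p) = b" if "p < length bags" for p
    using nth_mem[of "val p" words] val(1) that words by (auto simp: A_def)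
  have rel: "sat_locally G (bags ! p) (A p) \<and> agree (bags ! p) (A p) (bags ! q) (A q)" if e: "(p, q) \<in> set E" for p q
  proof -
    have pq: "p < length bags" "q < length bags" using E[OF e] by auto
    then have "val p < length words" "val q < length words" using val(1) by auto
    with bspec[OF val(2) e] pq show ?thesis by (simp add: A_def)
  qed
  \<comment> \<open>A bag may list a variable several times, so a priori it assigns a set of values.
    Agreement along a link makes the sets at both ends one and the same singleton.\<close>
  define W where "W p x = {v. (x, v) \<in> set (zip (bags ! p) (A p))}" for p x
  have W_ne: "W p x \<noteq> {}" if p: "p < length bags" and x: "x \<in> set (bags ! p)" for p x
  proof -
    obtain i where i: "i < length (bags ! p)" "bags ! p ! i = x" using x by (auto simp: in_set_conv_nth)
    then have "(x, A p ! i) \<in> set (zip (bags ! p) (A p))"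
      using lenA[OF p] len[OF p] by (auto simp: set_zip intro!: exI[of _ i])
    then show ?thesis by (auto simp: W_def)
  qed
  have W_eq: "W p x = W q x" if "(p, q) \<in> set E" "x \<in> set (bags ! p)" "x \<in> set (bags ! q)" for p q x
  proof -
    have "v = u" if "v \<in> W p x" "u \<in> W q x" for u v
      using rel[OF \<open>(p, q) \<in> set E\<close>] that unfolding agree_def W_def by fastforce
    moreover have "W p x \<noteq> {}" "W q x \<noteq> {}" using W_ne E that by blast+
    ultimately show ?thesis by blast
  qed
  have W_conn: "W p x = W q x" if pq: "p < length bags" "q < length bags" "x \<in> set (bags ! p)" "x \<in> set (bags ! q)" for p q x
    using conn[OF pq]
  proof (induction rule: rtrancl_induct)
    case (step q r)
    then have "W q x = W r x" using W_eq by blast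
    then show ?case using step by simp
  qed simp
  define a where "a x \<longleftrightarrow> (\<exists>p<length bags. x \<in> set (bags ! p) \<and> True \<in> W p x)" for x
  have "\<exists>l\<in>set c. a (fst l) = snd l" if c: "c \<in> set G" for c
  proof -
    obtain p where p: "(p, p) \<in> set E" "\<forall>l\<in>set c. fst l \<in> set (bags ! p)" using home[OF c] by blast
    then obtain l where l: "l \<in> set c" "l \<in> set (zip (bags ! p) (A p))"
      using rel[OF p(1)] c unfolding sat_locally_def by blast
    have pl: "p < length bags" using E[OF p(1)] by simp
    have lx: "fst l \<in> set (bags ! p)" using p l by blast
    have lW: "snd l \<in> W p (fst l)" using l by (simp add: W_def)
    have single: "v = u" if "v \<in> W p (fst l)" "u \<in> W p (fst l)" for u v
      using rel[OF p(1)] that unfolding agree_def W_def by fastforce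
    have "a (fst l) \<longleftrightarrow> True \<in> W p (fst l)"
      unfolding a_def using W_conn[OF pl _ lx] pl lx by blast
    then have "a (fst l) = snd l" using single lW by (cases "snd l") auto
    then show ?thesis using l by blast
  qed
  then show "\<exists>a. models a G" unfolding models_def by blast
next
  assume "\<exists>a. models a G"
  then obtain a where a: "models a G" ..
  \<comment> \<open>Padded to the common word length; \<open>zip\<close> ignores the
    padding.\<close>
  define A where "A p = map a (bags ! p) @ replicate (b - length (bags ! p)) False" for p
  have "A p \<in> set words" if "p < length bags" for p using len[OF that] by (simp add: words A_def)
  then have "\<forall>p. \<exists>i. p < length bags --> i < length words \<and> words ! i = A p" by (metis in_set_conv_nth)
  then obtain val where val: "\<forall>p. p < length bags --> val p < length words \<and> words ! val p = A p" by metis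
  have zip: "q \<in> set (zip (bags ! p) (A p)) \<longleftrightarrow> fst q \<in> set (bags ! p) \<and> snd q = a (fst q)" for p q
  proof -
    have "zip (bags ! p) (A p) = zip (bags ! p) (map a (bags ! p))" unfolding A_def by (simp add: zip_append2)
    then show ?thesis by (cases q) (auto simp: zip_map2 zip_same_conv_map)
  qed
  have "get False (get [] (map (\<lambda>a. map (\<lambda>b. sat_locally G (get [] bags (fst e)) a \<and>
       agree (get [] bags (fst e)) a (get [] bags (snd e)) b) words) words) (val (fst e))) (val (snd e))" if e: "e \<in> set E" for e
  proof -
    have l: "fst e < length bags" "snd e < length bags" using E[of "fst e" "snd e"] e by auto
    have "sat_locally G (bags ! fst e) (A (fst e))"
      unfolding sat_locally_def zip
    proof (intro ballI impI)
      fix c assume c: "c \<in> set G" "\<forall>l\<in>set c. fst l \<in> set (bags ! fst e)"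
      then obtain l where "l \<in> set c" "a (fst l) = snd l" using a unfolding models_def by blast
      then show "\<exists>l\<in>set c. fst l \<in> set (bags ! fst e) \<and> snd l = a (fst l)" using c by auto
    qed
    moreover have "agree (bags ! fst e) (A (fst e)) (bags ! snd e) (A (snd e))"
      unfolding agree_def by (intro ballI impI) (simp add: zip)
    ultimately show ?thesis using l val by simp
  qed
  then show "csp_sat (cover_csp G words bags E)" unfolding csp_sat_cover using val by blast
qed

end

subsection \<open>Routing occurrences from variables to clauses\<close>

definition shift :: "nat => nat => nat" where
  "shift i v = foldl (\<lambda>v _. v div 2) v (replicate i ())"

text \<open>Division expressed by counting positive multiples, so that the closure rules for lists
  apply.\<close>

definition quot :: "nat => nat => nat" where
  "quot m n = length (filter (\<lambda>j. Suc j * n \<le> m) [0..<m])"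

lemma shift: "shift i v = v div 2 ^ i"
  unfolding shift_def foldl_replicate by (induction i) (simp_all add: power_Suc2 div_mult2_eq del: power_Suc)

lemma quot: "0 < n ==> quot m n = m div n"
proof -
  assume n: "0 < n"
  have "set (filter (\<lambda>j. Suc j * n \<le> m) [0..<m]) = {..<m div n}"
  proof (intro equalityI subsetI)
    fix j assume "j \<in> set (filter (\<lambda>j. Suc j * n \<le> m) [0..<m])"
    then have "Suc j * n \<le> m" by simp
    then have "Suc j \<le> m div n" using n by (simp add: less_eq_div_iff_mult_less_eq)
    then show "j \<in> {..<m div n}" by simp
  next
    fix j assume "j \<in> {..<m div n}"
    then have "Suc j \<le> m div n" by simp
    then have "Suc j * n \<le> m" using n by (simp add: less_eq_div_iff_mult_less_eq)
    moreover have "Suc j * 1 \<le> Suc j * n" using n by (intro mult_le_mono) auto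
    ultimately show "j \<in> set (filter (\<lambda>j. Suc j * n \<le> m) [0..<m])" by simp
  qed
  then have "card (set (filter (\<lambda>j. Suc j * n \<le> m) [0..<m])) = m div n" by simp
  then show ?thesis unfolding quot_def using distinct_card[of "filter (\<lambda>j. Suc j * n \<le> m) [0..<m]"] by simp
qed

lemma PF_shift:
  assumes "PF i" "PF v" shows "PF (\<lambda>x. shift (i x) (v x))"
  unfolding shift_def
  by (rule PF_foldl_add[where B = "\<lambda>x. 0"]) (auto intro!: PF_intros PF_replicate_unit polyb_const assms)

lemma PF_quot:
  assumes "PF m" "PF n" shows "PF (\<lambda>x. quot (m x) (n x))"
  unfolding quot_def by (intro PF_intros assms PF_comp[OF assms(1)] PF_comp[OF assms(2)])

definition clause_vars :: "clause => nat list" where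
  "clause_vars c = map (\<lambda>l. fst l) c"

definition var_bound :: "clause list => nat" where
  "var_bound G = length (concat (map (\<lambda>c. concat (map (\<lambda>l. replicate (Suc (fst l)) ()) c)) G))"

text \<open>One entry for each occurrence of a variable in a clause, as a variable and a clause
  index. The entries are sorted by variable, so the occurrences of a variable are
  consecutive.\<close>

definition tokens :: "clause list => (nat \<times> nat) list" where
  "tokens G = concat (map (\<lambda>x. map (\<lambda>j. (x, j)) (filter (\<lambda>j. x \<in> set (clause_vars (get [] G j))) [0..<length G]))
     [0..<var_bound G])"

definition group :: "nat => nat => nat => nat" where
  "group K m j = quot j (Suc (quot m K))"

text \<open>Level \<open>i \<le> w\<close> sorts the occurrences by their keys, and equal keys by variables. Level 0 is thus
  sorted by groups of clauses and level \<open>w\<close>, if \<open>K \<le> 2 ^ w\<close>, by variables. In level \<open>w + 1\<close>, every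
  group has a bag of its own.\<close>

definition key :: "nat => nat => (nat \<times> nat) list => nat => nat => nat" where
  "key K m ts i r = shift i (group K m (snd (get (0, 0) ts r)))"

definition pos :: "nat => nat => (nat \<times> nat) list => nat => nat => nat" where
  "pos K m ts i r = length (filter (\<lambda>s. key K m ts i s < key K m ts i r \<or>
     key K m ts i s = key K m ts i r \<and> s < r) [0..<length ts])"

text \<open>Three occurrences for each clause of a group. The group size is rounded up, so that
  \<open>K\<close> groups hold all clauses and \<open>K\<close> bags of this size hold all
  occurrences.\<close>

definition bag_size :: "nat => nat => nat" where
  "bag_size K m = 3 * Suc (quot m K)"

definition node :: "nat => nat => nat => (nat \<times> nat) list => nat => nat => nat" where
  "node K w m ts i r = i * K + (if i \<le> w then quot (pos K m ts i r) (bag_size K m)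
     else group K m (snd (get (0, 0) ts r)))"

definition radix_bags :: "nat => nat => nat => (nat \<times> nat) list => nat list list" where
  "radix_bags K w m ts = map (\<lambda>p. map (\<lambda>r. fst (get (0, 0) ts r))
     (filter (\<lambda>r. \<exists>i\<in>set [0..<w + 2]. node K w m ts i r = p) [0..<length ts])) [0..<(w + 2) * K]"

text \<open>Every occurrence connects its bags in successive levels, and the bag of its clause group
  to level 0. In level \<open>w\<close>, where the order is that of the variables, neighbouring
  occurrences of the same variable are linked. Hence all bags with a given variable are connected.
  The last line provides the self-links at which clauses are checked.\<close>

definition radix_links :: "nat => nat => nat => (nat \<times> nat) list => (nat \<times> nat) list" where
  "radix_links K w m ts = dedup (
     concat (map (\<lambda>i. map (\<lambda>r. (node K w m ts i r, node K w m ts (Suc i) r)) [0..<length ts]) [0..<w]) @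
     map (\<lambda>r. (node K w m ts 0 r, node K w m ts (Suc w) r)) [0..<length ts] @
     map (\<lambda>r. (node K w m ts w r, node K w m ts w (Suc r)))
       (filter (\<lambda>r. Suc r < length ts \<and> fst (get (0, 0) ts r) = fst (get (0, 0) ts (Suc r))) [0..<length ts]) @
     map (\<lambda>\<beta>. (Suc w * K + \<beta>, Suc w * K + \<beta>)) [0..<K])"

definition radix_csp :: "clause list => bool list list => nat => nat => csp" where
  "radix_csp G words K w = cover_csp G words (radix_bags K w (length G) (tokens G)) (radix_links K w (length G) (tokens G))"

lemma PF_clause_vars: "PF c ==> PF (\<lambda>x. clause_vars (c x))"
  unfolding clause_vars_def by (intro PF_intros)

lemma PF_var_bound:
  assumes "PF G" shows "PF (\<lambda>x. var_bound (G x))"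
  unfolding var_bound_def by (intro PF_intros PF_replicate_unit assms)

lemma PF_tokens:
  assumes "PF G" shows "PF (\<lambda>x. tokens (G x))"
  unfolding tokens_def by (intro PF_clause_vars PF_var_bound PF_intros assms PF_comp[OF assms])

lemma PF_group:
  assumes "PF K" "PF m" "PF j" shows "PF (\<lambda>x. group (K x) (m x) (j x))"
  unfolding group_def by (intro PF_quot PF_Suc assms)

lemma PF_key:
  assumes "PF K" "PF m" "PF ts" "PF i" "PF r" shows "PF (\<lambda>x. key (K x) (m x) (ts x) (i x) (r x))"
  unfolding key_def by (intro PF_shift PF_group PF_get PF_snd PF_const assms)

lemma PF_pos:
  assumes "PF K" "PF m" "PF ts" "PF i" "PF r" shows "PF (\<lambda>x. pos (K x) (m x) (ts x) (i x) (r x))"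
  unfolding pos_def
  by (intro PF_key PF_intros assms PF_comp[OF assms(1)] PF_comp[OF assms(2)] PF_comp[OF assms(3)]
      PF_comp[OF assms(4)] PF_comp[OF assms(5)])

lemma PF_bag_size: "PF K ==> PF m ==> PF (\<lambda>x. bag_size (K x) (m x))"
  unfolding bag_size_def by (intro PF_mult PF_const PF_Suc PF_quot)

lemma PF_node:
  assumes "PF K" "PF w" "PF m" "PF ts" "PF i" "PF r" shows "PF (\<lambda>x. node (K x) (w x) (m x) (ts x) (i x) (r x))"
  unfolding node_def
  by (intro PF_quot PF_pos PF_group PF_bag_size PF_add PF_mult PF_if PF_le PF_get PF_snd PF_const assms)

lemma PF_radix_bags:
  assumes "PF K" "PF w" "PF m" "PF ts" shows "PF (\<lambda>x. radix_bags (K x) (w x) (m x) (ts x))"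
  unfolding radix_bags_def
  by (intro PF_node PF_intros assms PF_comp[OF assms(1)] PF_comp[OF assms(2)] PF_comp[OF assms(3)] PF_comp[OF assms(4)])

lemma PF_radix_links:
  assumes "PF K" "PF w" "PF m" "PF ts" shows "PF (\<lambda>x. radix_links (K x) (w x) (m x) (ts x))"
  unfolding radix_links_def
  by (intro PF_dedup PF_node PF_intros assms PF_comp[OF assms(1)] PF_comp[OF assms(2)] PF_comp[OF assms(3)] PF_comp[OF assms(4)])

lemma PF_radix_csp:
  assumes "PF G" "PF words" "PF K" "PF w" shows "PF (\<lambda>x. radix_csp (G x) (words x) (K x) (w x))"
  unfolding radix_csp_def by (intro PF_cover_csp PF_radix_bags PF_radix_links PF_tokens PF_length assms)

text \<open>The sum of the coordinates is injective on a chain.\<close>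

lemma card_chain:
  fixes f g :: "nat => nat"
  assumes K: "0 < K" and f: "\<And>r. r \<in> R ==> a \<le> f r \<and> f r < a + K" and g: "\<And>r. r \<in> R ==> b \<le> g r \<and> g r < b + K"
    and chain: "\<And>r s. r \<in> R ==> s \<in> R ==> f r \<le> f s \<and> g r \<le> g s \<or> f s \<le> f r \<and> g s \<le> g r"
  shows "card ((\<lambda>r. (f r, g r)) ` R) \<le> 2 * K"
proof -
  have "card ((\<lambda>r. (f r, g r)) ` R) \<le> card {a + b..<a + b + 2 * K}"
  proof (rule card_inj_on_le[where f = "\<lambda>p. fst p + snd p"])
    show "inj_on (\<lambda>p. fst p + snd p) ((\<lambda>r. (f r, g r)) ` R)"
    proof (rule inj_onI)
      fix p q assume "p \<in> (\<lambda>r. (f r, g r)) ` R" "q \<in> (\<lambda>r. (f r, g r)) ` R" and eq: "fst p + snd p = fst q + snd q"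
      then obtain r s where rs: "r \<in> R" "p = (f r, g r)" "s \<in> R" "q = (f s, g s)" by blast
      then have "f r + g r = f s + g s" using eq by simp
      with chain[OF rs(1,3)] have "f r = f s \<and> g r = g s" by linarith
      then show "p = q" using rs by simp
    qed
    show "(\<lambda>p. fst p + snd p) ` (\<lambda>r. (f r, g r)) ` R \<subseteq> {a + b..<a + b + 2 * K}"
    proof
      fix y assume "y \<in> (\<lambda>p. fst p + snd p) ` (\<lambda>r. (f r, g r)) ` R"
      then obtain r where "r \<in> R" "y = f r + g r" by auto
      then show "y \<in> {a + b..<a + b + 2 * K}" using f[of r] g[of r] by simp
    qed
  qed simp
  then show ?thesis by simp
qed

section \<open>Bag sizes, connectedness and number of links of the radix network\<close>

locale radix =
  fixes G :: "clause list" and K w :: nat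
  assumes G3: "c \<in> set G ==> length c \<le> 3" and K: "0 < K"
begin

abbreviation "m \<equiv> length G"
abbreviation "ts \<equiv> tokens G"
abbreviation "M \<equiv> length ts"
abbreviation "c0 \<equiv> Suc (m div K)"
abbreviation "bs \<equiv> bag_size K m"
abbreviation "grp r \<equiv> group K m (snd (ts ! r))"
abbreviation "nd \<equiv> node K w m ts"

lemma quotK: "quot m K = m div K" by (rule quot[OF K])

lemma bs: "bs = 3 * c0" by (simp add: bag_size_def quotK)

lemma group: "group K m j = j div c0" unfolding group_def quotK by (rule quot) simp

lemma m_less: "m < K * c0"
  using K by (simp add: mult.commute[of K] dividend_less_div_times)

lemma group_less: "j < m ==> group K m j < K"
  unfolding group using m_less by (intro less_mult_imp_div_less) simp

lemma set_tokens: "(x, j) \<in> set ts \<longleftrightarrow> j < m \<and> x \<in> set (clause_vars (G ! j))"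
proof -
  have "x < var_bound G" if jx: "j < m" "x \<in> set (clause_vars (G ! j))"
  proof -
    obtain l where l: "l \<in> set (G ! j)" "x = fst l" using jx(2) by (auto simp: clause_vars_def)
    have len: "length u \<le> length (concat xs)" if "u \<in> set xs" for u :: "unit list" and xs
      using that by (induction xs) auto
    have "Suc x \<le> length (concat (map (\<lambda>l. replicate (Suc (fst l)) ()) (G ! j)))"
      using len[of "replicate (Suc (fst l)) ()"] l by fastforce
    also have "\<dots> \<le> var_bound G" unfolding var_bound_def using jx(1) by (intro len) auto
    finally show ?thesis by simp
  qed
  then show ?thesis by (auto simp: tokens_def intro!: bexI[of _ x])
qed

lemma tokens_sorted: "sorted (map fst ts)" and tokens_distinct: "distinct ts"
proof -
  have "sorted (map fst (concat (map (\<lambda>x. map (\<lambda>j. (x, j)) (f x)) [0..<n]))) \<and>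
    (\<forall>p\<in>set (concat (map (\<lambda>x. map (\<lambda>j. (x, j)) (f x)) [0..<n])). fst p < n) \<and>
    distinct (concat (map (\<lambda>x. map (\<lambda>j. (x, j)) (f x)) [0..<n]))"
    if f: "\<And>x. distinct (f x)" for f :: "nat => nat list" and n
  proof (induction n)
    case (Suc n)
    have "sorted (map fst (map (\<lambda>j. (n, j)) (f n)))" by (simp add: comp_def map_replicate_const)
    moreover have "distinct (map (\<lambda>j. (n, j)) (f n))" using f by (simp add: distinct_map inj_on_def)
    moreover have "\<forall>p\<in>set (map (\<lambda>j. (n, j)) (f n)). fst p = n" by auto
    ultimately show ?case using Suc by (fastforce simp: sorted_append)
  qed simp
  from this[of "\<lambda>x. filter (\<lambda>j. x \<in> set (clause_vars (get [] G j))) [0..<length G]" "var_bound G"]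
  show "sorted (map fst ts)" "distinct ts" unfolding tokens_def by auto
qed

lemma ts_nth: "r < M ==> snd (ts ! r) < m \<and> fst (ts ! r) \<in> set (clause_vars (G ! snd (ts ! r)))"
  using set_tokens[of "fst (ts ! r)" "snd (ts ! r)"] nth_mem[of r ts] by simp

lemma card_tokens:
  assumes "finite J" shows "card {r. r < M \<and> snd (ts ! r) \<in> J} \<le> 3 * card J"
proof -
  have "card {r. r < M \<and> snd (ts ! r) \<in> J} = card ((!) ts ` {r. r < M \<and> snd (ts ! r) \<in> J})"
    using tokens_distinct by (intro card_image[symmetric]) (auto simp: inj_on_def nth_eq_iff_index_eq)
  also have "\<dots> \<le> card (\<Union>j\<in>J \<inter> {..<m}. (\<lambda>x. (x, j)) ` set (clause_vars (G ! j)))"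
  proof (rule card_mono)
    show "(!) ts ` {r. r < M \<and> snd (ts ! r) \<in> J} \<subseteq> (\<Union>j\<in>J \<inter> {..<m}. (\<lambda>x. (x, j)) ` set (clause_vars (G ! j)))"
    proof
      fix p assume "p \<in> (!) ts ` {r. r < M \<and> snd (ts ! r) \<in> J}"
      then obtain r where "r < M" "snd (ts ! r) \<in> J" "p = ts ! r" by blast
      then show "p \<in> (\<Union>j\<in>J \<inter> {..<m}. (\<lambda>x. (x, j)) ` set (clause_vars (G ! j)))"
        using ts_nth[of r] by (intro UN_I[of "snd (ts ! r)"] image_eqI[of _ _ "fst (ts ! r)"]) auto
    qed
  qed (use assms in auto)
  also have "\<dots> \<le> (\<Sum>j\<in>J \<inter> {..<m}. card ((\<lambda>x. (x, j)) ` set (clause_vars (G ! j))))"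
    using assms by (intro card_UN_le) simp
  also have "\<dots> \<le> (\<Sum>j\<in>J \<inter> {..<m}. 3)"
  proof (rule sum_mono)
    fix j assume "j \<in> J \<inter> {..<m}"
    then have "length (G ! j) \<le> 3" using G3 by simp
    moreover have "card ((\<lambda>x. (x, j)) ` set (clause_vars (G ! j))) \<le> length (clause_vars (G ! j))"
      using card_image_le[of "set (clause_vars (G ! j))" "\<lambda>x. (x, j)"] card_length[of "clause_vars (G ! j)"] by simp
    ultimately show "card ((\<lambda>x. (x, j)) ` set (clause_vars (G ! j))) \<le> 3" by (simp add: clause_vars_def)
  qed
  also have "\<dots> \<le> 3 * card J" using assms by (simp add: card_mono)
  finally show ?thesis .
qed

lemma M_le: "M \<le> 3 * m"
proof -
  have "{r. r < M \<and> snd (ts ! r) \<in> {..<m}} = {..<M}" using ts_nth by auto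
  then show ?thesis using card_tokens[of "{..<m}"] by simp
qed

definition before where
  "before i r s \<longleftrightarrow> key K m ts i r < key K m ts i s \<or> key K m ts i r = key K m ts i s \<and> r < s"

lemma pos: "pos K m ts i r = card {s. s < M \<and> before i s r}"
proof -
  have "set (filter (\<lambda>s. before i s r) [0..<M]) = {s. s < M \<and> before i s r}" by auto
  then show ?thesis unfolding pos_def before_def[symmetric]
    using distinct_card[of "filter (\<lambda>s. before i s r) [0..<M]"] by simp
qed

lemma before_total: "r \<noteq> s ==> before i r s \<or> before i s r"
  unfolding before_def by auto

lemma pos_less: "r < M ==> before i r s ==> pos K m ts i r < pos K m ts i s"
  unfolding pos by (rule psubset_card_mono) (auto simp: before_def)

lemma pos_M: "r < M ==> pos K m ts i r < M"
proof -
  assume "r < M"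
  then have "{s. s < M \<and> before i s r} \<subset> {..<M}" by (auto simp: before_def)
  then have "card {s. s < M \<and> before i s r} < card {..<M}" by (rule psubset_card_mono[rotated]) simp
  then show ?thesis by (simp add: pos)
qed

lemma pos_inj: "inj_on (pos K m ts i) {..<M}"
proof (rule inj_onI)
  fix r s assume "r \<in> {..<M}" "s \<in> {..<M}" "pos K m ts i r = pos K m ts i s"
  then show "r = s" using before_total[of r s i] pos_less[of r i s] pos_less[of s i r] by auto
qed

lemma pos_quot: "quot (pos K m ts i r) bs = pos K m ts i r div bs"
  by (rule quot) (simp add: bs)

lemma pos_quot_less: "r < M ==> pos K m ts i r div bs < K"
proof -
  assume "r < M"
  then have "pos K m ts i r < 3 * m" using pos_M M_le by (meson less_le_trans)
  also have "\<dots> < 3 * (K * c0)" using m_less by simp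
  also have "\<dots> = K * bs" by (simp add: bs algebra_simps)
  finally show ?thesis by (rule less_mult_imp_div_less)
qed

lemma node_inner: "i \<le> w ==> nd i r = i * K + pos K m ts i r div bs"
  unfolding node_def pos_quot by simp

lemma node_outer: "r < M ==> nd (Suc w) r = Suc w * K + grp r"
  unfolding node_def by simp

lemma node_bounds: "r < M ==> i \<le> Suc w ==> i * K \<le> nd i r \<and> nd i r < i * K + K"
  using node_inner[of i r] node_outer[of r] pos_quot_less[of r i] group_less ts_nth[of r]
  by (cases "i \<le> w") (auto simp: le_Suc_eq)

lemma node_less: "r < M ==> i \<le> Suc w ==> nd i r < (w + 2) * K"
proof -
  assume r: "r < M" "i \<le> Suc w"
  have "nd i r < Suc i * K" using node_bounds[OF r] by simp
  also have "\<dots> \<le> (w + 2) * K" using r by (intro mult_le_mono) auto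
  finally show ?thesis .
qed

lemma node_level: "r < M ==> s < M ==> i \<le> Suc w ==> j \<le> Suc w ==> nd i r = nd j s ==> i = j"
proof -
  assume a: "r < M" "s < M" "i \<le> Suc w" "j \<le> Suc w" "nd i r = nd j s"
  have "nd i r div K = i" "nd j s div K = j"
    using node_bounds[OF a(1,3)] node_bounds[OF a(2,4)] by (auto intro!: div_nat_eqI simp: mult.commute)
  then show ?thesis using a by simp
qed

abbreviation "bags \<equiv> radix_bags K w m ts"
abbreviation "links \<equiv> radix_links K w m ts"

lemma length_bags: "length bags = (w + 2) * K" by (simp add: radix_bags_def)

lemma set_levels: "set [0..<w + 2] = {..Suc w}" by auto

lemma set_bag: "p < (w + 2) * K ==> x \<in> set (bags ! p) \<longleftrightarrow> (\<exists>r<M. fst (ts ! r) = x \<and> (\<exists>i\<le>Suc w. nd i r = p))"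
proof -
  assume p: "p < (w + 2) * K"
  have b: "bags ! p = map (\<lambda>r. fst (get (0, 0) ts r)) (filter (\<lambda>r. \<exists>i\<in>set [0..<w + 2]. nd i r = p) [0..<M])"
    using p by (simp add: radix_bags_def)
  have "set (bags ! p) = (\<lambda>r. fst (get (0, 0) ts r)) ` {r \<in> set [0..<M]. \<exists>i\<in>set [0..<w + 2]. nd i r = p}"
    unfolding b by (simp only: set_map set_filter)
  then show ?thesis unfolding set_levels by auto
qed

text \<open>A bag belongs to a single level. In the sorted levels it holds a block of consecutive
  ranks, in the last level the occurrences in a block of consecutive clauses.\<close>

lemma length_bag:
  assumes "p < (w + 2) * K" shows "length (bags ! p) \<le> bs"
proof -
  let ?S = "{r. r < M \<and> (\<exists>i\<le>Suc w. nd i r = p)}"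
  have "length (bags ! p) = card (set (filter (\<lambda>r. \<exists>i\<in>set [0..<w + 2]. nd i r = p) [0..<M]))"
    using assms distinct_card[of "filter (\<lambda>r. \<exists>i\<in>set [0..<w + 2]. nd i r = p) [0..<M]"]
    by (simp add: radix_bags_def del: set_filter)
  also have "set (filter (\<lambda>r. \<exists>i\<in>set [0..<w + 2]. nd i r = p) [0..<M]) = ?S"
    unfolding set_filter set_levels by auto
  also have "card ?S \<le> bs"
  proof (cases "?S = {}")
    case False
    then obtain r0 i where r0: "r0 < M" "i \<le> Suc w" "nd i r0 = p" by blast
    have S: "?S \<subseteq> {r. r < M \<and> nd i r = p}" using node_level r0 by blast
    show ?thesis
    proof (cases "i \<le> w")
      case True
      have "pos K m ts i ` ?S \<subseteq> {(p - i * K) * bs..<(p - i * K) * bs + bs}"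
      proof
        fix y assume "y \<in> pos K m ts i ` ?S"
        then obtain r where r: "r < M" "nd i r = p" "y = pos K m ts i r" using S by blast
        then have "y div bs = p - i * K" using node_inner[OF True, of r] by simp
        moreover have "0 < bs" by (simp add: bs)
        ultimately show "y \<in> {(p - i * K) * bs..<(p - i * K) * bs + bs}"
          using div_times_less_eq_dividend[of y bs] dividend_less_div_times[of bs y] by auto
      qed
      from card_mono[OF _ this] have "card (pos K m ts i ` ?S) \<le> bs" by simp
      moreover have "inj_on (pos K m ts i) ?S" by (rule inj_on_subset[OF pos_inj]) auto
      ultimately show ?thesis by (simp add: card_image)
    next
      case False
      then have i: "i = Suc w" using r0 by simp
      define \<beta> where "\<beta> = p - Suc w * K"
      have "?S \<subseteq> {r. r < M \<and> snd (ts ! r) \<in> {\<beta> * c0..<\<beta> * c0 + c0}}"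
      proof
        fix r assume "r \<in> ?S"
        then have r: "r < M" "nd (Suc w) r = p" using S i by auto
        then have "snd (ts ! r) div c0 = \<beta>" using node_outer[of r] by (simp add: \<beta>_def group)
        then have "snd (ts ! r) \<in> {\<beta> * c0..<\<beta> * c0 + c0}"
          using div_times_less_eq_dividend[of "snd (ts ! r)" c0] dividend_less_div_times[of c0 "snd (ts ! r)"] by auto
        then show "r \<in> {r. r < M \<and> snd (ts ! r) \<in> {\<beta> * c0..<\<beta> * c0 + c0}}" using r by simp
      qed
      then have "card ?S \<le> card {r. r < M \<and> snd (ts ! r) \<in> {\<beta> * c0..<\<beta> * c0 + c0}}"
        by (rule card_mono[rotated]) (rule finite_subset[of _ "{..<M}"], auto)
      also have "\<dots> \<le> 3 * card {\<beta> * c0..<\<beta> * c0 + c0}" by (rule card_tokens) simp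
      finally show ?thesis by (simp add: bs)
    qed
  next
    case True
    then show ?thesis by (simp only: card.empty le0)
  qed
  finally show ?thesis .
qed

lemma set_links: "set links =
    (\<Union>i<w. (\<lambda>r. (nd i r, nd (Suc i) r)) ` {..<M}) \<union> (\<lambda>r. (nd 0 r, nd (Suc w) r)) ` {..<M} \<union>
    (\<lambda>r. (nd w r, nd w (Suc r))) ` {r. Suc r < M \<and> fst (ts ! r) = fst (ts ! Suc r)} \<union>
    (\<lambda>\<beta>. (Suc w * K + \<beta>, Suc w * K + \<beta>)) ` {..<K}"
proof -
  have 1: "set (filter (\<lambda>r. Suc r < M \<and> fst (get (0, 0) ts r) = fst (get (0, 0) ts (Suc r))) [0..<M]) =
    {r. Suc r < M \<and> fst (ts ! r) = fst (ts ! Suc r)}" by auto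
  show ?thesis
    unfolding radix_links_def dedup set_append set_concat set_map 1 set_upt atLeast0LessThan image_image Un_assoc ..
qed

lemma radix_cover:
  assumes "set words = {a. length a = bs}"
  shows "cover G words bags links bs"
proof
  show "bags \<noteq> []" using K by (simp flip: length_greater_0_conv add: length_bags)
  show "length (bags ! p) \<le> bs" if "p < length bags" for p using that length_bag by (simp add: length_bags)
  show "p < length bags \<and> q < length bags" if "(p, q) \<in> set links" for p q
    using that unfolding set_links length_bags
  proof (elim UnE UN_E imageE, goal_cases)
    case (1 i r)
    then show ?case using node_less[of r i] node_less[of r "Suc i"] by simp
  next
    case (2 r)
    then show ?case using node_less[of r 0] node_less[of r "Suc w"] by simp
  next
    case (3 r)
    then show ?case using node_less[of r w] node_less[of "Suc r" w] by simp
  next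
    case (4 \<beta>)
    then show ?case by simp
  qed
  show "\<exists>p. (p, p) \<in> set links \<and> (\<forall>l\<in>set c. fst l \<in> set (bags ! p))" if c: "c \<in> set G" for c
  proof -
    obtain j where j: "j < m" "G ! j = c" using c by (auto simp: in_set_conv_nth)
    define p where "p = Suc w * K + group K m j"
    have p: "p < (w + 2) * K" using group_less[OF j(1)] by (simp add: p_def)
    have "fst l \<in> set (bags ! p)" if "l \<in> set c" for l
    proof -
      have "(fst l, j) \<in> set ts" using that j by (auto simp: set_tokens clause_vars_def)
      then obtain r where r: "r < M" "ts ! r = (fst l, j)" by (auto simp: in_set_conv_nth)
      then have "nd (Suc w) r = p" by (simp add: node_outer p_def)
      then have "\<exists>i\<le>Suc w. nd i r = p" by (intro exI[of _ "Suc w"]) simp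
      then show ?thesis using r unfolding set_bag[OF p] by (intro exI[of _ r]) simp
    qed
    moreover have "(p, p) \<in> set links" unfolding set_links using group_less[OF j(1)] by (auto simp: p_def)
    ultimately show ?thesis by blast
  qed
  show "(p, q) \<in> {(p, q). ((p, q) \<in> set links \<or> (q, p) \<in> set links) \<and> x \<in> set (bags ! p) \<and> x \<in> set (bags ! q)}\<^sup>*"
    if pq: "p < length bags" "q < length bags" "x \<in> set (bags ! p)" "x \<in> set (bags ! q)" for p q x
  proof -
    let ?E = "{(p, q). ((p, q) \<in> set links \<or> (q, p) \<in> set links) \<and> x \<in> set (bags ! p) \<and> x \<in> set (bags ! q)}"
    have sym: "(u, v) \<in> ?E\<^sup>* ==> (v, u) \<in> ?E\<^sup>*" for u v
      using sym_rtrancl[of ?E] by (auto simp: sym_def)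
    have link: "(u, v) \<in> ?E\<^sup>*" if "(u, v) \<in> set links" "x \<in> set (bags ! u)" "x \<in> set (bags ! v)" for u v
      using that by (intro r_into_rtrancl) simp
    have mem: "x \<in> set (bags ! nd i r)" if "r < M" "fst (ts ! r) = x" "i \<le> Suc w" for i r
      using that unfolding set_bag[OF node_less[OF that(1,3)]] by blast
    have up: "(nd i r, nd (i + k) r) \<in> ?E\<^sup>*" if r: "r < M" "fst (ts ! r) = x" "i + k \<le> w" for i r k
      using that(3)
    proof (induction k)
      case (Suc k)
      have "(nd (i + k) r, nd (Suc (i + k)) r) \<in> set links"
        unfolding set_links using Suc.prems r(1) by auto
      then have "(nd (i + k) r, nd (Suc (i + k)) r) \<in> ?E\<^sup>*"
        by (intro link mem) (use r Suc.prems in simp_all)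
      then show ?case using Suc by (auto intro: rtrancl_trans)
    qed simp
    have top: "(nd i r, nd w r) \<in> ?E\<^sup>*" if r: "r < M" "fst (ts ! r) = x" "i \<le> Suc w" for i r
    proof (cases "i \<le> w")
      case True
      then show ?thesis using up[OF r(1,2), of i "w - i"] by simp
    next
      case False
      then have i: "i = Suc w" using r by simp
      have "(nd 0 r, nd (Suc w) r) \<in> set links" unfolding set_links using r(1) by auto
      then have "(nd 0 r, nd (Suc w) r) \<in> ?E\<^sup>*" by (intro link mem) (use r in simp_all)
      then have "(nd (Suc w) r, nd 0 r) \<in> ?E\<^sup>*" by (rule sym)
      also have "(nd 0 r, nd w r) \<in> ?E\<^sup>*" using up[OF r(1,2), of 0 w] by simp
      finally show ?thesis by (simp add: i)
    qed
    \<comment> \<open>As the tokens are sorted by variable, every occurrence between two occurrences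
      of \<open>x\<close> is one of \<open>x\<close>.\<close>
    have across: "(nd w r, nd w (r + k)) \<in> ?E\<^sup>*" if "r + k < M" "fst (ts ! r) = x" "fst (ts ! (r + k)) = x" for r k
      using that
    proof (induction k)
      case (Suc k)
      have "fst (ts ! r) \<le> fst (ts ! (r + k))" "fst (ts ! (r + k)) \<le> fst (ts ! (r + Suc k))"
        using sorted_nth_mono[OF tokens_sorted, of r "r + k"] sorted_nth_mono[OF tokens_sorted, of "r + k" "r + Suc k"]
          Suc.prems(1) by simp_all
      then have x: "fst (ts ! (r + k)) = x" using Suc.prems by simp
      have "(nd w (r + k), nd w (Suc (r + k))) \<in> set links"
        unfolding set_links using Suc.prems x by auto
      then have "(nd w (r + k), nd w (Suc (r + k))) \<in> ?E\<^sup>*"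
        by (intro link mem) (use Suc.prems x in simp_all)
      moreover have "(nd w r, nd w (r + k)) \<in> ?E\<^sup>*" using Suc x by simp
      ultimately show ?case by (auto intro: rtrancl_trans)
    qed simp
    have across': "(nd w r, nd w s) \<in> ?E\<^sup>*" if "r < M" "s < M" "fst (ts ! r) = x" "fst (ts ! s) = x" for r s
      using across[of r "s - r"] across[of s "r - s"] sym that by (cases "r \<le> s") auto
    obtain r i where r: "r < M" "fst (ts ! r) = x" "i \<le> Suc w" "nd i r = p" using pq by (auto simp: length_bags set_bag)
    obtain s j where s: "s < M" "fst (ts ! s) = x" "j \<le> Suc w" "nd j s = q" using pq by (auto simp: length_bags set_bag)
    have "(p, nd w r) \<in> ?E\<^sup>*" using top[OF r(1,2,3)] r(4) by simp
    also have "(nd w r, nd w s) \<in> ?E\<^sup>*" by (rule across'[OF r(1) s(1) r(2) s(2)])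
    also have "(nd w s, q) \<in> ?E\<^sup>*" using sym[OF top[OF s(1,2,3)]] s(4) by simp
    finally show ?thesis .
  qed
qed (rule assms)

lemma node_mono: "r < M ==> before i r s ==> i \<le> w ==> nd i r \<le> nd i s"
  using pos_less[of r i s] by (simp add: node_inner div_le_mono)

text \<open>From one level to the next, the keys lose their lowest bit. Among occurrences with the
  same lowest bit the two orders are compatible, so their pairs of bags form a chain with at most
  \<open>2 * K\<close> elements; the two values of the bit give \<open>4 * K\<close> for each of the
  \<open>w\<close> transitions. The link from level 0 to the clause groups and the links within
  level \<open>w\<close> give one chain each, and the self-links \<open>K\<close> more. For
  \<open>K = 2 ^ w\<close> all keys vanish in level \<open>w\<close>, which leaves the order of the
  variables.\<close>

lemma card_links:
  assumes "K = 2 ^ w" shows "length links \<le> (4 * w + 5) * K"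
proof -
  have key_Suc: "key K m ts (Suc i) r = key K m ts i r div 2" for i r
    unfolding key_def shift by (simp add: power_Suc2 div_mult2_eq del: power_Suc)
  have key_0: "r < M ==> key K m ts 0 r = grp r" for r unfolding key_def shift by simp
  have key_w: "r < M ==> key K m ts w r = 0" for r
    using group_less[of "snd (ts ! r)"] ts_nth[of r] unfolding key_def shift assms[symmetric] by simp
  have level: "card ((\<lambda>r. (nd i r, nd (Suc i) r)) ` {..<M}) \<le> 4 * K" if i: "i < w" for i
  proof -
    have half: "card ((\<lambda>r. (nd i r, nd (Suc i) r)) ` {r. r < M \<and> odd (key K m ts i r) = c}) \<le> 2 * K" for c
    proof (rule card_chain[OF K, where a = "i * K" and b = "Suc i * K"])
      show "i * K \<le> nd i r \<and> nd i r < i * K + K" "Suc i * K \<le> nd (Suc i) r \<and> nd (Suc i) r < Suc i * K + K"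
        if "r \<in> {r. r < M \<and> odd (key K m ts i r) = c}" for r
        using that i node_bounds[of r i] node_bounds[of r "Suc i"] by simp_all
      have *: "nd i r \<le> nd i s \<and> nd (Suc i) r \<le> nd (Suc i) s"
        if "before i r s" "r < M" "odd (key K m ts i r) = c" "odd (key K m ts i s) = c" for r s
      proof -
        have "x div 2 < y div 2" if "x < y" "odd x = odd y" for x y :: nat
          using that by presburger
        then have "before (Suc i) r s" using that unfolding before_def key_Suc by metis
        then show ?thesis using that i node_mono[of r i s] node_mono[of r "Suc i" s] by simp
      qed
      show "nd i r \<le> nd i s \<and> nd (Suc i) r \<le> nd (Suc i) s \<or> nd i s \<le> nd i r \<and> nd (Suc i) s \<le> nd (Suc i) r"
        if "r \<in> {r. r < M \<and> odd (key K m ts i r) = c}" "s \<in> {r. r < M \<and> odd (key K m ts i r) = c}" for r s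
        using that before_total[of r s i] *[of r s] *[of s r] by (cases "r = s") auto
    qed
    have "(\<lambda>r. (nd i r, nd (Suc i) r)) ` {..<M} =
      (\<lambda>r. (nd i r, nd (Suc i) r)) ` {r. r < M \<and> odd (key K m ts i r) = True} \<union>
      (\<lambda>r. (nd i r, nd (Suc i) r)) ` {r. r < M \<and> odd (key K m ts i r) = False}" by auto
    then have "card ((\<lambda>r. (nd i r, nd (Suc i) r)) ` {..<M}) \<le>
      card ((\<lambda>r. (nd i r, nd (Suc i) r)) ` {r. r < M \<and> odd (key K m ts i r) = True}) +
      card ((\<lambda>r. (nd i r, nd (Suc i) r)) ` {r. r < M \<and> odd (key K m ts i r) = False})"
      by (simp only: card_Un_le)
    then show ?thesis using half[of True] half[of False] by linarith
  qed
  have first: "card ((\<lambda>r. (nd 0 r, nd (Suc w) r)) ` {..<M}) \<le> 2 * K"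
  proof (rule card_chain[OF K, where a = 0 and b = "Suc w * K"])
    show "0 \<le> nd 0 r \<and> nd 0 r < 0 + K" "Suc w * K \<le> nd (Suc w) r \<and> nd (Suc w) r < Suc w * K + K"
      if "r \<in> {..<M}" for r using that node_bounds[of r 0] node_bounds[of r "Suc w"] by simp_all
    have *: "nd 0 r \<le> nd 0 s \<and> nd (Suc w) r \<le> nd (Suc w) s" if "before 0 r s" "r < M" "s < M" for r s
      using that node_mono[of r 0 s] key_0 by (auto simp: before_def node_outer)
    show "nd 0 r \<le> nd 0 s \<and> nd (Suc w) r \<le> nd (Suc w) s \<or> nd 0 s \<le> nd 0 r \<and> nd (Suc w) s \<le> nd (Suc w) r"
      if "r \<in> {..<M}" "s \<in> {..<M}" for r s
      using that before_total[of r s 0] *[of r s] *[of s r] by (cases "r = s") auto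
  qed
  have last: "card ((\<lambda>r. (nd w r, nd w (Suc r))) ` {r. Suc r < M \<and> fst (ts ! r) = fst (ts ! Suc r)}) \<le> 2 * K"
  proof (rule card_chain[OF K, where a = "w * K" and b = "w * K"])
    show "w * K \<le> nd w r \<and> nd w r < w * K + K" "w * K \<le> nd w (Suc r) \<and> nd w (Suc r) < w * K + K"
      if "r \<in> {r. Suc r < M \<and> fst (ts ! r) = fst (ts ! Suc r)}" for r
      using that node_bounds[of r w] node_bounds[of "Suc r" w] by simp_all
    have *: "nd w r \<le> nd w s" if "r \<le> s" "s < M" for r s
      using that node_mono[of r w s] key_w[of r] key_w[of s] by (cases "r = s") (auto simp: before_def)
    show "nd w r \<le> nd w s \<and> nd w (Suc r) \<le> nd w (Suc s) \<or> nd w s \<le> nd w r \<and> nd w (Suc s) \<le> nd w (Suc r)"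
      if "r \<in> {r. Suc r < M \<and> fst (ts ! r) = fst (ts ! Suc r)}" "s \<in> {r. Suc r < M \<and> fst (ts ! r) = fst (ts ! Suc r)}" for r s
      using that *[of r s] *[of s r] *[of "Suc r" "Suc s"] *[of "Suc s" "Suc r"] by (cases "r \<le> s") auto
  qed
  have loops: "card ((\<lambda>\<beta>. (Suc w * K + \<beta>, Suc w * K + \<beta>)) ` {..<K}) \<le> K"
    using card_image_le[of "{..<K}"] by simp
  have levels: "card (\<Union>i<w. (\<lambda>r. (nd i r, nd (Suc i) r)) ` {..<M}) \<le> w * (4 * K)"
  proof -
    have "card (\<Union>i<w. (\<lambda>r. (nd i r, nd (Suc i) r)) ` {..<M}) \<le> (\<Sum>i<w. card ((\<lambda>r. (nd i r, nd (Suc i) r)) ` {..<M}))"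
      by (rule card_UN_le) simp
    also have "\<dots> \<le> (\<Sum>i<w. 4 * K)" using level by (intro sum_mono) simp
    finally show ?thesis by simp
  qed
  have "length links = card (set links)" unfolding radix_links_def length_dedup dedup ..
  also have "\<dots> \<le> w * (4 * K) + 2 * K + 2 * K + K"
    unfolding set_links
    by (rule order_trans[OF card_Un_le] add_mono levels first last loops)+
  finally show ?thesis by (simp add: algebra_simps)
qed

lemma radix_correct:
  assumes "set words = {a. length a = bs}"
  shows "csp_wf (radix_csp G words K w)" "csp_sat (radix_csp G words K w) \<longleftrightarrow> (\<exists>a. models a G)"
  unfolding radix_csp_def using cover.cover_wf[OF radix_cover[OF assms]] cover.cover_sat[OF radix_cover[OF assms]] by blast+

lemma radix_size:
  "fst (radix_csp G words K w) = (w + 2) * K" "fst (snd (radix_csp G words K w)) = length words"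
  "length (snd (snd (radix_csp G words K w))) = length links"
  by (simp_all add: radix_csp_def cover_csp_def length_bags)

end

text \<open>The truncation makes the result polynomial in \<open>t\<close> and \<open>b\<close> for
  all arguments; if \<open>2 ^ b \<le> t\<close>, nothing is cut off.\<close>

definition all_bits :: "nat => nat => bool list list" where
  "all_bits t b = foldl (\<lambda>ds _. take t (concat (map (\<lambda>d. [False # d, True # d]) ds))) [[]] (replicate b ())"

lemma all_bits_Suc: "all_bits t (Suc b) = take t (concat (map (\<lambda>d. [False # d, True # d]) (all_bits t b)))"
  unfolding all_bits_def foldl_replicate by simp

lemma all_bits:
  assumes "2 ^ b \<le> t" shows "length (all_bits t b) = 2 ^ b \<and> set (all_bits t b) = {a. length a = b}"
  using assms
proof (induction b)
  case 0
  then show ?case by (simp add: all_bits_def)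
next
  case (Suc b)
  have two: "length (concat (map (\<lambda>d. [False # d, True # d]) ds)) = 2 * length ds" for ds
    by (induction ds) auto
  from Suc have IH: "length (all_bits t b) = 2 ^ b" "set (all_bits t b) = {a. length a = b}" by auto
  have "all_bits t (Suc b) = concat (map (\<lambda>d. [False # d, True # d]) (all_bits t b))"
    unfolding all_bits_Suc using Suc.prems by (intro take_all) (simp add: two IH)
  moreover have "(\<Union>d\<in>{a. length a = b}. {False # d, True # d}) = {a. length a = Suc b}"
  proof (intro equalityI subsetI)
    fix a assume "a \<in> {a :: bool list. length a = Suc b}"
    then obtain x d where "a = x # d" "length d = b" by (auto simp: length_Suc_conv)
    then show "a \<in> (\<Union>d\<in>{a. length a = b}. {False # d, True # d})" by (cases x) auto
  qed auto
  ultimately show ?case using IH by (simp add: two)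
qed

lemma all_bits_bound: "length (all_bits t b) \<le> Suc t \<and> (\<forall>d\<in>set (all_bits t b). length d \<le> b)"
proof (induction b)
  case 0
  then show ?case by (simp add: all_bits_def)
next
  case (Suc b)
  have "d \<in> set (all_bits t (Suc b)) ==> length d \<le> Suc b" for d
    unfolding all_bits_Suc using Suc by (fastforce dest!: in_set_takeD)
  then show ?case by (simp add: all_bits_Suc)
qed

lemma PF_all_bits:
  assumes "PF t" "PF b" shows "PF (\<lambda>x. all_bits (t x) (b x))"
  unfolding all_bits_def
proof (rule PF_foldl)
  show "polyb (\<lambda>x. (1 + sz (t x)) * (4 * sz (b x) + 2) + 1)"
    by (intro polyb_add polyb_mult polyb_const polyb_sz_PF assms)
  show "sz (foldl (\<lambda>ds _. take (t x) (concat (map (\<lambda>d. [False # d, True # d]) ds))) [[]] (take k (replicate (b x) ())))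
      \<le> (1 + sz (t x)) * (4 * sz (b x) + 2) + 1" if "k \<le> length (replicate (b x) ())" for x k
  proof -
    have "sz d \<le> 4 * sz (b x) + 1" if "d \<in> set (all_bits (t x) k)" for d
      using that all_bits_bound[of "t x" k] sz_bools(1)[of d] \<open>k \<le> length (replicate (b x) ())\<close> by fastforce
    then have "sz (all_bits (t x) k) \<le> length (all_bits (t x) k) * (4 * sz (b x) + 1 + 1) + 1" by (rule sz_list_bound)
    also have "\<dots> \<le> (1 + sz (t x)) * (4 * sz (b x) + 2) + 1"
      using all_bits_bound[of "t x" k] by (intro add_right_mono mult_le_mono) auto
    finally show ?thesis using that by (simp add: all_bits_def min_absorb1)
  qed
qed (intro PF_intros PF_replicate_unit PF_comp[OF assms(1)] assms)+

section \<open>Solving 3-CNF formulas by means of Steiner Orientation\<close>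

definition parse_literal :: "bool list => (nat \<times> bool) \<times> bool list" where
  "parse_literal s = ((fst (parse_nat (tl s)), hd s), snd (parse_nat (tl s)))"

definition parse_cnf :: "bool list => cnf" where
  "parse_cnf s = fst (parse_list (parse_list parse_literal) s)"

lemma PF_parse_literal: "PF parse_literal"
  unfolding parse_literal_def[abs_def] by (intro PF_Pair PF_fst PF_snd PF_hd PF_tl PF_comp[OF PF_parse_nat] PF_id)

lemma parse_literal_length: "length (snd (parse_literal s)) \<le> length s"
  using parse_nat_length[of "tl s"] by (simp add: parse_literal_def)

lemma PF_parse_cnf: "PF parse_cnf"
  unfolding parse_cnf_def[abs_def]
  by (intro PF_fst PF_parse_list PF_parse_literal parse_literal_length parse_list_length)

lemma parse_cnf: "parse_cnf (enc_cnf F) = F"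
proof -
  have 1: "parse_literal (enc_literal l @ u) = (l, u)" for l u
    by (cases l) (simp add: parse_literal_def)
  have 2: "parse_list parse_literal (enc_list enc_literal c @ u) = (c, u)" for c u
    using parse_list[of parse_literal enc_literal "\<lambda>l. l", OF 1] by simp
  have "parse_list (parse_list parse_literal) (enc_list (enc_list enc_literal) F @ []) = (F, [])"
    using parse_list[of "parse_list parse_literal" "enc_list enc_literal" "\<lambda>c. c", OF 2, of F "[]"] by simp
  then show ?thesis by (simp add: parse_cnf_def enc_cnf_def)
qed

definition lits :: "cnf => clause" where
  "lits F = dedup (concat F)"

definition canonical :: "cnf => cnf" where
  "canonical F = map (\<lambda>c. canon (lits F) c) F"

definition leaf_csp :: "nat => nat => nat => clause list => csp" where
  "leaf_csp t K w G = radix_csp G (all_bits t (bag_size K (length G))) K w"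

text \<open>The empty list means that the budget was too small for the sparsification, the words of
  a bag, or some run of the solver. Otherwise the answer is conclusive, whatever the parameters
  are.\<close>

definition attempt :: "prog => cnf => nat => nat => nat => nat => nat => bool list" where
  "attempt p F j t q K w =
     (if fst (sparsify (q * q) (lits F) (canonical F) t) = [] \<and>
         (\<forall>G\<in>set (snd (sparsify (q * q) (lits F) (canonical F) t)).
            bag_size K (length G) \<le> j \<and> halts_within p t (steiner_bits (leaf_csp t K w G)))
      then [\<exists>G\<in>set (snd (sparsify (q * q) (lits F) (canonical F) t)).
            accepts_within p t (steiner_bits (leaf_csp t K w G))]
      else [])"

text \<open>The parameters that suit a given precision are constants unknown to the program. Trying
  all triples below \<open>j\<close> costs a polynomial factor and finds them once \<open>j\<close>
  is large enough.\<close>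

definition search_round :: "prog => cnf => nat => nat => bool list" where
  "search_round p F j t = take 1 (concat (map (\<lambda>q. concat (map (\<lambda>K. concat (map (\<lambda>w. attempt p F j t q K w)
     [0..<j])) [1..<j])) [1..<j]))"

lemma PF_lits: "PF F ==> PF (\<lambda>x. lits (F x))"
  unfolding lits_def by (intro PF_dedup PF_concat)

lemma PF_canonical:
  assumes "PF F" shows "PF (\<lambda>x. canonical (F x))"
  unfolding canonical_def by (intro PF_map PF_canon PF_lits PF_snd PF_id PF_comp[OF assms] PF_fst assms)

lemma PF_leaf_csp:
  assumes "PF t" "PF K" "PF w" "PF G" shows "PF (\<lambda>x. leaf_csp (t x) (K x) (w x) (G x))"
  unfolding leaf_csp_def by (intro PF_radix_csp PF_all_bits PF_bag_size PF_length assms)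

lemma PF_halts_within: "PF n ==> PF x ==> PF (\<lambda>z. halts_within p (n z) (x z))"
  using PF_comp[OF PF_fst[OF PF_clocked_run[of p]] PF_Pair] by simp

lemma PF_accepts_within: "PF n ==> PF x ==> PF (\<lambda>z. accepts_within p (n z) (x z))"
  using PF_comp[OF PF_snd[OF PF_clocked_run[of p]] PF_Pair] by simp

lemma PF_attempt:
  assumes "PF F" "PF j" "PF t" "PF q" "PF K" "PF w"
  shows "PF (\<lambda>x. attempt p (F x) (j x) (t x) (q x) (K x) (w x))"
  unfolding attempt_def
  by (intro PF_if PF_conj PF_eq PF_ball PF_bex PF_le PF_Cons PF_const PF_halts_within PF_accepts_within
      PF_comp[OF PF_steiner_bits] PF_leaf_csp PF_sparsify PF_bag_size PF_length PF_mult PF_lits PF_canonical assms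
      PF_comp[OF assms(2)] PF_comp[OF assms(3)] PF_comp[OF assms(5)] PF_comp[OF assms(6)] PF_fst PF_snd PF_id)

lemma PF_search_round:
  assumes "PF F" "PF j" "PF t" shows "PF (\<lambda>x. search_round p (F x) (j x) (t x))"
  unfolding search_round_def
  by (intro PF_take PF_concat PF_map PF_upt PF_const PF_attempt assms
      PF_comp[OF assms(1)] PF_comp[OF assms(2)] PF_comp[OF assms(3)] PF_fst PF_snd PF_id)

section \<open>Correctness of the search and the program that performs it\<close>

lemma computes_unique: "computes p x t y ==> computes p x t' y' ==> t = t' \<and> y = y'"
  unfolding computes_def using exec_deterministic by blast

lemma canon_lits:
  assumes "c \<in> set F" shows "set (canon (lits F) c) = set c" "length (canon (lits F) c) \<le> length c"
proof -
  show 1: "set (canon (lits F) c) = set c" using assms by (auto simp: canon_def lits_def dedup)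
  have "distinct (canon (lits F) c)" by (simp add: canon_def lits_def dedup)
  then show "length (canon (lits F) c) \<le> length c" using 1 card_length distinct_card by metis
qed

lemma models_canonical: "models a (canonical F) \<longleftrightarrow> models a F"
  by (simp add: models_def canonical_def canon_lits)

lemma sparsification:
  assumes "three_cnf F" "0 < q" shows "sparsification (lits F) (canonical F) (q * q)"
proof
  show "distinct (lits F)" by (simp add: lits_def dedup)
  show "canon (lits F) c = c" if c: "c \<in> set (canonical F)" for c
  proof -
    obtain d where "c = canon (lits F) d" using c by (auto simp: canonical_def)
    then show ?thesis unfolding canon_def by (auto intro: filter_cong)
  qed
  show "length c \<le> 3" if "c \<in> set (canonical F)" for c
    using that assms(1) canon_lits(2) unfolding canonical_def three_cnf_def by fastforce
  show "1 \<le> q * q" using assms(2) by simp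
qed

locale steiner_solver =
  fixes p :: prog
  assumes solves: "steiner_instance G T ==> \<exists>t. computes p (enc_steiner G T) t [steiner_orientable G T]"
begin

text \<open>By determinism, a run that halts within the budget is the one that the solver promises,
  so its answer can be trusted.\<close>

lemma query_correct:
  assumes "\<forall>c\<in>set G. length c \<le> 3" "0 < K" "bag_size K (length G) \<le> j"
    and h: "halts_within p (2 ^ j) (steiner_bits (leaf_csp (2 ^ j) K w G))"
  shows "accepts_within p (2 ^ j) (steiner_bits (leaf_csp (2 ^ j) K w G)) \<longleftrightarrow> (\<exists>a. models a G)"
proof -
  have r: "radix G K" using assms by (simp add: radix_def)
  have "(2 :: nat) ^ bag_size K (length G) \<le> 2 ^ j" using assms(3) by (rule power_increasing) simp
  then have d: "set (all_bits (2 ^ j) (bag_size K (length G))) = {a. length a = bag_size K (length G)}"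
    using all_bits by blast
  obtain H T where H: "steiner_instance H T" "enc_steiner H T = steiner_bits (leaf_csp (2 ^ j) K w G)"
    "steiner_orientable H T \<longleftrightarrow> csp_sat (leaf_csp (2 ^ j) K w G)"
    by (rule steiner_reduction[OF radix.radix_correct(1)[OF r d, of w, folded leaf_csp_def]]) (rule that; assumption)
  have s: "steiner_orientable H T \<longleftrightarrow> (\<exists>a. models a G)"
    using H(3) radix.radix_correct(2)[OF r d, of w] unfolding leaf_csp_def by simp
  obtain t where t: "computes p (steiner_bits (leaf_csp (2 ^ j) K w G)) t [\<exists>a. models a G]"
    using solves[OF H(1)] unfolding H(2) s by blast
  obtain t' y where "t' < 2 ^ j" "computes p (steiner_bits (leaf_csp (2 ^ j) K w G)) t' y"
    using h unfolding halts_within_def by blast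
  then have "t < 2 ^ j" using computes_unique[OF t] by blast
  show ?thesis
  proof
    assume "accepts_within p (2 ^ j) (steiner_bits (leaf_csp (2 ^ j) K w G))"
    then obtain u where "computes p (steiner_bits (leaf_csp (2 ^ j) K w G)) u [True]"
      unfolding accepts_within_def by blast
    from computes_unique[OF t this] show "\<exists>a. models a G" by simp
  next
    assume "\<exists>a. models a G"
    then have "computes p (steiner_bits (leaf_csp (2 ^ j) K w G)) t [True]" using t by simp
    then show "accepts_within p (2 ^ j) (steiner_bits (leaf_csp (2 ^ j) K w G))"
      unfolding accepts_within_def using \<open>t < 2 ^ j\<close> by blast
  qed
qed

lemma attempt_correct:
  assumes F: "three_cnf F" and q: "0 < q" "0 < K" and b: "b \<in> set (attempt p F j (2 ^ j) q K w)"
  shows "b = cnf_satisfiable F"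
proof -
  interpret sparsification "lits F" "canonical F" "q * q" by (rule sparsification[OF F q(1)])
  let ?z = "sparsify (q * q) (lits F) (canonical F) (2 ^ j)"
  have z: "fst ?z = []" "\<forall>G\<in>set (snd ?z). bag_size K (length G) \<le> j \<and>
      halts_within p (2 ^ j) (steiner_bits (leaf_csp (2 ^ j) K w G))"
    "b = (\<exists>G\<in>set (snd ?z). accepts_within p (2 ^ j) (steiner_bits (leaf_csp (2 ^ j) K w G)))"
    using b unfolding attempt_def by (simp_all split: if_splits)
  have "accepts_within p (2 ^ j) (steiner_bits (leaf_csp (2 ^ j) K w G)) \<longleftrightarrow> (\<exists>a. models a G)"
    if "G \<in> set (snd ?z)" for G
    using sparsify_correct(2)[OF z(1)] that z(2) by (intro query_correct q) (auto simp: sparse_def)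
  then have "b = (\<exists>G\<in>set (snd ?z). \<exists>a. models a G)" unfolding z(3) by blast
  then show ?thesis using sparsify_correct(1)[OF z(1)] by (simp add: cnf_satisfiable_iff models_canonical)
qed

lemma search_round_correct:
  assumes "three_cnf F" "search_round p F j (2 ^ j) \<noteq> []"
  shows "search_round p F j (2 ^ j) = [cnf_satisfiable F]"
proof -
  obtain b bs where e: "search_round p F j (2 ^ j) = b # bs" using assms(2) by (cases "search_round p F j (2 ^ j)") auto
  have "length (b # bs) \<le> 1" unfolding e[symmetric] search_round_def by simp
  then have "bs = []" by simp
  moreover have "b \<in> set (search_round p F j (2 ^ j))" by (simp add: e)
  then have "b \<in> set (concat (map (\<lambda>q. concat (map (\<lambda>K. concat (map (\<lambda>w. attempt p F j (2 ^ j) q K w)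
     [0..<j])) [1..<j])) [1..<j]))" unfolding search_round_def by (rule in_set_takeD)
  then obtain q K w where "Suc 0 \<le> q" "Suc 0 \<le> K" "b \<in> set (attempt p F j (2 ^ j) q K w)" by auto
  then have "0 < q" "0 < K" "b \<in> set (attempt p F j (2 ^ j) q K w)" by simp_all
  then have "b = cnf_satisfiable F" using attempt_correct assms(1) by blast
  ultimately show ?thesis using e by simp
qed

lemma search_round_succeeds:
  assumes q: "0 < q" "q < j" "0 < K" "K < j" "w < j"
    and z: "fst (sparsify (q * q) (lits F) (canonical F) (2 ^ j)) = []"
    and h: "\<And>G. G \<in> set (snd (sparsify (q * q) (lits F) (canonical F) (2 ^ j))) ==>
      bag_size K (length G) \<le> j \<and> halts_within p (2 ^ j) (steiner_bits (leaf_csp (2 ^ j) K w G))"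
  shows "search_round p F j (2 ^ j) \<noteq> []"
proof -
  have "attempt p F j (2 ^ j) q K w \<noteq> []" unfolding attempt_def using z h by simp
  then obtain b where b: "b \<in> set (attempt p F j (2 ^ j) q K w)" by (cases "attempt p F j (2 ^ j) q K w") auto
  have concat: "u \<in> set (concat (map h xs))" if "u \<in> set (h x)" "x \<in> set xs"
    for u :: bool and h :: "nat => bool list" and x xs
    using that by auto
  have "b \<in> set (concat (map (\<lambda>w. attempt p F j (2 ^ j) q K w) [0..<j]))"
    by (rule concat[where x = w]) (use b q in simp_all)
  then have "b \<in> set (concat (map (\<lambda>K. concat (map (\<lambda>w. attempt p F j (2 ^ j) q K w) [0..<j])) [1..<j]))"
    by (rule concat[where x = K]) (use q in simp)
  then have "b \<in> set (concat (map (\<lambda>q. concat (map (\<lambda>K. concat (map (\<lambda>w. attempt p F j (2 ^ j) q K w)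
     [0..<j])) [1..<j])) [1..<j]))"
    by (rule concat[where x = q]) (use q in simp)
  then have "concat (map (\<lambda>q. concat (map (\<lambda>K. concat (map (\<lambda>w. attempt p F j (2 ^ j) q K w)
     [0..<j])) [1..<j])) [1..<j]) \<noteq> []" by (metis empty_iff empty_set)
  then show ?thesis unfolding search_round_def by simp
qed

text \<open>All time bounds are tried in turn, as the running time of the given program need not be computable.\<close>

definition body :: "cnf \<times> nat \<times> nat \<times> bool list => cnf \<times> nat \<times> nat \<times> bool list" where
  "body x = (fst x, Suc (fst (snd x)), fst (snd (snd x)) + fst (snd (snd x)),
     search_round p (fst x) (fst (snd x)) (fst (snd (snd x))))"

lemma body_iterate: "(body ^^ i) (F, 0, 1, []) = (F, i, 2 ^ i, if i = 0 then [] else search_round p F (i - 1) (2 ^ (i - 1)))"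
  by (induction i) (simp_all add: body_def)

lemma polyb_nat: "polyb (\<lambda>n :: nat. n)"
  by (rule polyb_mono[OF polyb_sz]) simp

text \<open>\<open>N\<close> may be any bound on a successful round: the program stops at the first
  success, and no earlier round has a larger budget.\<close>

lemma sat_solver_program:
  "\<exists>r c. \<forall>F N. three_cnf F --> (\<exists>j\<le>N. search_round p F j (2 ^ j) \<noteq> []) -->
    (\<exists>t. computes r (enc_cnf F) t [cnf_satisfiable F] \<and> t \<le> (2 * (2 ^ N * (length (enc_cnf F) + 2)) + 3) ^ c)"
proof -
  have pf: "PF (\<lambda>s :: bool list. (parse_cnf s, 0 :: nat, 1 :: nat, [] :: bool list))"
    by (intro PF_Pair PF_parse_cnf PF_const)
  have pb: "PF body" unfolding body_def[abs_def]
    by (intro PF_Pair PF_Suc PF_add PF_search_round PF_fst PF_snd PF_id)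
  have pc: "PF (\<lambda>x :: cnf \<times> nat \<times> nat \<times> bool list. snd (snd (snd x)) = [])"
    by (intro PF_eq PF_snd PF_id PF_const)
  have pl: "PF (\<lambda>x :: cnf \<times> nat \<times> nat \<times> bool list. snd (snd (snd x)))"
    by (intro PF_snd PF_id)
  obtain ri ki where ri: "realizes ri (\<lambda>s :: bool list. (parse_cnf s, 0 :: nat, 1 :: nat, [] :: bool list)) ki"
    using pf unfolding PF_def by blast
  obtain rb kb where rb: "realizes rb body kb" using pb unfolding PF_def by blast
  obtain rc kc where rc: "realizes rc (\<lambda>x :: cnf \<times> nat \<times> nat \<times> bool list. snd (snd (snd x)) = []) kc"
    using pc unfolding PF_def by blast
  obtain rl kl where rl: "realizes rl (\<lambda>x :: cnf \<times> nat \<times> nat \<times> bool list. snd (snd (snd x))) kl"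
    using pl unfolding PF_def by blast
  obtain k1 where k1: "\<forall>s. sz (parse_cnf s) \<le> (sz s + 2) ^ k1"
    using polyb_sz_PF[OF PF_parse_cnf] unfolding polyb_def by blast
  \<comment> \<open>With \<open>Y = 2 ^ N * (length s + 2)\<close> for the input \<open>s\<close>,
    \<open>Z Y\<close> exceeds the size of each loop state by at least 2, and \<open>P Y\<close>
    bounds the total time.\<close>
  define Z where "Z Y = (4 * Y) ^ k1 + 8 * Y + 13" for Y :: nat
  define P where "P Y = 40 * Y + 3 + ((4 * Y) ^ ki + (2 * Y * Z Y ^ (kb + kc + 10) + (Z Y ^ kl + 62)))" for Y
  have "polyb P" unfolding P_def Z_def
    by (intro polyb_add polyb_mult polyb_power polyb_const polyb_nat)
  then obtain c where c: "\<forall>Y. P Y \<le> (sz Y + 2) ^ c" unfolding polyb_def by blast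
  define r where "r = Seq read_input (Seq ri (Seq (while_prog rb rc) (Seq rl write_output)))"
  have main: "\<exists>t. computes r (enc_cnf F) t [cnf_satisfiable F] \<and> t \<le> (2 * (2 ^ N * (length (enc_cnf F) + 2)) + 3) ^ c"
    if F: "three_cnf F" and N: "\<exists>j\<le>N. search_round p F j (2 ^ j) \<noteq> []" for F N
  proof -
    define j where "j = (LEAST j. search_round p F j (2 ^ j) \<noteq> [])"
    have j: "search_round p F j (2 ^ j) \<noteq> []" using N LeastI_ex[of "\<lambda>j. search_round p F j (2 ^ j) \<noteq> []"] unfolding j_def by blast
    have jN: "j \<le> N" using N unfolding j_def by (meson Least_le order_trans)
    have less_j: "search_round p F i (2 ^ i) = []" if "i < j" for i using not_less_Least that unfolding j_def by blast
    define s where "s = enc_cnf F"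
    define Y where "Y = 2 ^ N * (length s + 2)"
    have Yl: "length s + 2 \<le> Y"
      using mult_le_mono1[of 1 "2 ^ N" "length s + 2"] unfolding Y_def by simp
    have YN: "2 ^ N \<le> Y" unfolding Y_def by simp
    have "N < 2 ^ N" by (rule less_exp)
    have "(2 :: nat) ^ N * 2 \<le> Y" unfolding Y_def by (intro mult_le_mono) auto
    have Y2: "N + 2 \<le> 2 * Y" using \<open>N < 2 ^ N\<close> YN Yl by linarith
    have szs: "sz s + 2 \<le> 4 * Y" using sz_bools(1)[of s] Yl by linarith
    have szF: "sz F \<le> (4 * Y) ^ k1"
    proof -
      have "sz F \<le> (sz s + 2) ^ k1" using k1[rule_format, of s] by (simp add: s_def parse_cnf)
      also have "\<dots> \<le> (4 * Y) ^ k1" using szs by (rule power_mono) simp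
      finally show ?thesis .
    qed
    have S: "sz ((body ^^ i) (F, 0, 1, [])) \<le> Z Y - 2" if i: "i \<le> Suc j" for i
    proof -
      have "sz (if i = 0 then [] else search_round p F (i - 1) (2 ^ (i - 1))) \<le> 5"
      proof -
        have "sz xs \<le> 5" if "length xs \<le> 1" for xs :: "bool list"
          using that by (cases xs) auto
        moreover have "length (search_round p F (i - 1) (2 ^ (i - 1))) \<le> 1" by (simp add: search_round_def)
        ultimately show ?thesis by simp
      qed
      moreover have "(2 :: nat) ^ i \<le> 2 ^ Suc N" using i jN by (intro power_increasing) auto
      then have "2 ^ i \<le> 2 * Y" using YN by simp
      moreover have "i < 2 ^ i" by (rule less_exp)
      ultimately have "sz (F, i, (2 :: nat) ^ i, if i = 0 then [] else search_round p F (i - 1) (2 ^ (i - 1))) + 2 \<le> Z Y"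
        using szF unfolding Z_def sz_simps by linarith
      then show ?thesis unfolding body_iterate by linarith
    qed
    have Z2: "2 \<le> Z Y" by (simp add: Z_def)
    have w: "runs (while_prog rb rc) (st (bits (F, 0 :: nat, 1 :: nat, [] :: bool list) @ []) [] [] [])
        ((Suc j + 1) * (Z Y - 2 + 2) ^ (kb + kc + 10)) (st (bits ((body ^^ Suc j) (F, 0, 1, [])) @ []) [] [] [])"
    proof (rule runs_while[OF rb rc _ _ S])
      show "snd (snd (snd ((body ^^ i) (F, 0, 1, [])))) = []" if "i < Suc j" for i
        unfolding body_iterate using less_j[of "i - 1"] that by (cases i) simp_all
      show "snd (snd (snd ((body ^^ Suc j) (F, 0, 1, [])))) \<noteq> []"
        unfolding body_iterate using j by simp
    qed
    have i: "runs ri (st (bits s) [] [] []) ((sz s + 2) ^ ki) (st (bits (F, 0 :: nat, 1 :: nat, [] :: bool list)) [] [] [])"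
      using ri[unfolded realizes_def, rule_format, of s "[]" "[]" "[]"] by (simp add: s_def parse_cnf)
    have l: "runs rl (st (bits ((body ^^ Suc j) (F, 0, 1, []))) [] [] []) ((sz ((body ^^ Suc j) (F, 0, 1, [])) + 2) ^ kl)
        (st (bits [cnf_satisfiable F]) [] [] [])"
      using rl[unfolded realizes_def, rule_format, of "(body ^^ Suc j) (F, 0, 1, [])" "[]" "[]" "[]"]
        search_round_correct[OF F j] unfolding body_iterate by simp
    have o: "runs write_output (st (bits [cnf_satisfiable F]) [] [] []) 62 (st [cnf_satisfiable F] [] [] [])"
      using runs_write_output[of "[cnf_satisfiable F]"] by simp
    note w' = w[unfolded append_Nil2]
    have "runs r (init s) (P Y) (init [cnf_satisfiable F])" unfolding r_def init_st
    proof (rule runs_mono[OF runs_Seq[OF runs_read_input runs_Seq[OF i runs_Seq[OF w' runs_Seq[OF l o]]]]])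
      have "(sz s + 2) ^ ki \<le> (4 * Y) ^ ki" using szs by (rule power_mono) simp
      moreover have "(Suc j + 1) * (Z Y - 2 + 2) ^ (kb + kc + 10) \<le> 2 * Y * Z Y ^ (kb + kc + 10)"
        using Z2 jN Y2 by (intro mult_le_mono) auto
      moreover have "(sz ((body ^^ Suc j) (F, 0, 1, [])) + 2) ^ kl \<le> Z Y ^ kl"
        using S[of "Suc j"] Z2 by (intro power_mono) auto
      moreover have "40 * length s + 3 \<le> 40 * Y + 3" using Yl by simp
      ultimately show "40 * length s + 3 + ((sz s + 2) ^ ki + ((Suc j + 1) * (Z Y - 2 + 2) ^ (kb + kc + 10) +
          ((sz ((body ^^ Suc j) (F, 0, 1, [])) + 2) ^ kl + 62))) \<le> P Y"
        unfolding P_def by (intro add_mono) auto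
    qed
    then obtain t where t: "t \<le> P Y" "exec r (init s) t (init [cnf_satisfiable F])" unfolding runs_def by blast
    have "computes r s t [cnf_satisfiable F]" using t(2) unfolding computes_def init_def by force
    moreover have "sz Y + 2 = 2 * Y + 3" by simp
    with order_trans[OF t(1) c[rule_format, of Y]] have "t \<le> (2 * Y + 3) ^ c" by (simp only:)
    ultimately show ?thesis unfolding s_def Y_def by blast
  qed
  show ?thesis
  proof (rule exI[of _ r], rule exI[of _ c], intro allI impI)
    fix F N assume "three_cnf F" "\<exists>j\<le>N. search_round p F j (2 ^ j) \<noteq> []"
    then show "\<exists>t. computes r (enc_cnf F) t [cnf_satisfiable F] \<and>
        t \<le> (2 * (2 ^ N * (length (enc_cnf F) + 2)) + 3) ^ c" by (rule main)
  qed
qed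

end

subsection \<open>Running time\<close>

lemma length_lits: "length (lits F) \<le> 2 * card (cnf_vars F)"
proof -
  have sub: "set (concat F) \<subseteq> cnf_vars F \<times> (UNIV :: bool set)"
  proof
    fix l assume "l \<in> set (concat F)"
    then obtain c where "c \<in> set F" "l \<in> set c" by auto
    then have "fst l \<in> cnf_vars F" unfolding cnf_vars_def by blast
    then show "l \<in> cnf_vars F \<times> UNIV" by (cases l) simp
  qed
  have fin: "finite (cnf_vars F)" by (simp add: cnf_vars_def)
  have "length (lits F) = card (set (concat F))" by (simp only: lits_def length_dedup)
  also have "\<dots> \<le> card (cnf_vars F \<times> (UNIV :: bool set))" using sub by (rule card_mono[rotated]) (simp add: fin)
  finally show ?thesis by (simp add: card_cartesian_product)
qed

text \<open>The induction starts at 12 because 1728 is at most 2048, whereas for 11 the number 1331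
  exceeds 1024.\<close>

lemma cube_le_exp: "12 \<le> q ==> q ^ 3 \<le> (2 :: nat) ^ (q - 1)"
proof (induction q rule: dec_induct)
  case (step n)
  have a: "12 * (n * n) \<le> n * (n * n)" using step(1) by (rule mult_le_mono1)
  have b: "n * 1 \<le> n * n" "1 * 1 \<le> n * n" using step(1) by (intro mult_le_mono; simp)+
  have "(Suc n) ^ 3 = n * (n * n) + 3 * (n * n) + 3 * n + 1" by (simp add: power3_eq_cube algebra_simps)
  then have "(Suc n) ^ 3 \<le> 2 * (n * (n * n))" using a b by linarith
  also have "\<dots> = 2 * n ^ 3" by (simp add: power3_eq_cube)
  also have "\<dots> \<le> 2 * 2 ^ (n - 1)" using step(3) by simp
  also have "\<dots> = 2 ^ (Suc n - 1)" using step(1) by (cases n) auto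
  finally show ?case .
qed simp

text \<open>The parameter is \<open>\<theta> = q * q\<close>. The excess \<open>1 / q ^ 3\<close> of
  \<gamma> over 1 is small enough for \<open>\<gamma> ^ (4 * \<theta> * l)\<close> to have an
  exponent of order \<open>l / q\<close>. It is also large enough: \<open>\<gamma> ^ (q ^ 3)\<close>
  is at least 2, so \<open>\<gamma> ^ (\<theta> * \<theta> - 1)\<close> is at least
  \<open>2 ^ (q - 1)\<close> and thus at least \<open>q ^ 3\<close>, which is what the second
  inequality amounts to.\<close>

lemma branching_factor:
  assumes q: "12 \<le> q"
  defines "\<gamma> \<equiv> 1 + 1 / real q ^ 3"
  shows "1 \<le> \<gamma>" "\<gamma> ^ (q * q * (q * q) - 1) + 1 \<le> \<gamma> ^ (q * q * (q * q))"
    "\<gamma> ^ (4 * (q * q) * l) \<le> exp (4 * real l / real q)"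
proof -
  have q0: "0 < real q" using q by simp
  show 1: "1 \<le> \<gamma>" by (simp add: \<gamma>_def)
  have c0: "0 < real q ^ 3" using q0 by simp
  have "1 + real (q ^ 3) * (1 / real q ^ 3) \<le> \<gamma> ^ (q ^ 3)"
    unfolding \<gamma>_def by (rule Bernoulli_inequality) (use c0 in \<open>simp add: order_trans[of _ 0]\<close>)
  then have two: "2 \<le> \<gamma> ^ (q ^ 3)" using c0 by simp
  have "real q ^ 3 \<le> 2 ^ (q - 1)" using cube_le_exp[OF q] by (metis of_nat_le_iff of_nat_numeral of_nat_power)
  also have "\<dots> \<le> (\<gamma> ^ (q ^ 3)) ^ (q - 1)" using two by (rule power_mono) simp
  also have "\<dots> = \<gamma> ^ (q ^ 3 * (q - 1))" by (simp add: power_mult)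
  also have "\<dots> \<le> \<gamma> ^ (q * q * (q * q) - 1)"
  proof (rule power_increasing[OF _ 1])
    have "q ^ 3 * (q - 1) = q * q * (q * q) - q ^ 3" by (simp add: power3_eq_cube diff_mult_distrib2 mult.assoc)
    also have "\<dots> \<le> q * q * (q * q) - 1" using q by (intro diff_le_mono2) simp
    finally show "q ^ 3 * (q - 1) \<le> q * q * (q * q) - 1" .
  qed
  finally have ge: "real q ^ 3 \<le> \<gamma> ^ (q * q * (q * q) - 1)" .
  have "0 < q * q * (q * q)" using q by simp
  then have "\<gamma> ^ (q * q * (q * q)) = \<gamma> ^ (q * q * (q * q) - 1) * \<gamma>" by (metis power_minus_mult)
  also have "\<dots> = \<gamma> ^ (q * q * (q * q) - 1) + \<gamma> ^ (q * q * (q * q) - 1) / real q ^ 3"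
    by (simp add: \<gamma>_def algebra_simps)
  finally show "\<gamma> ^ (q * q * (q * q) - 1) + 1 \<le> \<gamma> ^ (q * q * (q * q))"
    using ge c0 by (simp add: le_divide_eq)
  have "\<gamma> \<le> exp (1 / real q ^ 3)" unfolding \<gamma>_def by (rule exp_ge_add_one_self)
  then have "\<gamma> ^ (4 * (q * q) * l) \<le> exp (1 / real q ^ 3) ^ (4 * (q * q) * l)" using 1 by (intro power_mono) auto
  also have "\<dots> = exp (real (4 * (q * q) * l) * (1 / real q ^ 3))" by (rule exp_of_nat_mult[symmetric])
  also have "real (4 * (q * q) * l) * (1 / real q ^ 3) = 4 * real l / real q"
    using q0 by (simp add: field_simps power3_eq_cube)
  finally show "\<gamma> ^ (4 * (q * q) * l) \<le> exp (4 * real l / real q)" .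
qed

lemma ln2_ge_half: "1 / 2 \<le> ln (2 :: real)"
  using ln_le_minus_one[of "1 / 2 :: real"] by (simp add: ln_div)

lemma exp_le_powr: "0 \<le> x ==> exp x \<le> 2 powr (2 * x)" for x :: real
proof -
  assume "0 \<le> x"
  then have "x * 1 \<le> x * (2 * ln 2)" using ln2_ge_half by (intro mult_left_mono) auto
  then show ?thesis by (simp add: powr_def mult_ac)
qed

lemma power_of_two_between:
  fixes r :: real
  assumes "1 \<le> r" obtains j :: nat where "r \<le> 2 ^ j" "2 ^ j \<le> 2 * r"
proof
  let ?j = "nat \<lceil>log 2 r\<rceil>"
  have l: "0 \<le> log 2 r" using assms by simp
  then have j: "log 2 r \<le> real ?j" "real ?j \<le> log 2 r + 1" by linarith+
  have e: "2 ^ ?j = 2 powr real ?j" by (simp add: powr_realpow)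
  have r: "2 powr log 2 r = r" using assms by simp
  show "r \<le> 2 ^ ?j" using powr_mono[OF j(1), of 2] unfolding e r by simp
  have "2 powr real ?j \<le> 2 powr (log 2 r + 1)" by (rule powr_mono[OF j(2)]) simp
  then show "2 ^ ?j \<le> 2 * r" unfolding e powr_add r by simp
qed

section \<open>A fast solver for Steiner Orientation refutes the hypothesis\<close>

locale fast_steiner_solver =
  fixes p :: prog and f :: "nat => nat" and g :: "nat => real"
  assumes g: "g \<in> o(\<lambda>k. real k / ln (real k))"
    and in_time: "solves_steiner_orientation_in_time p (\<lambda>n k. real (f k) * real n powr g k)"
begin

sublocale steiner_solver p
  using in_time unfolding steiner_solver_def solves_steiner_orientation_in_time_def by blast

text \<open>The number of requests satisfies \<open>k \<le> 57 * w * K\<close> and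
  \<open>ln k \<ge> w / 2\<close>, so \<open>k / ln k\<close> is at most \<open>114 * K\<close>: the
  factor \<open>w\<close> for the levels cancels against the logarithm. The number of vertices is a
  constant times the square of the domain size \<open>2 ^ bs\<close>, where \<open>K * bs\<close> is
  at most three times \<open>length G + K\<close>. Hence the power of it that bounds the running
  time is at most a constant times \<open>2 powr (\<delta> * length G)\<close>.\<close>

lemma leaf_time:
  fixes \<delta> :: real
  assumes \<delta>: "0 < \<delta>"
  shows "\<exists>w0. \<forall>w\<ge>w0. \<exists>B\<ge>0. \<forall>G j. (\<forall>c\<in>set G. length c \<le> 3) --> bag_size (2 ^ w) (length G) \<le> j -->
    B * 2 powr (\<delta> * length G) < 2 ^ j --> halts_within p (2 ^ j) (steiner_bits (leaf_csp (2 ^ j) (2 ^ w) w G))"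
proof -
  \<comment> \<open>684 is the product of 2 for the squared domain size, 114 for
    \<open>k / ln k\<close>, and 3 for the occurrences per clause.\<close>
  define \<delta>' where "\<delta>' = \<delta> / 684"
  have \<delta>': "0 < \<delta>'" using \<delta> by (simp add: \<delta>'_def)
  obtain k1 where k1: "\<And>k. k1 \<le> k ==> norm (g k) \<le> \<delta>' * norm (real k / ln (real k))"
    using landau_o.smallD[OF g \<delta>'] unfolding eventually_sequentially by blast
  have "\<exists>B\<ge>0. \<forall>G j. (\<forall>c\<in>set G. length c \<le> 3) --> bag_size (2 ^ w) (length G) \<le> j -->
    B * 2 powr (\<delta> * length G) < 2 ^ j --> halts_within p (2 ^ j) (steiner_bits (leaf_csp (2 ^ j) (2 ^ w) w G))"
    if w: "Suc k1 \<le> w" for w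
  proof -
    define K :: nat where "K = 2 ^ w"
    define V where "V = (w + 2) * K"
    define M where "M = (4 * w + 5) * K"
    define c1 where "c1 = real (6 * M + 2 * V)"
    \<comment> \<open>For fixed \<open>w\<close> the number of requests is bounded, so the factor
      \<open>f k\<close> is at most this constant.\<close>
    define fm where "fm = Max (f ` {..6 * M + V})"
    define \<Gamma> where "\<Gamma> = 114 * \<delta>' * real K"
    define B where "B = real fm * c1 powr \<Gamma> * 2 powr (\<delta> * real K)"
    have K0: "0 < K" by (simp add: K_def)
    have \<Gamma>0: "0 \<le> \<Gamma>" using \<delta>' by (simp add: \<Gamma>_def)
    have B0: "0 \<le> B" by (simp add: B_def)
    have "halts_within p (2 ^ j) (steiner_bits (leaf_csp (2 ^ j) K w G))"
      if G: "\<forall>c\<in>set G. length c \<le> 3" and b: "bag_size K (length G) \<le> j" and lt: "B * 2 powr (\<delta> * length G) < 2 ^ j" for G j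
    proof -
      interpret r: radix G K w by standard (use G K0 in auto)
      define bs where "bs = bag_size K (length G)"
      define I where "I = leaf_csp (2 ^ j) K w G"
      define D where "D = length (all_bits (2 ^ j) bs)"
      have "(2 :: nat) ^ bs \<le> 2 ^ j" using b unfolding bs_def by (rule power_increasing) simp
      note ab = all_bits[OF this]
      have D: "D = 2 ^ bs" using ab by (simp add: D_def)
      have wf: "csp_wf I" unfolding I_def leaf_csp_def using r.radix_correct(1) ab by (simp add: bs_def)
      have sizes: "fst I = V" "fst (snd I) = D" "length (snd (snd I)) \<le> M"
        unfolding I_def leaf_csp_def r.radix_size D_def V_def M_def bs_def using r.card_links by (simp_all add: K_def)
      obtain H T where H: "steiner_instance H T" "enc_steiner H T = steiner_bits I" "card T = steiner_k I"
        "card (verts H) = length (csp_vertices I)"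
        by (rule steiner_reduction[OF wf]) (rule that; assumption)
      define k where "k = steiner_k I"
      define N where "N = card (verts H)"
      have k: "V \<le> k" "k \<le> 6 * M + V" using steiner_k_bounds[OF wf] sizes unfolding k_def by linarith+
      have N: "real N \<le> c1 * (real D * real D)"
      proof -
        have DD: "D \<le> D * D" unfolding D by simp
        let ?m = "length (snd (snd I))"
        have "N = 2 * (2 * ?m + V) * D + 2 * ?m * D * D" unfolding N_def H(4) length_csp_vertices[OF wf] sizes ..
        also have "\<dots> \<le> 2 * (2 * M + V) * D + 2 * M * D * D" using sizes(3) by (intro add_mono mult_le_mono) auto
        also have "\<dots> \<le> 2 * (2 * M + V) * (D * D) + 2 * M * (D * D)" by (rule add_mono[OF mult_le_mono2[OF DD] eq_refl[OF mult.assoc]])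
        also have "\<dots> = (6 * M + 2 * V) * (D * D)" by (simp add: algebra_simps)
        finally have "real N \<le> real ((6 * M + 2 * V) * (D * D))" by (rule of_nat_mono)
        then show ?thesis by (simp only: c1_def of_nat_mult)
      qed
      have "verts H \<noteq> {}" "finite (verts H)" using H(1) by (simp_all add: steiner_instance_def wf_mixed_graph_def)
      then have N1: "1 \<le> real N" unfolding N_def by (simp add: Suc_le_eq card_gt_0_iff)
      have gk: "g k \<le> \<Gamma>"
      proof -
        have w1: "1 \<le> real w" using w by simp
        have wK: "w < K" unfolding K_def by (rule less_exp)
        have KV: "K \<le> V" by (simp add: V_def)
        have "k1 \<le> k" using w wK KV k(1) by linarith
        have kK: "real K \<le> real k" using KV k(1) by simp
        have lnk: "real w / 2 \<le> ln (real k)"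
        proof -
          have "real w * (1 / 2) \<le> real w * ln 2" using ln2_ge_half by (intro mult_left_mono) auto
          also have "\<dots> = ln (real K)" by (simp add: K_def ln_realpow)
          also have "\<dots> \<le> ln (real k)" using kK K0 by simp
          finally show ?thesis by simp
        qed
        have "real k \<le> real (6 * M + V)" using k(2) by (rule of_nat_mono)
        also have "\<dots> = (25 * real w + 32) * real K" by (simp add: M_def V_def algebra_simps)
        also have "\<dots> \<le> (57 * real w) * real K" using w1 by (intro mult_right_mono) auto
        finally have k57: "real k \<le> 57 * real w * real K" .
        have "real k / ln (real k) \<le> (57 * real w * real K) / (real w / 2)"
          using k57 lnk w1 by (intro frac_le) auto
        also have "\<dots> = 114 * real K" using w1 by simp
        finally have q: "real k / ln (real k) \<le> 114 * real K" .
        have "0 < ln (real k)" using lnk w1 by linarith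
        then have "g k \<le> \<delta>' * (real k / ln (real k))" using k1[OF \<open>k1 \<le> k\<close>] by simp
        also have "\<dots> \<le> \<delta>' * (114 * real K)" using q \<delta>' by (intro mult_left_mono) auto
        finally show ?thesis by (simp add: \<Gamma>_def)
      qed
      obtain t where t: "computes p (enc_steiner H T) t [steiner_orientable H T]" "real t \<le> real (f k) * real N powr g k"
        using in_time H(1) unfolding solves_steiner_orientation_in_time_def N_def k_def H(3)[symmetric] by blast
      have Kbs: "real K * real bs \<le> 3 * (real (length G) + real K)"
      proof -
        have "K * bs = 3 * (K * (length G div K) + K)" unfolding bs_def r.bs by (simp add: algebra_simps)
        also have "\<dots> \<le> 3 * (length G + K)" using times_div_less_eq_dividend[of K "length G"] by simp
        finally have "real (K * bs) \<le> real (3 * (length G + K))" by (rule of_nat_mono)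
        then show ?thesis by simp
      qed
      have c1: "0 \<le> c1" by (simp add: c1_def)
      have "real t \<le> real fm * real N powr \<Gamma>"
      proof -
        have "real (f k) \<le> real fm" unfolding fm_def using k(2) by (intro of_nat_mono Max_ge) auto
        moreover have "real N powr g k \<le> real N powr \<Gamma>" using gk N1 by (intro powr_mono) auto
        ultimately have "real (f k) * real N powr g k \<le> real fm * real N powr \<Gamma>" by (intro mult_mono) auto
        then show ?thesis using t(2) by linarith
      qed
      also have "\<dots> \<le> real fm * (c1 * (real D * real D)) powr \<Gamma>"
        using N N1 \<Gamma>0 by (intro mult_left_mono powr_mono2) auto
      also have "(c1 * (real D * real D)) powr \<Gamma> = c1 powr \<Gamma> * (real D powr \<Gamma> * real D powr \<Gamma>)"
        using c1 by (simp add: powr_mult)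
      also have "real D powr \<Gamma> = 2 powr (real bs * \<Gamma>)"
        unfolding D by (simp add: powr_powr flip: powr_realpow)
      also have "2 powr (real bs * \<Gamma>) * 2 powr (real bs * \<Gamma>) = 2 powr (2 * (real bs * \<Gamma>))"
        unfolding powr_add[symmetric] mult_2 ..
      also have "real fm * (c1 powr \<Gamma> * 2 powr (2 * (real bs * \<Gamma>))) \<le> real fm * (c1 powr \<Gamma> * 2 powr (\<delta> * length G + \<delta> * real K))"
      proof (intro mult_left_mono powr_mono)
        have "2 * (real bs * \<Gamma>) = 228 * \<delta>' * (real K * real bs)" by (simp add: \<Gamma>_def)
        also have "\<dots> \<le> 228 * \<delta>' * (3 * (real (length G) + real K))" using Kbs \<delta>' by (intro mult_left_mono) auto
        also have "\<dots> = \<delta> * length G + \<delta> * real K" by (simp add: \<delta>'_def field_simps)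
        finally show "2 * (real bs * \<Gamma>) \<le> \<delta> * length G + \<delta> * real K" .
      qed auto
      also have "\<dots> = B * 2 powr (\<delta> * length G)" by (simp add: B_def powr_add)
      finally have "real t < 2 ^ j" using lt by linarith
      then have "t < 2 ^ j" by (simp flip: of_nat_less_iff)
      then show ?thesis using t(1) unfolding halts_within_def H(2) I_def by blast
    qed
    then show ?thesis using B0 unfolding K_def by blast
  qed
  then show ?thesis by blast
qed

lemma search_time:
  fixes \<epsilon> :: real
  assumes \<epsilon>: "0 < \<epsilon>"
  shows "\<exists>A>0. \<forall>F. three_cnf F -->
    (\<exists>j. search_round p F j (2 ^ j) \<noteq> [] \<and> 2 ^ j \<le> A * 2 powr (\<epsilon> * card (cnf_vars F)))"
proof -
  \<comment> \<open>The search tree has size about \<open>exp (4 * l / q)\<close> for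
    \<open>l\<close> literals. Two literals per variable and the passage to base 2 contribute a
    factor of 2 each, which gives 16.\<close>
  define q where "q = max 12 (nat \<lceil>16 / \<epsilon>\<rceil>)"
  have q12: "12 \<le> q" by (simp add: q_def)
  have "16 / \<epsilon> \<le> real q" unfolding q_def by linarith
  then have q\<epsilon>: "16 / real q \<le> \<epsilon>" using \<epsilon> q12 by (simp add: field_simps)
  \<comment> \<open>\<open>C / 2\<close> bounds the clauses per literal after sparsification, up to
    one extra clause, and there are two literals per variable.\<close>
  define C where "C = real (2 * (1 + q * q + q * q * (q * q)))"
  have C: "2 \<le> C" by (simp add: C_def)
  define \<delta> where "\<delta> = \<epsilon> / C"
  have \<delta>: "0 < \<delta>" using \<epsilon> C by (simp add: \<delta>_def)
  obtain w0 where w0: "\<forall>w\<ge>w0. \<exists>B\<ge>0. \<forall>G j. (\<forall>c\<in>set G. length c \<le> 3) --> bag_size (2 ^ w) (length G) \<le> j -->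
    B * 2 powr (\<delta> * length G) < 2 ^ j --> halts_within p (2 ^ j) (steiner_bits (leaf_csp (2 ^ j) (2 ^ w) w G))"
    using leaf_time[OF \<delta>] by blast
  \<comment> \<open>Makes \<open>K\<close> so large that the bag size, about three times the number
    of clauses divided by \<open>K\<close>, is at most \<open>6 + \<epsilon> * n\<close> for
    \<open>n\<close> variables.\<close>
  define w where "w = max w0 (nat \<lceil>3 * C / \<epsilon>\<rceil>)"
  define K :: nat where "K = 2 ^ w"
  have K0: "0 < K" by (simp add: K_def)
  have "3 * C / \<epsilon> \<le> real w" unfolding w_def by linarith
  also have "\<dots> \<le> real K" using less_exp[of w] by (simp add: K_def)
  finally have K\<epsilon>: "3 * C / real K \<le> \<epsilon>" using \<epsilon> K0 by (simp add: field_simps)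
  have "w0 \<le> w" by (simp add: w_def)
  then obtain B where B: "0 \<le> B" "\<And>G j. (\<forall>c\<in>set G. length c \<le> 3) ==> bag_size K (length G) \<le> j ==>
    B * 2 powr (\<delta> * length G) < 2 ^ j ==> halts_within p (2 ^ j) (steiner_bits (leaf_csp (2 ^ j) K w G))"
    using w0 unfolding K_def by blast
  \<comment> \<open>Every requirement on \<open>2 ^ j\<close> has the form of a constant times
    \<open>E\<close>, and \<open>A\<close> dominates all the constants: the first summand makes
    \<open>j\<close> exceed the parameters, 67 covers the factor 2 of the search tree and the
    \<open>64 = 2 ^ 6\<close> of the bag size, and the last summand together with a slack of 1
    covers the solver.\<close>
  define A where "A = 2 ^ (q + K + w + 1) + 67 + B * 2 powr \<delta>"
  have Apos: "1 \<le> A" "0 \<le> B * 2 powr \<delta>" using B(1) by (simp_all add: A_def add_nonneg_nonneg)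
  have "\<exists>j. search_round p F j (2 ^ j) \<noteq> [] \<and> 2 ^ j \<le> 2 * A * 2 powr (\<epsilon> * card (cnf_vars F))" if F: "three_cnf F" for F
  proof -
    define n where "n = card (cnf_vars F)"
    define E where "E = 2 powr (\<epsilon> * real n)"
    have E1: "1 \<le> E" using \<epsilon> by (simp add: E_def ge_one_powr_ge_zero)
    have AE: "1 \<le> A * E" using mult_mono[OF Apos(1) E1] Apos by simp
    obtain j where j: "A * E \<le> 2 ^ j" "2 ^ j \<le> 2 * (A * E)" by (rule power_of_two_between[OF AE])
    have part: "x * E \<le> 2 ^ j" if "x \<le> A" for x
      using mult_right_mono[OF that, of E] E1 j(1) by linarith
    have A_ge: "2 ^ (q + K + w + 1) \<le> A" "2 \<le> A" "64 \<le> A" "B * 2 powr \<delta> + 1 \<le> A"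
      using Apos(2) by (simp_all add: A_def)
    have "(2 :: real) ^ (q + K + w + 1) * 1 \<le> 2 ^ (q + K + w + 1) * E" using E1 by (intro mult_left_mono) auto
    then have "(2 :: real) ^ (q + K + w + 1) \<le> 2 ^ j" using part[OF A_ge(1)] by linarith
    then have "q + K + w + 1 \<le> j" by (rule power_le_imp_le_exp[rotated]) simp
    then have small: "q < j" "K < j" "w < j" by auto
    have q0: "0 < q" using q12 by simp
    interpret s: sparsification "lits F" "canonical F" "q * q" by (rule sparsification[OF F q0])
    let ?z = "sparsify (q * q) (lits F) (canonical F) (2 ^ j)"
    have L: "real (length (lits F)) \<le> 2 * real n"
      using length_lits[of F] unfolding n_def by (metis of_nat_le_iff of_nat_mult of_nat_numeral)
    have z: "fst ?z = []"
    proof (rule s.sparsify_terminates[OF branching_factor(1,2)[OF q12]])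
      have "(1 + 1 / real q ^ 3) ^ (4 * (q * q) * length (lits F)) \<le> exp (4 * real (length (lits F)) / real q)"
        by (rule branching_factor(3)[OF q12])
      also have "\<dots> \<le> exp (8 * real n / real q)" using L q0 by (simp add: divide_right_mono)
      also have "\<dots> \<le> 2 powr (2 * (8 * real n / real q))" by (rule exp_le_powr) simp
      also have "\<dots> = 2 powr (16 / real q * real n)" by simp
      also have "\<dots> \<le> E" unfolding E_def using q\<epsilon> by (intro powr_mono mult_right_mono) auto
      finally have "2 * (1 + 1 / real q ^ 3) ^ (4 * (q * q) * length (lits F)) \<le> 2 * E" by simp
      also have "\<dots> \<le> 2 ^ j" by (rule part[OF A_ge(2)])
      finally show "2 * (1 + 1 / real q ^ 3) ^ (4 * (q * q) * length (lits F)) \<le> real (2 ^ j)" by simp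
    qed
    have leaf: "bag_size K (length G) \<le> j \<and> halts_within p (2 ^ j) (steiner_bits (leaf_csp (2 ^ j) K w G))"
      if G: "G \<in> set (snd ?z)" for G
    proof -
      have sp: "\<forall>c\<in>set G. length c \<le> 3" "length G \<le> 1 + length (lits F) * (1 + q * q + q * q * (q * q))"
        using s.sparsify_correct(2)[OF z] G unfolding s.sparse_def by blast+
      have "real (length G) \<le> real (1 + length (lits F) * (1 + q * q + q * q * (q * q)))" using sp(2) by (rule of_nat_mono)
      also have "\<dots> = 1 + real (length (lits F)) * (C / 2)" by (simp add: C_def algebra_simps)
      also have "\<dots> \<le> 1 + (2 * real n) * (C / 2)" using L C by (intro add_left_mono mult_right_mono) auto
      finally have m: "real (length G) \<le> 1 + real n * C" by simp
      have bs: "real (bag_size K (length G)) \<le> 6 + \<epsilon> * real n"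
      proof -
        have "real (bag_size K (length G)) = 3 + 3 * real (length G div K)" by (simp add: bag_size_def quot[OF K0])
        also have "\<dots> \<le> 3 + 3 * (real (length G) / real K)"
        proof -
          have "real (length G div K * K) \<le> real (length G)" by (rule of_nat_mono) (rule div_times_less_eq_dividend)
          then have "real (length G div K) \<le> real (length G) / real K" using K0 by (simp add: le_divide_eq)
          then show ?thesis by simp
        qed
        also have "\<dots> \<le> 3 + 3 * ((1 + real n * C) / real K)" using m by (simp add: divide_right_mono)
        also have "\<dots> = 3 + 3 / real K + (3 * C / real K) * real n" by (simp add: add_divide_distrib algebra_simps)
        also have "\<dots> \<le> 3 + 3 + \<epsilon> * real n" using K\<epsilon> K0 by (intro add_mono mult_right_mono) (auto simp: divide_le_eq)
        finally show ?thesis by simp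
      qed
      have "(2 :: real) ^ bag_size K (length G) = 2 powr real (bag_size K (length G))" by (simp add: powr_realpow)
      also have "\<dots> \<le> 2 powr (6 + \<epsilon> * real n)" using bs by (intro powr_mono) auto
      also have "\<dots> = 64 * E" by (simp add: powr_add E_def)
      also have "\<dots> \<le> 2 ^ j" by (rule part[OF A_ge(3)])
      finally have b: "bag_size K (length G) \<le> j" by (rule power_le_imp_le_exp[rotated]) simp
      have "\<delta> * real (length G) \<le> \<delta> * (1 + real n * C)" using m \<delta> by (intro mult_left_mono) auto
      also have "\<dots> = \<delta> + \<epsilon> * real n" using C by (simp add: \<delta>_def field_simps)
      finally have "2 powr (\<delta> * real (length G)) \<le> 2 powr (\<delta> + \<epsilon> * real n)" by (intro powr_mono) auto
      then have "B * 2 powr (\<delta> * real (length G)) \<le> B * (2 powr \<delta> * E)"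
        using B(1) by (intro mult_left_mono) (simp_all add: powr_add E_def)
      also have "\<dots> < (B * 2 powr \<delta> + 1) * E" using E1 by (simp add: algebra_simps)
      also have "\<dots> \<le> 2 ^ j" by (rule part[OF A_ge(4)])
      finally show ?thesis using b B(2)[OF sp(1) b] by blast
    qed
    have "search_round p F j (2 ^ j) \<noteq> []"
      by (rule search_round_succeeds[OF q0 small(1) K0 small(2,3) z leaf])
    then show ?thesis using j(2) unfolding E_def n_def by (intro exI[of _ j]) (simp add: mult.assoc)
  qed
  then show ?thesis using Apos(1) by (intro exI[of _ "2 * A"]) simp
qed

text \<open>The program does not depend on \<epsilon>, so \<open>h\<close> can be read off from its
  actual running time, as a supremum over all formulas with \<open>n\<close> variables. For every
  \<epsilon> this supremum is at most a constant plus \<open>\<epsilon> * n\<close>, and therefore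
  it is \<open>o(n)\<close>.\<close>

theorem not_ETH: "\<not> ETH"
proof -
  obtain r c where r: "\<forall>F N. three_cnf F --> (\<exists>j\<le>N. search_round p F j (2 ^ j) \<noteq> []) -->
    (\<exists>t. computes r (enc_cnf F) t [cnf_satisfiable F] \<and> t \<le> (2 * (2 ^ N * (length (enc_cnf F) + 2)) + 3) ^ c)"
    using sat_solver_program by (elim exE)
  define len where "len F = real (length (enc_cnf F))" for F
  have len1: "1 \<le> len F" for F by (simp add: len_def enc_cnf_def enc_list_def enc_nat_def)
  define \<tau> where "\<tau> F = (THE t. computes r (enc_cnf F) t [cnf_satisfiable F])" for F
  have \<tau>: "\<tau> F = t" if "computes r (enc_cnf F) t [cnf_satisfiable F]" for F t
    unfolding \<tau>_def
    by (rule the_equality[where P = "\<lambda>t. computes r (enc_cnf F) t [cnf_satisfiable F]"])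
      (use that computes_unique[OF that] in blast)+
  have bound: "\<exists>A\<ge>1. \<forall>F. three_cnf F --> computes r (enc_cnf F) (\<tau> F) [cnf_satisfiable F] \<and>
      real (\<tau> F) / len F ^ c \<le> A * 2 powr (\<epsilon> * card (cnf_vars F))" if \<epsilon>: "0 < \<epsilon>" for \<epsilon> :: real
  proof -
    \<comment> \<open>The polynomial overhead raises \<open>2 ^ j\<close> to the power
      \<open>c\<close>, so the search is used with a correspondingly smaller precision.\<close>
    have "0 < \<epsilon> / (real c + 1)" using \<epsilon> by simp
    then obtain A where A: "A > 0" "\<forall>F. three_cnf F -->
      (\<exists>j. search_round p F j (2 ^ j) \<noteq> [] \<and> 2 ^ j \<le> A * 2 powr (\<epsilon> / (real c + 1) * card (cnf_vars F)))"
      using search_time by blast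
    have "computes r (enc_cnf F) (\<tau> F) [cnf_satisfiable F] \<and>
        real (\<tau> F) / len F ^ c \<le> max 1 ((9 * A) ^ c) * 2 powr (\<epsilon> * card (cnf_vars F))" if F: "three_cnf F" for F
    proof -
      define n where "n = real (card (cnf_vars F))"
      obtain j where j: "search_round p F j (2 ^ j) \<noteq> []" "2 ^ j \<le> A * 2 powr (\<epsilon> / (real c + 1) * n)"
        using A(2) F unfolding n_def by blast
      obtain t where t: "computes r (enc_cnf F) t [cnf_satisfiable F]" "t \<le> (2 * (2 ^ j * (length (enc_cnf F) + 2)) + 3) ^ c"
        using r[rule_format, OF F, of j] j(1) by blast
      have "real t \<le> real ((2 * (2 ^ j * (length (enc_cnf F) + 2)) + 3) ^ c)" using t(2) by (rule of_nat_mono)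
      also have "\<dots> = (2 * (2 ^ j * (len F + 2)) + 3) ^ c" by (simp add: len_def algebra_simps)
      also have "\<dots> \<le> (9 * 2 ^ j * len F) ^ c"
      proof (rule power_mono)
        have "(1 :: real) \<le> 2 ^ j" by simp
        then have x: "1 * 1 \<le> 2 ^ j * len F" "2 ^ j * 1 \<le> 2 ^ j * len F" using len1[of F] by (intro mult_mono; simp)+
        have "2 * (2 ^ j * (len F + 2)) + 3 = 2 * (2 ^ j * len F) + 4 * 2 ^ j + 3" by (simp add: algebra_simps)
        also have "\<dots> \<le> 9 * (2 ^ j * len F)" using x by linarith
        finally show "2 * (2 ^ j * (len F + 2)) + 3 \<le> 9 * 2 ^ j * len F" by simp
        show "0 \<le> 2 * (2 ^ j * (len F + 2)) + 3" using len1[of F] by simp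
      qed
      also have "\<dots> = (9 * 2 ^ j) ^ c * len F ^ c" by (simp add: power_mult_distrib)
      finally have "real t / len F ^ c \<le> (9 * 2 ^ j) ^ c" using len1[of F] by (simp add: divide_le_eq)
      also have "\<dots> \<le> (9 * (A * 2 powr (\<epsilon> / (real c + 1) * n))) ^ c" using j(2) by (intro power_mono) auto
      also have "\<dots> = (9 * A) ^ c * (2 powr (\<epsilon> / (real c + 1) * n)) ^ c" by (simp add: power_mult_distrib)
      also have "(2 powr (\<epsilon> / (real c + 1) * n)) ^ c = 2 powr (\<epsilon> / (real c + 1) * n * real c)"
        by (simp add: powr_powr flip: powr_realpow)
      also have "(9 * A) ^ c * 2 powr (\<epsilon> / (real c + 1) * n * real c) \<le> max 1 ((9 * A) ^ c) * 2 powr (\<epsilon> * n)"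
      proof (rule mult_mono[OF max.cobounded2 powr_mono])
        have "\<epsilon> / (real c + 1) * n * real c = \<epsilon> * n * (real c / (real c + 1))" by simp
        also have "\<dots> \<le> \<epsilon> * n * 1" using \<epsilon> by (intro mult_left_mono) (auto simp: n_def)
        finally show "\<epsilon> / (real c + 1) * n * real c \<le> \<epsilon> * n" by simp
      qed auto
      finally show ?thesis using t(1) \<tau>[OF t(1)] unfolding n_def by simp
    qed
    then show ?thesis by (intro exI[of _ "max 1 ((9 * A) ^ c)"]) simp
  qed
  \<comment> \<open>The exponent left after division by the polynomial factor; the maximum with 1
    keeps the logarithm nonnegative.\<close>
  define \<rho> where "\<rho> F = log 2 (max 1 (real (\<tau> F) / len F ^ c))" for F
  define h where "h n = Sup (\<rho> ` {F. three_cnf F \<and> card (cnf_vars F) = n})" for n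
  have ne: "\<exists>F. three_cnf F \<and> card (cnf_vars F) = n" for n
  proof (intro exI conjI)
    show "three_cnf (map (\<lambda>i. [(i, True)]) [0..<n])" by (auto simp: three_cnf_def)
    have "cnf_vars (map (\<lambda>i. [(i, True)]) [0..<n]) = {..<n}" by (auto simp: cnf_vars_def)
    then show "card (cnf_vars (map (\<lambda>i. [(i, True)]) [0..<n])) = n" by simp
  qed
  have \<rho>_bound: "\<exists>b\<ge>0. \<forall>F. three_cnf F --> \<rho> F \<le> b + \<epsilon> * card (cnf_vars F)" if \<epsilon>: "0 < \<epsilon>" for \<epsilon> :: real
  proof -
    obtain A where A: "1 \<le> A" "\<forall>F. three_cnf F --> computes r (enc_cnf F) (\<tau> F) [cnf_satisfiable F] \<and>
      real (\<tau> F) / len F ^ c \<le> A * 2 powr (\<epsilon> * card (cnf_vars F))" using bound[OF \<epsilon>] by blast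
    have "\<rho> F \<le> log 2 A + \<epsilon> * card (cnf_vars F)" if F: "three_cnf F" for F
    proof -
      have e1: "1 \<le> 2 powr (\<epsilon> * card (cnf_vars F))" using \<epsilon> by (simp add: ge_one_powr_ge_zero)
      have "1 * 1 \<le> A * 2 powr (\<epsilon> * card (cnf_vars F))" using A(1) e1 by (intro mult_mono) auto
      then have "max 1 (real (\<tau> F) / len F ^ c) \<le> A * 2 powr (\<epsilon> * card (cnf_vars F))" using A(2) F by simp
      then have "\<rho> F \<le> log 2 (A * 2 powr (\<epsilon> * card (cnf_vars F)))" unfolding \<rho>_def by (subst log_le_cancel_iff) auto
      also have "\<dots> = log 2 A + \<epsilon> * card (cnf_vars F)" using A(1) by (simp add: log_mult)
      finally show ?thesis .
    qed
    then show ?thesis using A(1) by (intro exI[of _ "log 2 A"]) simp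
  qed
  have \<rho>0: "0 \<le> \<rho> F" for F unfolding \<rho>_def by (subst zero_le_log_cancel_iff) auto
  have \<rho>h: "\<rho> F \<le> h (card (cnf_vars F))" if F: "three_cnf F" for F
  proof -
    obtain b where b: "\<forall>F. three_cnf F --> \<rho> F \<le> b + (1 :: real) * card (cnf_vars F)" using \<rho>_bound[OF zero_less_one] by blast
    have "bdd_above (\<rho> ` {F'. three_cnf F' \<and> card (cnf_vars F') = card (cnf_vars F)})"
    proof (rule bdd_aboveI)
      fix y assume "y \<in> \<rho> ` {F'. three_cnf F' \<and> card (cnf_vars F') = card (cnf_vars F)}"
      then obtain F' where "three_cnf F'" "card (cnf_vars F') = card (cnf_vars F)" "y = \<rho> F'" by blast
      then show "y \<le> b + card (cnf_vars F)" using b[rule_format, of F'] by simp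
    qed
    then show ?thesis unfolding h_def by (rule cSup_upper[rotated]) (rule imageI, simp add: F)
  qed
  have h_bound: "h n \<le> b + \<epsilon> * real n" if "\<forall>F. three_cnf F --> \<rho> F \<le> b + \<epsilon> * card (cnf_vars F)" for n and b \<epsilon> :: real
    unfolding h_def
  proof (rule cSup_least)
    show "\<rho> ` {F. three_cnf F \<and> card (cnf_vars F) = n} \<noteq> {}" using ne[of n] by blast
    fix y assume "y \<in> \<rho> ` {F. three_cnf F \<and> card (cnf_vars F) = n}"
    then obtain F where "three_cnf F" "card (cnf_vars F) = n" "y = \<rho> F" by blast
    then show "y \<le> b + \<epsilon> * real n" using that[rule_format, of F] by simp
  qed
  have h0: "0 \<le> h n" for n
  proof -
    obtain F where "three_cnf F" "card (cnf_vars F) = n" using ne by blast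
    then show ?thesis using \<rho>h[of F] \<rho>0[of F] by simp
  qed
  have "h \<in> o(\<lambda>n. real n)"
  proof (rule landau_o.smallI)
    fix e :: real assume e: "0 < e"
    then obtain b where b: "0 \<le> b" "\<forall>F. three_cnf F --> \<rho> F \<le> b + e / 2 * card (cnf_vars F)"
      using \<rho>_bound[OF half_gt_zero[OF e]] by blast
    show "\<forall>\<^sub>F n in sequentially. norm (h n) \<le> e * norm (real n)"
      unfolding eventually_sequentially
    proof (intro exI allI impI)
      fix n assume "nat \<lceil>2 * b / e\<rceil> \<le> n"
      then have "2 * b / e \<le> real n" by linarith
      then have "b \<le> e / 2 * real n" using e by (simp add: field_simps)
      then have "h n \<le> e * real n" using h_bound[OF b(2), of n] by linarith
      then show "norm (h n) \<le> e * norm (real n)" using h0[of n] by simp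
    qed
  qed
  moreover have "\<exists>t. computes r (enc_cnf F) t [cnf_satisfiable F] \<and>
      real t \<le> 2 powr (h (card (cnf_vars F))) * real (length (enc_cnf F)) ^ c" if F: "three_cnf F" for F
  proof (intro exI conjI)
    show "computes r (enc_cnf F) (\<tau> F) [cnf_satisfiable F]" using bound[OF zero_less_one] F by blast
    have "real (\<tau> F) / len F ^ c \<le> max 1 (real (\<tau> F) / len F ^ c)" by simp
    also have "\<dots> = 2 powr \<rho> F" by (simp add: \<rho>_def)
    also have "\<dots> \<le> 2 powr h (card (cnf_vars F))" using \<rho>h[OF F] by (intro powr_mono) auto
    finally show "real (\<tau> F) \<le> 2 powr (h (card (cnf_vars F))) * real (length (enc_cnf F)) ^ c"
      using len1[of F] by (simp add: divide_le_eq len_def[symmetric])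
  qed
  ultimately show ?thesis unfolding ETH_def by blast
qed

end

theorem theorem2:
  "W_hard 1 steiner_orientation \<and>
   (ETH \<longrightarrow>
     \<not> (\<exists>p (f :: nat \<Rightarrow> nat) (g :: nat \<Rightarrow> real).
          computable f \<and>
          g \<in> o(\<lambda>k. real k / ln (real k)) \<and>
          solves_steiner_orientation_in_time p (\<lambda>n k. real (f k) * real n powr g k)))"
proof (intro conjI impI notI steiner_orientation_W1_hard)
  assume ETH
  assume "\<exists>p (f :: nat \<Rightarrow> nat) (g :: nat \<Rightarrow> real). computable f \<and> g \<in> o(\<lambda>k. real k / ln (real k)) \<and>
    solves_steiner_orientation_in_time p (\<lambda>n k. real (f k) * real n powr g k)"
  then obtain p f g where "fast_steiner_solver p f g"
    by (elim exE conjE) (rule that, rule fast_steiner_solver.intro)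
  then have "\<not> ETH" by (rule fast_steiner_solver.not_ETH)
  then show False using \<open>ETH\<close> by blast
qed

end
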